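(* Let $1\le p,q\le\infty$, $t_1,t_2\in\mathbb{R}$, and $\tau\in\{0,1\}$. Then $$\forall\sigma\in W(\mathscr{F}L^p,L^q)(\mathbb{R}^{2d})\Longrightarrow OP_\tau(\sigma):\mathcal{M}^{2,2}_{v_{0,t_1}}(\mathbb{R}^d)\longrightarrow M^{2,2}_{v_{0,t_2}}(\mathbb{R}^d)$$ if and only if $$t_2\le0\le t_1\quad\text{and}\quad p,q\le2.$$
   Context: $\langle\cdot,\cdot\rangle$ extends $\langle f,g\rangle=\int f\bar g$ to $\mathcal{S}'\times\mathcal{S}$. $\langle x\rangle=(1+|x|^2)^{1/2}$ and $v_{s,t}(z)=\langle z_1\rangle^s\langle z_2\rangle^t$ for $z=(z_1,z_2)\in\mathbb{R}^{2d}$. $\tau$-Wigner distribution: $W_\tau(f_1,f_2)(x,\xi)=\int_{\mathbb{R}^d}f_1(x+\tau t)\overline{f_2(x-(1-\tau)t)}e^{-2\pi i\xi\cdot t}\,dt$. $\tau$-pseudodifferential operator with symbol $\sigma\in\mathcal{S}'(\mathbb{R}^{2d})$: $\langle OP_\tau(\sigma)f,g\rangle=\langle\sigma,W_\tau(g,f)\rangle$ for $f,g\in\mathcal{S}(\mathbb{R}^d)$. Function spaces: for $f\in\mathcal{S}'(\mathbb{R}^n)$ and a fixed nonzero $\phi\in\mathcal{S}(\mathbb{R}^n)$, $V_\phi f(x,\xi)=\langle f,M_\xi T_x\phi\rangle$ with $T_xg(t)=g(t-x)$, $M_\xi g(t)=e^{2\pi it\cdot\xi}g(t)$. $M^{p,q}_m(\mathbb{R}^n)$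 is the set of $f\in\mathcal{S}'(\mathbb{R}^n)$ with $\|f\|_{M^{p,q}_m}=\big(\int(\int|V_\phi f(x,\xi)|^pm(x,\xi)^pdx)^{q/p}d\xi\big)^{1/q}<\infty$ (usual modification if $p$ or $q$ is $\infty$; different $\phi$ give equivalent norms). $\mathcal{M}^{p,q}_m(\mathbb{R}^n)$ is the closure of $\mathcal{S}(\mathbb{R}^n)$ in $M^{p,q}_m(\mathbb{R}^n)$. ($M^{2,2}_{v_{0,t}}(\mathbb{R}^d)$ is the Sobolev space $H^t(\mathbb{R}^d)$.) The Wiener amalgam space $W(\mathscr{F}L^p,L^q)(\mathbb{R}^{2d})=\mathscr{F}M^{p,q}(\mathbb{R}^{2d})$ is the set of $F\in\mathcal{S}'(\mathbb{R}^{2d})$ with (up to equivalence) $\|F\|=\big(\int_{\mathbb{R}^{2d}}(\int_{\mathbb{R}^{2d}}|V_\Phi F(\zeta,-z)|^pdz)^{q/p}d\zeta\big)^{1/q}<\infty$ for a nonzero $\Phi\in\mathcal{S}(\mathbb{R}^{2d})$ (usual modifications). The notation "$\forall\sigma\in X\Longrightarrow OP_\tau(\sigma):\mathcal{M}^{p_1,q_1}_{m_1}\to M^{p_2,q_2}_{m_2}$" means that for every $\sigma\in X$ there is $C_\sigma$ with $\|OP_\tau(\sigma)f\|_{M^{p_2,q_2}_{m_2}}\le C_\sigma\|f\|_{M^{p_1,q_1}_{m_1}}$ for all $f\in\mathcal{S}(\mathbb{R}^d)$. *)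

theory Defs
  imports "HOL-Probability.Probability"
begin

section \<open>Schwartz functions and tempered distributions\<close>

text \<open>
  A list of basis vectors plays the role of a multi-index; repetitions and the order of the
  entries are immaterial for smooth functions.
\<close>

fun partial_derivs :: "'a::euclidean_space list \<Rightarrow> ('a \<Rightarrow> complex) \<Rightarrow> 'a \<Rightarrow> complex" where
  "partial_derivs [] f = f"
| "partial_derivs (b # bs) f = (\<lambda>x. frechet_derivative (partial_derivs bs f) (at x) b)"

definition japanese_bracket :: "'a::euclidean_space \<Rightarrow> real" where
  "japanese_bracket x = sqrt (1 + (norm x)\<^sup>2)"

definition schwartz_space :: "('a::euclidean_space \<Rightarrow> complex) set" where
  "schwartz_space = {f. \<forall>bs. set bs \<subseteq> Basis \<longrightarrow>
     (\<forall>x. partial_derivs bs f differentiable (at x)) \<and>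
     (\<forall>N::nat. bounded (range (\<lambda>x. japanese_bracket x ^ N * norm (partial_derivs bs f x))))}"

definition schwartz_seminorm :: "nat \<Rightarrow> ('a::euclidean_space \<Rightarrow> complex) \<Rightarrow> real" where
  "schwartz_seminorm N f =
     (\<Sum>bs | set bs \<subseteq> Basis \<and> length bs \<le> N.
        SUP x. japanese_bracket x ^ N * norm (partial_derivs bs f x))"

text \<open>
  Tempered distributions are complex-linear functionals on the Schwartz space that are continuous,
  i.e. dominated by one of the (increasing) seminorms that generate its topology.
  They are represented by total functions whose values off the Schwartz space are irrelevant.
\<close>

definition tempered_distributions :: "(('a::euclidean_space \<Rightarrow> complex) \<Rightarrow> complex) set" where
  "tempered_distributions = {T.
     (\<forall>f\<in>schwartz_space. \<forall>g\<in>schwartz_space. T (\<lambda>x. f x + g x) = T f + T g) \<and>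
     (\<forall>c. \<forall>f\<in>schwartz_space. T (\<lambda>x. c * f x) = c * T f) \<and>
     (\<exists>C N. \<forall>f\<in>schwartz_space. norm (T f) \<le> C * schwartz_seminorm N f)}"

definition distribution_of :: "('a::euclidean_space \<Rightarrow> complex) \<Rightarrow> ('a \<Rightarrow> complex) \<Rightarrow> complex" where
  "distribution_of f = (\<lambda>g. \<integral>x. f x * g x \<partial>lborel)"

text \<open>
  The sesquilinear pairing: for \<open>T = distribution_of f\<close> it is the integral of \<open>f\<close> times the
  conjugate of \<open>g\<close>.
\<close>

definition pairing ::
  "(('a::euclidean_space \<Rightarrow> complex) \<Rightarrow> complex) \<Rightarrow> ('a \<Rightarrow> complex) \<Rightarrow> complex" where
  "pairing T g = T (\<lambda>x. cnj (g x))"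


section \<open>Short-time Fourier transform\<close>

definition translation :: "'a::euclidean_space \<Rightarrow> ('a \<Rightarrow> complex) \<Rightarrow> 'a \<Rightarrow> complex" where
  "translation x g = (\<lambda>t. g (t - x))"

definition modulation :: "'a::euclidean_space \<Rightarrow> ('a \<Rightarrow> complex) \<Rightarrow> 'a \<Rightarrow> complex" where
  "modulation \<xi> g = (\<lambda>t. cis (2 * pi * (t \<bullet> \<xi>)) * g t)"

definition stft ::
  "('a::euclidean_space \<Rightarrow> complex) \<Rightarrow> (('a \<Rightarrow> complex) \<Rightarrow> complex) \<Rightarrow> 'a \<Rightarrow> 'a \<Rightarrow> complex" where
  "stft \<phi> T x \<xi> = pairing T (modulation \<xi> (translation x \<phi>))"


section \<open>Modulation and Wiener amalgam spaces\<close>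

definition ennreal_powr :: "ennreal \<Rightarrow> real \<Rightarrow> ennreal" where
  "ennreal_powr x r = (if x = \<infinity> then \<infinity> else ennreal (enn2real x powr r))"

definition Lp_enorm :: "ennreal \<Rightarrow> ('a::euclidean_space \<Rightarrow> ennreal) \<Rightarrow> ennreal" where
  "Lp_enorm p h =
     (if p = \<infinity> then esssup lborel h
      else ennreal_powr (\<integral>\<^sup>+x. ennreal_powr (h x) (enn2real p) \<partial>lborel) (1 / enn2real p))"

definition weight_v :: "real \<Rightarrow> real \<Rightarrow> 'a::euclidean_space \<Rightarrow> 'a \<Rightarrow> real" where
  "weight_v s t z1 z2 = japanese_bracket z1 powr s * japanese_bracket z2 powr t"

text \<open>
  The window is an explicit parameter. The norm takes the value \<open>\<infinity>\<close> outside the modulation space.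
\<close>

definition modulation_norm ::
  "('a::euclidean_space \<Rightarrow> complex) \<Rightarrow> ennreal \<Rightarrow> ennreal \<Rightarrow> ('a \<Rightarrow> 'a \<Rightarrow> real)
     \<Rightarrow> (('a \<Rightarrow> complex) \<Rightarrow> complex) \<Rightarrow> ennreal" where
  "modulation_norm \<phi> p q m T =
     Lp_enorm q (\<lambda>\<xi>. Lp_enorm p (\<lambda>x. ennreal (norm (stft \<phi> T x \<xi>) * m x \<xi>)))"

text \<open>In contrast to the modulation norm, here the inner integral runs over the frequency variable.\<close>

definition wiener_norm ::
  "('b::euclidean_space \<Rightarrow> complex) \<Rightarrow> ennreal \<Rightarrow> ennreal \<Rightarrow> (('b \<Rightarrow> complex) \<Rightarrow> complex) \<Rightarrow> ennreal" where
  "wiener_norm \<Phi> p q F =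
     Lp_enorm q (\<lambda>\<zeta>. Lp_enorm p (\<lambda>z. ennreal (norm (stft \<Phi> F \<zeta> (- z)))))"

definition wiener_amalgam ::
  "('b::euclidean_space \<Rightarrow> complex) \<Rightarrow> ennreal \<Rightarrow> ennreal \<Rightarrow> (('b \<Rightarrow> complex) \<Rightarrow> complex) set" where
  "wiener_amalgam \<Phi> p q = {F \<in> tempered_distributions. wiener_norm \<Phi> p q F < \<infinity>}"


section \<open>Pseudodifferential operators\<close>

definition wigner ::
  "real \<Rightarrow> ('a::euclidean_space \<Rightarrow> complex) \<Rightarrow> ('a \<Rightarrow> complex) \<Rightarrow> 'a \<times> 'a \<Rightarrow> complex" where
  "wigner \<tau> f1 f2 = (\<lambda>(x, \<xi>).
     \<integral>t. f1 (x + \<tau> *\<^sub>R t) * cnj (f2 (x - (1 - \<tau>) *\<^sub>R t)) * cis (- 2 * pi * (\<xi> \<bullet> t)) \<partial>lborel)"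

text \<open>
  \<open>op_tau \<tau> \<sigma> f\<close> is the complex-linear functional representing \<open>OP\<^sub>\<tau>(\<sigma>) f\<close>, hence the conjugate on
  the test function; see the lemma below for the defining weak identity.
\<close>

definition op_tau ::
  "real \<Rightarrow> (('a::euclidean_space \<times> 'a \<Rightarrow> complex) \<Rightarrow> complex) \<Rightarrow> ('a \<Rightarrow> complex)
     \<Rightarrow> ('a \<Rightarrow> complex) \<Rightarrow> complex" where
  "op_tau \<tau> \<sigma> f = (\<lambda>g. pairing \<sigma> (wigner \<tau> (\<lambda>x. cnj (g x)) f))"

lemma pairing_op_tau: "pairing (op_tau \<tau> \<sigma> f) g = pairing \<sigma> (wigner \<tau> g f)"
  by (simp add: op_tau_def pairing_def)

lemma pairing_distribution_of: "pairing (distribution_of f) g = (\<integral>x. f x * cnj (g x) \<partial>lborel)"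
  by (simp add: pairing_def distribution_of_def)

text \<open>
  Boundedness from the closure of the Schwartz space in one modulation space into another one,
  expressed by the norm estimate on the dense subspace of Schwartz functions.
\<close>

definition modulation_bounded ::
  "('a::euclidean_space \<Rightarrow> complex) \<Rightarrow> (('a \<Rightarrow> complex) \<Rightarrow> ('a \<Rightarrow> complex) \<Rightarrow> complex)
     \<Rightarrow> ennreal \<Rightarrow> ennreal \<Rightarrow> ('a \<Rightarrow> 'a \<Rightarrow> real) \<Rightarrow> ennreal \<Rightarrow> ennreal \<Rightarrow> ('a \<Rightarrow> 'a \<Rightarrow> real) \<Rightarrow> bool" where
  "modulation_bounded \<phi> A p1 q1 m1 p2 q2 m2 \<longleftrightarrow>
     (\<exists>C::real. \<forall>f\<in>schwartz_space.
        modulation_norm \<phi> p2 q2 m2 (A f)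
          \<le> ennreal C * modulation_norm \<phi> p1 q1 m1 (distribution_of f))"

end

theory Submission
  imports Defs "HOL-Real_Asymp.Real_Asymp"
begin

text \<open>
  Sufficiency. For exponents at most two, the reproducing formula of the short-time Fourier transform
  bounds it pointwise by its own convolution with a rapidly decaying kernel, so local
  integrability of low order improves to square integrability. Hence the symbol is in \<open>L\<^sup>2\<close>, the operator is
  Hilbert--Schmidt, and the weights only help.

  Necessity. For \<open>\<tau> \<in> {0, 1}\<close> the symbols \<open>cis (\<mp>2\<pi>x\<xi>) a(x) b(\<xi>)\<close> give operators of rank one, built from
  \<open>a\<close> and \<open>b\<close>. Series of such symbols are tested with Gaussian atoms placed so that all overlaps are
  nonnegative, which excludes cancellation. Atoms shifted along a lattice, with
  coefficients \<open>(k + 1) powr (- 1 / 2)\<close>, exclude \<open>q > 2\<close> (shifts in the variable of \<open>a\<close>) and \<open>p > 2\<close> (modulations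
  of \<open>b\<close>); atoms whose frequencies grow fast, with summable coefficients, exclude \<open>t2 > 0\<close> and \<open>t1 < 0\<close>.
\<close>

text \<open>Symbols are mere functionals, so no integral passes through them for free; exchanging a
  tempered distribution with an integral of Schwartz functions is the analytic core of the proof. In
  the norm of W(FL^p, L^q) the outer exponent q belongs to the position variable of the short-time
  Fourier transform and the inner exponent p to its frequency variable. Hence a lattice of
  translates costs an l^q norm of the coefficients and a lattice of modulations an l^p norm, whereas
  the operator tested with the same coefficients sees an l^2 norm;
  \<open>(k + 1) powr (- 1 / 2)\<close> lies in l^u exactly for u > 2. These coefficients are not
  summable. The series still converges as a distribution because the frequencies of its atoms grow
  linearly in k: for translates it is the chirp that turns a shift of position in one variable into
  a shift of frequency in the other. For the weights, an exponent r < 0 makes the energy of an atom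
  at frequency \<eta> at most of order \<open>\<langle>\<eta>\<rangle> powr (2 * r)\<close>, which
  drops below any fixed sequence of squared coefficients once the frequencies grow fast
  enough.\<close>

notation japanese_bracket ("\<langle>_\<rangle>")
section \<open>The Japanese bracket\<close>

lemma bracket_ge_1: "1 \<le> \<langle>x\<rangle>"
  by (simp add: japanese_bracket_def)

lemma bracket_pos [simp]: "0 < \<langle>x\<rangle>"
  using bracket_ge_1[of x] by linarith

lemma bracket_nonneg [simp]: "0 \<le> \<langle>x\<rangle>"
  using bracket_pos[of x] by linarith

lemma bracket_nonzero [simp]: "\<langle>x\<rangle> \<noteq> 0"
  using bracket_pos[of x] by linarith

lemma bracket_power_ge_1: "1 \<le> \<langle>x\<rangle> ^ N"
  by (simp add: bracket_ge_1)

lemma norm_le_bracket: "norm x \<le> \<langle>x\<rangle>"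
  by (simp add: japanese_bracket_def real_le_rsqrt)

lemma bracket_le: "\<langle>x\<rangle> \<le> 1 + norm x"
  unfolding japanese_bracket_def by (rule real_le_lsqrt) (auto simp: power2_eq_square algebra_simps)

lemma bracket_uminus [simp]: "\<langle>- x\<rangle> = \<langle>x\<rangle>"
  by (simp add: japanese_bracket_def)

lemma bracket_zero [simp]: "\<langle>0\<rangle> = 1"
  by (simp add: japanese_bracket_def)

lemma bracket_minus_commute: "\<langle>x - y\<rangle> = \<langle>y - x\<rangle>"
  by (simp add: japanese_bracket_def norm_minus_commute)

lemma bracket_sq: "\<langle>x\<rangle>\<^sup>2 = 1 + (norm x)\<^sup>2"
  by (simp add: japanese_bracket_def)

lemma bracket_mono: "norm x \<le> norm y \<Longrightarrow> \<langle>x\<rangle> \<le> \<langle>y\<rangle>"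
  by (simp add: japanese_bracket_def)

text \<open>A Peetre inequality, the source of every transfer of polynomial weights from a point to
  a translate of it. The factor 2 comes from (a + b)^2 \<le> 2 a^2 + 2 b^2 with some room to
  spare.\<close>

lemma bracket_add_le: "\<langle>x + y\<rangle> \<le> 2 * \<langle>x\<rangle> * \<langle>y\<rangle>"
proof (rule power2_le_imp_le)
  have "(norm (x + y))\<^sup>2 \<le> (norm x + norm y)\<^sup>2"
    by (simp add: norm_triangle_ineq power_mono)
  moreover have "(norm x + norm y)\<^sup>2 \<le> 2 * (norm x)\<^sup>2 + 2 * (norm y)\<^sup>2"
    using sum_squares_bound[of "norm x" "norm y"] by (simp add: power2_sum)
  moreover have "(1 + (norm x)\<^sup>2) * (1 + (norm y)\<^sup>2) = 1 + (norm x)\<^sup>2 + (norm y)\<^sup>2 + (norm x)\<^sup>2 * (norm y)\<^sup>2"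
    by (simp add: algebra_simps)
  moreover have "0 \<le> (norm x)\<^sup>2 * (norm y)\<^sup>2" "0 \<le> (norm x)\<^sup>2" "0 \<le> (norm y)\<^sup>2" by simp_all
  ultimately have "1 + (norm (x + y))\<^sup>2 \<le> 4 * ((1 + (norm x)\<^sup>2) * (1 + (norm y)\<^sup>2))"
    by linarith
  then show "\<langle>x + y\<rangle>\<^sup>2 \<le> (2 * \<langle>x\<rangle> * \<langle>y\<rangle>)\<^sup>2"
    by (simp only: power_mult_distrib bracket_sq mult.assoc) simp
qed simp

lemma bracket_add_power_le: "\<langle>x + y\<rangle> ^ N \<le> 2 ^ N * \<langle>x\<rangle> ^ N * \<langle>y\<rangle> ^ N"
  using power_mono[OF bracket_add_le[of x y], of N] by (simp add: power_mult_distrib)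

lemma bracket_shift_power_le: "\<langle>x\<rangle> ^ N \<le> 2 ^ N * \<langle>y\<rangle> ^ N * \<langle>x - y\<rangle> ^ N"
  using bracket_add_power_le[of "x - y" y N] by (simp add: mult.commute mult.left_commute)

lemma bracket_Pair: "\<langle>(x, y)\<rangle> \<le> \<langle>x\<rangle> * \<langle>y\<rangle>"
proof (rule power2_le_imp_le)
  show "\<langle>(x, y)\<rangle>\<^sup>2 \<le> (\<langle>x\<rangle> * \<langle>y\<rangle>)\<^sup>2"
    by (simp add: power_mult_distrib bracket_sq norm_Pair algebra_simps)
qed simp

lemma bracket_fst_le: "\<langle>fst z\<rangle> \<le> \<langle>z\<rangle>" and bracket_snd_le: "\<langle>snd z\<rangle> \<le> \<langle>z\<rangle>"
  by (intro bracket_mono; metis norm_fst_le norm_snd_le prod.collapse)+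

lemma continuous_bracket [continuous_intros]:
  "continuous_on A f \<Longrightarrow> continuous_on A (\<lambda>x. \<langle>f x\<rangle>)"
  unfolding japanese_bracket_def by (intro continuous_intros)

lemma borel_measurable_bracket [measurable]: "japanese_bracket \<in> borel_measurable borel"
  unfolding japanese_bracket_def[abs_def] by measurable

section \<open>Integrability of negative powers of the bracket\<close>

lemma integrable_inverse_one_plus_square:
  "integrable lborel (\<lambda>x::real. inverse (1 + x\<^sup>2))"
  using integrable_inverse_1_plus_square by (simp add: set_integrable_def)

text \<open>Two powers per dimension let the function split: each factor
  \<open>1 + (x \<bullet> b)\<^sup>2\<close> is at most the squared bracket, so the product of
  one-dimensional integrable functions is a majorant.\<close>

lemma integrable_inverse_bracket_power:
  assumes "2 * DIM('a::euclidean_space) \<le> N"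
  shows "integrable lborel (\<lambda>x::'a. inverse (\<langle>x\<rangle> ^ N))"
proof -
  have le: "inverse (\<langle>x\<rangle> ^ N) \<le> (\<Prod>b\<in>Basis. inverse (1 + (x \<bullet> b)\<^sup>2))" for x :: 'a
  proof -
    have "(\<Prod>b\<in>Basis. (1 + (x \<bullet> b)\<^sup>2)) \<le> (\<Prod>b\<in>(Basis::'a set). \<langle>x\<rangle>\<^sup>2)"
    proof (intro prod_mono conjI)
      fix b :: 'a assume b: "b \<in> Basis"
      have "(x \<bullet> b)\<^sup>2 \<le> (norm x)\<^sup>2"
        using Basis_le_norm[OF b, of x] power_mono[of "\<bar>x \<bullet> b\<bar>" "norm x" 2] by simp
      then show "1 + (x \<bullet> b)\<^sup>2 \<le> \<langle>x\<rangle>\<^sup>2" by (simp add: bracket_sq)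
    qed simp
    also have "\<dots> = \<langle>x\<rangle> ^ (2 * DIM('a))" by (simp add: power_mult)
    also have "\<dots> \<le> \<langle>x\<rangle> ^ N"
      by (rule power_increasing[OF assms bracket_ge_1])
    finally have "(\<Prod>b\<in>Basis. (1 + (x \<bullet> b)\<^sup>2)) \<le> \<langle>x\<rangle> ^ N" .
    moreover have "0 < (\<Prod>b\<in>Basis. (1 + (x \<bullet> b)\<^sup>2))"
      by (intro prod_pos) (simp add: add_pos_nonneg)
    moreover have "(\<Prod>b\<in>Basis. inverse (1 + (x \<bullet> b)\<^sup>2)) = inverse (\<Prod>b\<in>Basis. (1 + (x \<bullet> b)\<^sup>2))"
      using prod_inversef[of "\<lambda>b. 1 + (x \<bullet> b)\<^sup>2" Basis] by (simp add: o_def)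
    ultimately show ?thesis by (simp add: le_imp_inverse_le)
  qed
  have "(\<integral>\<^sup>+x. ennreal (inverse (\<langle>x\<rangle> ^ N)) \<partial>(lborel::'a measure))
      \<le> (\<integral>\<^sup>+x. (\<Prod>b\<in>Basis. ennreal (inverse (1 + (x \<bullet> b)\<^sup>2))) \<partial>(lborel::'a measure))"
    by (intro nn_integral_mono) (simp add: le prod_ennreal ennreal_leI)
  also have "\<dots> = (\<Prod>b\<in>(Basis::'a set). \<integral>\<^sup>+x. ennreal (inverse (1 + x\<^sup>2)) \<partial>lborel)"
    by (rule nn_integral_lborel_prod) auto
  also have "\<dots> < \<infinity>"
  proof -
    have "(\<integral>\<^sup>+x. ennreal (inverse (1 + x\<^sup>2)) \<partial>lborel) < \<infinity>"
      using integrable_inverse_one_plus_square by (simp add: integrable_iff_bounded)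
    then show ?thesis by (simp add: less_top[symmetric] power_eq_top_ennreal)
  qed
  finally show ?thesis
    by (intro integrableI_bounded) auto
qed

lemma integrable_bounded_by_bracket:
  fixes f :: "'a::euclidean_space \<Rightarrow> 'b::{banach, second_countable_topology}"
  assumes [measurable]: "f \<in> borel_measurable lborel"
    and "\<And>x. norm (f x) \<le> C * inverse (\<langle>x\<rangle> ^ N)" "2 * DIM('a) \<le> N"
  shows "integrable lborel f"
  by (rule Bochner_Integration.integrable_bound[OF integrable_mult_right[OF integrable_inverse_bracket_power[OF assms(3)], of C]])
    (auto simp: assms(1) intro!: order.trans[OF assms(2)])

section \<open>The Schwartz space\<close>

abbreviation dir_deriv :: "'a::euclidean_space \<Rightarrow> ('a \<Rightarrow> complex) \<Rightarrow> 'a \<Rightarrow> complex" where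
  "dir_deriv b f \<equiv> \<lambda>x. frechet_derivative f (at x) b"

lemma dir_deriv_eqI: "(\<And>x. (f has_derivative D x) (at x)) \<Longrightarrow> dir_deriv b f = (\<lambda>x. D x b)"
  using frechet_derivative_at by metis

text \<open>Membership in the Schwartz space is a condition on all iterated derivatives, which
  seldom stay inside a simple set of functions. They do stay among combinations of the generators
  with polynomial coefficients, and for this only the first derivatives of the generators have to be
  inspected.\<close>

inductive_set schwartz_closure :: "('a::euclidean_space \<Rightarrow> complex) set \<Rightarrow> ('a \<Rightarrow> complex) set"
  for F where
  base: "f \<in> F \<Longrightarrow> f \<in> schwartz_closure F"
| add: "f \<in> schwartz_closure F \<Longrightarrow> g \<in> schwartz_closure F \<Longrightarrow> (\<lambda>x. f x + g x) \<in> schwartz_closure F"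
| scale: "f \<in> schwartz_closure F \<Longrightarrow> (\<lambda>x. c * f x) \<in> schwartz_closure F"
| linear: "f \<in> schwartz_closure F \<Longrightarrow> (\<lambda>x. of_real (x \<bullet> v) * f x) \<in> schwartz_closure F"

lemma has_derivative_frechet:
  "f differentiable (at x) \<Longrightarrow> (f has_derivative (\<lambda>h. frechet_derivative f (at x) h)) (at x)"
  using frechet_derivative_works[of f "at x"] by simp

text \<open>Decay is claimed for all orders at once so that the case of a linear factor can borrow
  one order. Derivatives remain in the closure by the product rule: differentiating the linear
  factor in a fixed direction leaves a scalar multiple of \<open>f\<close>.\<close>

lemma schwartz_closureD:
  assumes "f \<in> schwartz_closure F"
    and "\<And>f x. f \<in> F \<Longrightarrow> f differentiable (at x)"
    and "\<And>f N. f \<in> F \<Longrightarrow> \<exists>C. \<forall>x. \<langle>x\<rangle> ^ N * norm (f x) \<le> C"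
    and "\<And>f b. f \<in> F \<Longrightarrow> b \<in> Basis \<Longrightarrow> dir_deriv b f \<in> schwartz_closure F"
  shows "(\<forall>x. f differentiable (at x)) \<and> (\<forall>N. \<exists>C. \<forall>x. \<langle>x\<rangle> ^ N * norm (f x) \<le> C) \<and>
    (\<forall>b\<in>Basis. dir_deriv b f \<in> schwartz_closure F)"
  using assms(1)
proof induction
  case (base f)
  then show ?case using assms(2-4) by blast
next
  case (add f g)
  have d: "((\<lambda>x. f x + g x) has_derivative (\<lambda>h. frechet_derivative f (at x) h + frechet_derivative g (at x) h)) (at x)" for x
    using add by (intro has_derivative_add has_derivative_frechet) auto
  have "\<exists>C. \<forall>x. \<langle>x\<rangle> ^ N * norm (f x + g x) \<le> C" for N
  proof -
    obtain C D where "\<forall>x. \<langle>x\<rangle> ^ N * norm (f x) \<le> C" "\<forall>x. \<langle>x\<rangle> ^ N * norm (g x) \<le> D"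
      using add by metis
    then have "\<langle>x\<rangle> ^ N * norm (f x + g x) \<le> C + D" for x
      using mult_left_mono[OF norm_triangle_ineq[of "f x" "g x"], of "\<langle>x\<rangle> ^ N"]
      by (smt (verit) bracket_nonneg zero_le_power distrib_left)
    then show ?thesis by blast
  qed
  moreover have "dir_deriv b (\<lambda>x. f x + g x) \<in> schwartz_closure F" if "b \<in> Basis" for b
    unfolding dir_deriv_eqI[OF d] using add that by (intro schwartz_closure.add) auto
  ultimately show ?case using differentiableI[OF d] by blast
next
  case (scale f c)
  have d: "((\<lambda>x. c * f x) has_derivative (\<lambda>h. c * frechet_derivative f (at x) h)) (at x)" for x
    using scale by (intro has_derivative_mult_right has_derivative_frechet) auto
  have "\<exists>C. \<forall>x. \<langle>x\<rangle> ^ N * norm (c * f x) \<le> C" for N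
  proof -
    obtain C where "\<forall>x. \<langle>x\<rangle> ^ N * norm (f x) \<le> C"
      using scale by metis
    then have "\<langle>x\<rangle> ^ N * norm (c * f x) \<le> norm c * C" for x
      by (simp add: norm_mult mult.left_commute mult_left_mono)
    then show ?thesis by blast
  qed
  moreover have "dir_deriv b (\<lambda>x. c * f x) \<in> schwartz_closure F" if "b \<in> Basis" for b
    unfolding dir_deriv_eqI[OF d] using scale that by (intro schwartz_closure.scale) auto
  ultimately show ?case using differentiableI[OF d] by blast
next
  case (linear f v)
  have d: "((\<lambda>x. of_real (x \<bullet> v) * f x) has_derivative
      (\<lambda>h. of_real (x \<bullet> v) * frechet_derivative f (at x) h + of_real (h \<bullet> v) * f x)) (at x)" for x
    using linear by (intro has_derivative_mult has_derivative_frechet has_derivative_of_real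
        has_derivative_inner_left has_derivative_ident) auto
  have "\<exists>C. \<forall>x. \<langle>x\<rangle> ^ N * norm (of_real (x \<bullet> v) * f x) \<le> C" for N
  proof -
    \<comment> \<open>The additional power of the bracket pays for the linear factor.\<close>
    obtain C where C: "\<And>x. \<langle>x\<rangle> ^ Suc N * norm (f x) \<le> C"
      using linear by metis
    have "\<langle>x\<rangle> ^ N * norm (of_real (x \<bullet> v) * f x) \<le> norm v * C" for x
    proof -
      have "\<bar>x \<bullet> v\<bar> \<le> \<langle>x\<rangle> * norm v"
        using Cauchy_Schwarz_ineq2[of x v] norm_le_bracket[of x]
        by (meson mult_right_mono norm_ge_zero order_trans)
      then have "\<bar>x \<bullet> v\<bar> * (\<langle>x\<rangle> ^ N * norm (f x)) \<le> (\<langle>x\<rangle> * norm v) * (\<langle>x\<rangle> ^ N * norm (f x))"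
        by (intro mult_right_mono) auto
      also have "\<dots> = norm v * (\<langle>x\<rangle> ^ Suc N * norm (f x))"
        by simp
      also have "\<dots> \<le> norm v * C"
        by (intro mult_left_mono C) auto
      finally show ?thesis by (simp add: norm_mult ac_simps)
    qed
    then show ?thesis by blast
  qed
  moreover have "dir_deriv b (\<lambda>x. of_real (x \<bullet> v) * f x) \<in> schwartz_closure F" if "b \<in> Basis" for b
    unfolding dir_deriv_eqI[OF d] using linear that
    by (intro schwartz_closure.add schwartz_closure.scale schwartz_closure.linear) auto
  ultimately show ?case using differentiableI[OF d] by blast
qed

lemma schwartz_closure_subset:
  assumes "\<And>f x. f \<in> F \<Longrightarrow> f differentiable (at x)"
    and "\<And>f N. f \<in> F \<Longrightarrow> \<exists>C. \<forall>x. \<langle>x\<rangle> ^ N * norm (f x) \<le> C"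
    and "\<And>f b. f \<in> F \<Longrightarrow> b \<in> Basis \<Longrightarrow> dir_deriv b f \<in> schwartz_closure F"
  shows "schwartz_closure F \<subseteq> schwartz_space"
proof
  fix f assume f: "f \<in> schwartz_closure F"
  note D = schwartz_closureD[OF _ assms]
  have mem: "partial_derivs bs f \<in> schwartz_closure F" if "set bs \<subseteq> Basis" for bs
    using that
  proof (induction bs)
    case (Cons b bs)
    then show ?case using D[of "partial_derivs bs f"] by auto
  qed (simp add: f)
  show "f \<in> schwartz_space"
    unfolding schwartz_space_def
  proof safe
    fix bs :: "'a list" and x assume "set bs \<subseteq> Basis"
    then show "partial_derivs bs f differentiable (at x)" using D[OF mem] by blast
  next
    fix bs :: "'a list" and N assume "set bs \<subseteq> Basis"
    then obtain C where "\<forall>x. \<langle>x\<rangle> ^ N * norm (partial_derivs bs f x) \<le> C" using D[OF mem] by blast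
    then show "bounded (range (\<lambda>x. \<langle>x\<rangle> ^ N * norm (partial_derivs bs f x)))"
      by (auto simp: bounded_iff intro!: exI[of _ C])
  qed
qed

lemma schwartzI:
  assumes "f \<in> F" "\<And>f x. f \<in> F \<Longrightarrow> f differentiable (at x)"
    and "\<And>f N. f \<in> F \<Longrightarrow> \<exists>C. \<forall>x. \<langle>x\<rangle> ^ N * norm (f x) \<le> C"
    and "\<And>f b. f \<in> F \<Longrightarrow> b \<in> Basis \<Longrightarrow> dir_deriv b f \<in> schwartz_closure F"
  shows "f \<in> schwartz_space"
  using schwartz_closure_subset[OF assms(2-4)] schwartz_closure.base[OF assms(1)] by blast

lemma schwartz_partial_derivs_differentiable:
  "f \<in> schwartz_space \<Longrightarrow> set bs \<subseteq> Basis \<Longrightarrow> partial_derivs bs f differentiable (at x)"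
  by (auto simp: schwartz_space_def)

lemma schwartz_differentiable: "f \<in> schwartz_space \<Longrightarrow> f differentiable (at x)"
  using schwartz_partial_derivs_differentiable[of f "[]"] by simp

lemma schwartz_partial_derivs_bounded:
  assumes "f \<in> schwartz_space" "set bs \<subseteq> Basis"
  obtains C where "\<And>x. \<langle>x\<rangle> ^ N * norm (partial_derivs bs f x) \<le> C"
proof -
  have "bounded (range (\<lambda>x. \<langle>x\<rangle> ^ N * norm (partial_derivs bs f x)))"
    using assms by (auto simp: schwartz_space_def)
  then show ?thesis
    using that by (auto simp: bounded_iff)
qed

lemma schwartz_bounded:
  assumes "f \<in> schwartz_space"
  obtains C where "0 < C" "\<And>x. \<langle>x\<rangle> ^ N * norm (f x) \<le> C"
proof -
  obtain C where C: "\<And>x. \<langle>x\<rangle> ^ N * norm (f x) \<le> C"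
    using schwartz_partial_derivs_bounded[OF assms, of "[]" N] by auto
  show ?thesis
    by (rule that[of "max C 1"]) (use C in \<open>auto simp: le_max_iff_disj\<close>)
qed

lemma schwartz_bounded_ex: "f \<in> schwartz_space \<Longrightarrow> \<exists>C. \<forall>x. \<langle>x\<rangle> ^ N * norm (f x) \<le> C"
  by (metis schwartz_bounded)

lemma schwartz_decay:
  assumes "f \<in> schwartz_space"
  obtains C where "0 < C" "\<And>x. norm (f x) \<le> C * inverse (\<langle>x\<rangle> ^ N)"
proof -
  obtain C where C: "0 < C" "\<And>x. \<langle>x\<rangle> ^ N * norm (f x) \<le> C" using schwartz_bounded[OF assms] by blast
  show ?thesis
    by (rule that[OF C(1)]) (use C(2) in \<open>auto simp: field_simps\<close>)
qed

lemma schwartz_partial_derivs_append: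
  "partial_derivs (bs @ cs) f = partial_derivs bs (partial_derivs cs f)"
  by (induction bs) auto

lemma schwartz_partial_derivs:
  assumes "f \<in> schwartz_space" "set bs \<subseteq> Basis"
  shows "partial_derivs bs f \<in> schwartz_space"
  using assms by (auto simp: schwartz_space_def simp flip: schwartz_partial_derivs_append)

lemma schwartz_dir_deriv:
  "f \<in> schwartz_space \<Longrightarrow> b \<in> Basis \<Longrightarrow> dir_deriv b f \<in> schwartz_space"
  using schwartz_partial_derivs[of f "[b]"] by simp

text \<open>With all Schwartz functions as generators the closure rules become stability properties
  of the space.\<close>

lemma schwartz_closure_schwartz: "schwartz_closure schwartz_space = schwartz_space"
proof
  show "schwartz_closure schwartz_space \<subseteq> schwartz_space"
    by (rule schwartz_closure_subset)
      (auto intro: schwartz_differentiable schwartz_dir_deriv schwartz_closure.base schwartz_bounded_ex)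
qed (auto intro: schwartz_closure.base)

section \<open>Products, shifts, chirps and tensor products of Schwartz functions\<close>

lemma schwartz_add: "f \<in> schwartz_space \<Longrightarrow> g \<in> schwartz_space \<Longrightarrow> (\<lambda>x. f x + g x) \<in> schwartz_space"
  using schwartz_closure.add[of f schwartz_space g] by (simp add: schwartz_closure_schwartz)

lemma schwartz_scale: "f \<in> schwartz_space \<Longrightarrow> (\<lambda>x. c * f x) \<in> schwartz_space"
  using schwartz_closure.scale[of f schwartz_space] by (simp add: schwartz_closure_schwartz)

lemma schwartz_linear: "f \<in> schwartz_space \<Longrightarrow> (\<lambda>x. of_real (x \<bullet> v) * f x) \<in> schwartz_space"
  using schwartz_closure.linear[of f schwartz_space] by (simp add: schwartz_closure_schwartz)

lemma schwartz_zero: "(\<lambda>_. 0) \<in> schwartz_space"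
  by (rule schwartzI[of _ "{\<lambda>_. 0}"])
    (auto simp: dir_deriv_eqI[OF has_derivative_const] intro: schwartz_closure.base)

lemma schwartz_diff: "f \<in> schwartz_space \<Longrightarrow> g \<in> schwartz_space \<Longrightarrow> (\<lambda>x. f x - g x) \<in> schwartz_space"
  using schwartz_add[OF _ schwartz_scale[of g "-1"], of f] by simp

lemma schwartz_sum:
  "(\<And>i. i \<in> I \<Longrightarrow> f i \<in> schwartz_space) \<Longrightarrow> (\<lambda>x. \<Sum>i\<in>I. f i x) \<in> schwartz_space"
  by (induction I rule: infinite_finite_induct) (auto intro: schwartz_add schwartz_zero)

text \<open>The generators are all products of Schwartz functions rather than the one at hand, since
  differentiation replaces a factor by its derivative. The same device serves conjugates,
  translates, phases and tensor products below.\<close>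

lemma schwartz_mult:
  assumes "f \<in> schwartz_space" "g \<in> schwartz_space"
  shows "(\<lambda>x. f x * g x) \<in> schwartz_space"
proof -
  let ?F = "{\<lambda>x. f x * g x |(f::'a \<Rightarrow> complex) g. f \<in> schwartz_space \<and> g \<in> schwartz_space}"
  have d: "((\<lambda>x. f x * g x) has_derivative
      (\<lambda>h. f x * frechet_derivative g (at x) h + frechet_derivative f (at x) h * g x)) (at x)"
    if "f \<in> schwartz_space" "g \<in> schwartz_space" for f g :: "'a \<Rightarrow> complex" and x
    using that by (intro has_derivative_mult has_derivative_frechet schwartz_differentiable)
  have mem: "(\<lambda>x. f x * g x) \<in> ?F" if "f \<in> schwartz_space" "g \<in> schwartz_space" for f g
    using that by blast
  show ?thesis
  proof (rule schwartzI[of _ ?F])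
    fix u :: "'a \<Rightarrow> complex" and N assume "u \<in> ?F"
    then obtain f g where u: "u = (\<lambda>x. f x * g x)" and fg: "f \<in> schwartz_space" "g \<in> schwartz_space"
      by auto
    obtain C where C: "0 < C" "\<And>x. \<langle>x\<rangle> ^ N * norm (f x) \<le> C" using schwartz_bounded[OF fg(1)] by blast
    obtain D where D: "0 < D" "\<And>x. \<langle>x\<rangle> ^ 0 * norm (g x) \<le> D" using schwartz_bounded[OF fg(2)] by blast
    have "\<langle>x\<rangle> ^ N * norm (u x) \<le> C * D" for x
      using mult_mono[OF C(2)[of x] D(2)[of x]] C(1) by (simp add: u norm_mult mult.assoc)
    then show "\<exists>C. \<forall>x. \<langle>x\<rangle> ^ N * norm (u x) \<le> C" by blast
  next
    fix u :: "'a \<Rightarrow> complex" and b :: 'a assume b: "b \<in> Basis" and "u \<in> ?F"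
    then obtain f g where u: "u = (\<lambda>x. f x * g x)" and fg: "f \<in> schwartz_space" "g \<in> schwartz_space"
      by auto
    show "dir_deriv b u \<in> schwartz_closure ?F"
      unfolding u dir_deriv_eqI[OF d[OF fg]]
      by (intro schwartz_closure.add schwartz_closure.base mem schwartz_dir_deriv fg b)
  qed (use assms differentiableI[OF d] in auto)
qed

lemma schwartz_cnj:
  assumes "f \<in> schwartz_space"
  shows "(\<lambda>x. cnj (f x)) \<in> schwartz_space"
proof (rule schwartzI[of _ "{\<lambda>x. cnj (f x) |f. f \<in> schwartz_space}"])
  have d: "((\<lambda>x. cnj (f x)) has_derivative (\<lambda>h. cnj (frechet_derivative f (at x) h))) (at x)"
    if "f \<in> schwartz_space" for f :: "'a \<Rightarrow> complex" and x
    using that by (intro has_derivative_cnj has_derivative_frechet schwartz_differentiable)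
  fix u :: "'a \<Rightarrow> complex" and b :: 'a assume b: "b \<in> Basis" and "u \<in> {\<lambda>x. cnj (f x) |f. f \<in> schwartz_space}"
  then obtain f where f: "u = (\<lambda>x. cnj (f x))" "f \<in> schwartz_space" by auto
  show "dir_deriv b u \<in> schwartz_closure {\<lambda>x. cnj (f x) |f. f \<in> schwartz_space}"
    unfolding f(1) dir_deriv_eqI[OF d[OF f(2)]]
    by (rule schwartz_closure.base, rule CollectI, rule exI, rule conjI[OF refl schwartz_dir_deriv[OF f(2) b]])
next
  fix u :: "'a \<Rightarrow> complex" and N assume "u \<in> {\<lambda>x. cnj (f x) |f. f \<in> schwartz_space}"
  then show "\<exists>C. \<forall>x. \<langle>x\<rangle> ^ N * norm (u x) \<le> C"
    using schwartz_bounded_ex by fastforce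
next
  fix u :: "'a \<Rightarrow> complex" and x assume "u \<in> {\<lambda>x. cnj (f x) |f. f \<in> schwartz_space}"
  then obtain f where f: "u = (\<lambda>x. cnj (f x))" "f \<in> schwartz_space" by auto
  show "u differentiable (at x)"
    unfolding f(1) by (intro differentiableI[OF has_derivative_cnj[OF has_derivative_frechet]] schwartz_differentiable f(2))
qed (use assms in auto)

lemma schwartz_translation:
  assumes "f \<in> schwartz_space"
  shows "(\<lambda>x. f (x - a)) \<in> schwartz_space"
proof (rule schwartzI[of _ "{\<lambda>x. f (x - a) |f. f \<in> schwartz_space}"])
  have d: "((\<lambda>x. f (x - a)) has_derivative (\<lambda>h. frechet_derivative f (at (x - a)) h)) (at x)"
    if "f \<in> schwartz_space" for f :: "'a \<Rightarrow> complex" and x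
  proof -
    have "((\<lambda>x. x - a) has_derivative (\<lambda>h. h)) (at x)"
      by (auto intro!: derivative_eq_intros)
    from has_derivative_compose[OF this has_derivative_frechet[OF schwartz_differentiable[OF that]]]
    show ?thesis .
  qed
  fix u :: "'a \<Rightarrow> complex" and b :: 'a assume b: "b \<in> Basis" and "u \<in> {\<lambda>x. f (x - a) |f. f \<in> schwartz_space}"
  then obtain f where f: "u = (\<lambda>x. f (x - a))" "f \<in> schwartz_space" by auto
  show "dir_deriv b u \<in> schwartz_closure {\<lambda>x. f (x - a) |f. f \<in> schwartz_space}"
    unfolding f(1) dir_deriv_eqI[OF d[OF f(2)]]
    by (rule schwartz_closure.base, rule CollectI, rule exI, rule conjI[OF refl schwartz_dir_deriv[OF f(2) b]])
next
  fix u :: "'a \<Rightarrow> complex" and N assume "u \<in> {\<lambda>x. f (x - a) |f. f \<in> schwartz_space}"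
  then obtain f where f: "u = (\<lambda>x. f (x - a))" "f \<in> schwartz_space" by auto
  obtain C where C: "0 < C" "\<And>x. \<langle>x\<rangle> ^ N * norm (f x) \<le> C" using schwartz_bounded[OF f(2)] by blast
  have "\<langle>x\<rangle> ^ N * norm (u x) \<le> 2 ^ N * \<langle>a\<rangle> ^ N * C" for x
  proof -
    have "\<langle>x\<rangle> ^ N * norm (u x) \<le> (2 ^ N * \<langle>a\<rangle> ^ N * \<langle>x - a\<rangle> ^ N) * norm (f (x - a))"
      unfolding f(1) by (intro mult_right_mono bracket_shift_power_le) auto
    also have "\<dots> = (2 ^ N * \<langle>a\<rangle> ^ N) * (\<langle>x - a\<rangle> ^ N * norm (f (x - a)))" by simp
    also have "\<dots> \<le> (2 ^ N * \<langle>a\<rangle> ^ N) * C" by (intro mult_left_mono C) auto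
    finally show ?thesis .
  qed
  then show "\<exists>C. \<forall>x. \<langle>x\<rangle> ^ N * norm (u x) \<le> C" by blast
next
  fix u :: "'a \<Rightarrow> complex" and x assume "u \<in> {\<lambda>x. f (x - a) |f. f \<in> schwartz_space}"
  then obtain f where f: "u = (\<lambda>x. f (x - a))" "f \<in> schwartz_space" by auto
  have "(f \<circ> (\<lambda>x. x - a)) differentiable at x"
    by (intro differentiable_chain_at derivative_intros schwartz_differentiable f(2))
  then show "u differentiable (at x)" by (simp add: f(1) o_def)
qed (use assms in auto)

lemma has_derivative_cis_comp:
  assumes "(q has_derivative q') (at x)"
  shows "((\<lambda>x. cis (q x)) has_derivative (\<lambda>h. \<i> * of_real (q' h) * cis (q x))) (at x)"
proof -
  have "((\<lambda>x. \<i> * of_real (q x)) has_derivative (\<lambda>h. \<i> * of_real (q' h))) (at x)"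
    by (intro has_derivative_mult_right has_derivative_of_real assms)
  from has_derivative_compose[OF this DERIV_exp[unfolded has_field_derivative_def]]
  show ?thesis by (simp add: cis_conv_exp mult.commute)
qed

text \<open>The hypothesis on \<open>q'\<close> holds for polynomials \<open>q\<close> of degree at most two.\<close>

lemma schwartz_cis_mult:
  fixes q :: "'a::euclidean_space \<Rightarrow> real"
  assumes "f \<in> schwartz_space" and q: "\<And>x. (q has_derivative q' x) (at x)"
    and lin: "\<And>b. b \<in> Basis \<Longrightarrow> \<exists>v c. \<forall>x. q' x b = x \<bullet> v + c"
  shows "(\<lambda>x. cis (q x) * f x) \<in> schwartz_space"
proof (rule schwartzI[of _ "{\<lambda>x. cis (q x) * f x |f. f \<in> schwartz_space}"])
  let ?F = "{\<lambda>x. cis (q x) * f x |f::'a \<Rightarrow> complex. f \<in> schwartz_space}"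
  have d: "((\<lambda>x. cis (q x) * f x) has_derivative
     (\<lambda>h. cis (q x) * frechet_derivative f (at x) h + \<i> * of_real (q' x h) * cis (q x) * f x)) (at x)"
    if "f \<in> schwartz_space" for f :: "'a \<Rightarrow> complex" and x
    using that by (intro has_derivative_mult has_derivative_cis_comp q has_derivative_frechet schwartz_differentiable)
  have mem: "(\<lambda>x. cis (q x) * f x) \<in> ?F" if "f \<in> schwartz_space" for f
    using that by blast
  show "u differentiable (at x)" if "u \<in> ?F" for u x
    using that differentiableI[OF d] by auto
  fix u :: "'a \<Rightarrow> complex" and b :: 'a assume b: "b \<in> Basis" and "u \<in> ?F"
  then obtain f where f: "u = (\<lambda>x. cis (q x) * f x)" "f \<in> schwartz_space" by auto
  obtain v c where vc: "\<And>x. q' x b = x \<bullet> v + c" using lin[OF b] by auto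
  have eq: "(\<lambda>x. cis (q x) * frechet_derivative f (at x) b + \<i> * of_real (q' x b) * cis (q x) * f x)
    = (\<lambda>x. cis (q x) * dir_deriv b f x + (\<i> * (of_real (x \<bullet> v) * (cis (q x) * f x)) + (\<i> * of_real c) * (cis (q x) * f x)))"
    by (simp add: vc algebra_simps)
  show "dir_deriv b u \<in> schwartz_closure ?F"
    unfolding f(1) dir_deriv_eqI[OF d[OF f(2)]] eq
    by (intro schwartz_closure.add schwartz_closure.scale schwartz_closure.linear schwartz_closure.base
        mem schwartz_dir_deriv f(2) b)
qed (use assms in \<open>auto simp: norm_mult intro: schwartz_bounded_ex\<close>)

lemma schwartz_cis_inner:
  "f \<in> schwartz_space \<Longrightarrow> (\<lambda>x. cis (c * (x \<bullet> z)) * f x) \<in> schwartz_space"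
  by (erule schwartz_cis_mult[where q' = "\<lambda>_ h. c * (h \<bullet> z)"])
    (auto intro!: derivative_eq_intros intro: exI[of _ 0])

lemma schwartz_modulation: "f \<in> schwartz_space \<Longrightarrow> modulation z f \<in> schwartz_space"
  using schwartz_cis_inner[of f "2 * pi" z] by (simp add: modulation_def mult.assoc)

lemma schwartz_translation': "f \<in> schwartz_space \<Longrightarrow> translation a f \<in> schwartz_space"
  unfolding translation_def by (rule schwartz_translation)

lemma schwartz_chirp:
  fixes f :: "'a::euclidean_space \<times> 'a \<Rightarrow> complex"
  assumes "f \<in> schwartz_space"
  shows "(\<lambda>(x, \<xi>). cis (c * (x \<bullet> \<xi>)) * f (x, \<xi>)) \<in> schwartz_space"
proof -
  have "(\<lambda>w. cis (c * (fst w \<bullet> snd w)) * f w) \<in> schwartz_space"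
  proof (rule schwartz_cis_mult[where q' = "\<lambda>w h. c * (fst w \<bullet> snd h + fst h \<bullet> snd w)", OF assms])
    fix b :: "'a \<times> 'a"
    show "\<exists>v d. \<forall>x::'a\<times>'a. c * (fst x \<bullet> snd b + fst b \<bullet> snd x) = x \<bullet> v + d"
      \<comment> \<open>The phase is a bilinear form, so its derivative in direction
        \<open>b\<close> pairs the point with \<open>b\<close> after the two components of
        \<open>b\<close> have been swapped.\<close>
      by (intro exI[of _ "(c *\<^sub>R snd b, c *\<^sub>R fst b)"] exI[of _ 0])
        (auto simp: inner_Pair algebra_simps inner_commute)
  qed (auto intro!: derivative_eq_intros)
  then show ?thesis by (simp add: case_prod_unfold)
qed

lemma schwartz_tensor:
  fixes f :: "'a::euclidean_space \<Rightarrow> complex" and g :: "'b::euclidean_space \<Rightarrow> complex"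
  assumes "f \<in> schwartz_space" "g \<in> schwartz_space"
  shows "(\<lambda>(x, y). f x * g y) \<in> schwartz_space"
proof -
  let ?F = "{\<lambda>w. f (fst w) * g (snd w) |(f::'a \<Rightarrow> complex) (g::'b \<Rightarrow> complex). f \<in> schwartz_space \<and> g \<in> schwartz_space}"
  have d: "((\<lambda>w. f (fst w) * g (snd w)) has_derivative
      (\<lambda>h. f (fst w) * frechet_derivative g (at (snd w)) (snd h) + frechet_derivative f (at (fst w)) (fst h) * g (snd w))) (at w)"
    if "f \<in> schwartz_space" "g \<in> schwartz_space" for f :: "'a \<Rightarrow> complex" and g :: "'b \<Rightarrow> complex" and w
    by (intro has_derivative_mult has_derivative_compose[OF has_derivative_fst[OF has_derivative_ident]]
        has_derivative_compose[OF has_derivative_snd[OF has_derivative_ident]]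
        has_derivative_frechet schwartz_differentiable that)
  have "(\<lambda>w. f (fst w) * g (snd w)) \<in> schwartz_space"
  proof (rule schwartzI[of _ ?F])
    fix u :: "'a \<times> 'b \<Rightarrow> complex" and N assume "u \<in> ?F"
    then obtain f g where u: "u = (\<lambda>w. f (fst w) * g (snd w))" and fg: "f \<in> schwartz_space" "g \<in> schwartz_space"
      by auto
    obtain C where C: "0 < C" "\<And>x. \<langle>x\<rangle> ^ N * norm (f x) \<le> C" using schwartz_bounded[OF fg(1)] by blast
    obtain D where D: "0 < D" "\<And>x. \<langle>x\<rangle> ^ N * norm (g x) \<le> D" using schwartz_bounded[OF fg(2)] by blast
    have "\<langle>w\<rangle> ^ N * norm (u w) \<le> C * D" for w
    proof -
      have "\<langle>w\<rangle> ^ N \<le> \<langle>fst w\<rangle> ^ N * \<langle>snd w\<rangle> ^ N"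
        using power_mono[OF bracket_Pair[of "fst w" "snd w"], of N] by (simp add: power_mult_distrib)
      then have "\<langle>w\<rangle> ^ N * norm (u w) \<le> (\<langle>fst w\<rangle> ^ N * \<langle>snd w\<rangle> ^ N) * norm (u w)"
        by (rule mult_right_mono) auto
      also have "\<dots> = (\<langle>fst w\<rangle> ^ N * norm (f (fst w))) * (\<langle>snd w\<rangle> ^ N * norm (g (snd w)))"
        by (simp add: u norm_mult)
      also have "\<dots> \<le> C * D"
        by (intro mult_mono C D) (use C in auto)
      finally show ?thesis .
    qed
    then show "\<exists>C. \<forall>x. \<langle>x\<rangle> ^ N * norm (u x) \<le> C" by blast
  next
    fix u :: "'a \<times> 'b \<Rightarrow> complex" and b :: "'a \<times> 'b" assume b: "b \<in> Basis" and "u \<in> ?F"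
    then obtain f g where u: "u = (\<lambda>w. f (fst w) * g (snd w))" and fg: "f \<in> schwartz_space" "g \<in> schwartz_space"
      by auto
    \<comment> \<open>A basis vector of the product space lies in one factor; linearity at 0 removes
      the term in which the other factor is differentiated.\<close>
    have lin: "frechet_derivative f (at x) 0 = 0" "frechet_derivative g (at y) 0 = 0" for x y
      using fg by (auto intro!: linear_0 linear_frechet_derivative schwartz_differentiable)
    from b consider b1 where "b = (b1, 0)" "b1 \<in> Basis" | b2 where "b = (0, b2)" "b2 \<in> Basis"
      by (auto simp: Basis_prod_def)
    then show "dir_deriv b u \<in> schwartz_closure ?F"
    proof cases
      case 1
      then have "dir_deriv b u = (\<lambda>w. dir_deriv b1 f (fst w) * g (snd w))"
        unfolding u dir_deriv_eqI[OF d[OF fg]] by (simp add: lin)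
      then show ?thesis
        using schwartz_dir_deriv[OF fg(1) 1(2)] fg(2) by (intro schwartz_closure.base) auto
    next
      case 2
      then have "dir_deriv b u = (\<lambda>w. f (fst w) * dir_deriv b2 g (snd w))"
        unfolding u dir_deriv_eqI[OF d[OF fg]] by (simp add: lin)
      then show ?thesis
        using schwartz_dir_deriv[OF fg(2) 2(2)] fg(1) by (intro schwartz_closure.base) auto
    qed
  qed (use assms differentiableI[OF d] in auto)
  then show ?thesis by (simp add: case_prod_unfold)
qed

section \<open>Continuity, integrability and Gaussian examples\<close>

lemma schwartz_continuous_on: "f \<in> schwartz_space \<Longrightarrow> continuous_on A f"
  by (meson continuous_at_imp_continuous_on differentiable_imp_continuous_within schwartz_differentiable)

lemma schwartz_borel [measurable_dest]: "f \<in> schwartz_space \<Longrightarrow> f \<in> borel_measurable borel"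
  by (simp add: borel_measurable_continuous_onI schwartz_continuous_on)

lemma schwartz_integrable:
  assumes "f \<in> schwartz_space"
  shows "integrable lborel f"
proof -
  obtain C where "\<And>x. norm (f x) \<le> C * inverse (\<langle>x\<rangle> ^ (2 * DIM('a)))"
    using schwartz_decay[OF assms] by blast
  then show ?thesis
    by (rule integrable_bounded_by_bracket[rotated]) (use assms in auto)
qed

text \<open>A directional derivative of a Gaussian is a linear factor times the same Gaussian, so a
  single generator is enough.\<close>

lemma schwartz_gaussian:
  assumes "0 < c"
  shows "(\<lambda>x::'a::euclidean_space. of_real (exp (- c * (norm x)\<^sup>2))) \<in> schwartz_space"
proof (rule schwartzI[of _ "{\<lambda>x. of_real (exp (- c * (norm x)\<^sup>2))}"])
  let ?g = "\<lambda>x::'a. complex_of_real (exp (- c * (norm x)\<^sup>2))"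
  have d: "(?g has_derivative (\<lambda>h. of_real (exp (- c * (norm x)\<^sup>2) * (- c * (2 * (x \<bullet> h)))))) (at x)" for x
    unfolding power2_norm_eq_inner
    by (rule has_derivative_of_real) (auto intro!: derivative_eq_intros simp: inner_commute)
  show "f differentiable (at x)" if "f \<in> {?g}" for f x
    using that differentiableI[OF d] by auto
  fix f and b :: 'a assume f: "f \<in> {?g}"
  have "dir_deriv b ?g = (\<lambda>x. of_real (- 2 * c) * (of_real (x \<bullet> b) * ?g x))"
    unfolding dir_deriv_eqI[OF d] by (simp add: ac_simps)
  also have "\<dots> \<in> schwartz_closure {?g}"
    by (intro schwartz_closure.scale schwartz_closure.linear schwartz_closure.base) simp
  finally show "dir_deriv b f \<in> schwartz_closure {?g}"
    using f by simp
next
  fix f :: "'a \<Rightarrow> complex" and N assume f: "f \<in> {\<lambda>x. of_real (exp (- c * (norm x)\<^sup>2))}"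
  have 1: "\<langle>x\<rangle> ^ N \<le> (1 + (norm x)\<^sup>2) ^ N" for x :: 'a
    using power_increasing[OF _ bracket_ge_1[of x], of N "2 * N"] by (simp add: power_mult bracket_sq)
  have "((\<lambda>t::real. (1 + t) ^ N * exp (- c * t)) \<longlongrightarrow> 0) at_top"
    using assms by real_asymp
  then have "eventually (\<lambda>t::real. (1 + t) ^ N * exp (- c * t) < 1) at_top"
    by (rule order_tendstoD) simp
  then obtain T where T: "\<And>t. T \<le> t \<Longrightarrow> (1 + t) ^ N * exp (- c * t) < 1"
    by (auto simp: eventually_at_top_linorder)
  have "(1 + (norm x)\<^sup>2) ^ N * exp (- c * (norm x)\<^sup>2) \<le> (1 + \<bar>T\<bar>) ^ N" for x :: 'a
  proof (cases "T \<le> (norm x)\<^sup>2")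
    case True
    have "1 \<le> (1 + \<bar>T\<bar>) ^ N" by (rule one_le_power) simp
    then show ?thesis using T[OF True] by linarith
  next
    case False
    have "(1 + (norm x)\<^sup>2) ^ N * exp (- c * (norm x)\<^sup>2) \<le> (1 + \<bar>T\<bar>) ^ N * 1"
      using False assms by (intro mult_mono power_mono) auto
    then show ?thesis by simp
  qed
  then have "\<langle>x\<rangle> ^ N * norm (f x) \<le> (1 + \<bar>T\<bar>) ^ N" for x
    using f order_trans[OF mult_right_mono[OF 1[of x], of "exp (- c * (norm x)\<^sup>2)"]] by auto
  then show "\<exists>C. \<forall>x. \<langle>x\<rangle> ^ N * norm (f x) \<le> C" by blast
qed auto

section \<open>Lebesgue integrals\<close>

lemma integral_affine:
  fixes f :: "'a::euclidean_space \<Rightarrow> 'b::{banach, second_countable_topology}"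
  assumes [measurable]: "f \<in> borel_measurable borel" and c: "c \<noteq> 0"
  shows "(\<integral>x. f x \<partial>lborel) = \<bar>c\<bar> ^ DIM('a) *\<^sub>R (\<integral>x. f (t + c *\<^sub>R x) \<partial>lborel)"
  by (subst lborel_affine[OF c, of t])
    (simp add: integral_density integral_distr)

lemma integral_translate:
  fixes f :: "'a::euclidean_space \<Rightarrow> 'b::{banach, second_countable_topology}"
  assumes [measurable]: "f \<in> borel_measurable borel"
  shows "(\<integral>x. f (x - a) \<partial>lborel) = (\<integral>x. f x \<partial>lborel)"
  using integral_affine[of f 1 "- a"] by simp

lemma integrable_translate:
  fixes f :: "'a::euclidean_space \<Rightarrow> 'b::{banach, second_countable_topology}"
  assumes "integrable lborel f"
  shows "integrable lborel (\<lambda>x. f (x - a))"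
proof -
  have "integrable (distr lborel borel ((+) (- a))) f"
    using assms by (simp add: lborel_distr_plus)
  then show ?thesis
    by (subst (asm) integrable_distr_eq) (use borel_measurable_integrable[OF assms] in auto)
qed

lemma nn_integral_translate:
  fixes f :: "'a::euclidean_space \<Rightarrow> ennreal"
  assumes [measurable]: "f \<in> borel_measurable borel"
  shows "(\<integral>\<^sup>+x. f (x - a) \<partial>lborel) = (\<integral>\<^sup>+x. f x \<partial>lborel)"
proof -
  have "(\<integral>\<^sup>+x. f x \<partial>lborel) = (\<integral>\<^sup>+x. f x \<partial>(distr lborel borel ((+) (- a))))"
    by (simp add: lborel_distr_plus)
  also have "\<dots> = (\<integral>\<^sup>+x. f (x - a) \<partial>lborel)"
    by (subst nn_integral_distr) auto
  finally show ?thesis by simp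
qed

lemma lborel_distr_reflect: "distr lborel borel (\<lambda>x. - x) = (lborel :: 'a::euclidean_space measure)"
  using lborel_affine[of "-1" "0::'a"] by (simp add: density_1)

lemma nn_integral_reflect:
  fixes f :: "'a::euclidean_space \<Rightarrow> ennreal"
  assumes [measurable]: "f \<in> borel_measurable borel"
  shows "(\<integral>\<^sup>+x. f (- x) \<partial>lborel) = (\<integral>\<^sup>+x. f x \<partial>lborel)"
proof -
  have "(\<integral>\<^sup>+x. f x \<partial>lborel) = (\<integral>\<^sup>+x. f x \<partial>(distr lborel borel (\<lambda>x. - x)))"
    by (simp add: lborel_distr_reflect)
  also have "\<dots> = (\<integral>\<^sup>+x. f (- x) \<partial>lborel)"
    by (subst nn_integral_distr) auto
  finally show ?thesis by simp
qed

lemma nn_integral_reflect_translate: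
  fixes f :: "'a::euclidean_space \<Rightarrow> ennreal"
  assumes [measurable]: "f \<in> borel_measurable borel"
  shows "(\<integral>\<^sup>+x. f (a - x) \<partial>lborel) = (\<integral>\<^sup>+x. f x \<partial>lborel)"
  using nn_integral_translate[of "\<lambda>x. f (- x)" a] nn_integral_reflect[of f] by simp

text \<open>The complex counterpart of the product formula for nonnegative integrands; it reduces
  the Fourier transform of a Gaussian to dimension one.\<close>

lemma integral_lborel_prod:
  fixes f :: "'a::euclidean_space \<Rightarrow> real \<Rightarrow> complex"
  assumes "\<And>b. b \<in> Basis \<Longrightarrow> integrable lborel (f b)"
  shows "(\<integral>x. (\<Prod>b\<in>Basis. f b (x \<bullet> b)) \<partial>lborel) = (\<Prod>b\<in>Basis. \<integral>x. f b x \<partial>lborel)"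
proof -
  interpret product_sigma_finite "\<lambda>_::'a. lborel :: real measure" by standard
  have [measurable]: "f b \<in> borel_measurable borel" if "b \<in> Basis" for b
    using borel_measurable_integrable[OF assms[OF that]] by simp
  have "(\<integral>x. (\<Prod>b\<in>Basis. f b (x \<bullet> b)) \<partial>lborel)
    = (\<integral>x. (\<Prod>b\<in>Basis. f b ((\<Sum>c\<in>Basis. x c *\<^sub>R c) \<bullet> b)) \<partial>(\<Pi>\<^sub>M b\<in>Basis. lborel))"
    by (subst lborel_eq, subst integral_distr) auto
  also have "\<dots> = (\<integral>x. (\<Prod>b\<in>Basis. f b (x b)) \<partial>(\<Pi>\<^sub>M b\<in>Basis. lborel))"
    by (intro Bochner_Integration.integral_cong prod.cong) auto
  also have "\<dots> = (\<Prod>b\<in>Basis. \<integral>x. f b x \<partial>lborel)"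
    by (rule product_integral_prod) (auto intro: assms)
  finally show ?thesis .
qed

text \<open>Justifies Fubini's theorem for Fourier inversion and Plancherel, where \<open>k\<close>
  is a tensor product multiplied by unimodular phases.\<close>

lemma integrable_tensor:
  fixes f :: "'a::euclidean_space \<Rightarrow> complex" and g :: "'b::euclidean_space \<Rightarrow> complex"
    and k :: "'a \<Rightarrow> 'b \<Rightarrow> complex"
  assumes f: "integrable lborel f" and g: "integrable lborel g"
    and [measurable]: "(\<lambda>(x, y). k x y) \<in> borel_measurable (lborel \<Otimes>\<^sub>M lborel)"
    and k: "\<And>x y. norm (k x y) \<le> norm (f x) * norm (g y)"
  shows "integrable (lborel \<Otimes>\<^sub>M lborel) (\<lambda>(x, y). k x y)"
proof (rule Bochner_Integration.integrable_bound)
  have [measurable]: "f \<in> borel_measurable lborel" "g \<in> borel_measurable lborel"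
    using f g by auto
  show "integrable (lborel \<Otimes>\<^sub>M lborel) (\<lambda>(x, y). f x * g y)"
  proof (rule lborel_pair.Fubini_integrable)
    show "integrable lborel (\<lambda>x. \<integral>y. norm (case (x, y) of (x, y) \<Rightarrow> f x * g y) \<partial>lborel)"
      using f by (simp add: norm_mult)
    show "AE x in lborel. integrable lborel (\<lambda>y. case (x, y) of (x, y) \<Rightarrow> f x * g y)"
      using g by simp
  qed measurable
qed (use k in \<open>auto simp: norm_mult\<close>)

text \<open>Differentiation under the integral sign for Frechet derivatives. The mean value
  inequality bounds the difference quotients by \<open>B\<close>, and subtracting the derivative
  costs another \<open>B\<close>, so \<open>2 * B w\<close> is a majorant for dominated convergence
  along sequences.\<close>

lemma has_derivative_lebesgue_integral:
  fixes F :: "'w \<Rightarrow> 'a::euclidean_space \<Rightarrow> complex"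
  assumes F: "\<And>w y. y \<in> ball y0 r \<Longrightarrow> (F w has_derivative F' w y) (at y)"
    and bound: "\<And>w y h. y \<in> ball y0 r \<Longrightarrow> norm (F' w y h) \<le> B w * norm h"
    and B: "integrable M B" and r: "0 < r"
    and int: "\<And>y. y \<in> ball y0 r \<Longrightarrow> integrable M (\<lambda>w. F w y)"
    and meas: "\<And>h. (\<lambda>w. F' w y0 h) \<in> borel_measurable M"
  shows "((\<lambda>y. \<integral>w. F w y \<partial>M) has_derivative (\<lambda>h. \<integral>w. F' w y0 h \<partial>M)) (at y0)"
proof -
  have y0: "y0 \<in> ball y0 r" using r by simp
  have B0: "0 \<le> B w" for w
  proof -
    obtain b :: 'a where "b \<in> Basis" by fastforce
    then show ?thesis using order_trans[OF norm_ge_zero bound[OF y0, of w b]] by simp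
  qed
  have int': "integrable M (\<lambda>w. F' w y0 h)" for h
    by (rule Bochner_Integration.integrable_bound[OF integrable_mult_left[OF B, of "norm h"]])
      (use meas bound[OF y0] B0 in auto)
  have lin: "bounded_linear (F' w y0)" for w
    using F[OF y0] has_derivative_bounded_linear by blast
  have "bounded_linear (\<lambda>h. \<integral>w. F' w y0 h \<partial>M)"
  proof (rule bounded_linear_intro[of _ "\<integral>w. B w \<partial>M"])
    fix h k :: 'a and c :: real
    show "(\<integral>w. F' w y0 (h + k) \<partial>M) = (\<integral>w. F' w y0 h \<partial>M) + (\<integral>w. F' w y0 k \<partial>M)"
      by (simp add: linear_simps[OF lin] int')
    show "(\<integral>w. F' w y0 (c *\<^sub>R h) \<partial>M) = c *\<^sub>R (\<integral>w. F' w y0 h \<partial>M)"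
      by (simp add: linear_simps[OF lin])
    have "norm (\<integral>w. F' w y0 h \<partial>M) \<le> (\<integral>w. B w * norm h \<partial>M)"
      by (rule order_trans[OF integral_norm_bound integral_mono]) (auto intro: int' B bound[OF y0])
    then show "norm (\<integral>w. F' w y0 h \<partial>M) \<le> norm h * (\<integral>w. B w \<partial>M)"
      by (simp add: mult.commute)
  qed
  moreover have "((\<lambda>y. norm (((\<integral>w. F w y \<partial>M) - (\<integral>w. F w y0 \<partial>M)) - (\<integral>w. F' w y0 (y - y0) \<partial>M)) / norm (y - y0))
      \<longlongrightarrow> 0) (at y0 within ball y0 r)"
    unfolding tendsto_at_iff_sequentially
  proof (intro allI impI)
    fix X assume X: "\<forall>i. X i \<in> ball y0 r - {y0}" "X \<longlonglongrightarrow> y0"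
    define R where "R i w = (1 / norm (X i - y0)) *\<^sub>R (F w (X i) - F w y0 - F' w y0 (X i - y0))" for i w
    have "(\<lambda>i. \<integral>w. R i w \<partial>M) \<longlonglongrightarrow> (\<integral>w. 0 \<partial>M)"
    proof (rule integral_dominated_convergence[where w = "\<lambda>w. 2 * B w"])
      show "AE w in M. (\<lambda>i. R i w) \<longlonglongrightarrow> 0"
      proof (rule AE_I2)
        fix w
        have "((\<lambda>y. (1 / norm (y - y0)) *\<^sub>R (F w y - (F w y0 + F' w y0 (y - y0)))) \<longlongrightarrow> 0) (at y0)"
          using F[OF y0, of w] by (simp add: has_derivative_within)
        then have "((\<lambda>y. (1 / norm (y - y0)) *\<^sub>R (F w y - (F w y0 + F' w y0 (y - y0)))) \<circ> X) \<longlonglongrightarrow> 0"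
          using X unfolding tendsto_at_iff_sequentially by blast
        then show "(\<lambda>i. R i w) \<longlonglongrightarrow> 0"
          by (simp add: R_def[abs_def] o_def diff_diff_eq)
      qed
      show "R i \<in> borel_measurable M" for i
        unfolding R_def[abs_def] using X int[of "X i"] int[OF y0] meas by auto
      show "AE w in M. norm (R i w) \<le> 2 * B w" for i
      proof (rule AE_I2)
        fix w
        have pos: "0 < norm (X i - y0)" using X by auto
        have "norm (F w (X i) - F w y0) \<le> B w * norm (X i - y0)"
        proof (rule differentiable_bound[of "ball y0 r"])
          show "(F w has_derivative F' w y) (at y within ball y0 r)" if "y \<in> ball y0 r" for y
            using F[OF that] has_derivative_at_withinI by blast
          show "onorm (F' w y) \<le> B w" if "y \<in> ball y0 r" for y
            by (rule onorm_bound) (auto intro: B0 bound[OF that])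
        qed (use X y0 in auto)
        then have "norm (F w (X i) - F w y0 - F' w y0 (X i - y0)) \<le> 2 * B w * norm (X i - y0)"
          using norm_triangle_ineq4[of "F w (X i) - F w y0" "F' w y0 (X i - y0)"] bound[OF y0, of w "X i - y0"]
          by linarith
        moreover have "norm (R i w) = norm (F w (X i) - F w y0 - F' w y0 (X i - y0)) / norm (X i - y0)"
          by (simp only: R_def norm_scaleR) simp
        ultimately show "norm (R i w) \<le> 2 * B w"
          using pos by (simp only: pos_divide_le_eq)
      qed
    qed (use B in auto)
    then have lim: "(\<lambda>i. norm (\<integral>w. R i w \<partial>M)) \<longlonglongrightarrow> 0"
      by (intro tendsto_norm_zero) simp
    have R: "norm (\<integral>w. R i w \<partial>M) = norm (((\<integral>w. F w (X i) \<partial>M) - (\<integral>w. F w y0 \<partial>M)) - (\<integral>w. F' w y0 (X i - y0) \<partial>M)) / norm (X i - y0)" for i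
    proof -
      have "integrable M (\<lambda>w. F w (X i))" using X int by auto
      then have "(\<integral>w. R i w \<partial>M) = (1 / norm (X i - y0)) *\<^sub>R
          (((\<integral>w. F w (X i) \<partial>M) - (\<integral>w. F w y0 \<partial>M)) - (\<integral>w. F' w y0 (X i - y0) \<partial>M))"
        unfolding R_def using int[OF y0] int' by (simp del: scaleR_diff_right scaleR_right_diff_distrib)
      then show ?thesis by (simp only: norm_scaleR) simp
    qed
    show "((\<lambda>y. norm (((\<integral>w. F w y \<partial>M) - (\<integral>w. F w y0 \<partial>M)) - (\<integral>w. F' w y0 (y - y0) \<partial>M)) / norm (y - y0)) \<circ> X) \<longlonglongrightarrow> 0"
      using lim unfolding o_def R .
  qed
  ultimately show ?thesis
    using r by (simp add: has_derivative_iff_norm at_within_open[OF y0])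
qed

section \<open>The Fourier transform of Schwartz functions\<close>

lemma frechet_derivative_expand:
  assumes "f \<in> schwartz_space"
  shows "frechet_derivative f (at x) h = (\<Sum>b\<in>Basis. (h \<bullet> b) *\<^sub>R dir_deriv b f x)"
proof -
  have lin: "linear (frechet_derivative f (at x))"
    by (intro linear_frechet_derivative schwartz_differentiable assms)
  have "frechet_derivative f (at x) (\<Sum>b\<in>Basis. (h \<bullet> b) *\<^sub>R b) = (\<Sum>b\<in>Basis. (h \<bullet> b) *\<^sub>R dir_deriv b f x)"
    unfolding linear_sum[OF lin] by (intro sum.cong refl linear_scale[OF lin])
  then show ?thesis unfolding euclidean_representation .
qed

lemma norm_frechet_derivative_le:
  assumes "f \<in> schwartz_space"
  shows "norm (frechet_derivative f (at x) h) \<le> (\<Sum>b\<in>Basis. norm (dir_deriv b f x)) * norm h"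
  unfolding sum_distrib_right frechet_derivative_expand[OF assms, of x h]
proof (rule sum_norm_le)
  fix b :: 'a assume "b \<in> Basis"
  then show "norm ((h \<bullet> b) *\<^sub>R dir_deriv b f x) \<le> norm (dir_deriv b f x) * norm h"
    using mult_left_mono[OF Basis_le_norm[of b h] norm_ge_zero[of "dir_deriv b f x"]]
    by (simp add: mult.commute)
qed

lemma schwartz_derivative_decay:
  fixes f :: "'a::euclidean_space \<Rightarrow> complex"
  assumes "f \<in> schwartz_space"
  obtains C where "0 < C" "\<And>x h. norm (frechet_derivative f (at x) h) \<le> C * inverse (\<langle>x\<rangle> ^ N) * norm h"
proof -
  have "\<exists>C. \<forall>x. 0 < C \<and> norm (dir_deriv b f x) \<le> C * inverse (\<langle>x\<rangle> ^ N)" if "b \<in> Basis" for b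
    using schwartz_decay[OF schwartz_dir_deriv[OF assms that], of N] by metis
  then obtain C where C: "\<And>b x. b \<in> Basis \<Longrightarrow> 0 < C b \<and> norm (dir_deriv b f x) \<le> C b * inverse (\<langle>x\<rangle> ^ N)"
    by metis
  show ?thesis
  proof (rule that[of "\<Sum>b\<in>Basis. C b"])
    show "0 < (\<Sum>b\<in>Basis. C b)" using C by (intro sum_pos) auto
    fix x h :: 'a
    have "(\<Sum>b\<in>Basis. norm (dir_deriv b f x)) \<le> (\<Sum>b\<in>Basis. C b * inverse (\<langle>x\<rangle> ^ N))"
      using C by (intro sum_mono) auto
    then show "norm (frechet_derivative f (at x) h) \<le> (\<Sum>b\<in>Basis. C b) * inverse (\<langle>x\<rangle> ^ N) * norm h"
      unfolding sum_distrib_right[symmetric]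
      by (rule order_trans[OF norm_frechet_derivative_le[OF assms] mult_right_mono]) auto
  qed
qed

lemma borel_measurable_frechet_derivative:
  assumes "f \<in> schwartz_space"
  shows "(\<lambda>x. frechet_derivative f (at x) h) \<in> borel_measurable borel"
proof -
  have "(\<lambda>x. \<Sum>b\<in>Basis. (h \<bullet> b) *\<^sub>R dir_deriv b f x) \<in> borel_measurable borel"
    by (intro borel_measurable_sum borel_measurable_scaleR borel_measurable_const
        schwartz_borel schwartz_dir_deriv assms)
  then show ?thesis by (simp only: frechet_derivative_expand[OF assms, of _ h])
qed

text \<open>Integration by parts at infinity: the integral of a translate does not depend on the
  translation, and differentiating this constant under the integral sign gives the claim.\<close>

lemma integral_dir_deriv_zero:
  fixes f :: "'a::euclidean_space \<Rightarrow> complex"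
  assumes f: "f \<in> schwartz_space" and b: "b \<in> Basis"
  shows "(\<integral>x. dir_deriv b f x \<partial>lborel) = 0"
proof -
  let ?N = "2 * DIM('a)"
  obtain C where C: "0 < C" "\<And>x h. norm (frechet_derivative f (at x) h) \<le> C * inverse (\<langle>x\<rangle> ^ ?N) * norm h"
    using schwartz_derivative_decay[OF f] by blast
  have fm [measurable]: "f \<in> borel_measurable borel" by (rule schwartz_borel[OF f])
  define D where "D x y h = frechet_derivative f (at (x + y)) h" for x y h
  have "((\<lambda>y. \<integral>x. f (x + y) \<partial>lborel) has_derivative (\<lambda>h. \<integral>x. D x 0 h \<partial>lborel)) (at 0)"
  proof (rule has_derivative_lebesgue_integral[where r = 1 and B = "\<lambda>x. C * 4 ^ ?N * inverse (\<langle>x\<rangle> ^ ?N)"])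
    fix x y h :: 'a assume y: "y \<in> ball 0 1"
    have "((\<lambda>y. x + y) has_derivative (\<lambda>h. h)) (at y)" by (auto intro!: derivative_eq_intros)
    from has_derivative_compose[OF this has_derivative_frechet[OF schwartz_differentiable[OF f]]]
    show "((\<lambda>y. f (x + y)) has_derivative D x y) (at y)" by (simp add: D_def[abs_def])
    \<comment> \<open>On the unit ball the bracket is at most 2; together with the 2 of the Peetre
      inequality this produces the 4 in the majorant.\<close>
    have "\<langle>y\<rangle> \<le> 2" using y bracket_le[of y] by simp
    then have "\<langle>x\<rangle> ^ ?N \<le> 4 ^ ?N * \<langle>x + y\<rangle> ^ ?N"
    proof -
      have "\<langle>x\<rangle> ^ ?N \<le> (2 ^ ?N * \<langle>x + y\<rangle> ^ ?N) * \<langle>y\<rangle> ^ ?N"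
        using bracket_shift_power_le[of x ?N "x + y"] by simp
      also have "\<dots> \<le> (2 ^ ?N * \<langle>x + y\<rangle> ^ ?N) * 2 ^ ?N"
        using \<open>\<langle>y\<rangle> \<le> 2\<close> by (intro mult_left_mono power_mono) auto
      also have "\<dots> = (2 * 2) ^ ?N * \<langle>x + y\<rangle> ^ ?N"
        unfolding power_mult_distrib by simp
      finally show ?thesis by simp
    qed
    then have "inverse (\<langle>x + y\<rangle> ^ ?N) \<le> 4 ^ ?N * inverse (\<langle>x\<rangle> ^ ?N)"
      by (simp add: field_simps)
    then show "norm (D x y h) \<le> C * 4 ^ ?N * inverse (\<langle>x\<rangle> ^ ?N) * norm h"
      unfolding D_def using C(1)
      by (intro order.trans[OF C(2)] mult_right_mono) (auto simp: mult.assoc)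
    show "integrable lborel (\<lambda>x. f (x + y))"
      using integrable_translate[OF schwartz_integrable[OF f], of "- y"] by simp
  next
    show "(\<lambda>w. D w 0 h) \<in> borel_measurable lborel" for h
      using borel_measurable_frechet_derivative[OF f] by (simp add: D_def)
  qed (auto intro!: integrable_inverse_bracket_power)
  moreover have "(\<integral>x. f (x + y) \<partial>lborel) = (\<integral>x. f x \<partial>lborel)" for y
    using integral_translate[of f "- y"] by simp
  ultimately have "((\<lambda>y::'a. \<integral>x. f x \<partial>lborel) has_derivative (\<lambda>h. \<integral>x. D x 0 h \<partial>lborel)) (at 0)"
    by simp
  then have "(\<lambda>h. \<integral>x. D x 0 h \<partial>lborel) = (\<lambda>h. 0)"
    by (rule has_derivative_unique) (rule has_derivative_const)
  then show ?thesis by (auto simp: D_def fun_eq_iff)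
qed

section \<open>The Fourier transform as a map of the Schwartz space into itself\<close>

definition fourier :: "('a::euclidean_space \<Rightarrow> complex) \<Rightarrow> 'a \<Rightarrow> complex" where
  "fourier f \<xi> = (\<integral>x. cis (- 2 * pi * (x \<bullet> \<xi>)) * f x \<partial>lborel)"

lemma integrable_cis_mult:
  assumes "integrable lborel (f :: 'a::euclidean_space \<Rightarrow> complex)" and "g \<in> borel_measurable borel"
  shows "integrable lborel (\<lambda>x. cis (g x) * f x)"
  by (rule Bochner_Integration.integrable_bound[OF assms(1)])
    (use assms in \<open>auto simp: norm_mult cis_conv_exp\<close>)

lemma norm_fourier_le: "norm (fourier f \<xi>) \<le> (\<integral>x. norm (f x) \<partial>lborel)"
  unfolding fourier_def by (rule order.trans[OF integral_norm_bound]) (simp add: norm_mult)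

text \<open>The derivative of \<open>f\<close> times a character integrates to zero; the product
  rule then moves the derivative from \<open>f\<close> to the character.\<close>

lemma fourier_dir_deriv:
  assumes f: "f \<in> schwartz_space" and b: "b \<in> Basis"
  shows "fourier (dir_deriv b f) \<xi> = 2 * pi * \<i> * (\<xi> \<bullet> b) * fourier f \<xi>"
proof -
  let ?w = "\<lambda>x. cis (- 2 * pi * (x \<bullet> \<xi>)) * f x"
  have d: "(?w has_derivative (\<lambda>h. cis (- 2 * pi * (x \<bullet> \<xi>)) * frechet_derivative f (at x) h
      + \<i> * of_real (- 2 * pi * (h \<bullet> \<xi>)) * cis (- 2 * pi * (x \<bullet> \<xi>)) * f x)) (at x)" for x
    by (intro has_derivative_mult has_derivative_cis_comp has_derivative_frechet schwartz_differentiable f)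
      (auto intro!: derivative_eq_intros)
  have int: "integrable lborel (\<lambda>x. cis (- 2 * pi * (x \<bullet> \<xi>)) * dir_deriv b f x)" "integrable lborel ?w"
    by (intro integrable_cis_mult schwartz_integrable schwartz_dir_deriv f b; simp)+
  have "0 = (\<integral>x. dir_deriv b ?w x \<partial>lborel)"
    using schwartz_cis_inner[OF f, of "- 2 * pi" \<xi>] by (intro integral_dir_deriv_zero[symmetric] b)
  also have "\<dots> = (\<integral>x. cis (- 2 * pi * (x \<bullet> \<xi>)) * dir_deriv b f x
      + (- 2 * pi * \<i> * (\<xi> \<bullet> b)) * ?w x \<partial>lborel)"
    unfolding dir_deriv_eqI[OF d] by (simp add: inner_commute ac_simps)
  also have "\<dots> = fourier (dir_deriv b f) \<xi> + (- 2 * pi * \<i> * (\<xi> \<bullet> b)) * fourier f \<xi>"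
    using int unfolding fourier_def by (subst Bochner_Integration.integral_add) auto
  finally show ?thesis by (simp add: algebra_simps)
qed

lemma fourier_partial_derivs_replicate:
  assumes f: "f \<in> schwartz_space" and b: "b \<in> Basis"
  shows "fourier (partial_derivs (replicate N b) f) \<xi> = (2 * pi * \<i> * (\<xi> \<bullet> b)) ^ N * fourier f \<xi>"
proof (induction N)
  case (Suc N)
  have "partial_derivs (replicate N b) f \<in> schwartz_space"
    by (rule schwartz_partial_derivs[OF f]) (use b in \<open>auto dest: in_set_replicate[THEN iffD1]\<close>)
  from fourier_dir_deriv[OF this b] show ?case by (simp add: Suc)
qed simp

text \<open>Only pure powers of single coordinates occur on the right, so that decay in all
  directions follows from repeated derivatives in one basis direction at a time. The maximum of 1
  and all absolute coordinates mediates, since its power is itself 1 or one of the summands.\<close>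

lemma bracket_power_le_sum:
  fixes x :: "'a::euclidean_space"
  shows "\<langle>x\<rangle> ^ N \<le> (1 + DIM('a)) ^ N * (1 + (\<Sum>b\<in>Basis. \<bar>x \<bullet> b\<bar> ^ N))"
proof -
  define M where "M = Max (insert 1 ((\<lambda>b. \<bar>x \<bullet> b\<bar>) ` Basis))"
  have M: "1 \<le> M" "\<And>b. b \<in> Basis \<Longrightarrow> \<bar>x \<bullet> b\<bar> \<le> M" unfolding M_def by (auto intro!: Max_ge simp del: Max_insert)
  have "\<langle>x\<rangle> \<le> 1 + (\<Sum>b\<in>Basis. \<bar>x \<bullet> b\<bar>)"
    using bracket_le[of x] norm_le_l1[of x] by simp
  also have "\<dots> \<le> M + (\<Sum>b\<in>(Basis::'a set). M)"
    using M by (intro add_mono sum_mono) auto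
  finally have "\<langle>x\<rangle> \<le> (1 + DIM('a)) * M" by (simp add: algebra_simps)
  then have "\<langle>x\<rangle> ^ N \<le> ((1 + DIM('a)) * M) ^ N" by (rule power_mono) simp
  also have "\<dots> = (1 + DIM('a)) ^ N * M ^ N" by (simp add: power_mult_distrib)
  also have "M ^ N \<le> 1 + (\<Sum>b\<in>Basis. \<bar>x \<bullet> b\<bar> ^ N)"
  proof -
    have "M \<in> insert 1 ((\<lambda>b. \<bar>x \<bullet> b\<bar>) ` Basis)" unfolding M_def by (rule Max_in) auto
    then consider "M = 1" | b where "b \<in> Basis" "M = \<bar>x \<bullet> b\<bar>" by auto
    then show ?thesis
    proof cases
      case 2
      have "\<bar>x \<bullet> b\<bar> ^ N \<le> (\<Sum>b\<in>Basis. \<bar>x \<bullet> b\<bar> ^ N)"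
        by (rule member_le_sum[OF 2(1)]) auto
      then show ?thesis using 2 by simp
    qed (simp add: sum_nonneg)
  qed
  finally show ?thesis by (simp add: mult_left_mono)
qed

lemma fourier_decay:
  fixes f :: "'a::euclidean_space \<Rightarrow> complex"
  assumes f: "f \<in> schwartz_space"
  shows "\<langle>\<xi>\<rangle> ^ N * norm (fourier f \<xi>) \<le> (1 + DIM('a)) ^ N *
    ((\<integral>x. norm (f x) \<partial>lborel) + (\<Sum>b\<in>Basis. \<integral>x. norm (partial_derivs (replicate N b) f x) \<partial>lborel))"
proof -
  have 1: "\<bar>\<xi> \<bullet> b\<bar> ^ N * norm (fourier f \<xi>) \<le> (\<integral>x. norm (partial_derivs (replicate N b) f x) \<partial>lborel)"
    if b: "b \<in> Basis" for b
  proof -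
    have "1 * \<bar>\<xi> \<bullet> b\<bar> ^ N \<le> (2 * pi) ^ N * \<bar>\<xi> \<bullet> b\<bar> ^ N"
      using pi_gt3 by (intro mult_right_mono one_le_power) auto
    then have "\<bar>\<xi> \<bullet> b\<bar> ^ N * norm (fourier f \<xi>) \<le> (2 * pi) ^ N * \<bar>\<xi> \<bullet> b\<bar> ^ N * norm (fourier f \<xi>)"
      by (intro mult_right_mono) auto
    also have "\<dots> = norm (fourier (partial_derivs (replicate N b) f) \<xi>)"
      by (simp add: fourier_partial_derivs_replicate[OF f b] norm_mult norm_power power_mult_distrib)
    also have "\<dots> \<le> (\<integral>x. norm (partial_derivs (replicate N b) f x) \<partial>lborel)"
      by (rule norm_fourier_le)
    finally show ?thesis .
  qed
  have "\<langle>\<xi>\<rangle> ^ N * norm (fourier f \<xi>) \<le> ((1 + DIM('a)) ^ N * (1 + (\<Sum>b\<in>Basis. \<bar>\<xi> \<bullet> b\<bar> ^ N))) * norm (fourier f \<xi>)"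
    by (intro mult_right_mono bracket_power_le_sum) auto
  also have "\<dots> = (1 + DIM('a)) ^ N * (norm (fourier f \<xi>) + (\<Sum>b\<in>Basis. \<bar>\<xi> \<bullet> b\<bar> ^ N * norm (fourier f \<xi>)))"
    by (simp add: distrib_right sum_distrib_right mult.assoc)
  also have "\<dots> \<le> (1 + DIM('a)) ^ N *
    ((\<integral>x. norm (f x) \<partial>lborel) + (\<Sum>b\<in>Basis. \<integral>x. norm (partial_derivs (replicate N b) f x) \<partial>lborel))"
    by (intro mult_left_mono add_mono norm_fourier_le sum_mono 1) auto
  finally show ?thesis .
qed

text \<open>The generators are all Fourier transforms of Schwartz functions: differentiating a
  transform multiplies the original function by a linear factor, which yields a generator
  again.\<close>

lemma schwartz_fourier:
  fixes f :: "'a::euclidean_space \<Rightarrow> complex"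
  assumes "f \<in> schwartz_space"
  shows "fourier f \<in> schwartz_space"
proof (rule schwartzI[of _ "fourier ` schwartz_space"])
  have d: "(fourier f has_derivative (\<lambda>h. \<integral>x. \<i> * of_real (- 2 * pi * (x \<bullet> h)) * cis (- 2 * pi * (x \<bullet> \<xi>)) * f x \<partial>lborel)) (at \<xi>)"
    if f: "f \<in> schwartz_space" for f :: "'a \<Rightarrow> complex" and \<xi>
    unfolding fourier_def[abs_def]
  proof (rule has_derivative_lebesgue_integral[where r = 1 and B = "\<lambda>x. 2 * pi * norm x * norm (f x)"])
    have [measurable]: "f \<in> borel_measurable borel" by (rule schwartz_borel[OF f])
    show "((\<lambda>\<xi>. cis (- 2 * pi * (x \<bullet> \<xi>)) * f x) has_derivative
       (\<lambda>h. \<i> * of_real (- 2 * pi * (x \<bullet> h)) * cis (- 2 * pi * (x \<bullet> \<xi>)) * f x)) (at \<xi>)" for x \<xi> :: 'a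
      by (intro has_derivative_mult_left has_derivative_cis_comp) (auto intro!: derivative_eq_intros)
    show "norm (\<i> * of_real (- 2 * pi * (x \<bullet> h)) * cis (- 2 * pi * (x \<bullet> \<xi>)) * f x) \<le> 2 * pi * norm x * norm (f x) * norm h" for x h \<xi> :: 'a
      using mult_right_mono[OF Cauchy_Schwarz_ineq2[of x h], of "norm (f x)"]
      by (simp add: norm_mult abs_mult ac_simps)
    obtain C where C: "\<And>x. norm (f x) \<le> C * inverse (\<langle>x\<rangle> ^ (2 * DIM('a) + 1))"
      using schwartz_decay[OF f] by metis
    have "integrable lborel (\<lambda>x. norm x * norm (f x))"
    proof (rule integrable_bounded_by_bracket[where C = C])
      fix x :: 'a
      have "norm x * norm (f x) \<le> \<langle>x\<rangle> * (C * inverse (\<langle>x\<rangle> ^ (2 * DIM('a) + 1)))"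
        by (intro mult_mono norm_le_bracket C) auto
      also have "\<dots> = C * inverse (\<langle>x\<rangle> ^ (2 * DIM('a)))" by (simp add: field_simps)
      finally show "norm (norm x * norm (f x)) \<le> C * inverse (\<langle>x\<rangle> ^ (2 * DIM('a)))" by simp
    qed auto
    then show "integrable lborel (\<lambda>x. 2 * pi * norm x * norm (f x))" by (simp add: mult.assoc)
    show "integrable lborel (\<lambda>x. cis (- 2 * pi * (x \<bullet> \<xi>)) * f x)" for \<xi>
      by (intro integrable_cis_mult schwartz_integrable f) auto
    show "(\<lambda>x. \<i> * of_real (- 2 * pi * (x \<bullet> h)) * cis (- 2 * pi * (x \<bullet> \<xi>)) * f x) \<in> borel_measurable lborel" for h \<xi>
      by (simp add: cis_conv_exp)
  qed simp
  fix u :: "'a \<Rightarrow> complex" assume "u \<in> fourier ` schwartz_space"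
  then obtain f where u: "u = fourier f" and f: "f \<in> schwartz_space" by auto
  show "u differentiable (at x)" for x
    unfolding u by (rule differentiableI[OF d[OF f]])
  show "\<exists>C. \<forall>x. \<langle>x\<rangle> ^ N * norm (u x) \<le> C" for N
    unfolding u using fourier_decay[OF f] by blast
  have "dir_deriv b u = fourier (\<lambda>x. (- 2 * pi * \<i>) * (of_real (x \<bullet> b) * f x))" for b
    unfolding u dir_deriv_eqI[OF d[OF f]] unfolding fourier_def[abs_def]
    by (intro ext Bochner_Integration.integral_cong refl) (simp add: ac_simps)
  then show "dir_deriv b u \<in> schwartz_closure (fourier ` schwartz_space)" for b
    by (simp only:) (intro schwartz_closure.base imageI schwartz_scale schwartz_linear f)
qed (use assms in auto)

section \<open>Fourier inversion\<close>

text \<open>Obtained from the characteristic function of the standard normal distribution by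
  rescaling. The factor \<open>s\<close> is chosen so that \<open>(s * x)\<^sup>2 / 2\<close> is the
  wanted exponent, and \<open>u\<close> so that \<open>u * (s * x)\<close> is the wanted
  phase.\<close>

lemma gaussian_fourier_real:
  fixes a t :: real
  assumes a: "0 < a"
  shows "integrable lborel (\<lambda>x. cis (- 2 * pi * (x * t)) * of_real (exp (- pi * a\<^sup>2 * x\<^sup>2)))"
    and "(\<integral>x. cis (- 2 * pi * (x * t)) * of_real (exp (- pi * a\<^sup>2 * x\<^sup>2)) \<partial>lborel)
      = of_real (exp (- pi * t\<^sup>2 / a\<^sup>2) / a)"
proof -
  define s where "s = sqrt (2 * pi) * a"
  have s: "0 < s" "s\<^sup>2 = 2 * pi * a\<^sup>2" using a by (auto simp: s_def power_mult_distrib)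
  define u where "u = - 2 * pi * t / s"
  let ?g = "\<lambda>x. iexp (u * x) * of_real (std_normal_density x)"
  have int: "integrable lborel ?g"
    by (rule Bochner_Integration.integrable_bound[OF integrable_normal_density[where \<mu> = 0 and \<sigma> = 1]])
      (auto simp: norm_mult)
  have "char std_normal_distribution u = (\<integral>x. std_normal_density x *\<^sub>R iexp (u * x) \<partial>lborel)"
    unfolding char_def by (subst integral_density) (auto simp: normal_density_nonneg)
  then have 1: "(\<integral>x. ?g x \<partial>lborel) = of_real (exp (- u\<^sup>2 / 2))"
    by (simp add: char_std_normal_distribution scaleR_conv_of_real mult.commute)
  have 2: "?g (s * x) = of_real (1 / sqrt (2 * pi)) * (cis (- 2 * pi * (x * t)) * of_real (exp (- pi * a\<^sup>2 * x\<^sup>2)))" for x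
  proof -
    have "u * (s * x) = - 2 * pi * (x * t)" using s by (simp add: u_def)
    moreover have "(s * x)\<^sup>2 / 2 = pi * a\<^sup>2 * x\<^sup>2" by (simp add: power_mult_distrib s)
    ultimately show ?thesis by (simp add: std_normal_density_def cis_conv_exp)
  qed
  have "integrable lborel (\<lambda>x. ?g (0 + s * x))"
    by (rule lborel_integrable_real_affine[OF int]) (use s in auto)
  then have int2: "integrable lborel (\<lambda>x. of_real (1 / sqrt (2 * pi)) * (cis (- 2 * pi * (x * t)) * of_real (exp (- pi * a\<^sup>2 * x\<^sup>2))))"
    unfolding add_0 2 .
  show "integrable lborel (\<lambda>x. cis (- 2 * pi * (x * t)) * of_real (exp (- pi * a\<^sup>2 * x\<^sup>2)))"
    using integrable_mult_right[OF int2, of "of_real (sqrt (2 * pi))"] by simp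
  have "of_real (exp (- u\<^sup>2 / 2)) = s *\<^sub>R (\<integral>x. ?g (0 + s * x) \<partial>lborel)"
    unfolding 1[symmetric] using lborel_integral_real_affine[of s ?g 0] s by simp
  also have "\<dots> = s *\<^sub>R (of_real (1 / sqrt (2 * pi)) * (\<integral>x. cis (- 2 * pi * (x * t)) * of_real (exp (- pi * a\<^sup>2 * x\<^sup>2)) \<partial>lborel))"
    unfolding add_0 2 by simp
  also have "\<dots> = of_real a * (\<integral>x. cis (- 2 * pi * (x * t)) * of_real (exp (- pi * a\<^sup>2 * x\<^sup>2)) \<partial>lborel)"
    by (simp add: s_def scaleR_conv_of_real)
  moreover have "u\<^sup>2 / 2 = pi * t\<^sup>2 / a\<^sup>2"
    using a by (simp add: u_def power_divide power_mult_distrib s(2)) (simp add: power2_eq_square field_simps)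
  ultimately show "(\<integral>x. cis (- 2 * pi * (x * t)) * of_real (exp (- pi * a\<^sup>2 * x\<^sup>2)) \<partial>lborel)
      = of_real (exp (- pi * t\<^sup>2 / a\<^sup>2) / a)"
    using a by (simp add: field_simps)
qed

text \<open>In this normalisation \<open>gaussian 1\<close> is its own Fourier transform and the
  parameter \<open>a\<close> passes to \<open>1 / a\<close>.\<close>

definition gaussian :: "real \<Rightarrow> 'a::euclidean_space \<Rightarrow> complex" where
  "gaussian a x = of_real (exp (- (pi * a\<^sup>2) * (norm x)\<^sup>2))"

lemma schwartz_gaussian': "0 < a \<Longrightarrow> gaussian a \<in> schwartz_space"
  unfolding gaussian_def[abs_def] by (intro schwartz_gaussian) simp

lemma cis_sum: "finite I \<Longrightarrow> cis (\<Sum>i\<in>I. f i) = (\<Prod>i\<in>I. cis (f i))"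
  by (induction I rule: finite_induct) (auto simp flip: cis_mult)

lemma fourier_gaussian:
  fixes \<xi> :: "'a::euclidean_space"
  assumes a: "0 < a"
  shows "fourier (gaussian a) \<xi> = of_real (1 / a ^ DIM('a)) * gaussian (1 / a) \<xi>"
proof -
  let ?f = "\<lambda>b x. cis (- 2 * pi * (x * (\<xi> \<bullet> b))) * complex_of_real (exp (- pi * a\<^sup>2 * x\<^sup>2))"
  have norm2: "(norm x)\<^sup>2 = (\<Sum>b\<in>Basis. (x \<bullet> b)\<^sup>2)" for x :: 'a
    by (subst euclidean_inner[of x x, unfolded dot_square_norm]) (simp add: power2_eq_square)
  have "cis (- 2 * pi * (x \<bullet> \<xi>)) * gaussian a x = (\<Prod>b\<in>Basis. ?f b (x \<bullet> b))" for x
    unfolding gaussian_def norm2 euclidean_inner[of x \<xi>] prod.distrib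
    by (simp add: sum_distrib_left cis_sum exp_sum flip: sum_negf)
  then have "fourier (gaussian a) \<xi> = (\<integral>x. (\<Prod>b\<in>Basis. ?f b (x \<bullet> b)) \<partial>lborel)"
    unfolding fourier_def by presburger
  also have "\<dots> = (\<Prod>b\<in>Basis. \<integral>x. ?f b x \<partial>lborel)"
    by (rule integral_lborel_prod) (rule gaussian_fourier_real(1)[OF a])
  also have "\<dots> = (\<Prod>b\<in>(Basis::'a set). of_real (exp (- pi * (\<xi> \<bullet> b)\<^sup>2 / a\<^sup>2) / a))"
    by (intro prod.cong refl gaussian_fourier_real(2) a)
  also have "\<dots> = of_real (1 / a ^ DIM('a)) * gaussian (1 / a) \<xi>"
    unfolding gaussian_def norm2
    by (simp add: prod_dividef exp_sum sum_distrib_left power_divide divide_simps flip: sum_negf)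
  finally show ?thesis .
qed

text \<open>Gaussian summability. A Gaussian factor makes the double integral absolutely convergent;
  exchanging the integrals gives an average of \<open>f\<close> near \<open>x\<close> against the
  transformed Gaussian, an approximate identity. Both sides converge by dominated convergence as
  \<open>a k\<close> tends to 0.\<close>

lemma fourier_inversion:
  fixes f :: "'a::euclidean_space \<Rightarrow> complex"
  assumes f: "f \<in> schwartz_space"
  shows "(\<integral>\<xi>. cis (2 * pi * (x \<bullet> \<xi>)) * fourier f \<xi> \<partial>lborel) = f x"
proof -
  define a :: "nat \<Rightarrow> real" where "a k = 1 / (1 + real k)" for k
  have a: "0 < a k" "a k \<le> 1" for k by (auto simp: a_def)
  have a0: "a \<longlonglongrightarrow> 0" unfolding a_def[abs_def] by real_asymp
  have [measurable]: "f \<in> borel_measurable borel" "fourier f \<in> borel_measurable borel"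
      "gaussian c \<in> borel_measurable borel" for c
    using f by (auto intro: schwartz_borel schwartz_fourier simp: gaussian_def[abs_def])
  have g1: "norm (gaussian c y) \<le> 1" for c and y :: 'a by (simp add: gaussian_def)
  have int_f: "integrable lborel f" and int_F: "integrable lborel (fourier f)"
    by (intro schwartz_integrable schwartz_fourier f)+
  let ?I = "\<lambda>k. \<integral>\<xi>. gaussian (a k) \<xi> * (cis (2 * pi * (x \<bullet> \<xi>)) * fourier f \<xi>) \<partial>lborel"
  have "?I \<longlonglongrightarrow> (\<integral>\<xi>. cis (2 * pi * (x \<bullet> \<xi>)) * fourier f \<xi> \<partial>lborel)"
  proof (rule integral_dominated_convergence[where w = "\<lambda>\<xi>. norm (fourier f \<xi>)"])
    show "AE \<xi> in lborel. (\<lambda>k. gaussian (a k) \<xi> * (cis (2 * pi * (x \<bullet> \<xi>)) * fourier f \<xi>))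
        \<longlonglongrightarrow> cis (2 * pi * (x \<bullet> \<xi>)) * fourier f \<xi>"
    proof (rule AE_I2)
      fix \<xi> :: 'a
      have "(\<lambda>k. gaussian (a k) \<xi> * (cis (2 * pi * (x \<bullet> \<xi>)) * fourier f \<xi>))
         \<longlonglongrightarrow> of_real (exp (- (pi * 0\<^sup>2) * (norm \<xi>)\<^sup>2)) * (cis (2 * pi * (x \<bullet> \<xi>)) * fourier f \<xi>)"
        unfolding gaussian_def by (intro tendsto_intros a0)
      then show "(\<lambda>k. gaussian (a k) \<xi> * (cis (2 * pi * (x \<bullet> \<xi>)) * fourier f \<xi>))
        \<longlonglongrightarrow> cis (2 * pi * (x \<bullet> \<xi>)) * fourier f \<xi>" by simp
    qed
    show "AE \<xi> in lborel. norm (gaussian (a k) \<xi> * (cis (2 * pi * (x \<bullet> \<xi>)) * fourier f \<xi>)) \<le> norm (fourier f \<xi>)" for k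
      using g1 by (auto simp: norm_mult intro!: mult_left_le_one_le)
  qed (use int_F in \<open>auto simp: cis_conv_exp\<close>)
  moreover have "?I k = (\<integral>z. f (x + a k *\<^sub>R z) * gaussian 1 z \<partial>lborel)" for k
  proof -
    let ?h = "\<lambda>\<xi> y. gaussian (a k) \<xi> * cis (2 * pi * (x \<bullet> \<xi>)) * (cis (- 2 * pi * (y \<bullet> \<xi>)) * f y)"
    have "?I k = (\<integral>\<xi>. (\<integral>y. ?h \<xi> y \<partial>lborel) \<partial>lborel)"
      unfolding fourier_def[of f] by (simp add: mult.assoc)
    also have "\<dots> = (\<integral>y. (\<integral>\<xi>. ?h \<xi> y \<partial>lborel) \<partial>lborel)"
    proof (rule lborel_pair.Fubini_integral[symmetric])
      show "integrable (lborel \<Otimes>\<^sub>M lborel) (\<lambda>(\<xi>, y). ?h \<xi> y)"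
        by (rule integrable_tensor[OF schwartz_integrable[OF schwartz_gaussian'[OF a(1)[of k]]] int_f])
          (auto simp: norm_mult cis_conv_exp)
    qed
    also have "\<dots> = (\<integral>y. f y * fourier (gaussian (a k)) (y - x) \<partial>lborel)"
    proof (intro Bochner_Integration.integral_cong refl)
      fix y :: 'a
      have "cis (2 * pi * (x \<bullet> \<xi>)) * cis (- 2 * pi * (y \<bullet> \<xi>)) = cis (- 2 * pi * (\<xi> \<bullet> (y - x)))" for \<xi>
        by (simp add: cis_mult inner_diff_right inner_commute algebra_simps)
      moreover have "?h \<xi> y = f y * ((cis (2 * pi * (x \<bullet> \<xi>)) * cis (- 2 * pi * (y \<bullet> \<xi>))) * gaussian (a k) \<xi>)" for \<xi>
        by (simp only: ac_simps)
      ultimately have "(\<integral>\<xi>. ?h \<xi> y \<partial>lborel) = (\<integral>\<xi>. f y * (cis (- 2 * pi * (\<xi> \<bullet> (y - x))) * gaussian (a k) \<xi>) \<partial>lborel)"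
        by (simp only:)
      then show "(\<integral>\<xi>. ?h \<xi> y \<partial>lborel) = f y * fourier (gaussian (a k)) (y - x)"
        unfolding fourier_def by (simp only: integral_mult_right_zero)
    qed
    \<comment> \<open>The substitution y = x + a z; its Jacobian cancels the factor
      \<open>1 / a ^ DIM('a)\<close> in the transform of the Gaussian.\<close>
    also have "\<dots> = a k ^ DIM('a) *\<^sub>R (\<integral>z. f (x + a k *\<^sub>R z) * fourier (gaussian (a k)) (x + a k *\<^sub>R z - x) \<partial>lborel)"
    proof -
      have "fourier (gaussian (a k)) \<in> borel_measurable (borel :: 'a measure)"
        by (intro schwartz_borel schwartz_fourier schwartz_gaussian' a)
      then show ?thesis
        using integral_affine[of "\<lambda>y. f y * fourier (gaussian (a k)) (y - x)" "a k" x] a[of k] by simp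
    qed
    also have "\<dots> = (\<integral>z. f (x + a k *\<^sub>R z) * gaussian 1 z \<partial>lborel)"
    proof -
      have "gaussian (1 / a k) (a k *\<^sub>R z) = gaussian 1 z" for z :: 'a
        using a[of k] by (simp add: gaussian_def power_mult_distrib power_divide)
      then show ?thesis
        using a(1)[of k] by (simp add: fourier_gaussian scaleR_conv_of_real mult.left_commute)
    qed
    finally show ?thesis .
  qed
  moreover have "(\<lambda>k. \<integral>z. f (x + a k *\<^sub>R z) * gaussian 1 z \<partial>lborel) \<longlonglongrightarrow> (\<integral>z. f x * gaussian 1 z \<partial>(lborel :: 'a measure))"
  proof -
    obtain C where C: "\<And>x. \<langle>x\<rangle> ^ 0 * norm (f x) \<le> C" using schwartz_bounded[OF f] by metis
    show ?thesis
    proof (rule integral_dominated_convergence[where w = "\<lambda>z. C * norm (gaussian 1 z)"])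
      show "AE z in lborel. (\<lambda>k. f (x + a k *\<^sub>R z) * gaussian 1 z) \<longlonglongrightarrow> f x * gaussian 1 z"
      proof (rule AE_I2, rule tendsto_mult[OF _ tendsto_const])
        fix z :: 'a
        have "(\<lambda>k. x + a k *\<^sub>R z) \<longlonglongrightarrow> x + 0 *\<^sub>R z" by (intro tendsto_intros a0)
        then show "(\<lambda>k. f (x + a k *\<^sub>R z)) \<longlonglongrightarrow> f x"
          by (intro isCont_tendsto_compose[of x f] differentiable_imp_continuous_within schwartz_differentiable f) simp
      qed
      show "integrable lborel (\<lambda>z::'a. C * norm (gaussian 1 z))"
        by (intro integrable_mult_right integrable_norm schwartz_integrable schwartz_gaussian') simp
    qed (use C in \<open>auto simp: norm_mult intro!: mult_right_mono\<close>)
  qed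
  moreover have "(\<integral>z. f x * gaussian 1 z \<partial>(lborel :: 'a measure)) = f x"
    using fourier_gaussian[of 1 "0::'a"] by (simp add: fourier_def) (simp add: gaussian_def)
  ultimately show ?thesis
    by (simp del: integral_mult_right_zero) (blast intro: LIMSEQ_unique)
qed

text \<open>Fubini uses integrability of \<open>f\<close> in \<open>x\<close> and of
  \<open>fourier g\<close> in \<open>\<xi>\<close>; the inner integral is then Fourier inversion for
  \<open>g\<close>.\<close>

lemma plancherel_inner:
  fixes f g :: "'a::euclidean_space \<Rightarrow> complex"
  assumes f: "integrable lborel f" and g: "g \<in> schwartz_space"
  shows "(\<integral>\<xi>. fourier f \<xi> * cnj (fourier g \<xi>) \<partial>lborel) = (\<integral>x. f x * cnj (g x) \<partial>lborel)"
proof -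
  have G: "fourier g \<in> schwartz_space" by (rule schwartz_fourier[OF g])
  have [measurable]: "f \<in> borel_measurable borel" "fourier g \<in> borel_measurable borel"
      "(\<lambda>\<xi>. cnj (fourier g \<xi>)) \<in> borel_measurable borel"
    using f G by (auto intro: schwartz_borel schwartz_cnj)
  let ?h = "\<lambda>\<xi> x. cis (- 2 * pi * (x \<bullet> \<xi>)) * f x * cnj (fourier g \<xi>)"
  have "(\<integral>\<xi>. fourier f \<xi> * cnj (fourier g \<xi>) \<partial>lborel) = (\<integral>\<xi>. (\<integral>x. ?h \<xi> x \<partial>lborel) \<partial>lborel)"
    unfolding fourier_def[of f] by (intro Bochner_Integration.integral_cong refl) simp
  also have "\<dots> = (\<integral>x. (\<integral>\<xi>. ?h \<xi> x \<partial>lborel) \<partial>lborel)"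
  proof (rule lborel_pair.Fubini_integral[symmetric])
    show "integrable (lborel \<Otimes>\<^sub>M lborel) (\<lambda>(\<xi>, x). ?h \<xi> x)"
      by (rule integrable_tensor[OF schwartz_integrable[OF G] f]) (auto simp: norm_mult cis_conv_exp)
  qed
  also have "\<dots> = (\<integral>x. f x * cnj (g x) \<partial>lborel)"
  proof (intro Bochner_Integration.integral_cong refl)
    fix x :: 'a
    have "?h \<xi> x = f x * cnj (cis (2 * pi * (x \<bullet> \<xi>)) * fourier g \<xi>)" for \<xi>
      by (simp add: cis_cnj)
    then have "(\<integral>\<xi>. ?h \<xi> x \<partial>lborel) = (\<integral>\<xi>. f x * cnj (cis (2 * pi * (x \<bullet> \<xi>)) * fourier g \<xi>) \<partial>lborel)"
      by (simp only:)
    then show "(\<integral>\<xi>. ?h \<xi> x \<partial>lborel) = f x * cnj (g x)"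
      by (simp only: integral_mult_right_zero Bochner_Integration.integral_cnj fourier_inversion[OF g])
  qed
  finally show ?thesis .
qed

section \<open>Tempered distributions\<close>

lemma finite_multi_indices: "finite {bs. set bs \<subseteq> (Basis :: 'a::euclidean_space set) \<and> length bs \<le> N}"
  by (rule finite_lists_length_le) simp

lemma schwartz_seminorm_upper:
  assumes f: "f \<in> schwartz_space" and bs: "set bs \<subseteq> Basis" "length bs \<le> N"
  shows "\<langle>x\<rangle> ^ N * norm (partial_derivs bs f x) \<le> schwartz_seminorm N f"
proof -
  have bdd: "bdd_above (range (\<lambda>x. \<langle>x\<rangle> ^ N * norm (partial_derivs cs f x)))" if "set cs \<subseteq> Basis" for cs
    using f that by (auto simp: schwartz_space_def intro: bounded_imp_bdd_above)
  have "\<langle>x\<rangle> ^ N * norm (partial_derivs bs f x) \<le> (SUP x. \<langle>x\<rangle> ^ N * norm (partial_derivs bs f x))"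
    by (rule cSUP_upper[OF UNIV_I bdd[OF bs(1)]])
  also have "\<dots> \<le> schwartz_seminorm N f"
    unfolding schwartz_seminorm_def
  proof (rule member_le_sum[OF _ _ finite_multi_indices])
    fix cs assume "cs \<in> {bs. set bs \<subseteq> Basis \<and> length bs \<le> N} - {bs}"
    then have "set cs \<subseteq> Basis" by auto
    from cSUP_upper[OF UNIV_I bdd[OF this], of 0]
    show "0 \<le> (SUP x. \<langle>x\<rangle> ^ N * norm (partial_derivs cs f x))"
      by (rule order.trans[rotated]) simp
  qed (use bs in auto)
  finally show ?thesis .
qed

lemma schwartz_seminorm_nonneg: "f \<in> schwartz_space \<Longrightarrow> 0 \<le> schwartz_seminorm N f"
  using schwartz_seminorm_upper[of f "[]" N 0] by (auto intro: order.trans[rotated])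

text \<open>The number of multi-indices enters because the seminorm is a sum of suprema and not a
  maximum.\<close>

lemma schwartz_seminorm_least:
  fixes f :: "'a::euclidean_space \<Rightarrow> complex"
  assumes "\<And>bs x. set bs \<subseteq> Basis \<Longrightarrow> length bs \<le> N \<Longrightarrow> \<langle>x\<rangle> ^ N * norm (partial_derivs bs f x) \<le> B"
  shows "schwartz_seminorm N f \<le> real (card {bs. set bs \<subseteq> (Basis :: 'a set) \<and> length bs \<le> N}) * B"
  unfolding schwartz_seminorm_def
  by (rule sum_bounded_above) (auto intro!: cSUP_least assms)

lemma partial_derivs_add:
  assumes "f \<in> schwartz_space" "g \<in> schwartz_space" "set bs \<subseteq> Basis"
  shows "partial_derivs bs (\<lambda>x. f x + g x) = (\<lambda>x. partial_derivs bs f x + partial_derivs bs g x)"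
  using assms(3)
proof (induction bs)
  case (Cons b bs)
  have d: "((\<lambda>x. partial_derivs bs f x + partial_derivs bs g x) has_derivative
      (\<lambda>h. frechet_derivative (partial_derivs bs f) (at x) h + frechet_derivative (partial_derivs bs g) (at x) h)) (at x)" for x
    by (intro has_derivative_add has_derivative_frechet schwartz_partial_derivs_differentiable assms)
      (use Cons in auto)
  show ?case using Cons by (simp add: dir_deriv_eqI[OF d])
qed simp

lemma partial_derivs_scale:
  assumes "f \<in> schwartz_space" "set bs \<subseteq> Basis"
  shows "partial_derivs bs (\<lambda>x. c * f x) = (\<lambda>x. c * partial_derivs bs f x)"
  using assms(2)
proof (induction bs)
  case (Cons b bs)
  have d: "((\<lambda>x. c * partial_derivs bs f x) has_derivative
      (\<lambda>h. c * frechet_derivative (partial_derivs bs f) (at x) h)) (at x)" for x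
    by (intro has_derivative_mult_right has_derivative_frechet schwartz_partial_derivs_differentiable assms)
      (use Cons in auto)
  show ?case using Cons by (simp add: dir_deriv_eqI[OF d])
qed simp

lemma partial_derivs_diff:
  assumes "f \<in> schwartz_space" "g \<in> schwartz_space" "set bs \<subseteq> Basis"
  shows "partial_derivs bs (\<lambda>x. f x - g x) = (\<lambda>x. partial_derivs bs f x - partial_derivs bs g x)"
  using partial_derivs_add[OF assms(1) schwartz_scale[OF assms(2), of "-1"] assms(3)]
    partial_derivs_scale[OF assms(2,3), of "-1"] by simp

lemma partial_derivs_zero: "set bs \<subseteq> Basis \<Longrightarrow> partial_derivs bs (\<lambda>_. 0) = (\<lambda>_. 0)"
  using partial_derivs_scale[OF schwartz_zero, of bs 0] by simp

lemma partial_derivs_sum: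
  assumes "\<And>i. i \<in> I \<Longrightarrow> f i \<in> schwartz_space" "set bs \<subseteq> Basis"
  shows "partial_derivs bs (\<lambda>x. \<Sum>i\<in>I. f i x) = (\<lambda>x. \<Sum>i\<in>I. partial_derivs bs (f i) x)"
  using assms(1)
proof (induction I rule: infinite_finite_induct)
  case (insert i I)
  then show ?case
    using partial_derivs_add[of "f i" "\<lambda>x. \<Sum>i\<in>I. f i x", OF _ schwartz_sum assms(2)] by simp
qed (simp_all add: partial_derivs_zero assms(2))

lemma schwartz_seminorm_triangle:
  assumes "f \<in> schwartz_space" "g \<in> schwartz_space"
  shows "schwartz_seminorm N (\<lambda>x. f x + g x) \<le> schwartz_seminorm N f + schwartz_seminorm N g"
  unfolding schwartz_seminorm_def sum.distrib[symmetric]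
proof (rule sum_mono)
  fix bs :: "'a list" assume "bs \<in> {bs. set bs \<subseteq> Basis \<and> length bs \<le> N}"
  then have bs: "set bs \<subseteq> Basis" by auto
  have bdd: "bdd_above (range (\<lambda>x. \<langle>x\<rangle> ^ N * norm (partial_derivs bs f x)))" if "f \<in> schwartz_space" for f
    using bs that by (auto simp: schwartz_space_def intro: bounded_imp_bdd_above)
  show "(SUP x. \<langle>x\<rangle> ^ N * norm (partial_derivs bs (\<lambda>x. f x + g x) x))
    \<le> (SUP x. \<langle>x\<rangle> ^ N * norm (partial_derivs bs f x)) + (SUP x. \<langle>x\<rangle> ^ N * norm (partial_derivs bs g x))"
  proof (rule cSUP_least)
    fix x :: 'a
    have "\<langle>x\<rangle> ^ N * norm (partial_derivs bs (\<lambda>x. f x + g x) x)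
      \<le> \<langle>x\<rangle> ^ N * norm (partial_derivs bs f x) + \<langle>x\<rangle> ^ N * norm (partial_derivs bs g x)"
      unfolding partial_derivs_add[OF assms bs] distrib_left[symmetric]
      by (intro mult_left_mono norm_triangle_ineq) auto
    also have "\<dots> \<le> (SUP x. \<langle>x\<rangle> ^ N * norm (partial_derivs bs f x)) + (SUP x. \<langle>x\<rangle> ^ N * norm (partial_derivs bs g x))"
      by (intro add_mono cSUP_upper UNIV_I bdd assms)
    finally show "\<langle>x\<rangle> ^ N * norm (partial_derivs bs (\<lambda>x. f x + g x) x) \<le> \<dots>" .
  qed simp
qed

lemma schwartz_seminorm_minus:
  assumes "f \<in> schwartz_space"
  shows "schwartz_seminorm N (\<lambda>x. - f x) = schwartz_seminorm N f"
  using partial_derivs_scale[OF assms, of _ "-1"] unfolding schwartz_seminorm_def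
  by (intro sum.cong refl) simp

lemma schwartz_seminorm_diff_triangle:
  assumes "f \<in> schwartz_space" "g \<in> schwartz_space"
  shows "schwartz_seminorm N (\<lambda>x. f x - g x) \<le> schwartz_seminorm N f + schwartz_seminorm N g"
  using schwartz_seminorm_triangle[OF assms(1) schwartz_scale[OF assms(2), of "-1"]]
    schwartz_seminorm_minus[OF assms(2)] by simp

section \<open>Linearity and continuity of tempered distributions\<close>

lemma temperedD_add:
  "T \<in> tempered_distributions \<Longrightarrow> f \<in> schwartz_space \<Longrightarrow> g \<in> schwartz_space \<Longrightarrow> T (\<lambda>x. f x + g x) = T f + T g"
  by (auto simp: tempered_distributions_def)

lemma temperedD_scale:
  "T \<in> tempered_distributions \<Longrightarrow> f \<in> schwartz_space \<Longrightarrow> T (\<lambda>x. c * f x) = c * T f"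
  by (auto simp: tempered_distributions_def)

lemma temperedD_bound:
  assumes "T \<in> tempered_distributions"
  obtains C N where "0 \<le> C" "\<And>f. f \<in> schwartz_space \<Longrightarrow> norm (T f) \<le> C * schwartz_seminorm N f"
proof -
  obtain C N where C: "\<And>f. f \<in> schwartz_space \<Longrightarrow> norm (T f) \<le> C * schwartz_seminorm N f"
    using assms unfolding tempered_distributions_def by blast
  show ?thesis
  proof (rule that[of "max C 0" N])
    fix f :: "'a \<Rightarrow> complex" assume f: "f \<in> schwartz_space"
    have "C * schwartz_seminorm N f \<le> max C 0 * schwartz_seminorm N f"
      by (intro mult_right_mono schwartz_seminorm_nonneg f) auto
    with C[OF f] show "norm (T f) \<le> max C 0 * schwartz_seminorm N f" by linarith
  qed simp
qed

lemma tempered_diff: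
  assumes "T \<in> tempered_distributions" "f \<in> schwartz_space" "g \<in> schwartz_space"
  shows "T (\<lambda>x. f x - g x) = T f - T g"
  using temperedD_add[OF assms(1,2) schwartz_scale[OF assms(3), of "-1"]]
    temperedD_scale[OF assms(1,3), of "-1"] by simp

lemma tempered_sum:
  assumes T: "T \<in> tempered_distributions" and f: "\<And>i. i \<in> I \<Longrightarrow> f i \<in> schwartz_space"
  shows "T (\<lambda>x. \<Sum>i\<in>I. c i * f i x) = (\<Sum>i\<in>I. c i * T (f i))"
proof -
  have zero: "T (\<lambda>_. 0) = 0"
    using temperedD_scale[OF T schwartz_zero, of 0] by simp
  show ?thesis
    using f
  proof (induction I rule: infinite_finite_induct)
    case (insert i I)
    have "T (\<lambda>x. c i * f i x + (\<Sum>i\<in>I. c i * f i x)) = c i * T (f i) + T (\<lambda>x. \<Sum>i\<in>I. c i * f i x)"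
      using insert.prems temperedD_scale[OF T, of "f i"]
      by (subst temperedD_add[OF T]) (auto intro!: schwartz_scale schwartz_sum)
    then show ?case using insert by simp
  qed (simp_all add: zero)
qed

lemma integral_norm_le_schwartz_seminorm:
  fixes f :: "'a::euclidean_space \<Rightarrow> complex"
  assumes f: "f \<in> schwartz_space" and bs: "set bs \<subseteq> Basis" "length bs \<le> N" and N: "2 * DIM('a) \<le> N"
  shows "(\<integral>x. norm (partial_derivs bs f x) \<partial>lborel) \<le> (\<integral>x. inverse (\<langle>x::'a\<rangle> ^ N) \<partial>lborel) * schwartz_seminorm N f"
proof -
  have "(\<integral>x. norm (partial_derivs bs f x) \<partial>lborel) \<le> (\<integral>x. inverse (\<langle>x::'a\<rangle> ^ N) * schwartz_seminorm N f \<partial>lborel)"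
  proof (rule integral_mono)
    fix x :: 'a
    show "norm (partial_derivs bs f x) \<le> inverse (\<langle>x\<rangle> ^ N) * schwartz_seminorm N f"
      using schwartz_seminorm_upper[OF f bs, of x] by (simp add: field_simps)
  qed (auto intro!: integrable_norm schwartz_integrable schwartz_partial_derivs f bs integrable_inverse_bracket_power N)
  then show ?thesis by simp
qed

lemma tempered_if_L1_bounded:
  fixes T :: "('a::euclidean_space \<Rightarrow> complex) \<Rightarrow> complex"
  assumes "\<And>f g. f \<in> schwartz_space \<Longrightarrow> g \<in> schwartz_space \<Longrightarrow> T (\<lambda>x. f x + g x) = T f + T g"
    and "\<And>c f. f \<in> schwartz_space \<Longrightarrow> T (\<lambda>x. c * f x) = c * T f"
    and bound: "\<And>f. f \<in> schwartz_space \<Longrightarrow> norm (T f) \<le> C * (\<integral>x. norm (f x) \<partial>lborel)" and C: "0 \<le> C"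
  shows "T \<in> tempered_distributions"
proof -
  let ?N = "2 * DIM('a)"
  have "norm (T f) \<le> (C * (\<integral>x. inverse (\<langle>x::'a\<rangle> ^ ?N) \<partial>lborel)) * schwartz_seminorm ?N f"
    if f: "f \<in> schwartz_space" for f
    using mult_left_mono[OF integral_norm_le_schwartz_seminorm[OF f, of "[]" ?N] C] bound[OF f]
    by (simp add: mult.assoc)
  then show ?thesis
    using assms(1,2) unfolding tempered_distributions_def by blast
qed

text \<open>Bounded functions cover Schwartz functions as well as characters; through the latter the
  value of a Fourier transform at a point becomes a tempered distribution.\<close>

lemma distribution_of_tempered:
  fixes u :: "'a::euclidean_space \<Rightarrow> complex"
  assumes [measurable]: "u \<in> borel_measurable borel" and B: "\<And>x. norm (u x) \<le> B"
  shows "distribution_of u \<in> tempered_distributions"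
proof (rule tempered_if_L1_bounded)
  have int: "integrable lborel (\<lambda>x. u x * f x)" if f: "f \<in> schwartz_space" for f :: "'a \<Rightarrow> complex"
    by (rule Bochner_Integration.integrable_bound[OF integrable_mult_right[OF schwartz_integrable[OF f], of "of_real B"]])
      (use f schwartz_borel[OF f] B in \<open>auto simp: norm_mult intro!: mult_right_mono order.trans[OF B]\<close>)
  show "0 \<le> B" using order.trans[OF norm_ge_zero B] .
  fix f g :: "'a \<Rightarrow> complex" and c :: complex assume f: "f \<in> schwartz_space"
  show "distribution_of u (\<lambda>x. c * f x) = c * distribution_of u f"
    unfolding distribution_of_def mult.left_commute[of _ c] by simp
  have "norm (distribution_of u f) \<le> (\<integral>x. norm (u x * f x) \<partial>lborel)"
    unfolding distribution_of_def by (rule integral_norm_bound)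
  also have "\<dots> \<le> (\<integral>x. B * norm (f x) \<partial>lborel)"
    by (intro integral_mono integrable_norm int f integrable_mult_right schwartz_integrable)
      (simp add: norm_mult B mult_right_mono)
  finally show "norm (distribution_of u f) \<le> B * (\<integral>x. norm (f x) \<partial>lborel)" by simp
  assume g: "g \<in> schwartz_space"
  show "distribution_of u (\<lambda>x. f x + g x) = distribution_of u f + distribution_of u g"
    unfolding distribution_of_def distrib_left
    by (rule Bochner_Integration.integral_add) (intro int f g)+
qed

section \<open>Superpositions of Schwartz functions\<close>

text \<open>Polynomial growth and sequential continuity in every seminorm: growth is absorbed by
  rapidly decaying coefficients, and continuity allows the family to be approximated by finitely
  many of its members.\<close>

definition schwartz_family :: "('w::euclidean_space \<Rightarrow> 'a::euclidean_space \<Rightarrow> complex) \<Rightarrow> bool" where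
  "schwartz_family G \<longleftrightarrow> (\<forall>w. G w \<in> schwartz_space) \<and>
     (\<forall>N. \<exists>C k. \<forall>w. schwartz_seminorm N (G w) \<le> C * \<langle>w\<rangle> ^ k) \<and>
     (\<forall>N X w. X \<longlonglongrightarrow> w \<longrightarrow> (\<lambda>i::nat. schwartz_seminorm N (\<lambda>y. G (X i) y - G w y)) \<longlonglongrightarrow> 0)"

lemma schwartz_familyD:
  assumes "schwartz_family G"
  shows "G w \<in> schwartz_space"
    and "X \<longlonglongrightarrow> w \<Longrightarrow> (\<lambda>i::nat. schwartz_seminorm N (\<lambda>y. G (X i) y - G w y)) \<longlonglongrightarrow> 0"
  using assms by (auto simp: schwartz_family_def)

lemma schwartz_family_bound:
  assumes "schwartz_family G"
  obtains C k where "0 \<le> C" "\<And>w. schwartz_seminorm N (G w) \<le> C * \<langle>w\<rangle> ^ k"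
proof -
  obtain C k where C: "\<And>w. schwartz_seminorm N (G w) \<le> C * \<langle>w\<rangle> ^ k"
    using assms unfolding schwartz_family_def by metis
  have "0 \<le> C * \<langle>0::'a\<rangle> ^ k"
    using order.trans[OF schwartz_seminorm_nonneg[OF schwartz_familyD(1)[OF assms]] C] .
  with C show ?thesis by (intro that[of C k]) auto
qed

lemma tendsto_0_if_norm_le:
  fixes f :: "nat \<Rightarrow> 'b::real_normed_vector"
  assumes "g \<longlonglongrightarrow> 0" "\<And>i. norm (f i) \<le> g i"
  shows "f \<longlonglongrightarrow> 0"
  by (rule Lim_null_comparison[OF _ assms(1)]) (simp add: assms(2))

lemma continuous_on_sequentiallyI:
  fixes f :: "'a::metric_space \<Rightarrow> 'b::metric_space"
  assumes "\<And>X x. X \<longlonglongrightarrow> x \<Longrightarrow> (\<lambda>i::nat. f (X i)) \<longlonglongrightarrow> f x"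
  shows "continuous_on UNIV f"
  using assms unfolding continuous_on_sequentially o_def by blast

lemma schwartz_family_tempered_continuous:
  assumes G: "schwartz_family G" and T: "T \<in> tempered_distributions"
  shows "continuous_on UNIV (\<lambda>w. T (G w))"
proof (rule continuous_on_sequentiallyI)
  fix X :: "nat \<Rightarrow> 'a" and w assume X: "X \<longlonglongrightarrow> w"
  obtain C N where C: "0 \<le> C" "\<And>f. f \<in> schwartz_space \<Longrightarrow> norm (T f) \<le> C * schwartz_seminorm N f"
    using temperedD_bound[OF T] by blast
  have "(\<lambda>i. C * schwartz_seminorm N (\<lambda>y. G (X i) y - G w y)) \<longlonglongrightarrow> C * 0"
    by (intro tendsto_mult tendsto_const schwartz_familyD[OF G] X)
  then have "(\<lambda>i. C * schwartz_seminorm N (\<lambda>y. G (X i) y - G w y)) \<longlonglongrightarrow> 0" by simp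
  moreover have "norm (T (G (X i)) - T (G w)) \<le> C * schwartz_seminorm N (\<lambda>y. G (X i) y - G w y)" for i
    unfolding tempered_diff[OF T schwartz_familyD(1)[OF G] schwartz_familyD(1)[OF G], symmetric]
    by (intro C schwartz_diff schwartz_familyD(1)[OF G])
  ultimately have "(\<lambda>i. T (G (X i)) - T (G w)) \<longlonglongrightarrow> 0"
    by (rule tendsto_0_if_norm_le)
  then show "(\<lambda>i. T (G (X i))) \<longlonglongrightarrow> T (G w)" by (simp add: LIM_zero_cancel)
qed

lemma schwartz_family_partial_derivs_continuous:
  assumes G: "schwartz_family G" and bs: "set bs \<subseteq> Basis"
  shows "continuous_on UNIV (\<lambda>w. partial_derivs bs (G w) y)"
proof (rule continuous_on_sequentiallyI)
  fix X :: "nat \<Rightarrow> 'a" and w assume X: "X \<longlonglongrightarrow> w"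
  have "norm (partial_derivs bs (G (X i)) y - partial_derivs bs (G w) y)
    \<le> schwartz_seminorm (length bs) (\<lambda>y. G (X i) y - G w y)" for i
  proof -
    have "1 * norm (partial_derivs bs (\<lambda>y. G (X i) y - G w y) y)
      \<le> \<langle>y\<rangle> ^ length bs * norm (partial_derivs bs (\<lambda>y. G (X i) y - G w y) y)"
      by (intro mult_right_mono bracket_power_ge_1) auto
    also have "\<dots> \<le> schwartz_seminorm (length bs) (\<lambda>y. G (X i) y - G w y)"
      by (intro schwartz_seminorm_upper schwartz_diff schwartz_familyD[OF G] bs order_refl)
    finally show ?thesis
      by (simp add: partial_derivs_diff[OF schwartz_familyD(1)[OF G] schwartz_familyD(1)[OF G] bs])
  qed
  then have "(\<lambda>i. partial_derivs bs (G (X i)) y - partial_derivs bs (G w) y) \<longlonglongrightarrow> 0"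
    by (rule tendsto_0_if_norm_le[OF schwartz_familyD(2)[OF G X, of "length bs"]])
  then show "(\<lambda>i. partial_derivs bs (G (X i)) y) \<longlonglongrightarrow> partial_derivs bs (G w) y"
    by (simp add: LIM_zero_cancel)
qed

text \<open>Makes the distance of \<open>G w\<close> from a fixed Schwartz function measurable in
  \<open>w\<close>, as needed to integrate discretisation errors.\<close>

lemma schwartz_family_seminorm_continuous:
  assumes G: "schwartz_family G" and g: "g \<in> schwartz_space"
  shows "continuous_on UNIV (\<lambda>w. schwartz_seminorm N (\<lambda>y. G w y - g y))"
proof (rule continuous_on_sequentiallyI)
  fix X :: "nat \<Rightarrow> 'a" and w assume X: "X \<longlonglongrightarrow> w"
  note mem = schwartz_familyD(1)[OF G]
  have "\<bar>schwartz_seminorm N (\<lambda>y. G (X i) y - g y) - schwartz_seminorm N (\<lambda>y. G w y - g y)\<bar>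
    \<le> schwartz_seminorm N (\<lambda>y. G (X i) y - G w y)" for i
    using schwartz_seminorm_triangle[OF schwartz_diff[OF mem[of "X i"] mem[of w]] schwartz_diff[OF mem[of w] g], of N]
      schwartz_seminorm_diff_triangle[OF schwartz_diff[OF mem[of "X i"] g] schwartz_diff[OF mem[of "X i"] mem[of w]], of N]
    by simp
  then have "(\<lambda>i. schwartz_seminorm N (\<lambda>y. G (X i) y - g y) - schwartz_seminorm N (\<lambda>y. G w y - g y)) \<longlonglongrightarrow> 0"
    by (intro tendsto_0_if_norm_le[OF schwartz_familyD(2)[OF G X, of N]]) simp
  then show "(\<lambda>i. schwartz_seminorm N (\<lambda>y. G (X i) y - g y)) \<longlonglongrightarrow> schwartz_seminorm N (\<lambda>y. G w y - g y)"
    by (simp add: LIM_zero_cancel)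
qed

definition superposition :: "('w::euclidean_space \<Rightarrow> complex) \<Rightarrow> ('w \<Rightarrow> 'a \<Rightarrow> complex) \<Rightarrow> 'a \<Rightarrow> complex" where
  "superposition a G y = (\<integral>w. a w * G w y \<partial>lborel)"

text \<open>All three claims rest on one bound of the derivatives by a power of
  \<open>\<langle>w\<rangle>\<close>, uniform in the other variable, which the coefficients absorb.
  They are stated for every derivative of the family so that induction over the multi-index can
  follow.\<close>

lemma superposition_partial_derivs_aux:
  fixes G :: "'w::euclidean_space \<Rightarrow> 'a::euclidean_space \<Rightarrow> complex"
  assumes G: "schwartz_family G" and a [measurable]: "a \<in> borel_measurable borel"
    and int: "\<And>k. integrable lborel (\<lambda>w. norm (a w) * \<langle>w\<rangle> ^ k)"
    and bs: "set bs \<subseteq> Basis"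
  shows "integrable lborel (\<lambda>w. a w * partial_derivs bs (G w) y)"
    and "((\<lambda>y. \<integral>w. a w * partial_derivs bs (G w) y \<partial>lborel) has_derivative
      (\<lambda>h. \<integral>w. a w * frechet_derivative (partial_derivs bs (G w)) (at y) h \<partial>lborel)) (at y)"
    and "\<exists>C. \<forall>y. \<langle>y\<rangle> ^ N * norm (\<integral>w. a w * partial_derivs bs (G w) y \<partial>lborel) \<le> C"
proof -
  note mem = schwartz_familyD(1)[OF G]
  have pm [measurable]: "(\<lambda>w. partial_derivs cs (G w) y) \<in> borel_measurable borel" if "set cs \<subseteq> Basis" for cs y
    by (rule borel_measurable_continuous_onI[OF schwartz_family_partial_derivs_continuous[OF G that]])
  have bound: "\<exists>C k. 0 \<le> C \<and> (\<forall>w y. \<langle>y\<rangle> ^ N * norm (partial_derivs cs (G w) y) \<le> C * \<langle>w\<rangle> ^ k)"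
    if cs: "set cs \<subseteq> Basis" for cs N
  proof -
    \<comment> \<open>A single index controls both the weight and the order of differentiation in
      this seminorm, hence the maximum.\<close>
    obtain C k where C: "0 \<le> C" "\<And>w. schwartz_seminorm (max N (length cs)) (G w) \<le> C * \<langle>w\<rangle> ^ k"
      using schwartz_family_bound[OF G] by blast
    have "\<langle>y\<rangle> ^ N * norm (partial_derivs cs (G w) y) \<le> C * \<langle>w\<rangle> ^ k" for w y
    proof -
      have "\<langle>y\<rangle> ^ N * norm (partial_derivs cs (G w) y) \<le> \<langle>y\<rangle> ^ max N (length cs) * norm (partial_derivs cs (G w) y)"
        by (intro mult_right_mono power_increasing bracket_ge_1) auto
      also have "\<dots> \<le> schwartz_seminorm (max N (length cs)) (G w)"
        by (intro schwartz_seminorm_upper mem cs) auto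
      finally show ?thesis using C(2)[of w] by linarith
    qed
    with C show ?thesis by blast
  qed
  have int1: "integrable lborel (\<lambda>w. a w * partial_derivs cs (G w) y)" if cs: "set cs \<subseteq> Basis" for cs y
  proof -
    obtain C k where C: "0 \<le> C" "\<And>w y. \<langle>y\<rangle> ^ 0 * norm (partial_derivs cs (G w) y) \<le> C * \<langle>w\<rangle> ^ k"
      using bound[OF cs] by blast
    show ?thesis
    proof (rule Bochner_Integration.integrable_bound[OF integrable_mult_right[OF int[of k], of C]])
      show "AE w in lborel. norm (a w * partial_derivs cs (G w) y) \<le> norm (C * (norm (a w) * \<langle>w\<rangle> ^ k))"
        using mult_left_mono[OF C(2)[of y], of "norm (a _)"] C(1)
        by (auto simp: norm_mult abs_mult ac_simps)
    qed (use cs in measurable)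
  qed
  then show "integrable lborel (\<lambda>w. a w * partial_derivs bs (G w) y)" using bs .
  show "\<exists>C. \<forall>y. \<langle>y\<rangle> ^ N * norm (\<integral>w. a w * partial_derivs bs (G w) y \<partial>lborel) \<le> C"
  proof -
    obtain C k where C: "0 \<le> C" "\<And>w y. \<langle>y\<rangle> ^ N * norm (partial_derivs bs (G w) y) \<le> C * \<langle>w\<rangle> ^ k"
      using bound[OF bs] by blast
    have "\<langle>y\<rangle> ^ N * norm (\<integral>w. a w * partial_derivs bs (G w) y \<partial>lborel) \<le> (\<integral>w. C * (norm (a w) * \<langle>w\<rangle> ^ k) \<partial>lborel)" for y
    proof -
      have "\<langle>y\<rangle> ^ N * norm (\<integral>w. a w * partial_derivs bs (G w) y \<partial>lborel)
          \<le> \<langle>y\<rangle> ^ N * (\<integral>w. norm (a w * partial_derivs bs (G w) y) \<partial>lborel)"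
        by (intro mult_left_mono integral_norm_bound) auto
      also have "\<dots> = (\<integral>w. norm (a w) * (\<langle>y\<rangle> ^ N * norm (partial_derivs bs (G w) y)) \<partial>lborel)"
        by (simp add: norm_mult mult.left_commute flip: integral_mult_right_zero)
      also have "\<dots> \<le> (\<integral>w. norm (a w) * (C * \<langle>w\<rangle> ^ k) \<partial>lborel)"
      proof (rule integral_mono)
        show "integrable lborel (\<lambda>w. norm (a w) * (\<langle>y\<rangle> ^ N * norm (partial_derivs bs (G w) y)))"
          using integrable_mult_right[OF integrable_norm[OF int1[OF bs, of y]], of "\<langle>y\<rangle> ^ N"]
          by (simp add: norm_mult mult.left_commute)
        show "integrable lborel (\<lambda>w. norm (a w) * (C * \<langle>w\<rangle> ^ k))"
          using integrable_mult_right[OF int[of k], of C] by (simp add: mult.left_commute)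
      qed (auto intro!: mult_left_mono C)
      finally show ?thesis by (simp add: mult.left_commute)
    qed
    then show ?thesis by blast
  qed
  show "((\<lambda>y. \<integral>w. a w * partial_derivs bs (G w) y \<partial>lborel) has_derivative
      (\<lambda>h. \<integral>w. a w * frechet_derivative (partial_derivs bs (G w)) (at y) h \<partial>lborel)) (at y)"
  proof -
    have "\<exists>B. integrable lborel B \<and> (\<forall>w y. norm (a w * dir_deriv b (partial_derivs bs (G w)) y) \<le> B w)" if b: "b \<in> Basis" for b
    proof -
      obtain C k where C: "0 \<le> C" "\<And>w y. \<langle>y\<rangle> ^ 0 * norm (partial_derivs (b # bs) (G w) y) \<le> C * \<langle>w\<rangle> ^ k"
      proof -
        have "set (b # bs) \<subseteq> Basis" using bs b by simp
        from bound[OF this, of 0] show ?thesis using that by blast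
      qed
      show ?thesis
        using mult_left_mono[OF C(2), of "norm (a _)"]
        by (intro exI[of _ "\<lambda>w. C * (norm (a w) * \<langle>w\<rangle> ^ k)"])
          (auto simp: norm_mult mult.left_commute intro!: integrable_mult_right int)
    qed
    then obtain B where B: "\<And>b. b \<in> Basis \<Longrightarrow> integrable lborel (B b)"
      "\<And>b w y. b \<in> Basis \<Longrightarrow> norm (a w * dir_deriv b (partial_derivs bs (G w)) y) \<le> B b w"
      by metis
    have exp: "frechet_derivative (partial_derivs bs (G w)) (at y) h
        = (\<Sum>b\<in>Basis. (h \<bullet> b) *\<^sub>R dir_deriv b (partial_derivs bs (G w)) y)" for w y h
      by (intro frechet_derivative_expand schwartz_partial_derivs mem bs)
    show ?thesis
    proof (rule has_derivative_lebesgue_integral[where r = 1 and B = "\<lambda>w. \<Sum>b\<in>Basis. B b w"])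
      fix w y h
      show "((\<lambda>y. a w * partial_derivs bs (G w) y) has_derivative
          (\<lambda>h. a w * frechet_derivative (partial_derivs bs (G w)) (at y) h)) (at y)"
        by (intro has_derivative_mult_right has_derivative_frechet schwartz_partial_derivs_differentiable mem bs)
      have "norm (a w * frechet_derivative (partial_derivs bs (G w)) (at y) h)
          \<le> norm (a w) * ((\<Sum>b\<in>Basis. norm (dir_deriv b (partial_derivs bs (G w)) y)) * norm h)"
        unfolding norm_mult by (intro mult_left_mono norm_frechet_derivative_le schwartz_partial_derivs mem bs) auto
      also have "\<dots> = (\<Sum>b\<in>Basis. norm (a w * dir_deriv b (partial_derivs bs (G w)) y)) * norm h"
        by (simp add: norm_mult sum_distrib_left)
      also have "\<dots> \<le> (\<Sum>b\<in>Basis. B b w) * norm h"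
        by (intro mult_right_mono sum_mono B) auto
      finally show "norm (a w * frechet_derivative (partial_derivs bs (G w)) (at y) h) \<le> (\<Sum>b\<in>Basis. B b w) * norm h" .
    next
      fix h
      have "(\<lambda>w. partial_derivs (b # bs) (G w) y) \<in> borel_measurable borel" if "b \<in> Basis" for b
        using bs that by (intro pm) simp
      then have "(\<lambda>w. \<Sum>b\<in>Basis. (h \<bullet> b) *\<^sub>R dir_deriv b (partial_derivs bs (G w)) y) \<in> borel_measurable borel"
        by (intro borel_measurable_sum borel_measurable_scaleR borel_measurable_const) auto
      then show "(\<lambda>w. a w * frechet_derivative (partial_derivs bs (G w)) (at y) h) \<in> borel_measurable lborel"
        unfolding exp[of _ y h] using a by simp
    qed (auto intro!: Bochner_Integration.integrable_sum B int1 bs)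
  qed
qed

lemma superposition_partial_derivs:
  fixes G :: "'w::euclidean_space \<Rightarrow> 'a::euclidean_space \<Rightarrow> complex"
  assumes G: "schwartz_family G" and a [measurable]: "a \<in> borel_measurable borel"
    and int: "\<And>k. integrable lborel (\<lambda>w. norm (a w) * \<langle>w\<rangle> ^ k)"
    and bs: "set bs \<subseteq> Basis"
  shows "partial_derivs bs (superposition a G) = (\<lambda>y. \<integral>w. a w * partial_derivs bs (G w) y \<partial>lborel)"
  using bs
proof (induction bs)
  case (Cons b bs)
  then have bs: "set bs \<subseteq> Basis" by simp
  show ?case
    using dir_deriv_eqI[OF superposition_partial_derivs_aux(2)[OF G a int bs], of b] Cons.IH[OF bs]
    by simp
qed (simp add: superposition_def[abs_def])

lemma superposition_schwartz:
  fixes G :: "'w::euclidean_space \<Rightarrow> 'a::euclidean_space \<Rightarrow> complex"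
  assumes G: "schwartz_family G" and a [measurable]: "a \<in> borel_measurable borel"
    and int: "\<And>k. integrable lborel (\<lambda>w. norm (a w) * \<langle>w\<rangle> ^ k)"
  shows "superposition a G \<in> schwartz_space"
  unfolding schwartz_space_def
proof safe
  fix bs :: "'a list" and x assume bs: "set bs \<subseteq> Basis"
  note [simp] = superposition_partial_derivs[OF G a int bs]
  show "partial_derivs bs (superposition a G) differentiable (at x)"
    using superposition_partial_derivs_aux(2)[OF G a int bs] differentiableI by auto
  show "bounded (range (\<lambda>x. \<langle>x\<rangle> ^ N * norm (partial_derivs bs (superposition a G) x)))" for N
    using superposition_partial_derivs_aux(3)[OF G a int bs, of N] by (auto simp: bounded_iff)
qed

text \<open>
  The discretisations \<open>s i\<close> of the identity turn the superposition into a finite sum, through which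
  \<open>T\<close> can be moved by linearity alone; continuity of \<open>T\<close> then handles the limit.
\<close>

lemma tempered_superposition:
  fixes G :: "'w::euclidean_space \<Rightarrow> 'a::euclidean_space \<Rightarrow> complex"
  assumes G: "schwartz_family G" and a [measurable]: "a \<in> borel_measurable borel"
    and int: "\<And>k. integrable lborel (\<lambda>w. norm (a w) * \<langle>w\<rangle> ^ k)"
    and T: "T \<in> tempered_distributions"
  shows "T (superposition a G) = (\<integral>w. a w * T (G w) \<partial>lborel)"
proof -
  note mem = schwartz_familyD(1)[OF G]
  obtain CT N where CT: "0 \<le> CT" "\<And>f. f \<in> schwartz_space \<Longrightarrow> norm (T f) \<le> CT * schwartz_seminorm N f"
    using temperedD_bound[OF T] by blast
  obtain C k where C: "0 \<le> C" "\<And>w. schwartz_seminorm N (G w) \<le> C * \<langle>w\<rangle> ^ k"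
    using schwartz_family_bound[OF G] by blast
  have inta: "integrable lborel a"
    by (rule Bochner_Integration.integrable_bound[OF int[of 0]]) auto
  \<comment> \<open>The bound by twice the norm keeps the polynomial majorants valid along the
    discretisations, uniformly in \<open>i\<close>.\<close>
  obtain s :: "nat \<Rightarrow> 'w \<Rightarrow> 'w" where s: "\<And>i. simple_function lborel (s i)"
    "\<And>w. (\<lambda>i. s i w) \<longlonglongrightarrow> w" "\<And>i w. norm (s i w) \<le> 2 * norm w"
    using borel_measurable_implies_sequence_metric[of "\<lambda>w::'w. w" lborel 0] by auto
  have fin: "finite (range (s i))" for i using simple_functionD(1)[OF s(1)] by simp
  have sets: "{w. s i w = v} \<in> sets borel" for i v
    using simple_functionD(2)[OF s(1), of i "{v}"] by (simp add: vimage_def)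
  define c where "c i v = (\<integral>w. a w * indicator {w. s i w = v} w \<partial>lborel)" for i v
  have intc: "integrable lborel (\<lambda>w. a w * indicator {w. s i w = v} w)" for i v
    using sets by (intro Bochner_Integration.integrable_bound[OF inta]) (auto split: split_indicator)
  have discrete: "(\<integral>w. a w * F (s i w) \<partial>lborel) = (\<Sum>v\<in>range (s i). c i v * F v)"
    and discrete_int: "integrable lborel (\<lambda>w. a w * F (s i w))" for i and F :: "'w \<Rightarrow> complex"
  proof -
    have eq: "a w * F (s i w) = (\<Sum>v\<in>range (s i). (a w * indicator {w. s i w = v} w) * F v)" for w
    proof -
      have "(\<Sum>v\<in>range (s i). (a w * indicator {w. s i w = v} w) * F v)
          = (\<Sum>v\<in>range (s i). if s i w = v then a w * F v else 0)"
        by (intro sum.cong) auto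
      then show ?thesis using fin[of i] by simp
    qed
    show "(\<integral>w. a w * F (s i w) \<partial>lborel) = (\<Sum>v\<in>range (s i). c i v * F v)"
      unfolding eq c_def using intc by (subst Bochner_Integration.integral_sum) auto
    show "integrable lborel (\<lambda>w. a w * F (s i w))"
      unfolding eq using intc by auto
  qed
  define I where "I i y = (\<Sum>v\<in>range (s i). c i v * G v y)" for i y
  have IS: "I i \<in> schwartz_space" for i
    unfolding I_def[abs_def] by (intro schwartz_sum schwartz_scale mem)
  have SS: "superposition a G \<in> schwartz_space" by (rule superposition_schwartz[OF G a int])
  have bs2: "\<langle>s i w\<rangle> ^ k \<le> 2 ^ k * \<langle>w\<rangle> ^ k" for i w
  proof -
    have "norm (s i w) \<le> norm (2 *\<^sub>R w)" using s(3) by simp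
    then have "\<langle>s i w\<rangle> \<le> \<langle>w + w\<rangle>" by (intro bracket_mono) (simp flip: scaleR_2)
    also have "\<dots> \<le> 2 * \<langle>w\<rangle>"
    proof (rule power2_le_imp_le)
      show "\<langle>w + w\<rangle>\<^sup>2 \<le> (2 * \<langle>w\<rangle>)\<^sup>2"
        by (simp add: power_mult_distrib bracket_sq flip: scaleR_2)
    qed simp
    finally show ?thesis using power_mono[of "\<langle>s i w\<rangle>" "2 * \<langle>w\<rangle>" k] by (simp add: power_mult_distrib)
  qed
  have "(\<lambda>i. T (I i)) \<longlonglongrightarrow> (\<integral>w. a w * T (G w) \<partial>lborel)"
  proof -
    have "(\<lambda>i. \<integral>w. a w * T (G (s i w)) \<partial>lborel) \<longlonglongrightarrow> (\<integral>w. a w * T (G w) \<partial>lborel)"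
    proof (rule integral_dominated_convergence[where w = "\<lambda>w. (CT * C * 2 ^ k) * (norm (a w) * \<langle>w\<rangle> ^ k)"])
      have cont: "continuous_on UNIV (\<lambda>w. T (G w))"
        by (rule schwartz_family_tempered_continuous[OF G T])
      have [measurable]: "(\<lambda>w. T (G w)) \<in> borel_measurable borel"
        by (rule borel_measurable_continuous_onI[OF cont])
      show "(\<lambda>w. a w * T (G w)) \<in> borel_measurable lborel" by simp
      show "(\<lambda>w. a w * T (G (s i w))) \<in> borel_measurable lborel" for i
        using discrete_int[where F = "\<lambda>v. T (G v)"] by (rule borel_measurable_integrable)
      show "AE w in lborel. (\<lambda>i. a w * T (G (s i w))) \<longlonglongrightarrow> a w * T (G w)"
        using cont s(2) by (auto intro!: tendsto_mult simp: continuous_on_sequentially o_def)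
      show "AE w in lborel. norm (a w * T (G (s i w))) \<le> (CT * C * 2 ^ k) * (norm (a w) * \<langle>w\<rangle> ^ k)" for i
      proof (rule AE_I2)
        fix w
        have "norm (T (G (s i w))) \<le> CT * (C * (2 ^ k * \<langle>w\<rangle> ^ k))"
          by (intro order.trans[OF CT(2)[OF mem]] mult_left_mono CT(1) order.trans[OF C(2)] C(1) bs2)
        then show "norm (a w * T (G (s i w))) \<le> (CT * C * 2 ^ k) * (norm (a w) * \<langle>w\<rangle> ^ k)"
          unfolding norm_mult using mult_left_mono[of _ _ "norm (a w)"] by (fastforce simp: ac_simps)
      qed
    qed (intro integrable_mult_right int)
    also have "(\<lambda>i. \<integral>w. a w * T (G (s i w)) \<partial>lborel) = (\<lambda>i. T (I i))"
      unfolding discrete[where F = "\<lambda>v. T (G v)"] I_def by (subst tempered_sum[OF T mem]) simp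
    finally show ?thesis .
  qed
  moreover have "(\<lambda>i. T (I i)) \<longlonglongrightarrow> T (superposition a G)"
  proof -
    \<comment> \<open>Up to the number of multi-indices, \<delta> bounds the seminorm of the
      difference between the superposition and its finite sum.\<close>
    define \<delta> where "\<delta> i = (\<integral>w. norm (a w) * schwartz_seminorm N (\<lambda>y. G w y - G (s i w) y) \<partial>lborel)" for i
    let ?c = "real (card {bs. set bs \<subseteq> (Basis :: 'a set) \<and> length bs \<le> N})"
    \<comment> \<open>On each level set of \<open>s i\<close> the subtracted function is fixed, so
      the seminorm is a finite sum of continuous functions times indicators.\<close>
    have meas: "(\<lambda>w. schwartz_seminorm N (\<lambda>y. G w y - G (s i w) y)) \<in> borel_measurable borel" for i
    proof -
      have "schwartz_seminorm N (\<lambda>y. G w y - G (s i w) y)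
          = (\<Sum>v\<in>range (s i). indicator {w. s i w = v} w * schwartz_seminorm N (\<lambda>y. G w y - G v y))" for w
      proof -
        have "(\<Sum>v\<in>range (s i). indicator {w. s i w = v} w * schwartz_seminorm N (\<lambda>y. G w y - G v y))
          = (\<Sum>v\<in>range (s i). if s i w = v then schwartz_seminorm N (\<lambda>y. G w y - G v y) else 0)"
          by (intro sum.cong) auto
        then show ?thesis using fin[of i] by simp
      qed
      moreover have "(\<lambda>w. schwartz_seminorm N (\<lambda>y. G w y - G v y)) \<in> borel_measurable borel" for v
        by (rule borel_measurable_continuous_onI[OF schwartz_family_seminorm_continuous[OF G mem]])
      ultimately show ?thesis using sets by simp
    qed
    have dom: "schwartz_seminorm N (\<lambda>y. G w y - G (s i w) y) \<le> (C * (1 + 2 ^ k)) * \<langle>w\<rangle> ^ k" for w i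
    proof -
      have "schwartz_seminorm N (\<lambda>y. G w y - G (s i w) y) \<le> C * \<langle>w\<rangle> ^ k + C * (2 ^ k * \<langle>w\<rangle> ^ k)"
        by (intro order.trans[OF schwartz_seminorm_diff_triangle[OF mem mem]] add_mono C(2)
            order.trans[OF C(2)] mult_left_mono bs2 C(1))
      then show ?thesis by (simp add: algebra_simps)
    qed
    have nonneg: "0 \<le> schwartz_seminorm N (\<lambda>y. G w y - G (s i w) y)" for w i
      by (intro schwartz_seminorm_nonneg schwartz_diff mem)
    have domi: "norm (norm (a w) * schwartz_seminorm N (\<lambda>y. G w y - G (s i w) y)) \<le> (C * (1 + 2 ^ k)) * (norm (a w) * \<langle>w\<rangle> ^ k)" for w i
      using mult_left_mono[OF dom[of w i], of "norm (a w)"] nonneg by (simp add: abs_mult ac_simps)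
    have int\<delta>: "integrable lborel (\<lambda>w. norm (a w) * schwartz_seminorm N (\<lambda>y. G w y - G (s i w) y))" for i
      by (rule Bochner_Integration.integrable_bound[OF integrable_mult_right[OF int[of k], of "C * (1 + 2 ^ k)"]])
        (use meas domi order.trans[OF domi abs_ge_self] in auto)
    have "\<delta> \<longlonglongrightarrow> (\<integral>w. (0::real) \<partial>(lborel :: 'w measure))"
      unfolding \<delta>_def
    proof (rule integral_dominated_convergence[where w = "\<lambda>w. (C * (1 + 2 ^ k)) * (norm (a w) * \<langle>w\<rangle> ^ k)"])
      show "AE w in lborel. (\<lambda>i. norm (a w) * schwartz_seminorm N (\<lambda>y. G w y - G (s i w) y)) \<longlonglongrightarrow> 0"
      proof (rule AE_I2)
        fix w
        have "schwartz_seminorm N (\<lambda>y. G w y - G (s i w) y) = schwartz_seminorm N (\<lambda>y. G (s i w) y - G w y)" for i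
          using schwartz_seminorm_minus[OF schwartz_diff[OF mem mem], of N "s i w" w] by simp
        then have "(\<lambda>i. norm (a w) * schwartz_seminorm N (\<lambda>y. G w y - G (s i w) y)) \<longlonglongrightarrow> norm (a w) * 0"
          using schwartz_familyD(2)[OF G s(2)[of w], of N] by (intro tendsto_mult tendsto_const) simp
        then show "(\<lambda>i. norm (a w) * schwartz_seminorm N (\<lambda>y. G w y - G (s i w) y)) \<longlonglongrightarrow> 0" by simp
      qed
    qed (use domi int\<delta> in \<open>auto intro!: integrable_mult_right int\<close>)
    then have \<delta>0: "\<delta> \<longlonglongrightarrow> 0" by simp
    have "norm (T (superposition a G) - T (I i)) \<le> CT * (?c * \<delta> i)" for i
    proof -
      have "schwartz_seminorm N (\<lambda>y. superposition a G y - I i y) \<le> ?c * \<delta> i"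
      proof (rule schwartz_seminorm_least)
        fix bs :: "'a list" and y :: 'a assume bs: "set bs \<subseteq> Basis" "length bs \<le> N"
        have "partial_derivs bs (I i) y = (\<Sum>v\<in>range (s i). c i v * partial_derivs bs (G v) y)"
          unfolding I_def[abs_def]
          by (subst partial_derivs_sum) (auto intro!: schwartz_scale mem bs sum.cong simp: partial_derivs_scale[OF mem bs(1)])
        then have "partial_derivs bs (\<lambda>y. superposition a G y - I i y) y
          = (\<integral>w. a w * partial_derivs bs (G w) y \<partial>lborel) - (\<integral>w. a w * partial_derivs bs (G (s i w)) y \<partial>lborel)"
          using discrete[where F = "\<lambda>w. partial_derivs bs (G w) y" and i = i]
          by (simp add: partial_derivs_diff[OF SS IS bs(1)] superposition_partial_derivs[OF G a int bs(1)])
        also have "\<dots> = (\<integral>w. a w * (partial_derivs bs (G w) y - partial_derivs bs (G (s i w)) y) \<partial>lborel)"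
          unfolding right_diff_distrib
          by (rule Bochner_Integration.integral_diff[symmetric])
            (rule superposition_partial_derivs_aux(1)[OF G a int bs(1)], rule discrete_int)
        finally have eq: "partial_derivs bs (\<lambda>y. superposition a G y - I i y) y
          = (\<integral>w. a w * partial_derivs bs (\<lambda>y. G w y - G (s i w) y) y \<partial>lborel)"
          by (simp add: partial_derivs_diff[OF mem mem bs(1)])
        have "\<langle>y\<rangle> ^ N * norm (partial_derivs bs (\<lambda>y. superposition a G y - I i y) y)
          \<le> \<langle>y\<rangle> ^ N * (\<integral>w. norm (a w * partial_derivs bs (\<lambda>y. G w y - G (s i w) y) y) \<partial>lborel)"
          unfolding eq by (intro mult_left_mono integral_norm_bound) auto
        also have "\<dots> = (\<integral>w. norm (a w) * (\<langle>y\<rangle> ^ N * norm (partial_derivs bs (\<lambda>y. G w y - G (s i w) y) y)) \<partial>lborel)"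
          by (simp add: norm_mult mult.left_commute flip: integral_mult_right_zero)
        also have "\<dots> \<le> \<delta> i"
          unfolding \<delta>_def
        proof (rule integral_mono[OF _ int\<delta>])
          have "integrable lborel (\<lambda>w. a w * partial_derivs bs (G w) y - a w * partial_derivs bs (G (s i w)) y)"
            by (intro Bochner_Integration.integrable_diff superposition_partial_derivs_aux(1)[OF G a int bs(1)] discrete_int)
          then have "integrable lborel (\<lambda>w. a w * partial_derivs bs (\<lambda>y. G w y - G (s i w) y) y)"
            by (simp add: partial_derivs_diff[OF mem mem bs(1)] right_diff_distrib)
          from integrable_mult_right[OF integrable_norm[OF this], of "\<langle>y\<rangle> ^ N"]
          show "integrable lborel (\<lambda>w. norm (a w) * (\<langle>y\<rangle> ^ N * norm (partial_derivs bs (\<lambda>y. G w y - G (s i w) y) y)))"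
            by (simp add: norm_mult mult.left_commute)
          show "norm (a w) * (\<langle>y\<rangle> ^ N * norm (partial_derivs bs (\<lambda>y. G w y - G (s i w) y) y))
            \<le> norm (a w) * schwartz_seminorm N (\<lambda>y. G w y - G (s i w) y)" for w
            by (intro mult_left_mono schwartz_seminorm_upper schwartz_diff mem bs) auto
        qed
        finally show "\<langle>y\<rangle> ^ N * norm (partial_derivs bs (\<lambda>y. superposition a G y - I i y) y) \<le> \<delta> i" .
      qed
      then show ?thesis
        unfolding tempered_diff[OF T SS IS, symmetric]
        by (intro order.trans[OF CT(2)[OF schwartz_diff[OF SS IS]]] mult_left_mono CT(1))
    qed
    moreover have "(\<lambda>i. CT * (?c * \<delta> i)) \<longlonglongrightarrow> 0"
      by (intro tendsto_mult_right_zero \<delta>0)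
    ultimately have "(\<lambda>i. T (superposition a G) - T (I i)) \<longlonglongrightarrow> 0"
      by (rule tendsto_0_if_norm_le[rotated])
    from tendsto_diff[OF tendsto_const[of "T (superposition a G)"] this] show ?thesis by simp
  qed
  ultimately show ?thesis using LIMSEQ_unique by blast
qed

section \<open>Time-frequency shifts\<close>

text \<open>
  The closure of the time-frequency shifts under the operations needed to differentiate them;
  a member is a family of functions of \<open>y\<close> indexed by phase space points \<open>(\<zeta>, z)\<close>.
\<close>

inductive_set tf_families :: "('a::euclidean_space \<times> 'a \<Rightarrow> 'a \<Rightarrow> complex) set" where
  base: "\<psi> \<in> schwartz_space \<Longrightarrow> (\<lambda>w y. cis (2 * pi * (y \<bullet> snd w)) * \<psi> (y - fst w)) \<in> tf_families"
| add: "A \<in> tf_families \<Longrightarrow> B \<in> tf_families \<Longrightarrow> (\<lambda>w y. A w y + B w y) \<in> tf_families"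
| scale: "A \<in> tf_families \<Longrightarrow> (\<lambda>w y. c * of_real (snd w \<bullet> v) * A w y) \<in> tf_families"

lemma tf_families_schwartz: "A \<in> tf_families \<Longrightarrow> A w \<in> schwartz_space"
  by (induction rule: tf_families.induct)
    (auto intro: schwartz_add schwartz_scale schwartz_cis_inner schwartz_translation)

lemma tf_families_dir_deriv:
  assumes "A \<in> tf_families" "b \<in> Basis"
  shows "(\<lambda>w. dir_deriv b (A w)) \<in> tf_families"
  using assms(1)
proof induction
  case (base \<psi>)
  have shift: "((\<lambda>y. \<psi> (y - fst w)) has_derivative (\<lambda>h. frechet_derivative \<psi> (at (y - fst w)) h)) (at y)"
    for w :: "'a \<times> 'a" and y
  proof -
    have "((\<lambda>x. x - fst w) has_derivative (\<lambda>h. h)) (at y)"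
      by (auto intro!: derivative_eq_intros)
    from has_derivative_compose[OF this has_derivative_frechet[OF schwartz_differentiable[OF base]]]
    show ?thesis .
  qed
  have d: "((\<lambda>y. cis (2 * pi * (y \<bullet> snd w)) * \<psi> (y - fst w)) has_derivative
      (\<lambda>h. cis (2 * pi * (y \<bullet> snd w)) * frechet_derivative \<psi> (at (y - fst w)) h
        + \<i> * of_real (2 * pi * (h \<bullet> snd w)) * cis (2 * pi * (y \<bullet> snd w)) * \<psi> (y - fst w))) (at y)"
    for w :: "'a \<times> 'a" and y
    by (intro has_derivative_mult has_derivative_cis_comp shift) (auto intro!: derivative_eq_intros)
  have "(\<lambda>w. dir_deriv b (\<lambda>y. cis (2 * pi * (y \<bullet> snd w)) * \<psi> (y - fst w)))
    = (\<lambda>w y. cis (2 * pi * (y \<bullet> snd w)) * dir_deriv b \<psi> (y - fst w)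
       + (2 * pi * \<i>) * of_real (snd w \<bullet> b) * (cis (2 * pi * (y \<bullet> snd w)) * \<psi> (y - fst w)))"
    unfolding dir_deriv_eqI[OF d] by (simp add: inner_commute ac_simps)
  also have "\<dots> \<in> tf_families"
    by (intro tf_families.add tf_families.scale tf_families.base schwartz_dir_deriv base assms(2))
  finally show ?case .
next
  case (add A B)
  have d: "((\<lambda>y. A w y + B w y) has_derivative
    (\<lambda>h. frechet_derivative (A w) (at y) h + frechet_derivative (B w) (at y) h)) (at y)" for w y
    by (intro has_derivative_add has_derivative_frechet schwartz_differentiable tf_families_schwartz add)
  show ?case unfolding dir_deriv_eqI[OF d] by (intro tf_families.add add)
next
  case (scale A c v)
  have d: "((\<lambda>y. c * of_real (snd w \<bullet> v) * A w y) has_derivative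
    (\<lambda>h. c * of_real (snd w \<bullet> v) * frechet_derivative (A w) (at y) h)) (at y)" for w y
    by (intro has_derivative_mult_right has_derivative_frechet schwartz_differentiable tf_families_schwartz scale)
  show ?case unfolding dir_deriv_eqI[OF d] by (intro tf_families.scale scale)
qed

lemma tf_families_partial_derivs:
  "A \<in> tf_families \<Longrightarrow> set bs \<subseteq> Basis \<Longrightarrow> (\<lambda>w. partial_derivs bs (A w)) \<in> tf_families"
  by (induction bs) (auto intro: tf_families_dir_deriv[of "\<lambda>w. partial_derivs _ (A w)"])

lemma abs_inner_le_bracket: "\<bar>snd w \<bullet> v\<bar> \<le> norm v * \<langle>w\<rangle>"
proof -
  have "\<bar>snd w \<bullet> v\<bar> \<le> norm (snd w) * norm v" by (rule Cauchy_Schwarz_ineq2)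
  also have "\<dots> \<le> \<langle>w\<rangle> * norm v"
    using norm_le_bracket[of "snd w"] bracket_snd_le[of w] by (intro mult_right_mono) auto
  finally show ?thesis by (simp add: mult.commute)
qed

lemma tf_families_bound:
  assumes "A \<in> tf_families"
  shows "\<exists>C k. 0 \<le> C \<and> (\<forall>w y. \<langle>y\<rangle> ^ N * norm (A w y) \<le> C * \<langle>w\<rangle> ^ k)"
  using assms
proof induction
  case (base \<psi>)
  obtain C where C: "0 < C" "\<And>x. \<langle>x\<rangle> ^ N * norm (\<psi> x) \<le> C" using schwartz_bounded[OF base] by blast
  have "\<langle>y\<rangle> ^ N * norm (cis (2 * pi * (y \<bullet> snd w)) * \<psi> (y - fst w)) \<le> (2 ^ N * C) * \<langle>w\<rangle> ^ N" for w :: "'a \<times> 'a" and y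
  proof -
    have "\<langle>y\<rangle> ^ N * norm (cis (2 * pi * (y \<bullet> snd w)) * \<psi> (y - fst w))
      \<le> (2 ^ N * \<langle>fst w\<rangle> ^ N * \<langle>y - fst w\<rangle> ^ N) * norm (\<psi> (y - fst w))"
      by (simp add: norm_mult bracket_shift_power_le mult_right_mono)
    also have "\<dots> = 2 ^ N * \<langle>fst w\<rangle> ^ N * (\<langle>y - fst w\<rangle> ^ N * norm (\<psi> (y - fst w)))" by simp
    also have "\<dots> \<le> 2 ^ N * \<langle>w\<rangle> ^ N * C"
      by (intro mult_mono C power_mono bracket_fst_le) auto
    finally show ?thesis by (simp add: ac_simps)
  qed
  then show ?case using C(1) by (intro exI[of _ "2 ^ N * C"] exI[of _ N]) auto
next
  case (add A B)
  obtain C k D l where CD: "0 \<le> C" "\<And>w y. \<langle>y\<rangle> ^ N * norm (A w y) \<le> C * \<langle>w\<rangle> ^ k"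
    "0 \<le> D" "\<And>w y. \<langle>y\<rangle> ^ N * norm (B w y) \<le> D * \<langle>w\<rangle> ^ l"
    using add.IH by blast
  have "\<langle>y\<rangle> ^ N * norm (A w y + B w y) \<le> (C + D) * \<langle>w\<rangle> ^ (k + l)" for w y
  proof -
    have "\<langle>y\<rangle> ^ N * norm (A w y + B w y) \<le> \<langle>y\<rangle> ^ N * norm (A w y) + \<langle>y\<rangle> ^ N * norm (B w y)"
      unfolding distrib_left[symmetric] by (intro mult_left_mono norm_triangle_ineq) auto
    also have "\<dots> \<le> C * \<langle>w\<rangle> ^ k + D * \<langle>w\<rangle> ^ l" by (intro add_mono CD)
    also have "\<dots> \<le> C * \<langle>w\<rangle> ^ (k + l) + D * \<langle>w\<rangle> ^ (k + l)"
      by (intro add_mono mult_left_mono power_increasing bracket_ge_1 CD) auto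
    finally show ?thesis by (simp add: distrib_right)
  qed
  then show ?case using CD by (intro exI[of _ "C + D"] exI[of _ "k + l"]) auto
next
  case (scale A c v)
  obtain C k where C: "0 \<le> C" "\<And>w y. \<langle>y\<rangle> ^ N * norm (A w y) \<le> C * \<langle>w\<rangle> ^ k"
    using scale.IH by blast
  have "\<langle>y\<rangle> ^ N * norm (c * of_real (snd w \<bullet> v) * A w y) \<le> (norm c * norm v * C) * \<langle>w\<rangle> ^ Suc k" for w y
  proof -
    have "\<langle>y\<rangle> ^ N * norm (c * of_real (snd w \<bullet> v) * A w y) = norm c * \<bar>snd w \<bullet> v\<bar> * (\<langle>y\<rangle> ^ N * norm (A w y))"
      by (simp add: norm_mult)
    also have "\<dots> \<le> norm c * (norm v * \<langle>w\<rangle>) * (C * \<langle>w\<rangle> ^ k)"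
      by (intro mult_mono abs_inner_le_bracket C) auto
    finally show ?thesis by (simp add: ac_simps)
  qed
  then show ?case using C by (intro exI[of _ "norm c * norm v * C"] exI[of _ "Suc k"]) auto
qed

lemma norm_cis_diff_le: "norm (cis a - cis b) \<le> \<bar>a - b\<bar>"
proof -
  have "iexp (a - b) = cis (a - b)" by (simp add: cis_conv_exp)
  then have "cis a - cis b = cis b * (iexp (a - b) - 1)"
    by (simp add: right_diff_distrib cis_mult)
  then show ?thesis
    using iexp_approx1[of "a - b" 0] by (simp add: norm_mult)
qed

lemma bracket_near_le:
  assumes "norm (w - w') \<le> 1"
  shows "\<langle>w'\<rangle> \<le> 4 * \<langle>w\<rangle>"
proof -
  have "\<langle>w'\<rangle> \<le> 2 * \<langle>w\<rangle> * \<langle>w' - w\<rangle>" using bracket_add_le[of w "w' - w"] by simp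
  also have "\<langle>w' - w\<rangle> \<le> 2" using assms bracket_le[of "w' - w"] by (simp add: norm_minus_commute)
  finally show ?thesis by (simp add: mult_left_mono)
qed

text \<open>The mean value inequality on a unit ball around \<open>y - \<zeta>\<close>. The decay of
  the derivative there becomes decay in \<open>y\<close> at the price of a power of
  \<open>\<langle>\<zeta>\<rangle>\<close>; the 8 combines the Peetre factor 2 with the factor 4 for
  points at distance at most one.\<close>

lemma schwartz_shift_lipschitz:
  fixes \<psi> :: "'a::euclidean_space \<Rightarrow> complex"
  assumes \<psi>: "\<psi> \<in> schwartz_space"
  obtains C where "0 \<le> C" "\<And>\<zeta> \<zeta>' y. norm (\<zeta> - \<zeta>') \<le> 1 \<Longrightarrow>
    \<langle>y\<rangle> ^ N * norm (\<psi> (y - \<zeta>) - \<psi> (y - \<zeta>')) \<le> C * \<langle>\<zeta>\<rangle> ^ N * norm (\<zeta> - \<zeta>')"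
proof -
  obtain C where C: "0 < C" "\<And>x h. norm (frechet_derivative \<psi> (at x) h) \<le> C * inverse (\<langle>x\<rangle> ^ N) * norm h"
    using schwartz_derivative_decay[OF \<psi>] by blast
  show ?thesis
  proof (rule that[of "C * 8 ^ N"])
    fix \<zeta> \<zeta>' y :: 'a assume near: "norm (\<zeta> - \<zeta>') \<le> 1"
    let ?B = "C * (8 ^ N * \<langle>\<zeta>\<rangle> ^ N * inverse (\<langle>y\<rangle> ^ N))"
    have "norm (\<psi> (y - \<zeta>) - \<psi> (y - \<zeta>')) \<le> ?B * norm ((y - \<zeta>) - (y - \<zeta>'))"
    proof (rule differentiable_bound[of "cball (y - \<zeta>) 1"])
      show "(\<psi> has_derivative frechet_derivative \<psi> (at x)) (at x within cball (y - \<zeta>) 1)" for x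
        using has_derivative_frechet[OF schwartz_differentiable[OF \<psi>], of x] has_derivative_at_withinI by blast
      fix x assume x: "x \<in> cball (y - \<zeta>) 1"
      have "\<langle>y\<rangle> ^ N \<le> 2 ^ N * \<langle>y - x\<rangle> ^ N * \<langle>x\<rangle> ^ N"
        using bracket_shift_power_le[of y N x] by (simp add: ac_simps)
      also have "\<dots> \<le> 2 ^ N * (4 * \<langle>\<zeta>\<rangle>) ^ N * \<langle>x\<rangle> ^ N"
      proof (intro mult_right_mono mult_left_mono power_mono bracket_near_le)
        have "\<zeta> - (y - x) = x - (y - \<zeta>)" by simp
        then show "norm (\<zeta> - (y - x)) \<le> 1"
          using x by (simp only: mem_cball dist_norm norm_minus_commute)
      qed auto
      also have "\<dots> = 8 ^ N * \<langle>\<zeta>\<rangle> ^ N * \<langle>x\<rangle> ^ N"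
        by (simp add: power_mult_distrib flip: power_mult_distrib[of 2 4])
      finally have "inverse (\<langle>x\<rangle> ^ N) \<le> 8 ^ N * \<langle>\<zeta>\<rangle> ^ N * inverse (\<langle>y\<rangle> ^ N)"
        by (simp add: field_simps)
      then have "C * inverse (\<langle>x\<rangle> ^ N) \<le> ?B" using C(1) by (intro mult_left_mono) auto
      then show "onorm (frechet_derivative \<psi> (at x)) \<le> ?B"
        using C(1) by (intro onorm_bound order.trans[OF C(2)] mult_right_mono) auto
    qed (use near in \<open>auto simp: dist_norm norm_minus_commute\<close>)
    then show "\<langle>y\<rangle> ^ N * norm (\<psi> (y - \<zeta>) - \<psi> (y - \<zeta>')) \<le> C * 8 ^ N * \<langle>\<zeta>\<rangle> ^ N * norm (\<zeta> - \<zeta>')"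
      by (simp add: field_simps norm_minus_commute)
  qed (use C in auto)
qed

text \<open>A quantitative continuity that survives differentiation in \<open>y\<close>, because
  derivatives of members are members. Two modulations differ by at most a multiple of
  \<open>norm y\<close> times the distance of their frequencies, which is why the window contributes
  decay of order \<open>Suc N\<close>.\<close>

lemma tf_families_lipschitz:
  assumes "A \<in> tf_families"
  shows "\<exists>C k. 0 \<le> C \<and> (\<forall>w w' y. norm (w - w') \<le> 1 \<longrightarrow>
    \<langle>y\<rangle> ^ N * norm (A w y - A w' y) \<le> C * \<langle>w\<rangle> ^ k * norm (w - w'))"
  using assms
proof induction
  case (base \<psi>)
  obtain C where C: "0 < C" "\<And>x. \<langle>x\<rangle> ^ Suc N * norm (\<psi> x) \<le> C" using schwartz_bounded[OF base] by blast
  obtain D where D: "0 \<le> D" "\<And>\<zeta> \<zeta>' y. norm (\<zeta> - \<zeta>') \<le> 1 \<Longrightarrow>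
      \<langle>y\<rangle> ^ N * norm (\<psi> (y - \<zeta>) - \<psi> (y - \<zeta>')) \<le> D * \<langle>\<zeta>\<rangle> ^ N * norm (\<zeta> - \<zeta>')"
    using schwartz_shift_lipschitz[OF base] by blast
  let ?e = "\<lambda>w y. cis (2 * pi * (y \<bullet> snd w))"
  have "\<langle>y\<rangle> ^ N * norm (?e w y * \<psi> (y - fst w) - ?e w' y * \<psi> (y - fst w'))
    \<le> (2 * pi * 2 ^ Suc N * C + D) * \<langle>w\<rangle> ^ Suc N * norm (w - w')" if near: "norm (w - w') \<le> 1" for w w' :: "'a \<times> 'a" and y
  proof -
    have "?e w y * \<psi> (y - fst w) - ?e w' y * \<psi> (y - fst w')
      = (?e w y - ?e w' y) * \<psi> (y - fst w) + ?e w' y * (\<psi> (y - fst w) - \<psi> (y - fst w'))"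
      by (simp add: algebra_simps)
    then have "norm (?e w y * \<psi> (y - fst w) - ?e w' y * \<psi> (y - fst w'))
      \<le> norm (?e w y - ?e w' y) * norm (\<psi> (y - fst w)) + norm (\<psi> (y - fst w) - \<psi> (y - fst w'))"
      using norm_triangle_ineq[of "(?e w y - ?e w' y) * \<psi> (y - fst w)" "?e w' y * (\<psi> (y - fst w) - \<psi> (y - fst w'))"]
      by (simp add: norm_mult)
    then have "\<langle>y\<rangle> ^ N * norm (?e w y * \<psi> (y - fst w) - ?e w' y * \<psi> (y - fst w'))
      \<le> \<langle>y\<rangle> ^ N * (norm (?e w y - ?e w' y) * norm (\<psi> (y - fst w))) + \<langle>y\<rangle> ^ N * norm (\<psi> (y - fst w) - \<psi> (y - fst w'))"
      unfolding distrib_left[symmetric] by (intro mult_left_mono) auto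
    also have "\<dots> \<le> 2 * pi * 2 ^ Suc N * C * \<langle>w\<rangle> ^ Suc N * norm (w - w') + D * \<langle>w\<rangle> ^ Suc N * norm (w - w')"
    proof (rule add_mono)
      have "norm (?e w y - ?e w' y) \<le> \<bar>2 * pi * (y \<bullet> snd w) - 2 * pi * (y \<bullet> snd w')\<bar>"
        by (rule norm_cis_diff_le)
      also have "\<dots> = 2 * pi * \<bar>y \<bullet> snd (w - w')\<bar>"
        by (simp add: inner_diff_right abs_mult flip: right_diff_distrib)
      also have "\<dots> \<le> 2 * pi * (\<langle>y\<rangle> * norm (w - w'))"
      proof (intro mult_left_mono)
        have "\<bar>y \<bullet> snd (w - w')\<bar> \<le> norm y * norm (snd (w - w'))" by (rule Cauchy_Schwarz_ineq2)
        also have "\<dots> \<le> \<langle>y\<rangle> * norm (w - w')"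
          by (intro mult_mono norm_le_bracket) (metis norm_snd_le prod.collapse, auto)
        finally show "\<bar>y \<bullet> snd (w - w')\<bar> \<le> \<langle>y\<rangle> * norm (w - w')" .
      qed auto
      finally have "\<langle>y\<rangle> ^ N * (norm (?e w y - ?e w' y) * norm (\<psi> (y - fst w)))
        \<le> \<langle>y\<rangle> ^ N * ((2 * pi * (\<langle>y\<rangle> * norm (w - w'))) * norm (\<psi> (y - fst w)))"
        by (intro mult_left_mono mult_right_mono) auto
      also have "\<dots> = 2 * pi * norm (w - w') * (\<langle>y\<rangle> ^ Suc N * norm (\<psi> (y - fst w)))" by simp
      also have "\<dots> \<le> 2 * pi * norm (w - w') * ((2 ^ Suc N * \<langle>fst w\<rangle> ^ Suc N * \<langle>y - fst w\<rangle> ^ Suc N) * norm (\<psi> (y - fst w)))"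
        by (intro mult_left_mono mult_right_mono bracket_shift_power_le) auto
      also have "\<dots> = 2 * pi * norm (w - w') * 2 ^ Suc N * \<langle>fst w\<rangle> ^ Suc N * (\<langle>y - fst w\<rangle> ^ Suc N * norm (\<psi> (y - fst w)))"
        by (simp only: ac_simps)
      also have "\<dots> \<le> 2 * pi * norm (w - w') * 2 ^ Suc N * \<langle>w\<rangle> ^ Suc N * C"
        by (intro mult_mono C power_mono bracket_fst_le order_refl) auto
      finally show "\<langle>y\<rangle> ^ N * (norm (?e w y - ?e w' y) * norm (\<psi> (y - fst w)))
        \<le> 2 * pi * 2 ^ Suc N * C * \<langle>w\<rangle> ^ Suc N * norm (w - w')" by (simp only: ac_simps)
    next
      have fn: "norm (fst w - fst w') \<le> norm (w - w')"
        by (metis fst_diff norm_fst_le prod.collapse)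
      then have "\<langle>y\<rangle> ^ N * norm (\<psi> (y - fst w) - \<psi> (y - fst w')) \<le> D * \<langle>fst w\<rangle> ^ N * norm (fst w - fst w')"
        using near by (intro D) auto
      also have "\<dots> \<le> D * \<langle>w\<rangle> ^ Suc N * norm (w - w')"
      proof (intro mult_mono fn D order_refl)
        have "\<langle>fst w\<rangle> ^ N \<le> \<langle>w\<rangle> ^ N" by (intro power_mono bracket_fst_le) auto
        also have "\<dots> \<le> \<langle>w\<rangle> ^ Suc N" by (intro power_increasing bracket_ge_1) auto
        finally show "\<langle>fst w\<rangle> ^ N \<le> \<langle>w\<rangle> ^ Suc N" .
      qed (use D in auto)
      finally show "\<langle>y\<rangle> ^ N * norm (\<psi> (y - fst w) - \<psi> (y - fst w')) \<le> D * \<langle>w\<rangle> ^ Suc N * norm (w - w')" .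
    qed
    finally show ?thesis by (simp only: distrib_right)
  qed
  then show ?case using C(1) D(1)
    by (intro exI[of _ "2 * pi * 2 ^ Suc N * C + D"] exI[of _ "Suc N"]) auto
next
  case (add A B)
  obtain C k D l where CD: "0 \<le> C" "\<And>w w' y. norm (w - w') \<le> 1 \<Longrightarrow> \<langle>y\<rangle> ^ N * norm (A w y - A w' y) \<le> C * \<langle>w\<rangle> ^ k * norm (w - w')"
    "0 \<le> D" "\<And>w w' y. norm (w - w') \<le> 1 \<Longrightarrow> \<langle>y\<rangle> ^ N * norm (B w y - B w' y) \<le> D * \<langle>w\<rangle> ^ l * norm (w - w')"
    using add.IH by blast
  have "\<langle>y\<rangle> ^ N * norm (A w y + B w y - (A w' y + B w' y)) \<le> (C + D) * \<langle>w\<rangle> ^ (k + l) * norm (w - w')"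
    if near: "norm (w - w') \<le> 1" for w w' y
  proof -
    have "\<langle>y\<rangle> ^ N * norm (A w y + B w y - (A w' y + B w' y))
       \<le> \<langle>y\<rangle> ^ N * norm (A w y - A w' y) + \<langle>y\<rangle> ^ N * norm (B w y - B w' y)"
      unfolding distrib_left[symmetric] add_diff_add by (intro mult_left_mono norm_triangle_ineq) auto
    also have "\<dots> \<le> C * \<langle>w\<rangle> ^ k * norm (w - w') + D * \<langle>w\<rangle> ^ l * norm (w - w')" by (intro add_mono CD near)
    also have "\<dots> \<le> C * \<langle>w\<rangle> ^ (k + l) * norm (w - w') + D * \<langle>w\<rangle> ^ (k + l) * norm (w - w')"
      by (intro add_mono mult_left_mono mult_right_mono power_increasing bracket_ge_1 CD) auto
    finally show ?thesis by (simp add: distrib_right)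
  qed
  then show ?case using CD by (intro exI[of _ "C + D"] exI[of _ "k + l"]) auto
next
  case (scale A c v)
  obtain C k where C: "0 \<le> C" "\<And>w w' y. norm (w - w') \<le> 1 \<Longrightarrow> \<langle>y\<rangle> ^ N * norm (A w y - A w' y) \<le> C * \<langle>w\<rangle> ^ k * norm (w - w')"
    using scale.IH by blast
  obtain D l where D: "0 \<le> D" "\<And>w y. \<langle>y\<rangle> ^ N * norm (A w y) \<le> D * \<langle>w\<rangle> ^ l"
    using tf_families_bound[OF scale.hyps] by blast
  let ?C = "norm c * norm v * (C + D * 4 ^ l)"
  have "\<langle>y\<rangle> ^ N * norm (c * of_real (snd w \<bullet> v) * A w y - c * of_real (snd w' \<bullet> v) * A w' y)
    \<le> ?C * \<langle>w\<rangle> ^ Suc (k + l) * norm (w - w')" if near: "norm (w - w') \<le> 1" for w w' y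
  proof -
    have eq: "c * of_real (snd w \<bullet> v) * A w y - c * of_real (snd w' \<bullet> v) * A w' y
      = c * (of_real (snd w \<bullet> v) * (A w y - A w' y) + of_real (snd (w - w') \<bullet> v) * A w' y)"
      by (simp add: algebra_simps inner_diff_left)
    have "\<langle>y\<rangle> ^ N * norm (c * of_real (snd w \<bullet> v) * A w y - c * of_real (snd w' \<bullet> v) * A w' y)
      \<le> norm c * (\<bar>snd w \<bullet> v\<bar> * (\<langle>y\<rangle> ^ N * norm (A w y - A w' y)) + \<bar>snd (w - w') \<bullet> v\<bar> * (\<langle>y\<rangle> ^ N * norm (A w' y)))"
    proof -
      have "\<langle>y\<rangle> ^ N * norm (c * (of_real (snd w \<bullet> v) * (A w y - A w' y) + of_real (snd (w - w') \<bullet> v) * A w' y))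
        \<le> \<langle>y\<rangle> ^ N * (norm c * (norm (of_real (snd w \<bullet> v) * (A w y - A w' y)) + norm (of_real (snd (w - w') \<bullet> v) * A w' y)))"
        unfolding norm_mult[of c] by (intro mult_left_mono norm_triangle_ineq) auto
      also have "\<dots> = norm c * (\<bar>snd w \<bullet> v\<bar> * (\<langle>y\<rangle> ^ N * norm (A w y - A w' y)) + \<bar>snd (w - w') \<bullet> v\<bar> * (\<langle>y\<rangle> ^ N * norm (A w' y)))"
        by (simp only: norm_mult norm_of_real distrib_left ac_simps)
      finally show ?thesis unfolding eq .
    qed
    also have "\<dots> \<le> norm c * ((norm v * \<langle>w\<rangle>) * (C * \<langle>w\<rangle> ^ (k + l) * norm (w - w')) + (norm (w - w') * norm v) * (D * (4 ^ l * \<langle>w\<rangle> ^ Suc (k + l))))"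
    proof -
      have 1: "\<langle>y\<rangle> ^ N * norm (A w y - A w' y) \<le> C * \<langle>w\<rangle> ^ (k + l) * norm (w - w')"
        by (rule order.trans[OF C(2)[OF near]])
          (intro mult_left_mono mult_right_mono power_increasing bracket_ge_1 C, auto)
      have 2: "\<bar>snd (w - w') \<bullet> v\<bar> \<le> norm (w - w') * norm v"
        by (rule order.trans[OF Cauchy_Schwarz_ineq2])
          (intro mult_right_mono, metis norm_snd_le prod.collapse, simp)
      have "\<langle>w'\<rangle> ^ l \<le> (4 * \<langle>w\<rangle>) ^ l" by (intro power_mono bracket_near_le near) auto
      also have "\<dots> = 4 ^ l * \<langle>w\<rangle> ^ l" by (simp add: power_mult_distrib)
      also have "\<dots> \<le> 4 ^ l * \<langle>w\<rangle> ^ Suc (k + l)" by (intro mult_left_mono power_increasing bracket_ge_1) auto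
      finally have 3: "\<langle>y\<rangle> ^ N * norm (A w' y) \<le> D * (4 ^ l * \<langle>w\<rangle> ^ Suc (k + l))"
        by (intro order.trans[OF D(2)] mult_left_mono D(1))
      show ?thesis
        using C(1) by (intro mult_left_mono[OF add_mono[OF mult_mono[OF abs_inner_le_bracket 1] mult_mono[OF 2 3]]]) auto
    qed
    also have "\<dots> = ?C * \<langle>w\<rangle> ^ Suc (k + l) * norm (w - w')"
      by (simp add: algebra_simps)
    finally show ?thesis .
  qed
  then show ?case using C D by (intro exI[of _ ?C] exI[of _ "Suc (k + l)"]) auto
qed

text \<open>Multi-indices of bounded length form a finite set; since the bounds are monotone in both
  constants, maxima serve all of them.\<close>

lemma finite_bound_uniform:
  assumes "finite S" "\<And>x. x \<in> S \<Longrightarrow> \<exists>C k. 0 \<le> C \<and> P x (C::real) (k::nat)"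
    and "\<And>x C k C' k'. P x C k \<Longrightarrow> C \<le> C' \<Longrightarrow> k \<le> k' \<Longrightarrow> P x C' k'"
  shows "\<exists>C k. 0 \<le> C \<and> (\<forall>x\<in>S. P x C k)"
  using assms(1,2)
proof (induction rule: finite_induct)
  case (insert x S)
  obtain C k D l where "0 \<le> C" "P x C k" "0 \<le> D" "\<And>y. y \<in> S \<Longrightarrow> P y D l"
    using insert by auto metis
  then have "P x (max C D) (max k l)" "\<And>y. y \<in> S \<Longrightarrow> P y (max C D) (max k l)"
    by (auto intro: assms(3)[of _ C k] assms(3)[of _ D l])
  then show ?case using \<open>0 \<le> C\<close>
    by (intro exI[of _ "max C D"] exI[of _ "max k l"]) auto
qed auto

lemma tf_families_schwartz_family:
  fixes A :: "'a::euclidean_space \<times> 'a \<Rightarrow> 'a \<Rightarrow> complex"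
  assumes A: "A \<in> tf_families"
  shows "schwartz_family A"
  unfolding schwartz_family_def
proof (intro conjI allI impI)
  show "A w \<in> schwartz_space" for w by (rule tf_families_schwartz[OF A])
  fix N
  let ?S = "{bs. set bs \<subseteq> (Basis :: 'a set) \<and> length bs \<le> N}"
  have "\<exists>C k. 0 \<le> C \<and> (\<forall>bs\<in>?S. \<forall>w y. \<langle>y\<rangle> ^ N * norm (partial_derivs bs (A w) y) \<le> C * \<langle>w\<rangle> ^ k)"
  proof (rule finite_bound_uniform[OF finite_multi_indices])
    fix bs assume "bs \<in> ?S"
    then show "\<exists>C k. 0 \<le> C \<and> (\<forall>w y. \<langle>y\<rangle> ^ N * norm (partial_derivs bs (A w) y) \<le> C * \<langle>w\<rangle> ^ k)"
      by (intro tf_families_bound tf_families_partial_derivs A) auto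
  next
    fix bs and C C' :: real and k k' :: nat
    assume *: "\<forall>w y. \<langle>y\<rangle> ^ N * norm (partial_derivs bs (A w) y) \<le> C * \<langle>w\<rangle> ^ k" "C \<le> C'" "k \<le> k'"
    have "0 \<le> C * \<langle>0::'a \<times> 'a\<rangle> ^ k"
      by (rule order.trans[OF _ *(1)[rule_format, of 0 0]]) auto
    then have "C * \<langle>w\<rangle> ^ k \<le> C' * \<langle>w\<rangle> ^ k'" for w :: "'a \<times> 'a"
      using *(2,3) by (intro mult_mono power_increasing bracket_ge_1) auto
    then show "\<forall>w y. \<langle>y\<rangle> ^ N * norm (partial_derivs bs (A w) y) \<le> C' * \<langle>w\<rangle> ^ k'"
      using *(1) order.trans by blast
  qed
  then obtain C k where C: "\<And>bs w y. bs \<in> ?S \<Longrightarrow> \<langle>y\<rangle> ^ N * norm (partial_derivs bs (A w) y) \<le> C * \<langle>w\<rangle> ^ k"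
    by blast
  have "schwartz_seminorm N (A w) \<le> (real (card ?S) * C) * \<langle>w\<rangle> ^ k" for w
    using schwartz_seminorm_least[of N "A w" "C * \<langle>w\<rangle> ^ k"] C by (simp add: mult.assoc)
  then show "\<exists>C k. \<forall>w. schwartz_seminorm N (A w) \<le> C * \<langle>w\<rangle> ^ k" by blast
next
  fix N and X :: "nat \<Rightarrow> 'a \<times> 'a" and w assume X: "X \<longlonglongrightarrow> w"
  let ?S = "{bs. set bs \<subseteq> (Basis :: 'a set) \<and> length bs \<le> N}"
  \<comment> \<open>The point \<open>w\<close> is fixed here, so its bracket power goes into
    \<open>C\<close>; the quantifier over \<open>k\<close> matches the shape of
    \<open>finite_bound_uniform\<close>.\<close>
  have "\<exists>C (k::nat). 0 \<le> C \<and> (\<forall>bs\<in>?S. \<forall>w' y. norm (w - w') \<le> 1 \<longrightarrow>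
      \<langle>y\<rangle> ^ N * norm (partial_derivs bs (A w) y - partial_derivs bs (A w') y) \<le> C * norm (w - w'))"
  proof (rule finite_bound_uniform[OF finite_multi_indices])
    fix bs assume "bs \<in> ?S"
    then have "\<exists>C k. 0 \<le> C \<and> (\<forall>w w' y. norm (w - w') \<le> 1 \<longrightarrow>
      \<langle>y\<rangle> ^ N * norm (partial_derivs bs (A w) y - partial_derivs bs (A w') y) \<le> C * \<langle>w\<rangle> ^ k * norm (w - w'))"
      by (intro tf_families_lipschitz[of "\<lambda>w. partial_derivs bs (A w)"] tf_families_partial_derivs A) auto
    then obtain C k where "0 \<le> C" "\<And>w'. \<forall>y. norm (w - w') \<le> 1 \<longrightarrow>
      \<langle>y\<rangle> ^ N * norm (partial_derivs bs (A w) y - partial_derivs bs (A w') y) \<le> C * \<langle>w\<rangle> ^ k * norm (w - w')"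
      by blast
    then show "\<exists>C (k::nat). 0 \<le> C \<and> (\<forall>w' y. norm (w - w') \<le> 1 \<longrightarrow>
      \<langle>y\<rangle> ^ N * norm (partial_derivs bs (A w) y - partial_derivs bs (A w') y) \<le> C * norm (w - w'))"
      by (intro exI[of _ "C * \<langle>w\<rangle> ^ k"]) auto
  next
    fix bs and C C' :: real
    assume *: "\<forall>w' y. norm (w - w') \<le> 1 \<longrightarrow>
      \<langle>y\<rangle> ^ N * norm (partial_derivs bs (A w) y - partial_derivs bs (A w') y) \<le> C * norm (w - w')" "C \<le> C'"
    then have "C * norm (w - w') \<le> C' * norm (w - w')" for w' by (intro mult_right_mono) auto
    then show "\<forall>w' y. norm (w - w') \<le> 1 \<longrightarrow>
      \<langle>y\<rangle> ^ N * norm (partial_derivs bs (A w) y - partial_derivs bs (A w') y) \<le> C' * norm (w - w')"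
      using *(1) order.trans by blast
  qed
  then obtain C where C: "\<And>bs w' y. bs \<in> ?S \<Longrightarrow> norm (w - w') \<le> 1 \<Longrightarrow>
      \<langle>y\<rangle> ^ N * norm (partial_derivs bs (A w) y - partial_derivs bs (A w') y) \<le> C * norm (w - w')"
    by blast
  have mem: "A w \<in> schwartz_space" for w by (rule tf_families_schwartz[OF A])
  have bound: "schwartz_seminorm N (\<lambda>y. A w' y - A w y) \<le> real (card ?S) * (C * norm (w' - w))"
    if near: "norm (w - w') \<le> 1" for w'
  proof (rule schwartz_seminorm_least)
    fix bs :: "'a list" and y assume bs: "set bs \<subseteq> Basis" "length bs \<le> N"
    show "\<langle>y\<rangle> ^ N * norm (partial_derivs bs (\<lambda>y. A w' y - A w y) y) \<le> C * norm (w' - w)"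
      using C[of bs w' y] bs near by (simp add: partial_derivs_diff[OF mem mem bs(1)] norm_minus_commute)
  qed
  have "(\<lambda>i. norm (X i - w)) \<longlonglongrightarrow> 0" using X LIM_zero tendsto_norm_zero by blast
  then have lim: "(\<lambda>i. real (card ?S) * (C * norm (X i - w))) \<longlonglongrightarrow> 0"
    by (intro tendsto_mult_right_zero)
  have ev: "eventually (\<lambda>i. norm (w - X i) \<le> 1) sequentially"
    using X unfolding tendsto_iff dist_norm
    by (rule allE[of _ 1]) (auto elim!: eventually_mono simp: norm_minus_commute)
  show "(\<lambda>i. schwartz_seminorm N (\<lambda>y. A (X i) y - A w y)) \<longlonglongrightarrow> 0"
  proof (rule Lim_null_comparison[OF _ lim])
    show "\<forall>\<^sub>F i in sequentially. norm (schwartz_seminorm N (\<lambda>y. A (X i) y - A w y)) \<le> real (card ?S) * (C * norm (X i - w))"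
      using ev by eventually_elim
        (simp add: bound schwartz_seminorm_nonneg schwartz_diff mem)
  qed
qed

definition tf_shift :: "('a::euclidean_space \<Rightarrow> complex) \<Rightarrow> 'a \<times> 'a \<Rightarrow> 'a \<Rightarrow> complex" where
  "tf_shift \<psi> w = modulation (snd w) (translation (fst w) \<psi>)"

lemma tf_shift_apply: "tf_shift \<psi> w y = cis (2 * pi * (y \<bullet> snd w)) * \<psi> (y - fst w)"
  by (simp add: tf_shift_def modulation_def translation_def)

lemma schwartz_family_tf_shift: "\<psi> \<in> schwartz_space \<Longrightarrow> schwartz_family (tf_shift \<psi>)"
  using tf_families_schwartz_family[OF tf_families.base] by (simp add: tf_shift_apply[abs_def] fun_eq_iff)

section \<open>The short-time Fourier transform of Schwartz functions\<close>

definition l2sq :: "('a::euclidean_space \<Rightarrow> complex) \<Rightarrow> real" where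
  "l2sq f = (\<integral>x. (norm (f x))\<^sup>2 \<partial>lborel)"

lemma l2sq_nonneg: "0 \<le> l2sq f"
  by (simp add: l2sq_def)

lemma integrable_norm_square:
  assumes "f \<in> schwartz_space"
  shows "integrable lborel (\<lambda>x. (norm (f x))\<^sup>2)"
  using integrable_norm[OF schwartz_integrable[OF schwartz_mult[OF assms assms]]]
  by (simp add: norm_mult power2_eq_square)

lemma nn_integral_norm_square:
  assumes "f \<in> schwartz_space"
  shows "(\<integral>\<^sup>+x. (ennreal (norm (f x)))\<^sup>2 \<partial>lborel) = ennreal (l2sq f)"
  unfolding l2sq_def
  by (subst nn_integral_eq_integral[symmetric])
    (auto simp: integrable_norm_square[OF assms] ennreal_power)

text \<open>Continuity makes the set of nonzero values open, and a nonempty open set is not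
  negligible.\<close>

lemma l2sq_pos:
  assumes "f \<in> schwartz_space" "f \<noteq> (\<lambda>_. 0)"
  shows "0 < l2sq f"
proof -
  obtain x0 where x0: "f x0 \<noteq> 0" using assms(2) by auto
  have [measurable]: "f \<in> borel_measurable borel" by (rule schwartz_borel[OF assms(1)])
  have "open {x. f x \<noteq> 0}"
    by (intro open_Collect_neq schwartz_continuous_on assms continuous_on_const)
  then have "\<not> negligible {x. f x \<noteq> 0}" using x0 open_not_negligible by blast
  then have "{x. f x \<noteq> 0} \<notin> null_sets lborel"
    using null_sets_completionI negligible_iff_null_sets by blast
  then have "\<not> (AE x in lborel. f x = 0)"
    using AE_iff_null[of lborel "\<lambda>x. f x = 0"] by simp
  then have "l2sq f \<noteq> 0"
    unfolding l2sq_def using integral_nonneg_eq_0_iff_AE[OF integrable_norm_square[OF assms(1)]] by simp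
  then show ?thesis using l2sq_nonneg[of f] by simp
qed

lemma l2sq_cnj: "l2sq (\<lambda>x. cnj (f x)) = l2sq f"
  by (simp add: l2sq_def)

text \<open>Extended values on the right admit infinite energies; a product that is not integrable
  has Bochner integral 0, which satisfies the bound as well.\<close>

lemma cauchy_schwarz_integral:
  fixes f g :: "'a \<Rightarrow> complex"
  assumes [measurable]: "f \<in> borel_measurable M" "g \<in> borel_measurable M"
  shows "(ennreal (norm (\<integral>x. f x * g x \<partial>M)))\<^sup>2
    \<le> (\<integral>\<^sup>+x. (ennreal (norm (f x)))\<^sup>2 \<partial>M) * (\<integral>\<^sup>+x. (ennreal (norm (g x)))\<^sup>2 \<partial>M)"
proof -
  have "ennreal (norm (\<integral>x. f x * g x \<partial>M)) \<le> (\<integral>\<^sup>+x. ennreal (norm (f x * g x)) \<partial>M)"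
    by (cases "integrable M (\<lambda>x. f x * g x)")
      (auto simp: integral_norm_bound_ennreal not_integrable_integral_eq)
  then have "(ennreal (norm (\<integral>x. f x * g x \<partial>M)))\<^sup>2 \<le> (\<integral>\<^sup>+x. ennreal (norm (f x)) * ennreal (norm (g x)) \<partial>M)\<^sup>2"
    by (intro power_mono) (auto simp: norm_mult ennreal_mult)
  also have "\<dots> \<le> (\<integral>\<^sup>+x. (ennreal (norm (f x)))\<^sup>2 \<partial>M) * (\<integral>\<^sup>+x. (ennreal (norm (g x)))\<^sup>2 \<partial>M)"
    by (rule Cauchy_Schwarz_nn_integral) auto
  finally show ?thesis .
qed

text \<open>The short-time Fourier transform of a function with an unconjugated window, hence
  bilinear; conjugates are supplied where they are needed. Written as a Fourier transform it
  inherits inversion and the rule for derivatives.\<close>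

definition gabor :: "('a::euclidean_space \<Rightarrow> complex) \<Rightarrow> ('a \<Rightarrow> complex) \<Rightarrow> 'a \<times> 'a \<Rightarrow> complex" where
  "gabor f \<psi> w = fourier (\<lambda>t. f t * \<psi> (t - fst w)) (snd w)"

text \<open>The frequency changes sign because the pairing is bilinear and does not conjugate the
  modulation.\<close>

lemma gabor_eq_distribution_of: "gabor f \<psi> w = distribution_of f (tf_shift \<psi> (fst w, - snd w))"
  unfolding gabor_def fourier_def distribution_of_def tf_shift_apply
  by (intro Bochner_Integration.integral_cong refl) (simp add: ac_simps)

lemma stft_eq_tf_shift: "stft \<phi> T x \<xi> = T (tf_shift (\<lambda>t. cnj (\<phi> t)) (x, - \<xi>))"
  by (simp add: stft_def pairing_def modulation_def translation_def tf_shift_apply[abs_def] cis_cnj)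

lemma gabor_cnj: "gabor (\<lambda>x. cnj (f x)) (\<lambda>x. cnj (\<psi> x)) (x, - \<xi>) = cnj (gabor f \<psi> (x, \<xi>))"
  unfolding gabor_def fourier_def
  by (simp add: cis_cnj flip: Bochner_Integration.integral_cnj)

lemma tempered_tf_shift_continuous:
  assumes "T \<in> tempered_distributions" "\<psi> \<in> schwartz_space"
  shows "continuous_on UNIV (\<lambda>w. T (tf_shift \<psi> w))"
  using schwartz_family_tempered_continuous[OF schwartz_family_tf_shift[OF assms(2)] assms(1)] .

lemma tempered_tf_shift_measurable:
  assumes "T \<in> tempered_distributions" "\<psi> \<in> schwartz_space"
  shows "(\<lambda>w. T (tf_shift \<psi> w)) \<in> borel_measurable borel"
  by (rule borel_measurable_continuous_onI[OF tempered_tf_shift_continuous[OF assms]])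

lemma stft_measurable:
  assumes "T \<in> tempered_distributions" "\<phi> \<in> schwartz_space"
  shows "(\<lambda>w. stft \<phi> T (fst w) (snd w)) \<in> borel_measurable borel"
    and "(\<lambda>w. stft \<phi> T (fst w) (- snd w)) \<in> borel_measurable borel"
proof -
  note [measurable] = tempered_tf_shift_measurable[OF assms(1) schwartz_cnj[OF assms(2)]]
  show "(\<lambda>w. stft \<phi> T (fst w) (snd w)) \<in> borel_measurable borel"
    unfolding stft_eq_tf_shift
    by (rule measurable_compose[of "\<lambda>w. (fst w, - snd w)" borel borel])
      (auto intro!: borel_measurable_continuous_onI continuous_intros)
  show "(\<lambda>w. stft \<phi> T (fst w) (- snd w)) \<in> borel_measurable borel"
    unfolding stft_eq_tf_shift by simp
qed

lemma distribution_of_schwartz: "f \<in> schwartz_space \<Longrightarrow> distribution_of f \<in> tempered_distributions"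
proof -
  assume f: "f \<in> schwartz_space"
  obtain C where "\<And>x. \<langle>x\<rangle> ^ 0 * norm (f x) \<le> C" using schwartz_bounded[OF f] by metis
  then show ?thesis using distribution_of_tempered[OF schwartz_borel[OF f], of C] by simp
qed

lemma gabor_continuous:
  assumes "f \<in> schwartz_space" "\<psi> \<in> schwartz_space"
  shows "continuous_on UNIV (gabor f \<psi>)"
proof -
  have "continuous_on UNIV ((\<lambda>w. distribution_of f (tf_shift \<psi> w)) \<circ> (\<lambda>w. (fst w, - snd w)))"
    by (rule continuous_on_compose)
      (auto intro!: continuous_intros continuous_on_subset[OF tempered_tf_shift_continuous] distribution_of_schwartz assms)
  then show ?thesis by (simp add: o_def gabor_eq_distribution_of[abs_def])
qed

lemma gabor_measurable:
  "f \<in> schwartz_space \<Longrightarrow> \<psi> \<in> schwartz_space \<Longrightarrow> gabor f \<psi> \<in> borel_measurable borel"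
  by (rule borel_measurable_continuous_onI[OF gabor_continuous])

lemma fourier_add:
  "integrable lborel f \<Longrightarrow> integrable lborel g \<Longrightarrow> fourier (\<lambda>x. f x + g x) \<xi> = fourier f \<xi> + fourier g \<xi>"
  unfolding fourier_def distrib_left
  by (rule Bochner_Integration.integral_add) (intro integrable_cis_mult; simp)+

text \<open>Trades a factor of frequency for a derivative of the function or of the window.\<close>

lemma gabor_dir_deriv:
  assumes f: "f \<in> schwartz_space" and \<psi>: "\<psi> \<in> schwartz_space" and b: "b \<in> Basis"
  shows "2 * pi * \<i> * (snd w \<bullet> b) * gabor f \<psi> w = gabor (dir_deriv b f) \<psi> w + gabor f (dir_deriv b \<psi>) w"
proof -
  let ?s = "\<lambda>t. \<psi> (t - fst w)"
  have s: "?s \<in> schwartz_space" by (rule schwartz_translation[OF \<psi>])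
  have sd: "(?s has_derivative (\<lambda>h. frechet_derivative \<psi> (at (t - fst w)) h)) (at t)" for t
  proof -
    have "((\<lambda>x. x - fst w) has_derivative (\<lambda>h. h)) (at t)"
      by (auto intro!: derivative_eq_intros)
    from has_derivative_compose[OF this has_derivative_frechet[OF schwartz_differentiable[OF \<psi>]]]
    show ?thesis .
  qed
  have d: "((\<lambda>t. f t * ?s t) has_derivative
    (\<lambda>h. f t * frechet_derivative \<psi> (at (t - fst w)) h + frechet_derivative f (at t) h * ?s t)) (at t)" for t
    by (intro has_derivative_mult sd has_derivative_frechet schwartz_differentiable f)
  have "2 * pi * \<i> * (snd w \<bullet> b) * gabor f \<psi> w = fourier (dir_deriv b (\<lambda>t. f t * ?s t)) (snd w)"
    unfolding gabor_def by (rule fourier_dir_deriv[OF schwartz_mult[OF f s] b, symmetric])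
  also have "\<dots> = gabor (dir_deriv b f) \<psi> w + gabor f (dir_deriv b \<psi>) w"
    unfolding dir_deriv_eqI[OF d] gabor_def
    by (subst fourier_add)
      (auto intro!: schwartz_integrable schwartz_mult s f schwartz_dir_deriv b schwartz_translation[OF schwartz_dir_deriv[OF \<psi> b]])
  finally show ?thesis .
qed

text \<open>By the Peetre inequality the weight at \<open>fst w\<close> is shared between
  \<open>t\<close> and \<open>t - fst w\<close>, where \<open>f\<close> and the window decay. The
  further \<open>2 * DIM('a)\<close> powers taken from \<open>f\<close> leave an integrable
  majorant.\<close>

lemma gabor_decay_fst:
  assumes f: "f \<in> schwartz_space" and \<psi>: "\<psi> \<in> schwartz_space"
  shows "\<exists>C. \<forall>w. \<langle>fst w\<rangle> ^ M * norm (gabor f \<psi> w) \<le> C"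
proof -
  obtain C where C: "0 < C" "\<And>x. \<langle>x\<rangle> ^ (M + 2 * DIM('a)) * norm (f x) \<le> C" using schwartz_bounded[OF f] by blast
  obtain D where D: "0 < D" "\<And>x. \<langle>x\<rangle> ^ M * norm (\<psi> x) \<le> D" using schwartz_bounded[OF \<psi>] by blast
  have "\<langle>fst w\<rangle> ^ M * norm (gabor f \<psi> w) \<le> 2 ^ M * C * D * (\<integral>x. inverse (\<langle>x::'a\<rangle> ^ (2 * DIM('a))) \<partial>lborel)" for w
  proof -
    have int: "integrable lborel (\<lambda>t. f t * \<psi> (t - fst w))"
      by (intro schwartz_integrable schwartz_mult schwartz_translation f \<psi>)
    have "\<langle>fst w\<rangle> ^ M * norm (gabor f \<psi> w) \<le> \<langle>fst w\<rangle> ^ M * (\<integral>t. norm (f t * \<psi> (t - fst w)) \<partial>lborel)"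
      unfolding gabor_def by (intro mult_left_mono norm_fourier_le) auto
    also have "\<dots> = (\<integral>t. \<langle>fst w\<rangle> ^ M * norm (f t * \<psi> (t - fst w)) \<partial>lborel)" by simp
    also have "\<dots> \<le> (\<integral>t. 2 ^ M * C * D * inverse (\<langle>t::'a\<rangle> ^ (2 * DIM('a))) \<partial>lborel)"
    proof (rule integral_mono)
      show "integrable lborel (\<lambda>t. \<langle>fst w\<rangle> ^ M * norm (f t * \<psi> (t - fst w)))"
        by (intro integrable_mult_right integrable_norm int)
      show "integrable lborel (\<lambda>t::'a. 2 ^ M * C * D * inverse (\<langle>t\<rangle> ^ (2 * DIM('a))))"
        by (intro integrable_mult_right integrable_inverse_bracket_power) simp
      fix t :: 'a
      have "\<langle>fst w\<rangle> ^ M * norm (f t * \<psi> (t - fst w)) \<le> (2 ^ M * \<langle>t\<rangle> ^ M * \<langle>t - fst w\<rangle> ^ M) * norm (f t * \<psi> (t - fst w))"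
        using bracket_shift_power_le[of "fst w" M t] by (intro mult_right_mono) (auto simp: bracket_minus_commute)
      also have "\<dots> = 2 ^ M * (\<langle>t\<rangle> ^ M * norm (f t)) * (\<langle>t - fst w\<rangle> ^ M * norm (\<psi> (t - fst w)))"
        by (simp add: norm_mult)
      also have "\<dots> \<le> 2 ^ M * (C * inverse (\<langle>t\<rangle> ^ (2 * DIM('a)))) * D"
      proof (rule mult_mono[OF mult_left_mono D(2)])
        show "\<langle>t\<rangle> ^ M * norm (f t) \<le> C * inverse (\<langle>t\<rangle> ^ (2 * DIM('a)))"
          using C(2)[of t] by (simp add: field_simps power_add)
      qed (use C(1) in auto)
      finally show "\<langle>fst w\<rangle> ^ M * norm (f t * \<psi> (t - fst w)) \<le> 2 ^ M * C * D * inverse (\<langle>t\<rangle> ^ (2 * DIM('a)))"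
        by (simp add: ac_simps)
    qed
    finally show ?thesis by simp
  qed
  then show ?thesis by blast
qed

text \<open>The induction keeps both functions arbitrary, since every step differentiates one of
  them.\<close>

lemma gabor_decay_directional:
  assumes b: "b \<in> Basis" and "f \<in> schwartz_space" "\<psi> \<in> schwartz_space"
  shows "\<exists>C. \<forall>w. \<bar>snd w \<bullet> b\<bar> ^ N * (\<langle>fst w\<rangle> ^ M * norm (gabor f \<psi> w)) \<le> C"
  using assms(2,3)
proof (induction N arbitrary: f \<psi>)
  case 0
  then show ?case using gabor_decay_fst[of f \<psi> M] by simp
next
  case (Suc N)
  note f = Suc.prems(1) and \<psi> = Suc.prems(2)
  obtain C D where CD: "\<And>w. \<bar>snd w \<bullet> b\<bar> ^ N * (\<langle>fst w\<rangle> ^ M * norm (gabor (dir_deriv b f) \<psi> w)) \<le> C"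
    "\<And>w. \<bar>snd w \<bullet> b\<bar> ^ N * (\<langle>fst w\<rangle> ^ M * norm (gabor f (dir_deriv b \<psi>) w)) \<le> D"
    using Suc.IH[OF schwartz_dir_deriv[OF f b] \<psi>] Suc.IH[OF f schwartz_dir_deriv[OF \<psi> b]] by blast
  have "\<bar>snd w \<bullet> b\<bar> ^ Suc N * (\<langle>fst w\<rangle> ^ M * norm (gabor f \<psi> w)) \<le> C + D" for w
  proof -
    have "\<bar>snd w \<bullet> b\<bar> * norm (gabor f \<psi> w) \<le> 2 * pi * \<bar>snd w \<bullet> b\<bar> * norm (gabor f \<psi> w)"
      using pi_gt3 mult_right_mono[of 1 "2 * pi" "\<bar>snd w \<bullet> b\<bar> * norm (gabor f \<psi> w)"] by simp
    also have "\<dots> = norm (2 * pi * \<i> * (snd w \<bullet> b) * gabor f \<psi> w)"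
      by (simp add: norm_mult)
    also have "\<dots> \<le> norm (gabor (dir_deriv b f) \<psi> w) + norm (gabor f (dir_deriv b \<psi>) w)"
      unfolding gabor_dir_deriv[OF f \<psi> b] by (rule norm_triangle_ineq)
    finally have "(\<bar>snd w \<bullet> b\<bar> ^ N * \<langle>fst w\<rangle> ^ M) * (\<bar>snd w \<bullet> b\<bar> * norm (gabor f \<psi> w))
      \<le> (\<bar>snd w \<bullet> b\<bar> ^ N * \<langle>fst w\<rangle> ^ M) * (norm (gabor (dir_deriv b f) \<psi> w) + norm (gabor f (dir_deriv b \<psi>) w))"
      by (intro mult_left_mono) auto
    also have "\<dots> \<le> C + D" using CD[of w] by (simp add: distrib_left ac_simps)
    finally show ?thesis by (simp add: ac_simps)
  qed
  then show ?case by blast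
qed

lemma gabor_decay:
  fixes f \<psi> :: "'a::euclidean_space \<Rightarrow> complex"
  assumes "f \<in> schwartz_space" "\<psi> \<in> schwartz_space"
  obtains C where "0 < C" "\<And>x z. \<langle>x\<rangle> ^ M * \<langle>z\<rangle> ^ N * norm (gabor f \<psi> (x, z)) \<le> C"
proof -
  have "\<forall>b\<in>Basis. \<exists>C. \<forall>w. \<bar>snd w \<bullet> b\<bar> ^ N * (\<langle>fst w\<rangle> ^ M * norm (gabor f \<psi> w)) \<le> C"
    using gabor_decay_directional[OF _ assms] by blast
  then obtain C where "\<forall>b\<in>Basis. \<forall>w. \<bar>snd w \<bullet> b\<bar> ^ N * (\<langle>fst w\<rangle> ^ M * norm (gabor f \<psi> w)) \<le> C b"
    by (rule bchoice[THEN exE])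
  then have C: "\<And>b w. b \<in> Basis \<Longrightarrow> \<bar>snd w \<bullet> b\<bar> ^ N * (\<langle>fst w\<rangle> ^ M * norm (gabor f \<psi> w)) \<le> C b"
    by blast
  obtain D where D: "\<And>w. \<langle>fst w\<rangle> ^ M * norm (gabor f \<psi> w) \<le> D"
    using gabor_decay_fst[OF assms] by metis
  let ?C = "(1 + DIM('a)) ^ N * (D + (\<Sum>b\<in>Basis. C b))"
  have "\<langle>x\<rangle> ^ M * \<langle>z\<rangle> ^ N * norm (gabor f \<psi> (x, z)) \<le> ?C" for x z
  proof -
    let ?g = "\<langle>x\<rangle> ^ M * norm (gabor f \<psi> (x, z))"
    have "\<langle>z\<rangle> ^ N * ?g \<le> ((1 + DIM('a)) ^ N * (1 + (\<Sum>b\<in>Basis. \<bar>z \<bullet> b\<bar> ^ N))) * ?g"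
      by (intro mult_right_mono bracket_power_le_sum) auto
    also have "\<dots> = (1 + DIM('a)) ^ N * (?g + (\<Sum>b\<in>Basis. \<bar>z \<bullet> b\<bar> ^ N * ?g))"
      by (simp only: distrib_right sum_distrib_right mult.assoc mult_1)
    also have "\<dots> \<le> ?C"
      using D[of "(x, z)"] C[of _ "(x, z)"] by (intro mult_left_mono add_mono sum_mono) auto
    finally show ?thesis by (simp only: ac_simps)
  qed
  then show ?thesis by (intro that[of "max 1 ?C"]) (auto simp: le_max_iff_disj)
qed

lemma gabor_weighted_integrable:
  fixes f \<psi> :: "'a::euclidean_space \<Rightarrow> complex"
  assumes f: "f \<in> schwartz_space" and \<psi>: "\<psi> \<in> schwartz_space"
  shows "integrable lborel (\<lambda>w. norm (gabor f \<psi> w) * \<langle>w\<rangle> ^ k)"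
proof -
  let ?N = "k + 2 * DIM('a \<times> 'a)"
  obtain C where C: "\<And>x z. \<langle>x\<rangle> ^ ?N * \<langle>z\<rangle> ^ ?N * norm (gabor f \<psi> (x, z)) \<le> C"
    using gabor_decay[OF assms] by metis
  have [measurable]: "gabor f \<psi> \<in> borel_measurable borel" by (rule gabor_measurable[OF assms])
  show ?thesis
  proof (rule integrable_bounded_by_bracket[of _ C "2 * DIM('a \<times> 'a)"])
    fix w :: "'a \<times> 'a"
    have "\<langle>w\<rangle> ^ ?N * norm (gabor f \<psi> w) \<le> (\<langle>fst w\<rangle> ^ ?N * \<langle>snd w\<rangle> ^ ?N) * norm (gabor f \<psi> w)"
      using power_mono[OF bracket_Pair[of "fst w" "snd w"], of ?N]
      by (intro mult_right_mono) (auto simp: power_mult_distrib)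
    also have "\<dots> \<le> C" using C[of "fst w" "snd w"] by simp
    finally show "norm (norm (gabor f \<psi> w) * \<langle>w\<rangle> ^ k) \<le> C * inverse (\<langle>w\<rangle> ^ (2 * DIM('a \<times> 'a)))"
      by (simp add: field_simps power_add)
  qed auto
qed

text \<open>For fixed \<open>x\<close> the integral over frequencies is Fourier inversion for
  \<open>f\<close> times the shifted window, evaluated at \<open>y\<close>; the remaining integral
  over \<open>x\<close> is the energy of the window.\<close>

lemma gabor_synthesis:
  fixes f \<phi> :: "'a::euclidean_space \<Rightarrow> complex"
  assumes f: "f \<in> schwartz_space" and \<phi>: "\<phi> \<in> schwartz_space"
  shows "superposition (gabor f \<phi>) (tf_shift (\<lambda>t. cnj (\<phi> t))) = (\<lambda>y. of_real (l2sq \<phi>) * f y)"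
proof
  fix y :: 'a
  let ?k = "\<lambda>w. gabor f \<phi> w * tf_shift (\<lambda>t. cnj (\<phi> t)) w y"
  have [measurable]: "gabor f \<phi> \<in> borel_measurable borel" by (rule gabor_measurable[OF assms])
  note fam = schwartz_family_tf_shift[OF schwartz_cnj[OF \<phi>]]
  have int: "integrable (lborel \<Otimes>\<^sub>M lborel) ?k"
    using superposition_partial_derivs_aux(1)[OF fam _ gabor_weighted_integrable[OF assms], of "[]" y]
    by (simp add: lborel_prod)
  have "superposition (gabor f \<phi>) (tf_shift (\<lambda>t. cnj (\<phi> t))) y = (\<integral>x. (\<integral>z. ?k (x, z) \<partial>lborel) \<partial>lborel)"
    unfolding superposition_def lborel_prod[symmetric]
    by (rule lborel_pair.integral_fst'[OF int, symmetric])
  also have "\<dots> = (\<integral>x. f y * of_real ((norm (\<phi> (y - x)))\<^sup>2) \<partial>lborel)"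
  proof (intro Bochner_Integration.integral_cong refl)
    fix x :: 'a
    have "?k (x, z) = cnj (\<phi> (y - x)) * (cis (2 * pi * (y \<bullet> z)) * fourier (\<lambda>t. f t * \<phi> (t - x)) z)" for z
      by (simp add: gabor_def tf_shift_apply)
    then have "(\<integral>z. ?k (x, z) \<partial>lborel) = cnj (\<phi> (y - x)) * (f y * \<phi> (y - x))"
      by (simp only: integral_mult_right_zero fourier_inversion[OF schwartz_mult[OF f schwartz_translation[OF \<phi>]]])
    then show "(\<integral>z. ?k (x, z) \<partial>lborel) = f y * of_real ((norm (\<phi> (y - x)))\<^sup>2)"
      by (simp only: complex_norm_square ac_simps)
  qed
  also have "\<dots> = f y * of_real (\<integral>x. (norm (\<phi> (y - x)))\<^sup>2 \<partial>lborel)"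
    by (simp only: integral_mult_right_zero integral_complex_of_real)
  also have "(\<integral>x. (norm (\<phi> (y - x)))\<^sup>2 \<partial>lborel) = l2sq \<phi>"
    using integral_affine[of "\<lambda>x. (norm (\<phi> x))\<^sup>2" "-1" y] schwartz_borel[OF \<phi>] by (simp add: l2sq_def)
  finally show "superposition (gabor f \<phi>) (tf_shift (\<lambda>t. cnj (\<phi> t))) y = of_real (l2sq \<phi>) * f y"
    by (simp add: mult.commute)
qed

text \<open>The inversion formula seen through \<open>T\<close>: a tempered distribution is
  determined by its values on the time-frequency shifts of one window. Self-reproduction of the
  short-time Fourier transform and duality estimates both start here.\<close>

lemma tempered_reproducing:
  assumes T: "T \<in> tempered_distributions" and f: "f \<in> schwartz_space" and \<phi>: "\<phi> \<in> schwartz_space"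
  shows "of_real (l2sq \<phi>) * T f = (\<integral>w. gabor f \<phi> w * T (tf_shift (\<lambda>t. cnj (\<phi> t)) w) \<partial>lborel)"
  using tempered_superposition[OF schwartz_family_tf_shift[OF schwartz_cnj[OF \<phi>]]
      gabor_measurable[OF f \<phi>] gabor_weighted_integrable[OF f \<phi>] T]
  by (simp add: gabor_synthesis[OF f \<phi>] temperedD_scale[OF T f])

text \<open>The Moyal identity, read off from the reproducing formula for the distribution with
  density \<open>cnj (f x)\<close>, evaluated at \<open>f\<close> itself.\<close>

lemma nn_integral_gabor:
  assumes f: "f \<in> schwartz_space" and \<phi>: "\<phi> \<in> schwartz_space"
  shows "(\<integral>\<^sup>+w. (ennreal (norm (gabor f \<phi> w)))\<^sup>2 \<partial>lborel) = ennreal (l2sq \<phi> * l2sq f)"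
proof -
  let ?T = "distribution_of (\<lambda>x. cnj (f x))"
  have T: "?T (tf_shift (\<lambda>t. cnj (\<phi> t)) w) = cnj (gabor f \<phi> w)" for w
    using gabor_cnj[of f \<phi> "fst w" "snd w"] gabor_eq_distribution_of[of "\<lambda>x. cnj (f x)" "\<lambda>t. cnj (\<phi> t)" "(fst w, - snd w)"]
    by simp
  have "?T f = of_real (l2sq f)"
    unfolding distribution_of_def l2sq_def
    by (subst integral_complex_of_real[symmetric], intro Bochner_Integration.integral_cong refl)
      (simp only: complex_norm_square mult.commute)
  moreover have "gabor f \<phi> w * ?T (tf_shift (\<lambda>t. cnj (\<phi> t)) w) = of_real ((norm (gabor f \<phi> w))\<^sup>2)" for w
    unfolding T by (simp only: complex_norm_square)
  ultimately have "complex_of_real (l2sq \<phi> * l2sq f) = of_real (\<integral>w. (norm (gabor f \<phi> w))\<^sup>2 \<partial>lborel)"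
    using tempered_reproducing[OF distribution_of_schwartz[OF schwartz_cnj[OF f]] f \<phi>]
    by (simp only: of_real_mult integral_complex_of_real)
  then have "(\<integral>w. (norm (gabor f \<phi> w))\<^sup>2 \<partial>lborel) = l2sq \<phi> * l2sq f"
    using of_real_eq_iff by metis
  moreover have "integrable lborel (\<lambda>w. (norm (gabor f \<phi> w))\<^sup>2)"
  proof -
    obtain C where C: "\<And>x z. \<langle>x\<rangle> ^ 0 * \<langle>z\<rangle> ^ 0 * norm (gabor f \<phi> (x, z)) \<le> C"
      using gabor_decay[OF assms] by metis
    then have C': "norm (gabor f \<phi> w) \<le> C" for w by (cases w) simp
    have [measurable]: "gabor f \<phi> \<in> borel_measurable borel" by (rule gabor_measurable[OF assms])
    have "integrable lborel (\<lambda>w. C * norm (gabor f \<phi> w))"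
      using gabor_weighted_integrable[OF assms, of 0] by simp
    then show ?thesis
      by (rule Bochner_Integration.integrable_bound)
        (auto simp: power2_eq_square abs_mult intro!: mult_right_mono order.trans[OF C'])
  qed
  ultimately show ?thesis
    by (simp add: ennreal_power nn_integral_eq_integral)
qed

text \<open>
  Testing \<open>T\<close> against the superposition with coefficients \<open>cnj F\<close> on a large ball, where \<open>F\<close> is the
  short-time Fourier transform of \<open>T\<close>, turns the bound for \<open>T\<close> into a bound for the \<open>L\<^sup>2\<close> norm of \<open>F\<close>.
\<close>

lemma bessel_tempered:
  fixes \<psi> :: "'a::euclidean_space \<Rightarrow> complex"
  assumes T: "T \<in> tempered_distributions" and \<psi>: "\<psi> \<in> schwartz_space" and K: "0 \<le> K"
    and bound: "\<And>f. f \<in> schwartz_space \<Longrightarrow> (norm (T f))\<^sup>2 \<le> K * l2sq f"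
  shows "(\<integral>\<^sup>+w. (ennreal (norm (T (tf_shift \<psi> w))))\<^sup>2 \<partial>lborel) \<le> ennreal (K * l2sq \<psi>)"
proof -
  define F where "F w = T (tf_shift \<psi> w)" for w
  have Fc: "continuous_on UNIV F" unfolding F_def by (rule tempered_tf_shift_continuous[OF T \<psi>])
  have [measurable]: "F \<in> borel_measurable borel" by (rule borel_measurable_continuous_onI[OF Fc])
  note fam = schwartz_family_tf_shift[OF \<psi>]
  \<comment> \<open>Truncation to a ball makes the coefficients decay whatever the growth of
    \<open>F\<close>, so that the superposition is a Schwartz function.\<close>
  define B where "B n = cball (0::'a \<times> 'a) (real n)" for n
  have [measurable]: "B n \<in> sets borel" for n by (simp add: B_def)
  define A where "A n = (\<integral>w. (norm (F w))\<^sup>2 * indicator (B n) w \<partial>lborel)" for n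
  have int: "integrable lborel (\<lambda>w. g w * indicator (B n) w)" if "continuous_on UNIV g" for g :: "'a \<times> 'a \<Rightarrow> real" and n
    using borel_integrable_compact[of "B n" g] continuous_on_subset[OF that]
    by (simp add: B_def mult.commute indicator_def if_distrib cong: if_cong)
  have AE: "(\<integral>\<^sup>+w. (ennreal (norm (F w)))\<^sup>2 * indicator (B n) w \<partial>lborel) = ennreal (A n)" for n
  proof -
    have "integrable lborel (\<lambda>w. (norm (F w))\<^sup>2 * indicator (B n) w)"
      by (intro int continuous_intros Fc)
    from nn_integral_eq_integral[OF this] show ?thesis
      unfolding A_def by (simp add: ennreal_power ennreal_mult'' ennreal_indicator)
  qed
  have A0: "0 \<le> A n" for n by (simp add: A_def)
  have A: "A n \<le> K * l2sq \<psi>" for n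
  proof -
    define a where "a w = cnj (F w) * indicator (B n) w" for w
    have [measurable]: "a \<in> borel_measurable borel"
      unfolding a_def using borel_measurable_continuous_onI[OF continuous_on_cnj[OF Fc]] by measurable
    have inta: "integrable lborel (\<lambda>w. norm (a w) * \<langle>w\<rangle> ^ k)" for k
    proof -
      have eq: "norm (a w) * \<langle>w\<rangle> ^ k = (norm (F w) * \<langle>w\<rangle> ^ k) * indicator (B n) w" for w
        by (simp add: a_def norm_mult indicator_def)
      show ?thesis unfolding eq by (intro int continuous_intros Fc)
    qed
    have am: "a \<in> borel_measurable borel" by measurable
    define I where "I = superposition a (tf_shift \<psi>)"
    have I: "I \<in> schwartz_space" unfolding I_def by (rule superposition_schwartz[OF fam am inta])
    have a2: "(\<integral>\<^sup>+w. (ennreal (norm (a w)))\<^sup>2 \<partial>lborel) = ennreal (A n)"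
      unfolding AE[symmetric] by (intro nn_integral_cong) (auto simp: a_def norm_mult indicator_def)
    have "T I = (\<integral>w. a w * F w \<partial>lborel)"
      unfolding I_def F_def by (rule tempered_superposition[OF fam am inta T])
    also have "\<dots> = (\<integral>w. complex_of_real ((norm (F w))\<^sup>2 * indicator (B n) w) \<partial>lborel)"
    proof (intro Bochner_Integration.integral_cong refl)
      fix w
      have "cnj (F w) * F w = of_real ((norm (F w))\<^sup>2)"
        by (simp only: complex_norm_square mult.commute)
      then show "a w * F w = complex_of_real ((norm (F w))\<^sup>2 * indicator (B n) w)"
        by (simp add: a_def indicator_def)
    qed
    also have "\<dots> = of_real (A n)" unfolding A_def by (rule integral_complex_of_real)
    finally have TI: "(A n)\<^sup>2 \<le> K * l2sq I" using bound[OF I] A0[of n] by simp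
    \<comment> \<open>Pairing \<open>I\<close> with its own conjugate and using Cauchy-Schwarz with
      the Moyal identity bounds \<open>l2sq I\<close> by \<open>A n * l2sq \<psi>\<close>. Inserted
      into the bound for \<open>(A n)\<^sup>2\<close>, one factor \<open>A n\<close> cancels and the
      estimate is uniform in \<open>n\<close>.\<close>
    let ?S = "distribution_of (\<lambda>x. cnj (I x))"
    have g: "?S (tf_shift \<psi> w) = cnj (gabor I (\<lambda>t. cnj (\<psi> t)) w)" for w
      using gabor_cnj[of I "\<lambda>t. cnj (\<psi> t)" "fst w" "snd w"] gabor_eq_distribution_of[of "\<lambda>x. cnj (I x)" \<psi> "(fst w, - snd w)"]
      by simp
    have gm: "(\<lambda>w. ?S (tf_shift \<psi> w)) \<in> borel_measurable borel"
      by (intro tempered_tf_shift_measurable distribution_of_schwartz schwartz_cnj I \<psi>)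
    have "of_real (l2sq I) = ?S I"
      unfolding distribution_of_def l2sq_def
      by (subst integral_complex_of_real[symmetric], intro Bochner_Integration.integral_cong refl)
        (simp only: complex_norm_square mult.commute)
    also have "\<dots> = (\<integral>w. a w * ?S (tf_shift \<psi> w) \<partial>lborel)"
      by (subst (2) I_def)
        (rule tempered_superposition[OF fam am inta distribution_of_schwartz[OF schwartz_cnj[OF I]]])
    finally have "(ennreal (norm (complex_of_real (l2sq I))))\<^sup>2 \<le> ennreal (A n) * (\<integral>\<^sup>+w. (ennreal (norm (gabor I (\<lambda>t. cnj (\<psi> t)) w)))\<^sup>2 \<partial>lborel)"
      using cauchy_schwarz_integral[of a lborel "\<lambda>w. ?S (tf_shift \<psi> w)"] am gm by (simp add: a2 g)
    also have "\<dots> = ennreal (A n * (l2sq \<psi> * l2sq I))"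
      using A0[of n] l2sq_nonneg[of \<psi>] l2sq_nonneg[of I]
      by (simp add: nn_integral_gabor[OF I schwartz_cnj[OF \<psi>]] l2sq_cnj ennreal_mult)
    finally have "(l2sq I)\<^sup>2 \<le> A n * (l2sq \<psi> * l2sq I)"
      using A0[of n] l2sq_nonneg[of \<psi>] l2sq_nonneg[of I] by (simp add: ennreal_power)
    then have "l2sq I \<le> A n * l2sq \<psi>"
      using A0[of n] l2sq_nonneg[of \<psi>] l2sq_nonneg[of I]
      by (cases "l2sq I = 0") (auto simp: power2_eq_square)
    then have "(A n)\<^sup>2 \<le> K * (A n * l2sq \<psi>)" using TI K by (meson mult_left_mono order_trans)
    then show ?thesis
      using A0[of n] K l2sq_nonneg[of \<psi>] by (cases "A n = 0") (auto simp: power2_eq_square)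
  qed
  have mono: "incseq B" unfolding B_def by (intro monoI subset_cball) simp
  have un: "(\<Union>n. B n) = UNIV"
    unfolding B_def by (auto simp: dist_norm) (metis real_arch_simple)
  have "(\<integral>\<^sup>+w. (ennreal (norm (F w)))\<^sup>2 \<partial>lborel) = (\<integral>\<^sup>+w. (SUP n. (ennreal (norm (F w)))\<^sup>2 * indicator (B n) w) \<partial>lborel)"
  proof (intro nn_integral_cong antisym)
    fix w :: "'a \<times> 'a"
    obtain n where "w \<in> B n" using un by blast
    then have "(ennreal (norm (F w)))\<^sup>2 = (ennreal (norm (F w)))\<^sup>2 * indicator (B n) w" by simp
    also have "\<dots> \<le> (SUP n. (ennreal (norm (F w)))\<^sup>2 * indicator (B n) w)" by (rule SUP_upper) simp
    finally show "(ennreal (norm (F w)))\<^sup>2 \<le> (SUP n. (ennreal (norm (F w)))\<^sup>2 * indicator (B n) w)" .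
  qed (auto intro!: SUP_least simp: indicator_def)
  also have "\<dots> = (SUP n. \<integral>\<^sup>+w. (ennreal (norm (F w)))\<^sup>2 * indicator (B n) w \<partial>lborel)"
    using mono by (intro nn_integral_monotone_convergence_SUP)
      (auto simp: incseq_def le_fun_def indicator_def)
  also have "\<dots> \<le> ennreal (K * l2sq \<psi>)"
    unfolding AE by (intro SUP_least ennreal_leI A)
  finally show ?thesis unfolding F_def .
qed

text \<open>The converse of the Bessel estimate: Cauchy-Schwarz in the reproducing formula, where
  the Moyal identity evaluates the energy of \<open>f\<close>.\<close>

lemma tempered_l2_bound:
  assumes T: "T \<in> tempered_distributions" and \<phi>: "\<phi> \<in> schwartz_space" "0 < l2sq \<phi>"
    and S: "(\<integral>\<^sup>+w. (ennreal (norm (T (tf_shift (\<lambda>t. cnj (\<phi> t)) w))))\<^sup>2 \<partial>lborel) \<le> ennreal S" "0 \<le> S"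
    and f: "f \<in> schwartz_space"
  shows "(norm (T f))\<^sup>2 \<le> S / l2sq \<phi> * l2sq f"
proof -
  have "(ennreal (norm (of_real (l2sq \<phi>) * T f)))\<^sup>2
    \<le> (\<integral>\<^sup>+w. (ennreal (norm (gabor f \<phi> w)))\<^sup>2 \<partial>lborel) * (\<integral>\<^sup>+w. (ennreal (norm (T (tf_shift (\<lambda>t. cnj (\<phi> t)) w))))\<^sup>2 \<partial>lborel)"
    unfolding tempered_reproducing[OF T f \<phi>(1)]
    by (rule cauchy_schwarz_integral)
      (use gabor_measurable[OF f \<phi>(1)] tempered_tf_shift_measurable[OF T schwartz_cnj[OF \<phi>(1)]] in auto)
  also have "\<dots> \<le> ennreal (l2sq \<phi> * l2sq f) * ennreal S"
    unfolding nn_integral_gabor[OF f \<phi>(1)] by (intro mult_left_mono S) auto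
  also have "\<dots> = ennreal (l2sq \<phi> * l2sq f * S)"
    using S(2) l2sq_nonneg[of f] \<phi>(2) by (simp add: ennreal_mult)
  finally have "(l2sq \<phi> * norm (T f))\<^sup>2 \<le> l2sq \<phi> * l2sq f * S"
    using S(2) l2sq_nonneg[of f] \<phi>(2) by (simp add: ennreal_power norm_mult)
  then show ?thesis
    using \<phi>(2) by (simp add: power2_eq_square field_simps)
qed

section \<open>Lebesgue norms\<close>

lemma ennreal_powr_measurable [measurable]: "(\<lambda>x. ennreal_powr x r) \<in> borel_measurable borel"
  unfolding ennreal_powr_def by measurable

lemma ennreal_powr_mono: "x \<le> y \<Longrightarrow> 0 \<le> r \<Longrightarrow> ennreal_powr x r \<le> ennreal_powr y r"
  by (auto simp: ennreal_powr_def top.extremum_uniqueI less_top intro!: ennreal_leI powr_mono2 enn2real_mono)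

lemma ennreal_powr_ennreal: "0 \<le> x \<Longrightarrow> ennreal_powr (ennreal x) r = ennreal (x powr r)"
  by (simp add: ennreal_powr_def)

lemma ennreal_top_power2: "(top::ennreal)\<^sup>2 = top"
  by (simp add: power2_eq_square ennreal_top_mult)

lemma ennreal_powr_two: "ennreal_powr x 2 = x\<^sup>2"
  by (cases x) (auto simp: ennreal_powr_def ennreal_power ennreal_top_power2)

lemma ennreal_powr_half_power2: "(ennreal_powr x (1 / 2))\<^sup>2 = x"
  by (cases x) (auto simp: ennreal_powr_def ennreal_power ennreal_top_power2 powr_half_sqrt)

lemma ennreal_power2_le_iff: "(x::ennreal)\<^sup>2 \<le> y\<^sup>2 \<longleftrightarrow> x \<le> y"
  by (cases x; cases y)
    (auto simp: ennreal_power ennreal_top_power2 top_unique power2_le_iff_abs_le abs_le_square_iff)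

text \<open>For the infinite exponent, an essential supremum is at most \<open>c\<close> exactly
  when the section where \<open>h\<close> exceeds \<open>c\<close> is null, and measures of sections
  depend measurably on the parameter.\<close>

lemma Lp_enorm_measurable:
  assumes [measurable]: "(\<lambda>(x, y). h x y) \<in> borel_measurable (borel \<Otimes>\<^sub>M borel)"
  shows "(\<lambda>x::'a::euclidean_space. Lp_enorm p (\<lambda>y::'b::euclidean_space. h x y)) \<in> borel_measurable borel"
proof (cases "p = \<infinity>")
  case True
  have "{x. esssup lborel (h x) \<le> c} \<in> sets borel" for c
  proof -
    have hx: "h x \<in> borel_measurable lborel" for x by measurable
    have "esssup lborel (h x) \<le> c \<longleftrightarrow> emeasure lborel {y. c < h x y} = 0" for x
    proof
      assume le: "esssup lborel (h x) \<le> c"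
      have "{y. c < h x y} \<subseteq> {y. esssup lborel (h x) < h x y}" using le by auto
      moreover have "{y. esssup lborel (h x) < h x y} \<in> null_sets lborel"
        using esssup_zero_measure[of lborel "h x"] hx by (auto simp: null_sets_def)
      ultimately have "{y. c < h x y} \<in> null_sets lborel"
        by (rule null_sets_subset[rotated 2]) (use hx in measurable)
      then show "emeasure lborel {y. c < h x y} = 0" by auto
    next
      assume "emeasure lborel {y. c < h x y} = 0"
      then have "AE y in lborel. h x y \<le> c"
        by (intro AE_I[of _ _ "{y. c < h x y}"]) (use hx in \<open>auto simp: not_le\<close>)
      then show "esssup lborel (h x) \<le> c" by (intro esssup_I hx)
    qed
    moreover have "(\<lambda>x. emeasure lborel {y. c < h x y}) \<in> borel_measurable borel"
    proof -
      have "{w \<in> space (borel \<Otimes>\<^sub>M lborel). c < h (fst w) (snd w)} \<in> sets (borel \<Otimes>\<^sub>M (lborel :: 'b measure))"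
        by measurable
      from lborel.measurable_emeasure_Pair[OF this] show ?thesis
        by (simp add: vimage_def space_pair_measure)
    qed
    ultimately show ?thesis by simp
  qed
  then show ?thesis
    using True by (auto simp: Lp_enorm_def intro!: borel_measurableI_le)
next
  case False
  then show ?thesis unfolding Lp_enorm_def by simp
qed

text \<open>A substitute for Young's inequality that splits \<open>F\<close> at height
  \<open>B\<close>. Below it F^2 \<le> B^(2 - r) F^r, to be combined with Cauchy-Schwarz in the
  kernel; above it F \<le> B^(1 - r) F^r, to be combined with the uniform bound for
  \<open>u\<close>, the convolution of F^r with \<open>k\<close>. Both parts contribute c B^(2 - r)
  u, and the integral of \<open>u\<close> is at most c B^r. The two inequalities are where the range
  of \<open>r\<close> between 1 and 2 enters.\<close>

lemma convolution_square_integral: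
  fixes F k :: "'a::euclidean_space \<Rightarrow> ennreal"
  assumes [measurable]: "F \<in> borel_measurable borel" "k \<in> borel_measurable borel"
    and r: "1 \<le> r" "r \<le> 2" and B: "0 \<le> B"
    and F: "(\<integral>\<^sup>+x. ennreal_powr (F x) r \<partial>lborel) \<le> ennreal (B powr r)"
    and k: "\<And>x. k x \<le> c" "(\<integral>\<^sup>+x. k x \<partial>lborel) \<le> c"
  shows "(\<integral>\<^sup>+x. (\<integral>\<^sup>+y. F y * k (x - y) \<partial>lborel)\<^sup>2 \<partial>lborel) \<le> 4 * c\<^sup>2 * ennreal (B\<^sup>2)"
proof (cases "B = 0")
  case True
  then have "(\<integral>\<^sup>+x. ennreal_powr (F x) r \<partial>lborel) = 0" using F by simp
  then have "AE x in lborel. ennreal_powr (F x) r = 0"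
    by (subst (asm) nn_integral_0_iff_AE) auto
  then have "AE x in lborel. F x = 0"
    by (rule AE_mp) (auto simp: ennreal_powr_def enn2real_eq_0_iff split: if_splits)
  then have "(\<integral>\<^sup>+y. F y * k (x - y) \<partial>lborel) = 0" for x
    by (subst nn_integral_0_iff_AE) (auto elim: AE_mp)
  then show ?thesis by simp
next
  case False
  then have B: "0 < B" using B by simp
  define u where "u x = (\<integral>\<^sup>+y. ennreal_powr (F y) r * k (x - y) \<partial>lborel)" for x
  have [measurable]: "u \<in> borel_measurable borel" unfolding u_def by measurable
  have kx: "(\<integral>\<^sup>+y. k (x - y) \<partial>lborel) \<le> c" for x
    using k(2) nn_integral_reflect_translate[of k x] by simp
  have u_le: "u x \<le> ennreal (B powr r) * c" for x
  proof -
    have "u x \<le> (\<integral>\<^sup>+y. ennreal_powr (F y) r * c \<partial>lborel)"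
      unfolding u_def by (intro nn_integral_mono mult_left_mono k) auto
    also have "\<dots> \<le> ennreal (B powr r) * c"
      by (subst nn_integral_multc) (auto intro: mult_right_mono F)
    finally show ?thesis .
  qed
  have int_u: "(\<integral>\<^sup>+x. u x \<partial>lborel) \<le> ennreal (B powr r) * c"
  proof -
    have "(\<integral>\<^sup>+x. u x \<partial>lborel) = (\<integral>\<^sup>+y. (\<integral>\<^sup>+x. ennreal_powr (F y) r * k (x - y) \<partial>lborel) \<partial>lborel)"
      unfolding u_def by (rule lborel_pair.Fubini') measurable
    also have "\<dots> = (\<integral>\<^sup>+y. ennreal_powr (F y) r * (\<integral>\<^sup>+x. k x \<partial>lborel) \<partial>lborel)"
      by (intro nn_integral_cong) (simp add: nn_integral_cmult nn_integral_translate)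
    also have "\<dots> \<le> (\<integral>\<^sup>+y. ennreal_powr (F y) r * c \<partial>lborel)"
      by (intro nn_integral_mono mult_left_mono k) auto
    also have "\<dots> \<le> ennreal (B powr r) * c"
      by (subst nn_integral_multc) (auto intro: mult_right_mono F)
    finally show ?thesis .
  qed
  have small: "(F y)\<^sup>2 \<le> ennreal (B powr (2 - r)) * ennreal_powr (F y) r" if le: "F y \<le> ennreal B" for y
  proof -
    obtain t where t: "F y = ennreal t" "0 \<le> t" "t \<le> B"
      using le B by (cases "F y") (auto simp: top_unique)
    have "t\<^sup>2 \<le> B powr (2 - r) * t powr r"
    proof (cases "t = 0")
      case False
      then have "t\<^sup>2 = t powr (2 - r) * t powr r"
        using t by (simp flip: powr_add)
      also have "\<dots> \<le> B powr (2 - r) * t powr r"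
        using t r by (intro mult_right_mono powr_mono2) auto
      finally show ?thesis .
    qed (use r in simp)
    then show ?thesis
      using t by (simp add: ennreal_powr_ennreal ennreal_power ennreal_leI flip: ennreal_mult)
  qed
  have large: "F y \<le> ennreal (B powr (1 - r)) * ennreal_powr (F y) r" if less: "ennreal B < F y" for y
  proof (cases "F y")
    case top
    then show ?thesis using B by (simp add: ennreal_powr_def ennreal_mult_top)
  next
    case (real t)
    then have "B < t" using less B by (simp add: ennreal_less_iff)
    have "t = t powr (1 - r) * t powr r"
      using \<open>B < t\<close> B by (simp flip: powr_add)
    also have "\<dots> \<le> B powr (1 - r) * t powr r"
      using \<open>B < t\<close> B r by (intro mult_right_mono powr_mono2') auto
    finally show ?thesis
      using real by (simp add: ennreal_powr_ennreal ennreal_leI flip: ennreal_mult)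
  qed
  have v: "(\<integral>\<^sup>+y. F y * k (x - y) \<partial>lborel)\<^sup>2 \<le> 4 * c * ennreal (B powr (2 - r)) * u x" for x
  proof -
    let ?S = "\<lambda>y. if F y \<le> ennreal B then F y else 0"
    let ?L = "\<lambda>y. if F y \<le> ennreal B then 0 else F y"
    let ?a = "\<integral>\<^sup>+y. ?S y * k (x - y) \<partial>lborel"
    let ?b = "\<integral>\<^sup>+y. ?L y * k (x - y) \<partial>lborel"
    have e1: "(\<integral>\<^sup>+y. F y * k (x - y) \<partial>lborel) = ?a + ?b"
      by (subst nn_integral_add[symmetric]) (auto intro!: nn_integral_cong)
    have e2: "(?a + ?b)\<^sup>2 \<le> 2 * ?a\<^sup>2 + 2 * ?b\<^sup>2"
    proof (cases ?a; cases ?b)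
      fix a b assume ab: "?a = ennreal a" "0 \<le> a" "?b = ennreal b" "0 \<le> b"
      have "(a + b)\<^sup>2 \<le> 2 * a\<^sup>2 + 2 * b\<^sup>2" using sum_squares_bound[of a b] by (simp add: power2_sum)
      then have "ennreal ((a + b)\<^sup>2) \<le> ennreal (2 * a\<^sup>2 + 2 * b\<^sup>2)" by (rule ennreal_leI)
      moreover have "ennreal (2 * a\<^sup>2 + 2 * b\<^sup>2) = 2 * ennreal (a\<^sup>2) + 2 * ennreal (b\<^sup>2)"
        by (simp add: ennreal_plus ennreal_mult)
      moreover have "(ennreal a + ennreal b)\<^sup>2 = ennreal ((a + b)\<^sup>2)"
        using ab(2,4) by (simp add: ennreal_power flip: ennreal_plus)
      ultimately show ?thesis
        unfolding ab using ab(2,4) by (simp add: ennreal_power)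
    qed (auto simp: power2_eq_square ennreal_mult_top ennreal_top_mult)
    have e3: "?a\<^sup>2 \<le> c * ennreal (B powr (2 - r)) * u x"
    proof -
      \<comment> \<open>The square root of the kernel goes to both factors of Cauchy-Schwarz, so
        that one of them is just the mass of the kernel.\<close>
      define K where "K y = ennreal_powr (k (x - y)) (1 / 2)" for y
      have K: "K y * K y = k (x - y)" for y
        unfolding K_def using ennreal_powr_half_power2 by (simp add: power2_eq_square)
      have [measurable]: "K \<in> borel_measurable borel" unfolding K_def by measurable
      have "?a\<^sup>2 = (\<integral>\<^sup>+y. (?S y * K y) * K y \<partial>lborel)\<^sup>2"
        by (simp add: mult.assoc K)
      also have "\<dots> \<le> (\<integral>\<^sup>+y. (?S y * K y)\<^sup>2 \<partial>lborel) * (\<integral>\<^sup>+y. (K y)\<^sup>2 \<partial>lborel)"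
        by (rule Cauchy_Schwarz_nn_integral) measurable
      also have "\<dots> \<le> (ennreal (B powr (2 - r)) * u x) * c"
      proof (rule mult_mono)
        have "(\<integral>\<^sup>+y. (?S y * K y)\<^sup>2 \<partial>lborel) \<le> (\<integral>\<^sup>+y. ennreal (B powr (2 - r)) * (ennreal_powr (F y) r * k (x - y)) \<partial>lborel)"
        proof (rule nn_integral_mono)
          fix y
          have "(?S y * K y)\<^sup>2 = (?S y)\<^sup>2 * k (x - y)" by (simp add: power2_eq_square flip: K) (simp add: ac_simps)
          also have "\<dots> \<le> (ennreal (B powr (2 - r)) * ennreal_powr (F y) r) * k (x - y)"
            using small[of y] by (intro mult_right_mono) auto
          finally show "(?S y * K y)\<^sup>2 \<le> ennreal (B powr (2 - r)) * (ennreal_powr (F y) r * k (x - y))"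
            by (simp add: mult.assoc)
        qed
        then show "(\<integral>\<^sup>+y. (?S y * K y)\<^sup>2 \<partial>lborel) \<le> ennreal (B powr (2 - r)) * u x"
          by (simp add: nn_integral_cmult u_def)
        show "(\<integral>\<^sup>+y. (K y)\<^sup>2 \<partial>lborel) \<le> c" using kx by (simp add: power2_eq_square K)
      qed auto
      finally show ?thesis by (simp add: ac_simps)
    qed
    have e4: "?b\<^sup>2 \<le> c * ennreal (B powr (2 - r)) * u x"
    proof -
      have "?b \<le> (\<integral>\<^sup>+y. ennreal (B powr (1 - r)) * (ennreal_powr (F y) r * k (x - y)) \<partial>lborel)"
      proof (rule nn_integral_mono)
        fix y
        have "?L y * k (x - y) \<le> (ennreal (B powr (1 - r)) * ennreal_powr (F y) r) * k (x - y)"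
          using large[of y] by (intro mult_right_mono) (auto simp: not_le)
        then show "?L y * k (x - y) \<le> ennreal (B powr (1 - r)) * (ennreal_powr (F y) r * k (x - y))"
          by (simp add: mult.assoc)
      qed
      then have "?b \<le> ennreal (B powr (1 - r)) * u x" by (simp add: nn_integral_cmult u_def)
      then have "?b\<^sup>2 \<le> (ennreal (B powr (1 - r)) * u x) * (ennreal (B powr (1 - r)) * u x)"
        unfolding power2_eq_square by (intro mult_mono) auto
      also have "\<dots> \<le> (ennreal (B powr (1 - r)) * u x) * (ennreal (B powr (1 - r)) * (ennreal (B powr r) * c))"
        by (intro mult_left_mono u_le) auto
      also have "\<dots> = c * (ennreal (B powr (1 - r)) * ennreal (B powr (1 - r)) * ennreal (B powr r)) * u x"
        by (simp add: ac_simps)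
      also have "ennreal (B powr (1 - r)) * ennreal (B powr (1 - r)) * ennreal (B powr r) = ennreal (B powr (2 - r))"
        using B by (simp flip: ennreal_mult powr_add)
      finally show ?thesis .
    qed
    have "(\<integral>\<^sup>+y. F y * k (x - y) \<partial>lborel)\<^sup>2 \<le> 2 * (c * ennreal (B powr (2 - r)) * u x) + 2 * (c * ennreal (B powr (2 - r)) * u x)"
      unfolding e1 by (intro order.trans[OF e2] add_mono mult_left_mono e3 e4) auto
    also have "\<dots> = 4 * c * ennreal (B powr (2 - r)) * u x"
      by (simp add: mult.assoc flip: distrib_right)
    finally show ?thesis .
  qed
  have "(\<integral>\<^sup>+x. (\<integral>\<^sup>+y. F y * k (x - y) \<partial>lborel)\<^sup>2 \<partial>lborel) \<le> (\<integral>\<^sup>+x. 4 * c * ennreal (B powr (2 - r)) * u x \<partial>lborel)"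
    by (intro nn_integral_mono v)
  also have "\<dots> = 4 * c * ennreal (B powr (2 - r)) * (\<integral>\<^sup>+x. u x \<partial>lborel)"
    by (rule nn_integral_cmult) simp
  also have "\<dots> \<le> 4 * c * ennreal (B powr (2 - r)) * (ennreal (B powr r) * c)"
    by (intro mult_left_mono int_u) auto
  also have "\<dots> = 4 * c\<^sup>2 * (ennreal (B powr (2 - r)) * ennreal (B powr r))"
    by (simp add: power2_eq_square ac_simps)
  also have "ennreal (B powr (2 - r)) * ennreal (B powr r) = ennreal (B\<^sup>2)"
    using B by (simp flip: ennreal_mult powr_add)
  finally show ?thesis .
qed

lemma Lp_enorm_finite_exponent:
  assumes "p \<noteq> \<infinity>" "1 \<le> p" "Lp_enorm p h = ennreal B" "0 \<le> B"
  shows "(\<integral>\<^sup>+x. ennreal_powr (h x) (enn2real p) \<partial>lborel) = ennreal (B powr enn2real p)"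
proof -
  have p: "1 \<le> enn2real p" using assms(1,2) by (cases p) auto
  let ?I = "\<integral>\<^sup>+x. ennreal_powr (h x) (enn2real p) \<partial>lborel"
  have eq: "ennreal_powr ?I (1 / enn2real p) = ennreal B" using assms by (simp add: Lp_enorm_def)
  show ?thesis
  proof (cases ?I)
    case (real t)
    then have "t powr (1 / enn2real p) = B" using eq assms(4) by (simp add: ennreal_powr_ennreal)
    then have "B powr enn2real p = t" using real p by (auto simp: powr_powr)
    then show ?thesis using real by simp
  qed (use eq in \<open>simp add: ennreal_powr_def\<close>)
qed

text \<open>The inner convolution is the scalar estimate for each \<open>x\<close>. For the outer
  one, expanding the square into a double integral and applying Cauchy-Schwarz in \<open>y\<close>
  takes the place of Minkowski's integral inequality; what remains is a scalar convolution of the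
  inner norms \<open>f\<close>.\<close>

lemma mixed_norm_self_convolution:
  fixes F :: "'a::euclidean_space \<Rightarrow> 'a \<Rightarrow> ennreal" and k :: "'a \<Rightarrow> ennreal"
  assumes [measurable]: "(\<lambda>(x, y). F x y) \<in> borel_measurable (borel \<Otimes>\<^sub>M borel)" "k \<in> borel_measurable borel"
    and pq: "1 \<le> p" "p \<le> 2" "1 \<le> q" "q \<le> 2"
    and fin: "Lp_enorm q (\<lambda>x. Lp_enorm p (F x)) < \<infinity>"
    and k: "\<And>x. k x \<le> c" "(\<integral>\<^sup>+x. k x \<partial>lborel) \<le> c" and c: "c < \<infinity>" "c \<noteq> 0"
  shows "(\<integral>\<^sup>+x. (\<integral>\<^sup>+y. (\<integral>\<^sup>+x'. (\<integral>\<^sup>+y'. F x' y' * k (y - y') \<partial>lborel) * k (x - x') \<partial>lborel)\<^sup>2 \<partial>lborel) \<partial>lborel) < \<infinity>"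
proof -
  have fin2: "p < top" "q < top"
    using pq(2,4) by (auto intro: le_less_trans simp: less_top)
  then have top: "p \<noteq> \<infinity>" "q \<noteq> \<infinity>" by auto
  have pq': "1 \<le> enn2real p" "enn2real p \<le> 2" "1 \<le> enn2real q" "enn2real q \<le> 2"
    using enn2real_mono[of 1 p] enn2real_mono[of p 2] enn2real_mono[of 1 q] enn2real_mono[of q 2] pq fin2
    by simp_all
  define f where "f x = Lp_enorm p (F x)" for x
  have [measurable]: "f \<in> borel_measurable borel" unfolding f_def by (rule Lp_enorm_measurable) measurable
  define v where "v x y = (\<integral>\<^sup>+y'. F x y' * k (y - y') \<partial>lborel)" for x y
  have [measurable]: "(\<lambda>(x, y). v x y) \<in> borel_measurable (borel \<Otimes>\<^sub>M borel)" unfolding v_def by measurable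
  have v2: "(\<integral>\<^sup>+y. (v x y)\<^sup>2 \<partial>lborel) \<le> (2 * c * f x)\<^sup>2" for x
  proof (cases "f x")
    case (real B)
    have "(\<integral>\<^sup>+y. ennreal_powr (F x y) (enn2real p) \<partial>lborel) = ennreal (B powr enn2real p)"
      by (rule Lp_enorm_finite_exponent) (use real top pq in \<open>auto simp: f_def\<close>)
    then have "(\<integral>\<^sup>+y. (v x y)\<^sup>2 \<partial>lborel) \<le> 4 * c\<^sup>2 * ennreal (B\<^sup>2)"
      unfolding v_def by (intro convolution_square_integral[of "F x" k "enn2real p" B c])
        (use real pq' k in auto)
    then show ?thesis using real by (simp add: power_mult_distrib ennreal_power)
  next
    case top
    then show ?thesis using c by (simp add: power2_eq_square ennreal_mult_top)
  qed
  have vv: "(\<integral>\<^sup>+y. v x y * v x' y \<partial>lborel) \<le> (2 * c * f x) * (2 * c * f x')" for x x'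
  proof -
    have "(\<integral>\<^sup>+y. v x y * v x' y \<partial>lborel)\<^sup>2 \<le> (\<integral>\<^sup>+y. (v x y)\<^sup>2 \<partial>lborel) * (\<integral>\<^sup>+y. (v x' y)\<^sup>2 \<partial>lborel)"
      by (rule Cauchy_Schwarz_nn_integral) measurable
    also have "\<dots> \<le> (2 * c * f x)\<^sup>2 * (2 * c * f x')\<^sup>2"
      by (intro mult_mono v2) auto
    finally show ?thesis
      unfolding power_mult_distrib[symmetric] ennreal_power2_le_iff by (simp add: power_mult_distrib ac_simps)
  qed
  have "(\<integral>\<^sup>+y. (\<integral>\<^sup>+x'. v x' y * k (x - x') \<partial>lborel)\<^sup>2 \<partial>lborel) \<le> (4 * c\<^sup>2) * (\<integral>\<^sup>+x'. f x' * k (x - x') \<partial>lborel)\<^sup>2" for x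
  proof -
    define J where "J = (\<integral>\<^sup>+x'. f x' * k (x - x') \<partial>lborel)"
    have "(\<integral>\<^sup>+y. (\<integral>\<^sup>+x'. v x' y * k (x - x') \<partial>lborel)\<^sup>2 \<partial>lborel)
      = (\<integral>\<^sup>+y. (\<integral>\<^sup>+x'. (\<integral>\<^sup>+x''. (v x' y * v x'' y) * (k (x - x') * k (x - x'')) \<partial>lborel) \<partial>lborel) \<partial>lborel)"
      by (intro nn_integral_cong)
        (simp add: power2_eq_square nn_integral_cmult[symmetric] nn_integral_multc[symmetric] ac_simps)
    also have "\<dots> = (\<integral>\<^sup>+x'. (\<integral>\<^sup>+y. (\<integral>\<^sup>+x''. (v x' y * v x'' y) * (k (x - x') * k (x - x'')) \<partial>lborel) \<partial>lborel) \<partial>lborel)"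
      by (rule lborel_pair.Fubini') measurable
    also have "\<dots> = (\<integral>\<^sup>+x'. (\<integral>\<^sup>+x''. (\<integral>\<^sup>+y. (v x' y * v x'' y) * (k (x - x') * k (x - x'')) \<partial>lborel) \<partial>lborel) \<partial>lborel)"
      by (intro nn_integral_cong lborel_pair.Fubini') measurable
    also have "\<dots> \<le> (\<integral>\<^sup>+x'. (\<integral>\<^sup>+x''. ((2 * c * f x') * (2 * c * f x'')) * (k (x - x') * k (x - x'')) \<partial>lborel) \<partial>lborel)"
      by (intro nn_integral_mono) (simp add: nn_integral_multc vv mult_right_mono)
    also have "\<dots> = (\<integral>\<^sup>+x'. (\<integral>\<^sup>+x''. (4 * c\<^sup>2 * (f x' * k (x - x'))) * (f x'' * k (x - x'')) \<partial>lborel) \<partial>lborel)"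
      by (intro nn_integral_cong) (simp add: power2_eq_square ac_simps)
    also have "\<dots> = (\<integral>\<^sup>+x'. (4 * c\<^sup>2 * (f x' * k (x - x'))) * J \<partial>lborel)"
      unfolding J_def by (intro nn_integral_cong nn_integral_cmult) measurable
    also have "\<dots> = (\<integral>\<^sup>+x'. 4 * c\<^sup>2 * (f x' * k (x - x')) \<partial>lborel) * J"
      by (rule nn_integral_multc) measurable
    also have "(\<integral>\<^sup>+x'. 4 * c\<^sup>2 * (f x' * k (x - x')) \<partial>lborel) = 4 * c\<^sup>2 * J"
      unfolding J_def by (rule nn_integral_cmult) measurable
    also have "4 * c\<^sup>2 * J * J = (4 * c\<^sup>2) * (\<integral>\<^sup>+x'. f x' * k (x - x') \<partial>lborel)\<^sup>2"
      by (simp add: J_def power2_eq_square mult.assoc)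
    finally show ?thesis .
  qed
  then have "(\<integral>\<^sup>+x. (\<integral>\<^sup>+y. (\<integral>\<^sup>+x'. v x' y * k (x - x') \<partial>lborel)\<^sup>2 \<partial>lborel) \<partial>lborel)
    \<le> (\<integral>\<^sup>+x. (4 * c\<^sup>2) * (\<integral>\<^sup>+x'. f x' * k (x - x') \<partial>lborel)\<^sup>2 \<partial>lborel)"
    by (intro nn_integral_mono)
  also have "\<dots> = (4 * c\<^sup>2) * (\<integral>\<^sup>+x. (\<integral>\<^sup>+x'. f x' * k (x - x') \<partial>lborel)\<^sup>2 \<partial>lborel)"
    by (rule nn_integral_cmult) measurable
  also have "\<dots> < \<infinity>"
  proof -
    obtain B where B: "Lp_enorm q f = ennreal B" "0 \<le> B"
      using fin by (cases "Lp_enorm q f") (auto simp: f_def[abs_def])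
    have "(\<integral>\<^sup>+x. (\<integral>\<^sup>+x'. f x' * k (x - x') \<partial>lborel)\<^sup>2 \<partial>lborel) \<le> 4 * c\<^sup>2 * ennreal (B\<^sup>2)"
      using Lp_enorm_finite_exponent[OF top(2) pq(3) B]
      by (intro convolution_square_integral[of f k "enn2real q" B c]) (use B pq' k in auto)
    also have "\<dots> < \<infinity>" using c by (simp add: ennreal_mult_less_top power2_eq_square)
    finally show ?thesis using c by (simp add: ennreal_mult_less_top power2_eq_square)
  qed
  finally show ?thesis unfolding v_def .
qed

section \<open>Wiener amalgam spaces with exponents at most two\<close>

text \<open>Covariance: a time-frequency shift translates the transform up to a phase that is
  constant in the integration variable.\<close>

lemma norm_gabor_tf_shift:
  assumes "f \<in> schwartz_space" "\<psi> \<in> schwartz_space"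
  shows "norm (gabor (tf_shift f u) \<psi> w) = norm (gabor f \<psi> (w - u))"
proof -
  let ?h = "\<lambda>t. cis (- 2 * pi * (t \<bullet> snd (w - u))) * (f t * \<psi> (t - fst (w - u)))"
  let ?g = "\<lambda>t. cis (- 2 * pi * (t \<bullet> snd w)) * (tf_shift f u t * \<psi> (t - fst w))"
  have "cis (- 2 * pi * (t \<bullet> snd w)) * cis (2 * pi * (t \<bullet> snd u))
      = cis (- 2 * pi * (fst u \<bullet> snd (w - u))) * cis (- 2 * pi * ((t - fst u) \<bullet> snd (w - u)))" for t
    by (simp add: cis_mult inner_diff_left inner_diff_right algebra_simps)
  then have "?g t = cis (- 2 * pi * (fst u \<bullet> snd (w - u))) * ?h (t - fst u)" for t
    by (simp add: tf_shift_apply diff_diff_eq mult.assoc[symmetric] add.commute)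
  then have "gabor (tf_shift f u) \<psi> w = (\<integral>t. cis (- 2 * pi * (fst u \<bullet> snd (w - u))) * ?h (t - fst u) \<partial>lborel)"
    unfolding gabor_def fourier_def by presburger
  also have "\<dots> = cis (- 2 * pi * (fst u \<bullet> snd (w - u))) * (\<integral>t. ?h (t - fst u) \<partial>lborel)"
    by (rule integral_mult_right_zero)
  also have "(\<integral>t. ?h (t - fst u) \<partial>lborel) = (\<integral>t. ?h t \<partial>lborel)"
  proof (rule integral_translate)
    have "(\<lambda>t. f t * \<psi> (t - fst (w - u))) \<in> borel_measurable borel"
      by (intro schwartz_borel schwartz_mult assms schwartz_translation)
    then show "?h \<in> borel_measurable borel" by (simp add: cis_conv_exp)
  qed
  also have "\<dots> = gabor f \<psi> (w - u)" by (simp add: gabor_def fourier_def)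
  finally show ?thesis by (simp add: norm_mult)
qed

lemma tf_shift_schwartz: "f \<in> schwartz_space \<Longrightarrow> tf_shift f u \<in> schwartz_space"
  unfolding tf_shift_def by (intro schwartz_modulation schwartz_translation')

text \<open>A common majorant, up to constants, for the rapidly decaying Gabor transforms, extended
  valued for use in nonnegative integrals and series.\<close>

definition bracket_kernel :: "nat \<Rightarrow> 'a::euclidean_space \<Rightarrow> ennreal" where
  "bracket_kernel N x = ennreal (inverse (\<langle>x\<rangle> ^ N))"

lemma bracket_kernel_measurable [measurable]: "bracket_kernel N \<in> borel_measurable borel"
  unfolding bracket_kernel_def[abs_def] by measurable

lemma bracket_kernel_le_1: "bracket_kernel N x \<le> 1"
  using bracket_power_ge_1[of x N] by (simp add: bracket_kernel_def inverse_le_1_iff)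

lemma bracket_kernel_minus_commute: "bracket_kernel N (x - y) = bracket_kernel N (y - x)"
  by (simp add: bracket_kernel_def bracket_minus_commute)

lemma nn_integral_bracket_kernel:
  assumes "2 * DIM('a::euclidean_space) \<le> N"
  shows "(\<integral>\<^sup>+x. bracket_kernel N (x::'a) \<partial>lborel) < \<infinity>"
  using integrable_inverse_bracket_power[OF assms]
  unfolding bracket_kernel_def integrable_iff_bounded by simp

lemma gabor_le_bracket_kernel:
  assumes "f \<in> schwartz_space" "\<psi> \<in> schwartz_space"
  obtains C where "0 < C"
    "\<And>x z. ennreal (norm (gabor f \<psi> (x, z))) \<le> ennreal C * (bracket_kernel N x * bracket_kernel N z)"
proof -
  obtain C where C: "0 < C" "\<And>x z. \<langle>x\<rangle> ^ N * \<langle>z\<rangle> ^ N * norm (gabor f \<psi> (x, z)) \<le> C"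
    using gabor_decay[OF assms] by blast
  show ?thesis
  proof (rule that[OF C(1)])
    fix x z
    have "norm (gabor f \<psi> (x, z)) \<le> C * (inverse (\<langle>x\<rangle> ^ N) * inverse (\<langle>z\<rangle> ^ N))"
      using C(2)[of x z] by (simp add: field_simps)
    then show "ennreal (norm (gabor f \<psi> (x, z))) \<le> ennreal C * (bracket_kernel N x * bracket_kernel N z)"
      using C(1) by (simp add: bracket_kernel_def ennreal_leI flip: ennreal_mult)
  qed
qed

lemma nn_integral_lborel_Pair:
  fixes f :: "'a::euclidean_space \<times> 'b::euclidean_space \<Rightarrow> ennreal"
  assumes [measurable]: "f \<in> borel_measurable borel"
  shows "(\<integral>\<^sup>+w. f w \<partial>lborel) = (\<integral>\<^sup>+x. (\<integral>\<^sup>+y. f (x, y) \<partial>lborel) \<partial>lborel)"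
proof -
  have "f \<in> borel_measurable (lborel \<Otimes>\<^sub>M lborel)"
    by (simp add: lborel_prod)
  from lborel.nn_integral_fst[OF this] show ?thesis by (simp add: lborel_prod)
qed

lemma wiener_amalgam_square_integrable:
  fixes \<Phi> :: "'a::euclidean_space \<Rightarrow> complex"
  assumes \<sigma>: "\<sigma> \<in> wiener_amalgam \<Phi> p q" and \<Phi>: "\<Phi> \<in> schwartz_space" "\<Phi> \<noteq> (\<lambda>_. 0)"
    and pq: "1 \<le> p" "p \<le> 2" "1 \<le> q" "q \<le> 2"
  shows "(\<integral>\<^sup>+w. (ennreal (norm (\<sigma> (tf_shift (\<lambda>t. cnj (\<Phi> t)) w))))\<^sup>2 \<partial>lborel) < \<infinity>"
proof -
  let ?N = "2 * DIM('a)"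
  let ?k = "bracket_kernel ?N :: 'a \<Rightarrow> ennreal"
  let ?\<psi> = "\<lambda>t. cnj (\<Phi> t)"
  define L where "L = l2sq \<Phi>"
  have T: "\<sigma> \<in> tempered_distributions" using \<sigma> by (simp add: wiener_amalgam_def)
  have \<psi>: "?\<psi> \<in> schwartz_space" by (rule schwartz_cnj[OF \<Phi>(1)])
  have L: "0 < L" unfolding L_def by (rule l2sq_pos[OF \<Phi>])
  define F where "F x z = ennreal (norm (\<sigma> (tf_shift ?\<psi> (x, z))))" for x z
  have Sm [measurable]: "(\<lambda>w. \<sigma> (tf_shift ?\<psi> w)) \<in> borel_measurable borel"
    by (rule tempered_tf_shift_measurable[OF T \<psi>])
  have Fm [measurable]: "(\<lambda>(x, z). F x z) \<in> borel_measurable (borel \<Otimes>\<^sub>M borel)"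
    using Sm unfolding F_def by (simp add: borel_prod case_prod_unfold)
  obtain C where C: "0 < C" "\<And>x z. ennreal (norm (gabor ?\<psi> \<Phi> (x, z))) \<le> ennreal C * (?k x * ?k z)"
    using gabor_le_bracket_kernel[OF \<psi> \<Phi>(1)] by blast
  define G where "G x z = (\<integral>\<^sup>+x'. (\<integral>\<^sup>+z'. F x' z' * ?k (z - z') \<partial>lborel) * ?k (x - x') \<partial>lborel)" for x z
  have Gm [measurable]: "(\<lambda>(x, z). G x z) \<in> borel_measurable (borel \<Otimes>\<^sub>M borel)"
    unfolding G_def by measurable
  \<comment> \<open>The reproducing formula with a shifted window as test function: its coefficients
    are, in modulus, a translate of one rapidly decaying transform, so the right-hand side is a
    convolution.\<close>
  have FG: "F x z \<le> ennreal (C / L) * G x z" for x z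
  proof -
    have gm [measurable]: "gabor (tf_shift ?\<psi> (x, z)) \<Phi> \<in> borel_measurable borel"
      by (rule gabor_measurable[OF tf_shift_schwartz[OF \<psi>] \<Phi>(1)])
    let ?I = "\<lambda>w. gabor (tf_shift ?\<psi> (x, z)) \<Phi> w * \<sigma> (tf_shift ?\<psi> w)"
    have "ennreal (norm (\<integral>w. ?I w \<partial>lborel)) \<le> (\<integral>\<^sup>+w. ennreal (norm (?I w)) \<partial>lborel)"
      by (cases "integrable lborel ?I") (auto simp: integral_norm_bound_ennreal not_integrable_integral_eq)
    then have "ennreal L * F x z \<le> (\<integral>\<^sup>+w. ennreal (norm (?I w)) \<partial>lborel)"
      using tempered_reproducing[OF T tf_shift_schwartz[OF \<psi>] \<Phi>(1), of "(x, z)", symmetric] L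
      by (simp add: F_def L_def norm_mult ennreal_mult)
    also have "\<dots> = (\<integral>\<^sup>+x'. (\<integral>\<^sup>+z'. ennreal (norm (?I (x', z'))) \<partial>lborel) \<partial>lborel)"
      by (rule nn_integral_lborel_Pair) measurable
    also have "\<dots> \<le> (\<integral>\<^sup>+x'. (\<integral>\<^sup>+z'. ennreal C * (F x' z' * ?k (z - z') * ?k (x - x')) \<partial>lborel) \<partial>lborel)"
    proof (intro nn_integral_mono)
      fix x' z'
      have "ennreal (norm (?I (x', z'))) = ennreal (norm (gabor ?\<psi> \<Phi> (x' - x, z' - z))) * F x' z'"
        by (simp add: norm_mult norm_gabor_tf_shift[OF \<psi> \<Phi>(1)] ennreal_mult F_def)
      also have "\<dots> \<le> (ennreal C * (?k (x' - x) * ?k (z' - z))) * F x' z'"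
        by (intro mult_right_mono C) auto
      finally show "ennreal (norm (?I (x', z'))) \<le> ennreal C * (F x' z' * ?k (z - z') * ?k (x - x'))"
        by (simp add: bracket_kernel_minus_commute[of _ x'] bracket_kernel_minus_commute[of _ z'] ac_simps)
    qed
    also have "\<dots> = ennreal C * G x z"
      unfolding G_def by (simp add: nn_integral_cmult nn_integral_multc)
    finally have "ennreal (1 / L) * (ennreal L * F x z) \<le> ennreal (1 / L) * (ennreal C * G x z)"
      by (intro mult_left_mono) auto
    then show ?thesis
      using L C(1) by (simp add: mult.assoc[symmetric] flip: ennreal_mult)
  qed
  \<comment> \<open>One constant for the supremum and for the mass of the kernel; the 1 covers the
    supremum and keeps \<open>c\<close> nonzero.\<close>
  define c where "c = max 1 (\<integral>\<^sup>+x. ?k x \<partial>lborel)"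
  have "(\<integral>\<^sup>+x. (\<integral>\<^sup>+z. (G x z)\<^sup>2 \<partial>lborel) \<partial>lborel) < \<infinity>"
    unfolding G_def
  proof (rule mixed_norm_self_convolution[where c = c and p = p and q = q])
    have "wiener_norm \<Phi> p q \<sigma> < \<infinity>" using \<sigma> by (simp add: wiener_amalgam_def)
    then show "Lp_enorm q (\<lambda>x. Lp_enorm p (F x)) < \<infinity>"
      by (simp add: wiener_norm_def stft_eq_tf_shift F_def[abs_def])
    show "?k x \<le> c" for x using bracket_kernel_le_1[of ?N x] by (simp add: c_def le_max_iff_disj)
    show "c < \<infinity>" unfolding c_def using nn_integral_bracket_kernel[of ?N, where 'a = 'a] by simp
    have "1 \<le> c" by (simp add: c_def)
    then show "c \<noteq> 0" by auto
  qed (auto simp: c_def pq)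
  then have "ennreal ((C / L)\<^sup>2) * (\<integral>\<^sup>+x. (\<integral>\<^sup>+z. (G x z)\<^sup>2 \<partial>lborel) \<partial>lborel) < \<infinity>"
    by (simp add: ennreal_mult_less_top)
  moreover have "(\<integral>\<^sup>+w. (ennreal (norm (\<sigma> (tf_shift ?\<psi> w))))\<^sup>2 \<partial>lborel)
    \<le> ennreal ((C / L)\<^sup>2) * (\<integral>\<^sup>+x. (\<integral>\<^sup>+z. (G x z)\<^sup>2 \<partial>lborel) \<partial>lborel)"
  proof -
    have "(\<integral>\<^sup>+w. (ennreal (norm (\<sigma> (tf_shift ?\<psi> w))))\<^sup>2 \<partial>lborel) = (\<integral>\<^sup>+x. (\<integral>\<^sup>+z. (F x z)\<^sup>2 \<partial>lborel) \<partial>lborel)"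
      unfolding F_def by (rule nn_integral_lborel_Pair) measurable
    also have "\<dots> \<le> (\<integral>\<^sup>+x. (\<integral>\<^sup>+z. ennreal ((C / L)\<^sup>2) * (G x z)\<^sup>2 \<partial>lborel) \<partial>lborel)"
    proof (intro nn_integral_mono)
      fix x z
      have "(F x z)\<^sup>2 \<le> (ennreal (C / L) * G x z)\<^sup>2" by (intro power_mono FG) auto
      then show "(F x z)\<^sup>2 \<le> ennreal ((C / L)\<^sup>2) * (G x z)\<^sup>2"
        using C(1) L by (simp add: power_mult_distrib ennreal_power)
    qed
    also have "\<dots> = ennreal ((C / L)\<^sup>2) * (\<integral>\<^sup>+x. (\<integral>\<^sup>+z. (G x z)\<^sup>2 \<partial>lborel) \<partial>lborel)"
      by (simp add: nn_integral_cmult)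
    finally show ?thesis .
  qed
  ultimately show ?thesis by (rule le_less_trans[rotated])
qed

section \<open>Modulation norms with exponent two\<close>

lemma bracket_snd_measurable [measurable]:
  "(\<lambda>w::'a::euclidean_space \<times> 'b::euclidean_space. \<langle>snd w\<rangle>) \<in> borel_measurable borel"
  by (intro borel_measurable_continuous_onI continuous_intros)

lemma reflect_snd_measurable:
  "(\<lambda>w::'a::euclidean_space \<times> 'b::euclidean_space. (fst w, - snd w)) \<in> borel_measurable borel"
  by (intro borel_measurable_continuous_onI continuous_intros)

text \<open>The square of the norm with exponents two as a single integral over phase space.
  Compared with \<open>stft\<close> the frequency is reflected, which the even weight does not
  notice.\<close>

definition modulation_energy :: "('a::euclidean_space \<Rightarrow> complex) \<Rightarrow> real \<Rightarrow> (('a \<Rightarrow> complex) \<Rightarrow> complex) \<Rightarrow> ennreal" where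
  "modulation_energy \<phi> s T =
     (\<integral>\<^sup>+w. (ennreal (norm (T (tf_shift (\<lambda>t. cnj (\<phi> t)) w)) * \<langle>snd w\<rangle> powr s))\<^sup>2 \<partial>lborel)"

lemma modulation_norm_square:
  fixes \<phi> :: "'a::euclidean_space \<Rightarrow> complex"
  assumes Sm [measurable]: "(\<lambda>w. T (tf_shift (\<lambda>t. cnj (\<phi> t)) w)) \<in> borel_measurable borel"
  shows "(modulation_norm \<phi> 2 2 (weight_v 0 s) T)\<^sup>2 = modulation_energy \<phi> s T"
proof -
  define h where "h w = (ennreal (norm (T (tf_shift (\<lambda>t. cnj (\<phi> t)) w)) * \<langle>snd w\<rangle> powr s))\<^sup>2" for w
  have hm [measurable]: "h \<in> borel_measurable borel" unfolding h_def by measurable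
  have "(modulation_norm \<phi> 2 2 (weight_v 0 s) T)\<^sup>2 = (\<integral>\<^sup>+\<xi>. (\<integral>\<^sup>+x. h (x, - \<xi>) \<partial>lborel) \<partial>lborel)"
    unfolding modulation_norm_def Lp_enorm_def h_def
    by (simp add: ennreal_powr_two ennreal_powr_half_power2 stft_eq_tf_shift weight_v_def)
  also have "\<dots> = (\<integral>\<^sup>+\<xi>. (\<integral>\<^sup>+x. h (x, \<xi>) \<partial>lborel) \<partial>lborel)"
    by (rule nn_integral_reflect[of "\<lambda>\<xi>. \<integral>\<^sup>+x. h (x, \<xi>) \<partial>lborel"]) measurable
  also have "\<dots> = (\<integral>\<^sup>+x. (\<integral>\<^sup>+\<xi>. h (x, \<xi>) \<partial>lborel) \<partial>lborel)"
    by (rule lborel_pair.Fubini') measurable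
  also have "\<dots> = modulation_energy \<phi> s T"
    unfolding modulation_energy_def h_def[symmetric] by (rule nn_integral_lborel_Pair[symmetric]) measurable
  finally show ?thesis .
qed

lemma modulation_energy_mono:
  assumes "s \<le> t"
  shows "modulation_energy \<phi> s T \<le> modulation_energy \<phi> t T"
  unfolding modulation_energy_def
  by (intro nn_integral_mono power_mono ennreal_leI mult_left_mono powr_mono assms bracket_ge_1) auto

lemma modulation_energy_distribution_of:
  assumes "f \<in> schwartz_space" "\<phi> \<in> schwartz_space"
  shows "modulation_energy \<phi> s (distribution_of f)
    = (\<integral>\<^sup>+w. (ennreal (norm (gabor f (\<lambda>t. cnj (\<phi> t)) w) * \<langle>snd w\<rangle> powr s))\<^sup>2 \<partial>lborel)"
proof -
  have gm [measurable]: "gabor f (\<lambda>t. cnj (\<phi> t)) \<in> borel_measurable borel"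
    by (intro gabor_measurable schwartz_cnj assms)
  let ?h = "\<lambda>w. (ennreal (norm (gabor f (\<lambda>t. cnj (\<phi> t)) w) * \<langle>snd w\<rangle> powr s))\<^sup>2"
  have hm [measurable]: "?h \<in> borel_measurable borel" by measurable
  have "modulation_energy \<phi> s (distribution_of f) = (\<integral>\<^sup>+w. ?h (fst w, - snd w) \<partial>lborel)"
    unfolding modulation_energy_def by (simp add: gabor_eq_distribution_of)
  also have "\<dots> = (\<integral>\<^sup>+x. (\<integral>\<^sup>+\<xi>. ?h (x, - \<xi>) \<partial>lborel) \<partial>lborel)"
    by (subst nn_integral_lborel_Pair) (use measurable_compose[OF reflect_snd_measurable hm] in simp_all)
  also have "\<dots> = (\<integral>\<^sup>+x. (\<integral>\<^sup>+\<xi>. ?h (x, \<xi>) \<partial>lborel) \<partial>lborel)"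
    by (intro nn_integral_cong nn_integral_reflect) measurable
  also have "\<dots> = (\<integral>\<^sup>+w. ?h w \<partial>lborel)"
    by (rule nn_integral_lborel_Pair[symmetric]) measurable
  finally show ?thesis .
qed

lemma modulation_energy_0:
  assumes "f \<in> schwartz_space" "\<phi> \<in> schwartz_space"
  shows "modulation_energy \<phi> 0 (distribution_of f) = ennreal (l2sq \<phi> * l2sq f)"
  unfolding modulation_energy_distribution_of[OF assms]
  using nn_integral_gabor[OF assms(1) schwartz_cnj[OF assms(2)]] by (simp add: l2sq_cnj)

text \<open>The two constants are related by squaring and taking roots. A negative constant is read
  as 0 by \<open>ennreal\<close>, hence the maxima.\<close>

lemma modulation_bounded_iff_energy:
  assumes \<phi>: "\<phi> \<in> schwartz_space"
    and A: "\<And>f. f \<in> schwartz_space \<Longrightarrow> (\<lambda>w. A f (tf_shift (\<lambda>t. cnj (\<phi> t)) w)) \<in> borel_measurable borel"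
  shows "modulation_bounded \<phi> A 2 2 (weight_v 0 s) 2 2 (weight_v 0 t) \<longleftrightarrow>
    (\<exists>C::real. \<forall>f\<in>schwartz_space. modulation_energy \<phi> t (A f) \<le> ennreal C * modulation_energy \<phi> s (distribution_of f))"
proof -
  have sq: "modulation_norm \<phi> 2 2 (weight_v 0 t) (A f) \<le> ennreal C * modulation_norm \<phi> 2 2 (weight_v 0 s) (distribution_of f)
    \<longleftrightarrow> modulation_energy \<phi> t (A f) \<le> (ennreal C)\<^sup>2 * modulation_energy \<phi> s (distribution_of f)"
    if "f \<in> schwartz_space" for f C
    using modulation_norm_square[OF A[OF that], of t]
      modulation_norm_square[OF tempered_tf_shift_measurable[OF distribution_of_schwartz[OF that] schwartz_cnj[OF \<phi>]], of s]
      ennreal_power2_le_iff[of "modulation_norm \<phi> 2 2 (weight_v 0 t) (A f)"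
        "ennreal C * modulation_norm \<phi> 2 2 (weight_v 0 s) (distribution_of f)"]
    by (simp add: power_mult_distrib)
  show ?thesis
  proof
    assume "modulation_bounded \<phi> A 2 2 (weight_v 0 s) 2 2 (weight_v 0 t)"
    then obtain C where "\<forall>f\<in>schwartz_space. modulation_energy \<phi> t (A f) \<le> (ennreal C)\<^sup>2 * modulation_energy \<phi> s (distribution_of f)"
      using sq unfolding modulation_bounded_def by blast
    moreover have "(ennreal C)\<^sup>2 = ennreal ((max C 0)\<^sup>2)"
      by (cases "0 \<le> C") (auto simp: ennreal_power max_def ennreal_neg)
    ultimately show "\<exists>C::real. \<forall>f\<in>schwartz_space. modulation_energy \<phi> t (A f) \<le> ennreal C * modulation_energy \<phi> s (distribution_of f)"
      by metis
  next
    assume "\<exists>C::real. \<forall>f\<in>schwartz_space. modulation_energy \<phi> t (A f) \<le> ennreal C * modulation_energy \<phi> s (distribution_of f)"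
    then obtain C where "\<forall>f\<in>schwartz_space. modulation_energy \<phi> t (A f) \<le> ennreal C * modulation_energy \<phi> s (distribution_of f)"
      by blast
    moreover have "ennreal C = (ennreal (sqrt (max C 0)))\<^sup>2"
      by (cases "0 \<le> C") (auto simp: ennreal_power max_def ennreal_neg)
    ultimately have "\<forall>f\<in>schwartz_space. modulation_energy \<phi> t (A f) \<le> (ennreal (sqrt (max C 0)))\<^sup>2 * modulation_energy \<phi> s (distribution_of f)"
      by simp
    then show "modulation_bounded \<phi> A 2 2 (weight_v 0 s) 2 2 (weight_v 0 t)"
      unfolding modulation_bounded_def using sq by blast
  qed
qed

section \<open>The Wigner distribution\<close>

text \<open>The test function to which the symbol is applied; with the conjugates in these places it
  is bilinear in \<open>g\<close> and \<open>f\<close>.\<close>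

definition wigner_test :: "real \<Rightarrow> ('a::euclidean_space \<Rightarrow> complex) \<Rightarrow> ('a \<Rightarrow> complex) \<Rightarrow> 'a \<times> 'a \<Rightarrow> complex" where
  "wigner_test \<tau> g f w = cnj (wigner \<tau> (\<lambda>x. cnj (g x)) f w)"

lemma op_tau_eq: "op_tau \<tau> \<sigma> f g = \<sigma> (wigner_test \<tau> g f)"
  by (simp add: op_tau_def pairing_def wigner_test_def[abs_def])

text \<open>At an endpoint value of \<tau> one of the two arguments no longer depends on
  \<open>t\<close>, and the integral over the other one is a Fourier transform up to a
  chirp.\<close>

lemma wigner_test_0:
  fixes f g :: "'a::euclidean_space \<Rightarrow> complex"
  assumes f: "f \<in> schwartz_space"
  shows "wigner_test 0 g f (x, \<xi>) = cis (2 * pi * (x \<bullet> \<xi>)) * (g x * fourier f \<xi>)"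
proof -
  have [measurable]: "f \<in> borel_measurable borel" by (rule schwartz_borel[OF f])
  let ?h = "\<lambda>s. cis (- 2 * pi * (s \<bullet> \<xi>)) * f s"
  have "wigner_test 0 g f (x, \<xi>) = (\<integral>t. g x * (f (x - t) * cis (2 * pi * (\<xi> \<bullet> t))) \<partial>lborel)"
    unfolding wigner_test_def wigner_def
    by (simp add: cis_cnj mult.assoc flip: Bochner_Integration.integral_cnj)
  also have "\<dots> = g x * (\<integral>t. f (x - t) * cis (2 * pi * (\<xi> \<bullet> t)) \<partial>lborel)"
    by (rule integral_mult_right_zero)
  also have "(\<integral>t. f (x - t) * cis (2 * pi * (\<xi> \<bullet> t)) \<partial>lborel) = (\<integral>t. cis (2 * pi * (x \<bullet> \<xi>)) * ?h (x - t) \<partial>lborel)"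
  proof (intro Bochner_Integration.integral_cong refl)
    fix t
    have "cis (2 * pi * (\<xi> \<bullet> t)) = cis (2 * pi * (x \<bullet> \<xi>)) * cis (- 2 * pi * ((x - t) \<bullet> \<xi>))"
      by (simp add: cis_mult inner_diff_left inner_commute algebra_simps)
    then show "f (x - t) * cis (2 * pi * (\<xi> \<bullet> t)) = cis (2 * pi * (x \<bullet> \<xi>)) * ?h (x - t)" by simp
  qed
  also have "\<dots> = cis (2 * pi * (x \<bullet> \<xi>)) * (\<integral>t. ?h (x - t) \<partial>lborel)"
    by (rule integral_mult_right_zero)
  also have "(\<integral>t. ?h (x - t) \<partial>lborel) = fourier f \<xi>"
    unfolding fourier_def using integral_affine[of ?h "-1" x] by (simp add: cis_conv_exp)
  finally show ?thesis by (simp add: ac_simps)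
qed

lemma wigner_test_1:
  fixes f g :: "'a::euclidean_space \<Rightarrow> complex"
  assumes g: "g \<in> schwartz_space"
  shows "wigner_test 1 g f (x, \<xi>) = cis (- 2 * pi * (x \<bullet> \<xi>)) * (f x * fourier g (- \<xi>))"
proof -
  have [measurable]: "g \<in> borel_measurable borel" by (rule schwartz_borel[OF g])
  let ?h = "\<lambda>s. cis (- 2 * pi * (s \<bullet> (- \<xi>))) * g s"
  have "wigner_test 1 g f (x, \<xi>) = (\<integral>t. f x * (g (x + t) * cis (2 * pi * (\<xi> \<bullet> t))) \<partial>lborel)"
    unfolding wigner_test_def wigner_def
    by (simp add: cis_cnj ac_simps flip: Bochner_Integration.integral_cnj)
  also have "\<dots> = f x * (\<integral>t. g (x + t) * cis (2 * pi * (\<xi> \<bullet> t)) \<partial>lborel)"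
    by (rule integral_mult_right_zero)
  also have "(\<integral>t. g (x + t) * cis (2 * pi * (\<xi> \<bullet> t)) \<partial>lborel) = (\<integral>t. cis (- 2 * pi * (x \<bullet> \<xi>)) * ?h (t - (- x)) \<partial>lborel)"
  proof (intro Bochner_Integration.integral_cong refl)
    fix t
    have "cis (2 * pi * (\<xi> \<bullet> t)) = cis (- 2 * pi * (x \<bullet> \<xi>)) * cis (- 2 * pi * ((x + t) \<bullet> (- \<xi>)))"
      by (simp add: cis_mult inner_add_left inner_commute algebra_simps)
    then show "g (x + t) * cis (2 * pi * (\<xi> \<bullet> t)) = cis (- 2 * pi * (x \<bullet> \<xi>)) * ?h (t - (- x))" by (simp add: add.commute)
  qed
  also have "\<dots> = cis (- 2 * pi * (x \<bullet> \<xi>)) * (\<integral>t. ?h (t - (- x)) \<partial>lborel)"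
    by (rule integral_mult_right_zero)
  also have "(\<integral>t. ?h (t - (- x)) \<partial>lborel) = fourier g (- \<xi>)"
    unfolding fourier_def using integral_translate[of ?h "- x"] by (simp add: cis_conv_exp)
  finally show ?thesis by (simp add: ac_simps)
qed

text \<open>Reflection is the square of the Fourier transform.\<close>

lemma schwartz_reflect:
  assumes "f \<in> schwartz_space"
  shows "(\<lambda>x. f (- x)) \<in> schwartz_space"
proof -
  have "fourier (fourier f) x = f (- x)" for x
    using fourier_inversion[OF assms, of "- x"] by (simp add: fourier_def[of "fourier f"] inner_commute)
  then show ?thesis using schwartz_fourier[OF schwartz_fourier[OF assms]] by presburger
qed

lemma wigner_test_schwartz:
  fixes f g :: "'a::euclidean_space \<Rightarrow> complex"
  assumes "\<tau> \<in> {0, 1}" "f \<in> schwartz_space" "g \<in> schwartz_space"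
  shows "wigner_test \<tau> g f \<in> schwartz_space"
proof (cases "\<tau> = 0")
  case True
  have "wigner_test \<tau> g f = (\<lambda>(x, \<xi>). cis ((2 * pi) * (x \<bullet> \<xi>)) * (case (x, \<xi>) of (x, \<xi>) \<Rightarrow> g x * fourier f \<xi>))"
    using True by (auto simp: wigner_test_0[OF assms(2)])
  then show ?thesis
    by (simp only:) (intro schwartz_chirp schwartz_tensor schwartz_fourier assms)
next
  case False
  then have "\<tau> = 1" using assms(1) by simp
  then have "wigner_test \<tau> g f = (\<lambda>(x, \<xi>). cis ((- 2 * pi) * (x \<bullet> \<xi>)) * (case (x, \<xi>) of (x, \<xi>) \<Rightarrow> f x * fourier g (- \<xi>)))"
    by (auto simp: wigner_test_1[OF assms(3)])
  then show ?thesis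
    by (simp only:) (intro schwartz_chirp schwartz_tensor schwartz_reflect schwartz_fourier assms)
qed

section \<open>Linearity and isometry of the Wigner distribution\<close>

lemma wigner_test_add:
  assumes "\<tau> \<in> {0, 1}" "f \<in> schwartz_space" "g \<in> schwartz_space" "h \<in> schwartz_space"
  shows "wigner_test \<tau> (\<lambda>x. g x + h x) f = (\<lambda>w. wigner_test \<tau> g f w + wigner_test \<tau> h f w)"
  using assms
  by (auto simp: wigner_test_0 wigner_test_1 schwartz_add fourier_add schwartz_integrable algebra_simps)

lemma fourier_scale: "fourier (\<lambda>x. c * f x) \<xi> = c * fourier f \<xi>"
  unfolding fourier_def mult.left_commute[of _ c] by (rule integral_mult_right_zero)

lemma wigner_test_scale:
  assumes "\<tau> \<in> {0, 1}" "f \<in> schwartz_space" "g \<in> schwartz_space"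
  shows "wigner_test \<tau> (\<lambda>x. c * g x) f = (\<lambda>w. c * wigner_test \<tau> g f w)"
  using assms by (auto simp: wigner_test_0 wigner_test_1 schwartz_scale fourier_scale)

lemma l2sq_fourier:
  assumes "f \<in> schwartz_space"
  shows "l2sq (fourier f) = l2sq f"
proof -
  have "complex_of_real (l2sq g) = (\<integral>x. g x * cnj (g x) \<partial>lborel)" for g :: "'a \<Rightarrow> complex"
    unfolding l2sq_def by (subst integral_complex_of_real[symmetric]) (simp only: complex_norm_square)
  then have "complex_of_real (l2sq (fourier f)) = of_real (l2sq f)"
    using plancherel_inner[OF schwartz_integrable[OF assms] assms] by simp
  then show ?thesis by simp
qed

lemma l2sq_tensor:
  fixes f :: "'a::euclidean_space \<Rightarrow> complex" and g :: "'b::euclidean_space \<Rightarrow> complex"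
  assumes "\<And>x y. norm (h (x, y)) = norm (f x) * norm (g y)"
    and h: "h \<in> schwartz_space" and f: "f \<in> schwartz_space" and g: "g \<in> schwartz_space"
  shows "l2sq h = l2sq f * l2sq g"
proof -
  have [measurable]: "f \<in> borel_measurable borel" "g \<in> borel_measurable borel" "h \<in> borel_measurable borel"
    using assms by (auto intro: schwartz_borel)
  have "ennreal (l2sq h) = (\<integral>\<^sup>+x. (\<integral>\<^sup>+y. (ennreal (norm (f x)))\<^sup>2 * (ennreal (norm (g y)))\<^sup>2 \<partial>lborel) \<partial>lborel)"
    unfolding nn_integral_norm_square[OF h, symmetric]
    by (subst nn_integral_lborel_Pair) (simp_all add: assms(1) ennreal_mult power_mult_distrib)
  also have "\<dots> = ennreal (l2sq f * l2sq g)"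
    by (simp add: nn_integral_cmult nn_integral_multc nn_integral_norm_square[OF f] nn_integral_norm_square[OF g]
        ennreal_mult l2sq_nonneg)
  finally show ?thesis by (simp add: l2sq_nonneg)
qed

text \<open>The chirp is unimodular and Plancherel removes the Fourier transform from one factor. It
  is this identity that turns a square integrable symbol into a bounded operator.\<close>

lemma l2sq_wigner_test:
  fixes f g :: "'a::euclidean_space \<Rightarrow> complex"
  assumes "\<tau> \<in> {0, 1}" "f \<in> schwartz_space" "g \<in> schwartz_space"
  shows "l2sq (wigner_test \<tau> g f) = l2sq f * l2sq g"
proof (cases "\<tau> = 0")
  case True
  have "l2sq (wigner_test \<tau> g f) = l2sq g * l2sq (fourier f)"
    by (rule l2sq_tensor)
      (auto simp: True wigner_test_0 assms norm_mult intro!: wigner_test_schwartz schwartz_fourier assms)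
  then show ?thesis by (simp add: l2sq_fourier assms mult.commute)
next
  case False
  then have \<tau>: "\<tau> = 1" using assms(1) by simp
  have "l2sq (wigner_test \<tau> g f) = l2sq f * l2sq (\<lambda>x. fourier g (- x))"
    by (rule l2sq_tensor)
      (auto simp: \<tau> wigner_test_1 assms norm_mult intro!: wigner_test_schwartz schwartz_reflect schwartz_fourier assms)
  moreover have "l2sq (\<lambda>x. fourier g (- x)) = l2sq (fourier g)"
    using integral_affine[of "\<lambda>x. (norm (fourier g x))\<^sup>2" "-1" 0] schwartz_borel[OF schwartz_fourier[OF assms(3)]]
    by (simp add: l2sq_def)
  ultimately show ?thesis by (simp add: l2sq_fourier assms)
qed

text \<open>Yields temperedness of \<open>op_tau \<tau> \<sigma> f\<close> from its bound on square
  integrals, without estimating seminorms of Wigner distributions.\<close>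

lemma tempered_if_l2_bounded:
  fixes T :: "('a::euclidean_space \<Rightarrow> complex) \<Rightarrow> complex"
  assumes "\<And>f g. f \<in> schwartz_space \<Longrightarrow> g \<in> schwartz_space \<Longrightarrow> T (\<lambda>x. f x + g x) = T f + T g"
    and "\<And>c f. f \<in> schwartz_space \<Longrightarrow> T (\<lambda>x. c * f x) = c * T f"
    and bound: "\<And>f. f \<in> schwartz_space \<Longrightarrow> (norm (T f))\<^sup>2 \<le> K * l2sq f" and K: "0 \<le> K"
  shows "T \<in> tempered_distributions"
proof -
  let ?N = "2 * DIM('a)"
  define J where "J = (\<integral>x. inverse (\<langle>x::'a\<rangle> ^ ?N) \<partial>lborel)"
  have J: "0 \<le> J" unfolding J_def by simp
  have "norm (T f) \<le> sqrt (K * J) * schwartz_seminorm ?N f" if f: "f \<in> schwartz_space" for f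
  proof -
    let ?s = "schwartz_seminorm ?N f"
    have "l2sq f \<le> (\<integral>x. ?s\<^sup>2 * inverse (\<langle>x::'a\<rangle> ^ ?N) \<partial>lborel)"
      unfolding l2sq_def
    proof (rule integral_mono)
      fix x :: 'a
      have "norm (f x) \<le> ?s * inverse (\<langle>x\<rangle> ^ ?N)"
        using schwartz_seminorm_upper[OF f, of "[]" ?N x] by (simp add: field_simps)
      then have "(norm (f x))\<^sup>2 \<le> (?s * inverse (\<langle>x\<rangle> ^ ?N))\<^sup>2" by (intro power_mono) auto
      also have "\<dots> = ?s\<^sup>2 * (inverse (\<langle>x\<rangle> ^ ?N) * inverse (\<langle>x\<rangle> ^ ?N))"
        by (simp add: power2_eq_square)
      also have "\<dots> \<le> ?s\<^sup>2 * (1 * inverse (\<langle>x\<rangle> ^ ?N))"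
        by (intro mult_left_mono mult_right_mono) (auto simp: inverse_le_1_iff bracket_power_ge_1)
      finally show "(norm (f x))\<^sup>2 \<le> ?s\<^sup>2 * inverse (\<langle>x\<rangle> ^ ?N)" by simp
    qed (intro integrable_norm_square f integrable_mult_right integrable_inverse_bracket_power order_refl)+
    then have "l2sq f \<le> ?s\<^sup>2 * J" by (simp add: J_def)
    then have "(norm (T f))\<^sup>2 \<le> K * (?s\<^sup>2 * J)"
      using bound[OF f] K by (meson mult_left_mono order_trans)
    also have "\<dots> = (sqrt (K * J) * ?s)\<^sup>2" using K J by (simp add: power_mult_distrib)
    finally show ?thesis
      by (rule power2_le_imp_le) (use schwartz_seminorm_nonneg[OF f] K J in auto)
  qed
  then show ?thesis using assms(1,2) unfolding tempered_distributions_def by blast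
qed

section \<open>Sufficiency\<close>

text \<open>The symbol extends to a bounded functional for the square norm, so the bilinear form of
  the operator is bounded by the product of the square norms. The Bessel estimate converts this into
  energies of weight exponent 0, and monotonicity in the exponent admits \<open>t2\<close> and
  \<open>t1\<close>.\<close>

lemma modulation_bounded_if_exponents_le_2:
  fixes \<phi> :: "'a::euclidean_space \<Rightarrow> complex" and \<Phi> :: "'a \<times> 'a \<Rightarrow> complex"
  assumes \<tau>: "\<tau> \<in> {0, 1}" and \<sigma>: "\<sigma> \<in> wiener_amalgam \<Phi> p q"
    and \<phi>: "\<phi> \<in> schwartz_space" "\<phi> \<noteq> (\<lambda>_. 0)" and \<Phi>: "\<Phi> \<in> schwartz_space" "\<Phi> \<noteq> (\<lambda>_. 0)"
    and pq: "1 \<le> p" "p \<le> 2" "1 \<le> q" "q \<le> 2" and t: "t2 \<le> 0" "0 \<le> t1"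
  shows "modulation_bounded \<phi> (op_tau \<tau> \<sigma>) 2 2 (weight_v 0 t1) 2 2 (weight_v 0 t2)"
proof -
  have T: "\<sigma> \<in> tempered_distributions" using \<sigma> by (simp add: wiener_amalgam_def)
  obtain S where S: "(\<integral>\<^sup>+w. (ennreal (norm (\<sigma> (tf_shift (\<lambda>t. cnj (\<Phi> t)) w))))\<^sup>2 \<partial>lborel) = ennreal S" "0 \<le> S"
    using wiener_amalgam_square_integrable[OF \<sigma> \<Phi> pq] by (auto simp: less_top_ennreal)
  define K where "K = S / l2sq \<Phi>"
  have K: "0 \<le> K" using S l2sq_nonneg[of \<Phi>] by (simp add: K_def)
  have \<sigma>K: "(norm (\<sigma> G))\<^sup>2 \<le> K * l2sq G" if "G \<in> schwartz_space" for G
    unfolding K_def using S by (intro tempered_l2_bound T \<Phi> l2sq_pos that) auto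
  have op: "(norm (op_tau \<tau> \<sigma> f g))\<^sup>2 \<le> (K * l2sq f) * l2sq g"
    if "f \<in> schwartz_space" "g \<in> schwartz_space" for f g
    using \<sigma>K[OF wigner_test_schwartz[OF \<tau> that]] by (simp add: op_tau_eq l2sq_wigner_test[OF \<tau> that] mult.assoc)
  have tempered: "op_tau \<tau> \<sigma> f \<in> tempered_distributions" if f: "f \<in> schwartz_space" for f
  proof (rule tempered_if_l2_bounded[of _ "K * l2sq f"])
    show "op_tau \<tau> \<sigma> f (\<lambda>x. g x + h x) = op_tau \<tau> \<sigma> f g + op_tau \<tau> \<sigma> f h"
      if "g \<in> schwartz_space" "h \<in> schwartz_space" for g h
      using that by (simp add: op_tau_eq wigner_test_add[OF \<tau> f] temperedD_add[OF T] wigner_test_schwartz[OF \<tau> f])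
    show "op_tau \<tau> \<sigma> f (\<lambda>x. c * g x) = c * op_tau \<tau> \<sigma> f g" if "g \<in> schwartz_space" for c g
      using that by (simp add: op_tau_eq wigner_test_scale[OF \<tau> f] temperedD_scale[OF T] wigner_test_schwartz[OF \<tau> f])
  qed (use op f K l2sq_nonneg in \<open>auto intro: mult_nonneg_nonneg\<close>)
  have "modulation_energy \<phi> t2 (op_tau \<tau> \<sigma> f) \<le> ennreal K * modulation_energy \<phi> t1 (distribution_of f)"
    if f: "f \<in> schwartz_space" for f
  proof -
    have "modulation_energy \<phi> t2 (op_tau \<tau> \<sigma> f) \<le> modulation_energy \<phi> 0 (op_tau \<tau> \<sigma> f)"
      by (rule modulation_energy_mono[OF t(1)])
    also have "\<dots> \<le> ennreal ((K * l2sq f) * l2sq \<phi>)"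
      using bessel_tempered[OF tempered[OF f] schwartz_cnj[OF \<phi>(1)] _ op[OF f]] K l2sq_nonneg[of f]
      by (simp add: modulation_energy_def l2sq_cnj)
    also have "\<dots> = ennreal K * modulation_energy \<phi> 0 (distribution_of f)"
      using K l2sq_nonneg[of f] l2sq_nonneg[of \<phi>]
      by (simp add: modulation_energy_0[OF f \<phi>(1)] ac_simps flip: ennreal_mult)
    also have "\<dots> \<le> ennreal K * modulation_energy \<phi> t1 (distribution_of f)"
      by (intro mult_left_mono modulation_energy_mono t) auto
    finally show ?thesis .
  qed
  then show ?thesis
    using modulation_bounded_iff_energy[OF \<phi>(1), of "op_tau \<tau> \<sigma>"]
      tempered_tf_shift_measurable[OF tempered schwartz_cnj[OF \<phi>(1)]] by blast
qed

section \<open>Reproducing formula for pseudodifferential operators\<close>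

lemma fourier_tf_shift:
  assumes \<psi>: "\<psi> \<in> schwartz_space"
  shows "fourier (tf_shift \<psi> w) \<eta> = cis (- 2 * pi * (fst w \<bullet> (\<eta> - snd w))) * fourier \<psi> (\<eta> - snd w)"
proof -
  let ?h = "\<lambda>t. cis (- 2 * pi * (t \<bullet> (\<eta> - snd w))) * \<psi> t"
  have "cis (- 2 * pi * (x \<bullet> \<eta>)) * tf_shift \<psi> w x = cis (- 2 * pi * (fst w \<bullet> (\<eta> - snd w))) * ?h (x - fst w)" for x
  proof -
    have "cis (- 2 * pi * (x \<bullet> \<eta>)) * cis (2 * pi * (x \<bullet> snd w))
      = cis (- 2 * pi * (fst w \<bullet> (\<eta> - snd w))) * cis (- 2 * pi * ((x - fst w) \<bullet> (\<eta> - snd w)))"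
      by (simp add: cis_mult inner_diff_left inner_diff_right algebra_simps)
    then show ?thesis by (simp add: tf_shift_apply mult.assoc[symmetric])
  qed
  then have "fourier (tf_shift \<psi> w) \<eta> = (\<integral>x. cis (- 2 * pi * (fst w \<bullet> (\<eta> - snd w))) * ?h (x - fst w) \<partial>lborel)"
    unfolding fourier_def by presburger
  also have "\<dots> = cis (- 2 * pi * (fst w \<bullet> (\<eta> - snd w))) * (\<integral>x. ?h (x - fst w) \<partial>lborel)"
    by (rule integral_mult_right_zero)
  also have "(\<integral>x. ?h (x - fst w) \<partial>lborel) = fourier \<psi> (\<eta> - snd w)"
    unfolding fourier_def
    by (rule integral_translate) (use schwartz_borel[OF \<psi>] in \<open>simp add: cis_conv_exp\<close>)
  finally show ?thesis .
qed

definition wigner_phase :: "real \<Rightarrow> 'a::euclidean_space \<times> 'a \<Rightarrow> complex" where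
  "wigner_phase \<tau> w = (if \<tau> = 0 then 1 else cis (2 * pi * (fst w \<bullet> snd w)))"

text \<open>The point of the doubled phase space by which the Wigner distribution moves when its
  test argument moves by \<open>w\<close>. It depends linearly on \<open>w\<close>, so the moved
  distributions form a Schwartz family again.\<close>

definition wigner_shift :: "real \<Rightarrow> 'a::euclidean_space \<times> 'a \<Rightarrow> ('a \<times> 'a) \<times> ('a \<times> 'a)" where
  "wigner_shift \<tau> w = ((if \<tau> = 0 then (fst w, 0) else (0, - snd w)), (snd w, fst w))"

text \<open>Covariance of the Wigner distribution, by comparing phases. For \<tau> = 0 the test
  function enters directly; for \<tau> = 1 it enters through its reflected Fourier transform, which
  exchanges position and frequency and leaves the phase \<open>wigner_phase\<close>.\<close>

lemma wigner_test_tf_shift: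
  fixes f \<psi> :: "'a::euclidean_space \<Rightarrow> complex"
  assumes \<tau>: "\<tau> \<in> {0, 1}" and f: "f \<in> schwartz_space" and \<psi>: "\<psi> \<in> schwartz_space"
  shows "wigner_test \<tau> (tf_shift \<psi> w) f
    = (\<lambda>y. wigner_phase \<tau> w * tf_shift (wigner_test \<tau> \<psi> f) (wigner_shift \<tau> w) y)"
proof
  fix y :: "'a \<times> 'a"
  obtain x \<xi> where y: "y = (x, \<xi>)" by (cases y)
  obtain x0 z0 where w: "w = (x0, z0)" by (cases w)
  show "wigner_test \<tau> (tf_shift \<psi> w) f y = wigner_phase \<tau> w * tf_shift (wigner_test \<tau> \<psi> f) (wigner_shift \<tau> w) y"
  proof (cases "\<tau> = 0")
    case True
    have "cis (2 * pi * (x \<bullet> \<xi>)) * cis (2 * pi * (x \<bullet> z0))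
      = cis (2 * pi * (x \<bullet> z0 + \<xi> \<bullet> x0)) * cis (2 * pi * ((x - x0) \<bullet> \<xi>))"
      by (simp add: cis_mult inner_diff_left inner_commute algebra_simps)
    then show ?thesis
      using True by (simp add: y w wigner_test_0[OF f] wigner_phase_def wigner_shift_def tf_shift_apply inner_Pair mult.assoc[symmetric])
  next
    case False
    then have \<tau>: "\<tau> = 1" using \<tau> by simp
    have "cis (- 2 * pi * (x \<bullet> \<xi>)) * cis (- 2 * pi * (x0 \<bullet> (- \<xi> - z0)))
      = cis (2 * pi * (x0 \<bullet> z0)) * (cis (2 * pi * (x \<bullet> z0 + \<xi> \<bullet> x0)) * cis (- 2 * pi * (x \<bullet> (\<xi> + z0))))"
      by (simp add: cis_mult inner_diff_right inner_add_right inner_commute algebra_simps)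
    then have "cis (- 2 * pi * (x \<bullet> \<xi>)) * cis (- 2 * pi * (x0 \<bullet> (- \<xi> - z0))) * (f x * fourier \<psi> (- \<xi> - z0))
      = cis (2 * pi * (x0 \<bullet> z0)) * (cis (2 * pi * (x \<bullet> z0 + \<xi> \<bullet> x0)) * cis (- 2 * pi * (x \<bullet> (\<xi> + z0)))) * (f x * fourier \<psi> (- \<xi> - z0))"
      by (rule arg_cong)
    moreover have "- (\<xi> + z0) = - \<xi> - z0" by simp
    ultimately show ?thesis
      unfolding y w \<tau> wigner_test_1[OF tf_shift_schwartz[OF \<psi>]] fourier_tf_shift[OF \<psi>] tf_shift_apply[of "wigner_test 1 \<psi> f"]
      by (simp add: wigner_test_1[OF \<psi>] wigner_phase_def wigner_shift_def inner_Pair mult.assoc mult.left_commute)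
  qed
qed

lemma bounded_linear_wigner_shift: "bounded_linear (wigner_shift \<tau>)"
  unfolding wigner_shift_def
  by (cases "\<tau> = 0")
    (auto intro!: bounded_linear_Pair bounded_linear_fst bounded_linear_snd bounded_linear_zero bounded_linear_minus)

lemma schwartz_family_compose:
  assumes G: "schwartz_family G" and L: "bounded_linear L"
  shows "schwartz_family (\<lambda>w. G (L w))"
proof -
  obtain K where K: "0 < K" "\<And>w. norm (L w) \<le> norm w * K" using bounded_linear.pos_bounded[OF L] by blast
  have "\<exists>C k. \<forall>w. schwartz_seminorm N (G (L w)) \<le> C * \<langle>w\<rangle> ^ k" for N
  proof -
    obtain C k where C: "0 \<le> C" "\<And>w. schwartz_seminorm N (G w) \<le> C * \<langle>w\<rangle> ^ k"
      using schwartz_family_bound[OF G] by blast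
    have "schwartz_seminorm N (G (L w)) \<le> (C * (1 + K) ^ k) * \<langle>w\<rangle> ^ k" for w
    proof -
      have "\<langle>L w\<rangle> \<le> 1 + K * \<langle>w\<rangle>"
        using bracket_le[of "L w"] K(2)[of w] mult_right_mono[OF norm_le_bracket[of w], of K] K(1)
        unfolding mult.commute[of K] by linarith
      also have "\<dots> \<le> (1 + K) * \<langle>w\<rangle>" using bracket_ge_1[of w] by (simp add: distrib_right)
      finally have "\<langle>L w\<rangle> ^ k \<le> ((1 + K) * \<langle>w\<rangle>) ^ k" by (intro power_mono) auto
      then have "C * \<langle>L w\<rangle> ^ k \<le> C * ((1 + K) * \<langle>w\<rangle>) ^ k" using C(1) by (rule mult_left_mono)
      then show ?thesis using C(2)[of "L w"] by (simp add: power_mult_distrib mult.assoc)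
    qed
    then show ?thesis by blast
  qed
  moreover have "(\<lambda>i. L (X i)) \<longlonglongrightarrow> L w" if "X \<longlonglongrightarrow> w" for X w
    by (rule bounded_linear.tendsto[OF L that])
  ultimately show ?thesis
    using G unfolding schwartz_family_def by blast
qed

lemma wigner_phase_measurable [measurable]: "wigner_phase \<tau> \<in> borel_measurable borel"
  by (cases "\<tau> = 0")
    (auto simp: wigner_phase_def[abs_def] cis_conv_exp intro!: borel_measurable_continuous_onI continuous_intros)

lemma norm_wigner_phase [simp]: "norm (wigner_phase \<tau> w) = 1"
  by (simp add: wigner_phase_def)

lemma op_tau_tf_shift:
  assumes "\<tau> \<in> {0, 1}" "\<sigma> \<in> tempered_distributions" "f \<in> schwartz_space" "\<psi> \<in> schwartz_space"
  shows "op_tau \<tau> \<sigma> f (tf_shift \<psi> w) = wigner_phase \<tau> w * \<sigma> (tf_shift (wigner_test \<tau> \<psi> f) (wigner_shift \<tau> w))"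
  unfolding op_tau_eq wigner_test_tf_shift[OF assms(1,3,4)]
  by (intro temperedD_scale assms tf_shift_schwartz wigner_test_schwartz)

lemma op_tau_tf_shift_measurable:
  assumes \<tau>: "\<tau> \<in> {0, 1}" and \<sigma>: "\<sigma> \<in> tempered_distributions" and f: "f \<in> schwartz_space" and \<psi>: "\<psi> \<in> schwartz_space"
  shows "(\<lambda>w. op_tau \<tau> \<sigma> f (tf_shift \<psi> w)) \<in> borel_measurable borel"
proof -
  have "continuous_on UNIV (\<lambda>w. \<sigma> (tf_shift (wigner_test \<tau> \<psi> f) (wigner_shift \<tau> w)))"
    by (rule schwartz_family_tempered_continuous[OF schwartz_family_compose[OF schwartz_family_tf_shift bounded_linear_wigner_shift] \<sigma>])
      (intro wigner_test_schwartz assms)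
  from borel_measurable_continuous_onI[OF this] show ?thesis
    unfolding op_tau_tf_shift[OF assms] by measurable
qed

lemma fourier_superposition:
  fixes G :: "'w::euclidean_space \<Rightarrow> 'a::euclidean_space \<Rightarrow> complex"
  assumes "schwartz_family G" "a \<in> borel_measurable borel" "\<And>k. integrable lborel (\<lambda>w. norm (a w) * \<langle>w\<rangle> ^ k)"
  shows "fourier (superposition a G) \<xi> = (\<integral>w. a w * fourier (G w) \<xi> \<partial>lborel)"
proof -
  have "fourier g \<xi> = distribution_of (\<lambda>x. cis (- 2 * pi * (x \<bullet> \<xi>))) g" for g
    by (simp add: fourier_def distribution_of_def)
  moreover have "distribution_of (\<lambda>x::'a. cis (- 2 * pi * (x \<bullet> \<xi>))) \<in> tempered_distributions"
    by (rule distribution_of_tempered[where B = 1]) (simp_all add: cis_conv_exp)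
  ultimately show ?thesis using tempered_superposition[OF assms] by simp
qed

lemma op_tau_reproducing:
  fixes f h \<phi> :: "'a::euclidean_space \<Rightarrow> complex"
  assumes \<tau>: "\<tau> \<in> {0, 1}" and \<sigma>: "\<sigma> \<in> tempered_distributions"
    and f: "f \<in> schwartz_space" and h: "h \<in> schwartz_space" and \<phi>: "\<phi> \<in> schwartz_space"
  shows "of_real (l2sq \<phi>) * op_tau \<tau> \<sigma> f h
    = (\<integral>w. gabor h \<phi> w * op_tau \<tau> \<sigma> f (tf_shift (\<lambda>t. cnj (\<phi> t)) w) \<partial>lborel)"
proof -
  let ?\<psi> = "\<lambda>t. cnj (\<phi> t)"
  have \<psi>: "?\<psi> \<in> schwartz_space" by (rule schwartz_cnj[OF \<phi>])
  define a where "a w = gabor h \<phi> w * wigner_phase \<tau> w" for w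
  define G where "G w = tf_shift (wigner_test \<tau> ?\<psi> f) (wigner_shift \<tau> w)" for w
  have G: "schwartz_family G"
    unfolding G_def
    by (rule schwartz_family_compose[OF schwartz_family_tf_shift[OF wigner_test_schwartz[OF \<tau> f \<psi>]] bounded_linear_wigner_shift])
  have gm [measurable]: "gabor h \<phi> \<in> borel_measurable borel" by (rule gabor_measurable[OF h \<phi>])
  have am: "a \<in> borel_measurable borel" unfolding a_def by measurable
  have ai: "integrable lborel (\<lambda>w. norm (a w) * \<langle>w\<rangle> ^ k)" for k
    using gabor_weighted_integrable[OF h \<phi>] by (simp add: a_def norm_mult)
  have aG: "a w * G w y = gabor h \<phi> w * wigner_test \<tau> (tf_shift ?\<psi> w) f y" for w y
    by (simp add: a_def G_def wigner_test_tf_shift[OF \<tau> f \<psi>])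
  have "superposition a G = wigner_test \<tau> (\<lambda>x. of_real (l2sq \<phi>) * h x) f"
  proof
    fix y :: "'a \<times> 'a"
    obtain x \<xi> where y: "y = (x, \<xi>)" by (cases y)
    note fam = schwartz_family_tf_shift[OF \<psi>] and gw = gabor_weighted_integrable[OF h \<phi>]
    show "superposition a G y = wigner_test \<tau> (\<lambda>x. of_real (l2sq \<phi>) * h x) f y"
    proof (cases "\<tau> = 0")
      case True
      have "superposition a G y = (\<integral>w. (cis (2 * pi * (x \<bullet> \<xi>)) * fourier f \<xi>) * (gabor h \<phi> w * tf_shift ?\<psi> w x) \<partial>lborel)"
        unfolding superposition_def aG using True by (simp add: y wigner_test_0[OF f] ac_simps)
      also have "\<dots> = (cis (2 * pi * (x \<bullet> \<xi>)) * fourier f \<xi>) * superposition (gabor h \<phi>) (tf_shift ?\<psi>) x"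
        unfolding superposition_def by (rule integral_mult_right_zero)
      finally show ?thesis
        using True by (simp add: y wigner_test_0[OF f] gabor_synthesis[OF h \<phi>])
    next
      case False
      then have \<tau>: "\<tau> = 1" using \<tau> by simp
      \<comment> \<open>For \<tau> = 1 the test function appears under a Fourier transform, which
        must be exchanged with the superposition.\<close>
      have "superposition a G y = (\<integral>w. (cis (- 2 * pi * (x \<bullet> \<xi>)) * f x) * (gabor h \<phi> w * fourier (tf_shift ?\<psi> w) (- \<xi>)) \<partial>lborel)"
        unfolding superposition_def aG unfolding \<tau> y wigner_test_1[OF tf_shift_schwartz[OF \<psi>]] by (simp add: ac_simps)
      also have "\<dots> = (cis (- 2 * pi * (x \<bullet> \<xi>)) * f x) * fourier (superposition (gabor h \<phi>) (tf_shift ?\<psi>)) (- \<xi>)"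
        unfolding fourier_superposition[OF fam gm gw] by (rule integral_mult_right_zero)
      finally show ?thesis
        using \<tau> by (simp add: y wigner_test_1 schwartz_scale h gabor_synthesis[OF h \<phi>])
    qed
  qed
  then have "op_tau \<tau> \<sigma> f (\<lambda>x. of_real (l2sq \<phi>) * h x) = (\<integral>w. a w * \<sigma> (G w) \<partial>lborel)"
    using tempered_superposition[OF G am ai \<sigma>] by (simp add: op_tau_eq)
  moreover have "a w * \<sigma> (G w) = gabor h \<phi> w * op_tau \<tau> \<sigma> f (tf_shift ?\<psi> w)" for w
    by (simp add: a_def G_def op_tau_tf_shift[OF \<tau> \<sigma> f \<psi>])
  moreover have "op_tau \<tau> \<sigma> f (\<lambda>x. of_real (l2sq \<phi>) * h x) = of_real (l2sq \<phi>) * op_tau \<tau> \<sigma> f h"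
    unfolding op_tau_eq wigner_test_scale[OF \<tau> f h]
    by (intro temperedD_scale \<sigma> wigner_test_schwartz \<tau> f h)
  ultimately show ?thesis by simp
qed

definition gabor_energy :: "('a::euclidean_space \<Rightarrow> complex) \<Rightarrow> real \<Rightarrow> ('a \<Rightarrow> complex) \<Rightarrow> ennreal" where
  "gabor_energy \<psi> s f = (\<integral>\<^sup>+w. (ennreal (norm (gabor f \<psi> w) * \<langle>snd w\<rangle> powr s))\<^sup>2 \<partial>lborel)"

text \<open>Duality of weighted spaces: in the reproducing formula the weight of exponent
  \<open>t2\<close> is inserted on the side of the operator and its inverse on the side of
  \<open>h\<close>, and Cauchy-Schwarz is applied. Necessity then only needs lower bounds for single
  numbers.\<close>

lemma op_tau_weak_bound:
  fixes \<phi> :: "'a::euclidean_space \<Rightarrow> complex"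
  assumes \<tau>: "\<tau> \<in> {0, 1}" and \<sigma>: "\<sigma> \<in> tempered_distributions" and \<phi>: "\<phi> \<in> schwartz_space"
    and bounded: "modulation_bounded \<phi> (op_tau \<tau> \<sigma>) 2 2 (weight_v 0 t1) 2 2 (weight_v 0 t2)"
  obtains C where "0 \<le> C"
    "\<And>f h. f \<in> schwartz_space \<Longrightarrow> h \<in> schwartz_space \<Longrightarrow>
      (ennreal (l2sq \<phi> * norm (op_tau \<tau> \<sigma> f h)))\<^sup>2
        \<le> ennreal C * (gabor_energy (\<lambda>t. cnj (\<phi> t)) t1 f * gabor_energy \<phi> (- t2) h)"
proof -
  let ?\<psi> = "\<lambda>t. cnj (\<phi> t)"
  have \<psi>: "?\<psi> \<in> schwartz_space" by (rule schwartz_cnj[OF \<phi>])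
  obtain C where C: "\<And>f. f \<in> schwartz_space \<Longrightarrow>
      modulation_energy \<phi> t2 (op_tau \<tau> \<sigma> f) \<le> ennreal C * modulation_energy \<phi> t1 (distribution_of f)"
    using modulation_bounded_iff_energy[OF \<phi>, of "op_tau \<tau> \<sigma>"] op_tau_tf_shift_measurable[OF \<tau> \<sigma> _ \<psi>] bounded
    by blast
  have "(ennreal (l2sq \<phi> * norm (op_tau \<tau> \<sigma> f h)))\<^sup>2
      \<le> ennreal (max C 0) * (gabor_energy ?\<psi> t1 f * gabor_energy \<phi> (- t2) h)"
    if f: "f \<in> schwartz_space" and h: "h \<in> schwartz_space" for f h
  proof -
    define T where "T w = op_tau \<tau> \<sigma> f (tf_shift ?\<psi> w)" for w
    have [measurable]: "T \<in> borel_measurable borel"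
      unfolding T_def by (rule op_tau_tf_shift_measurable[OF \<tau> \<sigma> f \<psi>])
    have [measurable]: "gabor h \<phi> \<in> borel_measurable borel" by (rule gabor_measurable[OF h \<phi>])
    let ?u = "\<lambda>w. gabor h \<phi> w * of_real (\<langle>snd w\<rangle> powr (- t2))"
    let ?v = "\<lambda>w. T w * of_real (\<langle>snd w\<rangle> powr t2)"
    have "\<langle>snd w\<rangle> powr (- t2) * \<langle>snd w\<rangle> powr t2 = 1" for w :: "'a \<times> 'a" by (simp flip: powr_add)
    then have "complex_of_real (\<langle>snd w\<rangle> powr (- t2)) * of_real (\<langle>snd w\<rangle> powr t2) = 1" for w :: "'a \<times> 'a"
      by (simp flip: of_real_mult)
    then have uv: "?u w * ?v w = gabor h \<phi> w * T w" for w
      by (metis (no_types, lifting) mult.assoc mult.commute mult_1)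
    have "(ennreal (norm (of_real (l2sq \<phi>) * op_tau \<tau> \<sigma> f h)))\<^sup>2
      \<le> (\<integral>\<^sup>+w. (ennreal (norm (?u w)))\<^sup>2 \<partial>lborel) * (\<integral>\<^sup>+w. (ennreal (norm (?v w)))\<^sup>2 \<partial>lborel)"
      unfolding op_tau_reproducing[OF \<tau> \<sigma> f h \<phi>] T_def[symmetric] uv[symmetric]
      by (rule cauchy_schwarz_integral) measurable
    also have "(\<integral>\<^sup>+w. (ennreal (norm (?u w)))\<^sup>2 \<partial>lborel) = gabor_energy \<phi> (- t2) h"
      by (simp add: gabor_energy_def norm_mult)
    also have "(\<integral>\<^sup>+w. (ennreal (norm (?v w)))\<^sup>2 \<partial>lborel) = modulation_energy \<phi> t2 (op_tau \<tau> \<sigma> f)"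
      by (simp add: modulation_energy_def norm_mult T_def)
    also have "gabor_energy \<phi> (- t2) h * modulation_energy \<phi> t2 (op_tau \<tau> \<sigma> f)
      \<le> gabor_energy \<phi> (- t2) h * (ennreal C * modulation_energy \<phi> t1 (distribution_of f))"
      by (intro mult_left_mono C f) auto
    also have "\<dots> = ennreal (max C 0) * (gabor_energy ?\<psi> t1 f * gabor_energy \<phi> (- t2) h)"
      unfolding modulation_energy_distribution_of[OF f \<phi>] gabor_energy_def
      by (cases "0 \<le> C") (simp_all add: max_def ennreal_neg ac_simps)
    finally show ?thesis by (simp add: norm_mult l2sq_nonneg)
  qed
  then show ?thesis by (intro that[of "max C 0"]) auto
qed

section \<open>Lattice sums and their Lebesgue norms\<close>

lemma summable_inverse_one_plus_square: "summable (\<lambda>j. 1 / (1 + (real j)\<^sup>2))"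
proof (rule summable_comparison_test')
  show "summable (\<lambda>j. inverse ((real j)\<^sup>2))" using inverse_power_summable[of 2] by simp
  show "norm (1 / (1 + (real j)\<^sup>2)) \<le> inverse ((real j)\<^sup>2)" if "1 \<le> j" for j
    using that by (simp add: field_simps add_pos_nonneg)
qed

text \<open>Rounding the offset to an integer costs a factor 4, and for an integer offset every
  distance occurs at most twice; this explains the bound \<open>4 * (2 * s)\<close>.\<close>

lemma lattice_sum_bounded:
  obtains S :: real where "0 \<le> S" "\<And>t. (\<Sum>k. ennreal (1 / (1 + (real k - t)\<^sup>2))) \<le> ennreal S"
proof -
  define s where "s = (\<Sum>j. 1 / (1 + (real j)\<^sup>2))"
  have s: "(\<Sum>j. ennreal (1 / (1 + (real j)\<^sup>2))) = ennreal s"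
    unfolding s_def by (rule suminf_ennreal2[OF _ summable_inverse_one_plus_square]) simp
  have s0: "0 \<le> s" unfolding s_def by (rule suminf_nonneg[OF summable_inverse_one_plus_square]) simp
  have int: "(\<Sum>k. ennreal (1 / (1 + (real k - of_int m)\<^sup>2))) \<le> ennreal (2 * s)" for m :: int
  proof (cases "m \<le> 0")
    case True
    have "(\<Sum>k. ennreal (1 / (1 + (real k - of_int m)\<^sup>2))) \<le> (\<Sum>k. ennreal (1 / (1 + (real k)\<^sup>2)))"
    proof (intro suminf_le ennreal_leI)
      fix k
      have "(real k)\<^sup>2 \<le> (real k - of_int m)\<^sup>2" using True by (intro power_mono) auto
      then show "1 / (1 + (real k - of_int m)\<^sup>2) \<le> 1 / (1 + (real k)\<^sup>2)"
        by (intro divide_left_mono) (auto simp: add_pos_nonneg)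
    qed auto
    also have "\<dots> \<le> ennreal (2 * s)" unfolding s using s0 by (intro ennreal_leI) simp
    finally show ?thesis .
  next
    case False
    then obtain n where n: "m = int n" by (metis int_eq_iff less_imp_le not_le)
    let ?f = "\<lambda>k. ennreal (1 / (1 + (real k - of_int m)\<^sup>2))"
    have "(\<Sum>k. ?f k) = (\<Sum>k. ?f (k + n)) + (\<Sum>k<n. ?f k)"
      by (rule suminf_offset) auto
    also have "(\<Sum>k. ?f (k + n)) = ennreal s" using s by (simp add: n)
    finally have eq: "(\<Sum>k. ?f k) = ennreal s + (\<Sum>k<n. ?f k)" .
    have "(\<Sum>k<n. ?f k) \<le> ennreal s"
    proof -
      \<comment> \<open>Read backwards, the terms below the offset have distances
        \<open>Suc k\<close>, which brings them under the one-sided series.\<close>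
      have "(\<Sum>k<n. ?f k) = (\<Sum>k<n. ?f (n - Suc k))" by (rule sum.nat_diff_reindex[symmetric])
      also have "\<dots> = (\<Sum>k<n. ennreal (1 / (1 + (real (Suc k))\<^sup>2)))"
        by (intro sum.cong refl) (auto simp: n of_nat_diff power2_eq_square algebra_simps)
      also have "\<dots> \<le> (\<Sum>k<n. ennreal (1 / (1 + (real k)\<^sup>2)))"
        by (intro sum_mono ennreal_leI divide_left_mono) (auto simp: add_pos_nonneg power_mono)
      also have "\<dots> \<le> (\<Sum>k. ennreal (1 / (1 + (real k)\<^sup>2)))"
        by (rule sum_le_suminf) auto
      finally show ?thesis unfolding s .
    qed
    then have "(\<Sum>k. ?f k) \<le> ennreal s + ennreal s" unfolding eq by (rule add_left_mono)
    also have "\<dots> = ennreal (2 * s)" unfolding mult_2 by (rule ennreal_plus[symmetric]) (rule s0)+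
    finally show ?thesis .
  qed
  show ?thesis
  proof (rule that[of "4 * (2 * s)"])
    fix t :: real
    define m where "m = \<lfloor>t\<rfloor>"
    have tm: "\<bar>t - of_int m\<bar> \<le> 1" unfolding m_def by linarith
    have "(\<Sum>k. ennreal (1 / (1 + (real k - t)\<^sup>2))) \<le> (\<Sum>k. 4 * ennreal (1 / (1 + (real k - of_int m)\<^sup>2)))"
    proof (rule suminf_le)
      fix k
      have "(t - of_int m)\<^sup>2 \<le> 1" using power_mono[OF tm, of 2] by simp
      moreover have "(real k - of_int m)\<^sup>2 \<le> 2 * (real k - t)\<^sup>2 + 2 * (t - of_int m)\<^sup>2"
        using sum_squares_bound[of "real k - t" "t - of_int m"] power2_sum[of "real k - t" "t - of_int m"] by simp
      moreover have "0 \<le> (real k - t)\<^sup>2" by simp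
      moreover have "1 + u \<le> 4 * (1 + v)" if "w \<le> 1" "u \<le> 2 * v + 2 * w" "0 \<le> v" for u v w :: real
        using that by argo
      ultimately have "1 + (real k - of_int m)\<^sup>2 \<le> 4 * (1 + (real k - t)\<^sup>2)" by blast
      then have "1 / (1 + (real k - t)\<^sup>2) \<le> 4 * (1 / (1 + (real k - of_int m)\<^sup>2))"
        by (simp add: field_simps add_pos_nonneg)
      then have "ennreal (1 / (1 + (real k - t)\<^sup>2)) \<le> ennreal (4 * (1 / (1 + (real k - of_int m)\<^sup>2)))"
        by (rule ennreal_leI)
      then show "ennreal (1 / (1 + (real k - t)\<^sup>2)) \<le> 4 * ennreal (1 / (1 + (real k - of_int m)\<^sup>2))"
        by (simp only: ennreal_mult' ennreal_numeral zero_le_numeral)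
    qed auto
    also have "\<dots> = 4 * (\<Sum>k. ennreal (1 / (1 + (real k - of_int m)\<^sup>2)))" by simp
    also have "\<dots> \<le> 4 * ennreal (2 * s)" by (intro mult_left_mono int) auto
    also have "\<dots> = ennreal (4 * (2 * s))" using s0 by (simp add: ennreal_mult)
    finally show "(\<Sum>k. ennreal (1 / (1 + (real k - t)\<^sup>2))) \<le> ennreal (4 * (2 * s))" .
  qed (use s0 in simp)
qed

text \<open>The bracket dominates the coordinate along \<open>b\<close>, so the bound is the
  one-dimensional one and does not depend on \<open>x\<close>.\<close>

lemma bracket_kernel_lattice_sum:
  fixes b :: "'a::euclidean_space"
  assumes N: "2 \<le> N"
  obtains S :: real where "0 \<le> S" "\<And>b x. b \<in> Basis \<Longrightarrow> (\<Sum>k. bracket_kernel N (real k *\<^sub>R b - (x :: 'a))) \<le> ennreal S"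
proof -
  obtain S :: real where S: "0 \<le> S" "\<And>t. (\<Sum>k. ennreal (1 / (1 + (real k - t)\<^sup>2))) \<le> ennreal S"
    using lattice_sum_bounded by blast
  have "(\<Sum>k. bracket_kernel N (real k *\<^sub>R b - x)) \<le> ennreal S" if b: "b \<in> Basis" for b x :: 'a
  proof -
    have "(\<Sum>k. bracket_kernel N (real k *\<^sub>R b - x)) \<le> (\<Sum>k. ennreal (1 / (1 + (real k - x \<bullet> b)\<^sup>2)))"
      unfolding bracket_kernel_def
    proof (intro suminf_le ennreal_leI)
      fix k
      let ?y = "real k *\<^sub>R b - x"
      have "?y \<bullet> b = real k - x \<bullet> b" using b by (simp add: inner_diff_left)
      then have "(real k - x \<bullet> b)\<^sup>2 \<le> (norm ?y)\<^sup>2"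
        using power_mono[OF Basis_le_norm[OF b, of ?y], of 2] by simp
      then have "1 + (real k - x \<bullet> b)\<^sup>2 \<le> \<langle>?y\<rangle>\<^sup>2" by (simp add: bracket_sq)
      also have "\<dots> \<le> \<langle>?y\<rangle> ^ N" by (rule power_increasing[OF N bracket_ge_1])
      finally have "inverse (\<langle>?y\<rangle> ^ N) \<le> inverse (1 + (real k - x \<bullet> b)\<^sup>2)"
        by (intro le_imp_inverse_le) (auto simp: add_pos_nonneg)
      then show "inverse (\<langle>?y\<rangle> ^ N) \<le> 1 / (1 + (real k - x \<bullet> b)\<^sup>2)" by (simp add: inverse_eq_divide)
    qed auto
    also have "\<dots> \<le> ennreal S" by (rule S)
    finally show ?thesis .
  qed
  with S(1) show ?thesis by (rule that)
qed

text \<open>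
  A substitute for Jensen's inequality, obtained by summing \<open>x \<le> t + t\<^sup>1\<^sup>-\<^sup>r x\<^sup>r\<close> for an optimal \<open>t\<close>.
\<close>

lemma weighted_suminf_powr_le:
  fixes c :: "nat \<Rightarrow> real" and k :: "nat \<Rightarrow> ennreal"
  assumes c: "\<And>j. 0 \<le> c j" and r: "1 \<le> r" and S: "(\<Sum>j. k j) \<le> ennreal S" "0 \<le> S"
  shows "ennreal_powr (\<Sum>j. ennreal (c j) * k j) r \<le> ennreal ((S + 1) powr r) * (\<Sum>j. ennreal (c j powr r) * k j)"
proof -
  define U where "U = (\<Sum>j. ennreal (c j powr r) * k j)"
  have pos: "ennreal_powr (\<Sum>j. ennreal (c j) * k j) r \<le> ennreal ((S + 1) powr r) * U"
    if u: "U = ennreal u" "0 < u" for u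
  proof -
    \<comment> \<open>The value that balances the two terms, as
      \<open>t powr (1 - r) * u = t\<close>; the mass \<open>S\<close> of the kernels and this
      second term add up to the factor \<open>S + 1\<close>.\<close>
    define t where "t = u powr (1 / r)"
    have t: "0 < t" using u by (simp add: t_def)
    have young: "c j \<le> t + t powr (1 - r) * c j powr r" for j
    proof (cases "c j \<le> t")
      case False
      then have "c j = c j powr (1 - r) * c j powr r" using t by (simp flip: powr_add)
      also have "\<dots> \<le> t powr (1 - r) * c j powr r"
        using False t r by (intro mult_right_mono powr_mono2') auto
      finally show ?thesis using t by simp
    qed (simp add: add_increasing2)
    have "(\<Sum>j. ennreal (c j) * k j) \<le> (\<Sum>j. ennreal t * k j + ennreal (t powr (1 - r)) * (ennreal (c j powr r) * k j))"
    proof (intro suminf_le)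
      fix j
      have "ennreal (c j) \<le> ennreal t + ennreal (t powr (1 - r)) * ennreal (c j powr r)"
        using ennreal_leI[OF young[of j]] t by (simp add: ennreal_mult ennreal_plus)
      then have "ennreal (c j) * k j \<le> (ennreal t + ennreal (t powr (1 - r)) * ennreal (c j powr r)) * k j"
        by (rule mult_right_mono) simp
      then show "ennreal (c j) * k j \<le> ennreal t * k j + ennreal (t powr (1 - r)) * (ennreal (c j powr r) * k j)"
        by (simp add: distrib_right mult.assoc)
    qed auto
    also have "\<dots> = ennreal t * (\<Sum>j. k j) + ennreal (t powr (1 - r)) * U"
      unfolding U_def by (simp add: suminf_add[symmetric])
    also have "\<dots> \<le> ennreal t * ennreal S + ennreal (t powr (1 - r)) * ennreal u"
      unfolding u(1) by (intro add_mono mult_left_mono S) auto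
    also have "\<dots> = ennreal ((S + 1) * t)"
    proof -
      have "t powr (1 - r) * u = t powr (1 - r) * t powr r" using u r by (simp add: t_def powr_powr)
      also have "\<dots> = t" using t by (simp flip: powr_add)
      finally have "ennreal t * ennreal S + ennreal (t powr (1 - r)) * ennreal u = ennreal (S * t) + ennreal t"
        using S(2) t u by (simp add: mult.commute flip: ennreal_mult)
      also have "\<dots> = ennreal ((S + 1) * t)" using S(2) t by (simp add: distrib_right ennreal_plus)
      finally show ?thesis .
    qed
    finally have "ennreal_powr (\<Sum>j. ennreal (c j) * k j) r \<le> ennreal_powr (ennreal ((S + 1) * t)) r"
      using r by (intro ennreal_powr_mono) auto
    also have "\<dots> = ennreal (((S + 1) * t) powr r)" using S(2) t by (intro ennreal_powr_ennreal) simp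
    also have "\<dots> = ennreal ((S + 1) powr r * u)"
      using S(2) t u r by (simp add: powr_mult) (simp add: t_def powr_powr)
    also have "\<dots> = ennreal ((S + 1) powr r) * U" using u by (simp add: ennreal_mult)
    finally show ?thesis .
  qed
  have "ennreal_powr (\<Sum>j. ennreal (c j) * k j) r \<le> ennreal ((S + 1) powr r) * U"
  proof (cases U)
    case (real u)
    show ?thesis
    proof (cases "u = 0")
      case True
      then have "ennreal (c j powr r) * k j = 0" for j
        using real True sum_le_suminf[of "\<lambda>j. ennreal (c j powr r) * k j" "{j}"] unfolding U_def by auto
      then have "ennreal (c j) * k j = 0" for j
        using c[of j] by (auto simp: ennreal_eq_0_iff powr_le_cancel_iff)
      then have "(\<Sum>j. ennreal (c j) * k j) = 0" by (simp only: suminf_zero)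
      then show ?thesis by (simp add: ennreal_powr_def)
    qed (use real pos in auto)
  next
    case top
    then show ?thesis using S(2) by (simp add: ennreal_mult_top)
  qed
  then show ?thesis by (simp add: U_def)
qed

text \<open>Interpolation between the integral and the supremum for one function: h^r \<le> w^(r -
  1) h. The assumption \<open>1 \<le> D\<close> gives \<open>D \<le> D powr r\<close>, so the same
  constant serves every exponent.\<close>

lemma Lp_enorm_le:
  fixes h :: "'a::euclidean_space \<Rightarrow> ennreal" and D :: real
  assumes p: "1 \<le> p" and [measurable]: "h \<in> borel_measurable borel" and D: "1 \<le> D"
    and h: "\<And>x. h x \<le> W" "(\<integral>\<^sup>+x. h x \<partial>lborel) \<le> ennreal D * W"
  shows "Lp_enorm p h \<le> ennreal D * W"
proof (cases W)
  case top
  then show ?thesis using D by (simp add: ennreal_mult_top)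
next
  case W: (real w)
  show ?thesis
  proof (cases "p = \<infinity>")
    case True
    have "esssup lborel h \<le> W" by (rule esssup_I) (auto simp: h)
    also have "\<dots> \<le> ennreal D * W" using D mult_right_mono[of 1 "ennreal D" W] by simp
    finally show ?thesis using True by (simp add: Lp_enorm_def)
  next
    case False
    define r where "r = enn2real p"
    have r: "1 \<le> r" using False p by (cases p) (auto simp: r_def)
    have "ennreal_powr (h x) r \<le> ennreal (w powr (r - 1)) * h x" for x
    proof -
      obtain y where y: "h x = ennreal y" "0 \<le> y" "y \<le> w"
        using h(1)[of x] W by (cases "h x") (auto simp: top_unique)
      have "y powr r \<le> w powr (r - 1) * y"
      proof (cases "y = 0")
        case False
        then have "y powr r = y powr (r - 1) * y" using y powr_add[of y "r - 1" 1] by simp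
        also have "\<dots> \<le> w powr (r - 1) * y" using y r by (intro mult_right_mono powr_mono2) auto
        finally show ?thesis .
      qed simp
      then show ?thesis using y by (simp add: ennreal_powr_ennreal ennreal_leI flip: ennreal_mult)
    qed
    then have "(\<integral>\<^sup>+x. ennreal_powr (h x) r \<partial>lborel) \<le> (\<integral>\<^sup>+x. ennreal (w powr (r - 1)) * h x \<partial>lborel)"
      by (rule nn_integral_mono)
    also have "\<dots> = ennreal (w powr (r - 1)) * (\<integral>\<^sup>+x. h x \<partial>lborel)" by (simp add: nn_integral_cmult)
    also have "\<dots> \<le> ennreal (w powr (r - 1)) * (ennreal D * W)" by (intro mult_left_mono h) auto
    also have "\<dots> = ennreal (D * (w powr (r - 1) * w))" using W D by (simp add: ac_simps flip: ennreal_mult)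
    also have "\<dots> \<le> ennreal ((D * w) powr r)"
    proof (intro ennreal_leI)
      have "w powr (r - 1) * w \<le> w powr r"
        using W r powr_add[of w "r - 1" 1] by (cases "w = 0") auto
      moreover have "D \<le> D powr r" using D r powr_mono[of 1 r D] by simp
      ultimately have "D * (w powr (r - 1) * w) \<le> D powr r * w powr r"
        using W by (intro mult_mono) auto
      then show "D * (w powr (r - 1) * w) \<le> (D * w) powr r" using D W by (simp add: powr_mult)
    qed
    finally have "ennreal_powr (\<integral>\<^sup>+x. ennreal_powr (h x) r \<partial>lborel) (1 / r) \<le> ennreal_powr (ennreal ((D * w) powr r)) (1 / r)"
      using r by (intro ennreal_powr_mono) auto
    also have "\<dots> = ennreal D * W"
      using D W r by (simp add: ennreal_powr_ennreal powr_powr ennreal_mult)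
    finally show ?thesis using False by (simp add: Lp_enorm_def r_def)
  qed
qed

lemma Lp_enorm_mono:
  assumes "1 \<le> p" "f \<in> borel_measurable borel" and "\<And>x. f x \<le> g x"
  shows "Lp_enorm p (f :: 'a::euclidean_space \<Rightarrow> ennreal) \<le> Lp_enorm p g"
proof (cases "p = \<infinity>")
  case True
  then show ?thesis using assms by (auto simp: Lp_enorm_def intro!: esssup_mono)
next
  case False
  then have "1 \<le> enn2real p" using assms(1) by (cases p) auto
  then show ?thesis
    using False assms(3) by (auto simp: Lp_enorm_def intro!: ennreal_powr_mono nn_integral_mono)
qed

text \<open>The bound is uniform in the centres \<open>Z k\<close>, which is what makes it usable
  for atoms at arbitrary positions. The kernel is at most 1 and has mass \<open>J\<close>; adding 1
  to \<open>J\<close> meets the requirement that the constant be at least 1.\<close>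

lemma Lp_enorm_kernel_sum:
  assumes N: "2 * DIM('a::euclidean_space) \<le> N" and p: "1 \<le> p"
  obtains D :: real where "1 \<le> D"
    "\<And>(w :: nat \<Rightarrow> ennreal) Z. Lp_enorm p (\<lambda>z::'a. \<Sum>k. w k * bracket_kernel N (z - Z k)) \<le> ennreal D * (\<Sum>k. w k)"
proof -
  obtain J where J: "(\<integral>\<^sup>+x. bracket_kernel N (x::'a) \<partial>lborel) = ennreal J" "0 \<le> J"
    using nn_integral_bracket_kernel[OF N] by (auto simp: less_top_ennreal)
  have tr: "(\<integral>\<^sup>+z. bracket_kernel N (z - a) \<partial>lborel) = ennreal J" for a :: 'a
    unfolding J(1)[symmetric] by (rule nn_integral_translate) measurable
  have "Lp_enorm p (\<lambda>z::'a. \<Sum>k. w k * bracket_kernel N (z - Z k)) \<le> ennreal (J + 1) * (\<Sum>k. w k)"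
    for w :: "nat \<Rightarrow> ennreal" and Z
  proof (rule Lp_enorm_le[OF p])
    have m: "(\<lambda>z. bracket_kernel N (z - Z k)) \<in> borel_measurable borel" for k by measurable
    then show "(\<lambda>z::'a. \<Sum>k. w k * bracket_kernel N (z - Z k)) \<in> borel_measurable borel" by measurable
    show "(\<Sum>k. w k * bracket_kernel N (z - Z k)) \<le> (\<Sum>k. w k)" for z
      using mult_left_mono[OF bracket_kernel_le_1, of "w _" N] by (intro suminf_le) auto
    have "(\<integral>\<^sup>+z. (\<Sum>k. w k * bracket_kernel N (z - Z k)) \<partial>lborel) = (\<Sum>k. w k * ennreal J)"
      using m by (subst nn_integral_suminf) (auto simp: nn_integral_cmult tr)
    also have "\<dots> = ennreal J * (\<Sum>k. w k)" by (simp add: mult.commute)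
    also have "\<dots> \<le> ennreal (J + 1) * (\<Sum>k. w k)" by (intro mult_right_mono ennreal_leI) auto
    finally show "(\<integral>\<^sup>+z. (\<Sum>k. w k * bracket_kernel N (z - Z k)) \<partial>lborel) \<le> ennreal (J + 1) * (\<Sum>k. w k)" .
  qed (use J in auto)
  then show ?thesis using J by (intro that[of "J + 1"]) auto
qed

text \<open>Along a lattice the kernels overlap boundedly, so p-th powers of the coefficients may be
  summed instead of the coefficients themselves. For the infinite exponent bounded coefficients
  suffice.\<close>

lemma Lp_enorm_lattice_kernel_sum:
  fixes b :: "'a::euclidean_space" and c :: "nat \<Rightarrow> real"
  assumes N: "2 * DIM('a) \<le> N" and p: "1 \<le> p" and b: "b \<in> Basis"
    and c: "\<And>k. 0 \<le> c k" "\<And>k. c k \<le> 1" "p \<noteq> \<infinity> \<Longrightarrow> summable (\<lambda>k. c k powr enn2real p)"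
  shows "Lp_enorm p (\<lambda>z::'a. \<Sum>k. ennreal (c k) * bracket_kernel N (z - real k *\<^sub>R b)) < \<infinity>"
proof -
  have N2: "2 \<le> N" using N DIM_positive[where 'a = 'a] by linarith
  obtain S :: real where S: "0 \<le> S" "\<And>b x. b \<in> Basis \<Longrightarrow> (\<Sum>k. bracket_kernel N (real k *\<^sub>R b - (x :: 'a))) \<le> ennreal S"
    using bracket_kernel_lattice_sum[OF N2] by blast
  obtain J where J: "(\<integral>\<^sup>+x. bracket_kernel N (x::'a) \<partial>lborel) = ennreal J" "0 \<le> J"
    using nn_integral_bracket_kernel[OF N] by (auto simp: less_top_ennreal)
  have tr: "(\<integral>\<^sup>+z. bracket_kernel N (z - a) \<partial>lborel) = ennreal J" for a :: 'a
    unfolding J(1)[symmetric] by (rule nn_integral_translate) measurable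
  have m: "(\<lambda>z. bracket_kernel N (z - real k *\<^sub>R b)) \<in> borel_measurable borel" for k by measurable
  then have [measurable]: "(\<lambda>z. \<Sum>k. ennreal (c k) * bracket_kernel N (z - real k *\<^sub>R b)) \<in> borel_measurable borel"
    by measurable
  have S': "(\<Sum>k. bracket_kernel N (z - real k *\<^sub>R b)) \<le> ennreal S" for z
    using S(2)[OF b, of z] by (simp add: bracket_kernel_minus_commute[of N z])
  show ?thesis
  proof (cases "p = \<infinity>")
    case True
    have "(\<Sum>k. ennreal (c k) * bracket_kernel N (z - real k *\<^sub>R b)) \<le> ennreal S" for z
    proof -
      have "ennreal (c k) * bracket_kernel N (z - real k *\<^sub>R b) \<le> 1 * bracket_kernel N (z - real k *\<^sub>R b)" for k
        using c by (intro mult_right_mono) auto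
      then have "(\<Sum>k. ennreal (c k) * bracket_kernel N (z - real k *\<^sub>R b)) \<le> (\<Sum>k. bracket_kernel N (z - real k *\<^sub>R b))"
        by (intro suminf_le) auto
      then show ?thesis using S'[of z] by (rule order.trans)
    qed
    then have "Lp_enorm p (\<lambda>z. \<Sum>k. ennreal (c k) * bracket_kernel N (z - real k *\<^sub>R b)) \<le> ennreal S"
      using True by (auto simp: Lp_enorm_def intro!: esssup_I)
    then show ?thesis by (simp add: order.strict_trans1)
  next
    case False
    define r where "r = enn2real p"
    have r: "1 \<le> r" using False p by (cases p) (auto simp: r_def)
    have "(\<integral>\<^sup>+z. ennreal_powr (\<Sum>k. ennreal (c k) * bracket_kernel N (z - real k *\<^sub>R b)) r \<partial>lborel)
      \<le> (\<integral>\<^sup>+z. ennreal ((S + 1) powr r) * (\<Sum>k. ennreal (c k powr r) * bracket_kernel N (z - real k *\<^sub>R b)) \<partial>lborel)"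
      by (intro nn_integral_mono weighted_suminf_powr_le c r S S')
    also have "\<dots> = ennreal ((S + 1) powr r) * (\<integral>\<^sup>+z. (\<Sum>k. ennreal (c k powr r) * bracket_kernel N (z - real k *\<^sub>R b)) \<partial>lborel)"
      by (rule nn_integral_cmult) (use m in measurable)
    also have "(\<integral>\<^sup>+z. (\<Sum>k. ennreal (c k powr r) * bracket_kernel N (z - real k *\<^sub>R b)) \<partial>lborel)
      = (\<Sum>k. \<integral>\<^sup>+z. ennreal (c k powr r) * bracket_kernel N (z - real k *\<^sub>R b) \<partial>lborel)"
      by (rule nn_integral_suminf) (use m in measurable)
    also have "\<dots> = (\<Sum>k. ennreal (c k powr r) * ennreal J)"
      by (intro arg_cong[where f = suminf] ext, subst nn_integral_cmult) (use m tr in auto)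
    also have "\<dots> = (\<Sum>k. ennreal (c k powr r)) * ennreal J" by (rule ennreal_suminf_multc)
    also have "ennreal ((S + 1) powr r) * ((\<Sum>k. ennreal (c k powr r)) * ennreal J) < \<infinity>"
    proof -
      have "(\<Sum>k. ennreal (c k powr r)) = ennreal (\<Sum>k. c k powr r)"
        using c(3)[OF False] by (intro suminf_ennreal2) (auto simp: r_def)
      then show ?thesis by (simp add: ennreal_mult_less_top)
    qed
    finally show ?thesis
      using False by (auto simp: Lp_enorm_def r_def ennreal_powr_def)
  qed
qed

lemma ennreal_powr_cmult:
  assumes "0 < a" "0 < r"
  shows "ennreal_powr (ennreal a * x) r = ennreal (a powr r) * ennreal_powr x r"
proof (cases x)
  case (real y)
  then have "ennreal_powr (ennreal a * x) r = ennreal_powr (ennreal (a * y)) r"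
    using assms by (simp add: ennreal_mult)
  also have "\<dots> = ennreal (a powr r) * ennreal_powr x r"
    using assms real by (subst ennreal_powr_ennreal) (auto simp: powr_mult ennreal_mult ennreal_powr_ennreal)
  finally show ?thesis .
next
  case top
  then show ?thesis using assms by (simp add: ennreal_powr_def ennreal_mult_top)
qed

lemma Lp_enorm_cmult_le:
  fixes h :: "'a::euclidean_space \<Rightarrow> ennreal"
  assumes p: "1 \<le> p" and [measurable]: "h \<in> borel_measurable borel" and a: "0 < a"
  shows "Lp_enorm p (\<lambda>x. ennreal a * h x) \<le> ennreal a * Lp_enorm p h"
proof (cases "p = \<infinity>")
  case True
  have "AE x in lborel. h x \<le> esssup lborel h" by (rule esssup_AE) measurable
  then have "AE x in lborel. ennreal a * h x \<le> ennreal a * esssup lborel h"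
    by eventually_elim (auto intro: mult_left_mono)
  then show ?thesis using True by (auto simp: Lp_enorm_def intro: esssup_I)
next
  case False
  define r where "r = enn2real p"
  have r: "1 \<le> r" using False p by (cases p) (auto simp: r_def)
  have "(\<integral>\<^sup>+x. ennreal_powr (ennreal a * h x) r \<partial>lborel) = ennreal (a powr r) * (\<integral>\<^sup>+x. ennreal_powr (h x) r \<partial>lborel)"
    using a r by (simp add: ennreal_powr_cmult nn_integral_cmult)
  then show ?thesis
    using False a r by (simp add: Lp_enorm_def ennreal_powr_cmult powr_powr flip: r_def)
qed

lemma norm_suminf_le_ennreal:
  fixes f :: "nat \<Rightarrow> complex"
  shows "ennreal (norm (suminf f)) \<le> (\<Sum>k. ennreal (norm (f k)))"
proof (cases "(\<Sum>k. ennreal (norm (f k))) = top")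
  case False
  then have s: "summable (\<lambda>k. norm (f k))" by (intro summable_suminf_not_top) auto
  have "ennreal (norm (suminf f)) \<le> ennreal (\<Sum>k. norm (f k))" by (intro ennreal_leI summable_norm s)
  also have "\<dots> = (\<Sum>k. ennreal (norm (f k)))" by (rule suminf_ennreal2[symmetric]) (auto simp: s)
  finally show ?thesis .
qed simp

section \<open>Series of time-frequency shifts\<close>

text \<open>The pairing is a Fourier transform evaluated at the frequency of the atom, so one
  derivative gains one factor of that frequency. One factor is just what is required later: it turns
  coefficients of order -1/2 into terms of order -3/2 when the frequencies grow linearly.\<close>

lemma tf_shift_pairing_bound:
  fixes \<psi> :: "'a::euclidean_space \<Rightarrow> complex"
  assumes \<psi>: "\<psi> \<in> schwartz_space" and b: "b \<in> Basis"
  obtains C where "0 \<le> C" "\<And>w G. G \<in> schwartz_space \<Longrightarrow>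
    (1 + \<bar>snd w \<bullet> b\<bar>) * norm (distribution_of (tf_shift \<psi> w) G) \<le> C * schwartz_seminorm (2 * DIM('a)) G"
proof -
  let ?N = "2 * DIM('a)"
  define J where "J = (\<integral>x. inverse (\<langle>x::'a\<rangle> ^ ?N) \<partial>lborel)"
  have J: "0 \<le> J" unfolding J_def by simp
  have d\<psi>: "dir_deriv b \<psi> \<in> schwartz_space" by (rule schwartz_dir_deriv[OF \<psi> b])
  obtain B0 where "\<forall>x. \<langle>x\<rangle> ^ 0 * norm (\<psi> x) \<le> B0" using schwartz_bounded_ex[OF \<psi>] by blast
  then have B0: "norm (\<psi> x) \<le> B0" for x by simp
  obtain B1 where "\<forall>x. \<langle>x\<rangle> ^ 0 * norm (dir_deriv b \<psi> x) \<le> B1" using schwartz_bounded_ex[OF d\<psi>] by blast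
  then have B1: "norm (dir_deriv b \<psi> x) \<le> B1" for x by simp
  have B: "0 \<le> B0" "0 \<le> B1" using B0[of 0] B1[of 0] norm_ge_zero order_trans by blast+
  have le: "(\<integral>y. norm (\<eta> (y - a) * F y) \<partial>lborel) \<le> B * (\<integral>y. norm (F y) \<partial>lborel)"
    if "\<eta> \<in> schwartz_space" "F \<in> schwartz_space" "\<And>x. norm (\<eta> x) \<le> B" for \<eta> F :: "'a \<Rightarrow> complex" and a B
  proof -
    have "(\<integral>y. norm (\<eta> (y - a) * F y) \<partial>lborel) \<le> (\<integral>y. B * norm (F y) \<partial>lborel)"
    proof (rule integral_mono)
      show "integrable lborel (\<lambda>y. norm (\<eta> (y - a) * F y))"
        by (intro integrable_norm schwartz_integrable schwartz_mult schwartz_translation that)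
      show "integrable lborel (\<lambda>y. B * norm (F y))"
        by (intro integrable_mult_right integrable_norm schwartz_integrable that)
      show "norm (\<eta> (y - a) * F y) \<le> B * norm (F y)" for y
        by (simp add: norm_mult mult_right_mono that)
    qed
    then show ?thesis by simp
  qed
  have "(1 + \<bar>snd w \<bullet> b\<bar>) * norm (distribution_of (tf_shift \<psi> w) G) \<le> ((2 * B0 + B1) * J) * schwartz_seminorm ?N G"
    if G: "G \<in> schwartz_space" for w G
  proof -
    let ?s = "schwartz_seminorm ?N G"
    have s: "0 \<le> ?s" by (rule schwartz_seminorm_nonneg[OF G])
    have dG: "dir_deriv b G \<in> schwartz_space" by (rule schwartz_dir_deriv[OF G b])
    have iG: "(\<integral>y. norm (G y) \<partial>lborel) \<le> J * ?s"
      using integral_norm_le_schwartz_seminorm[OF G, of "[]" ?N] by (simp add: J_def)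
    have idG: "(\<integral>y. norm (dir_deriv b G y) \<partial>lborel) \<le> J * ?s"
      using integral_norm_le_schwartz_seminorm[OF G, of "[b]" ?N] b DIM_positive[where 'a = 'a] by (simp add: J_def)
    define H where "H y = \<psi> (y - fst w) * G y" for y
    have H: "H \<in> schwartz_space" unfolding H_def by (intro schwartz_mult schwartz_translation \<psi> G)
    have eq: "distribution_of (tf_shift \<psi> w) G = fourier H (- snd w)"
      by (simp add: distribution_of_def fourier_def tf_shift_apply H_def mult.assoc)
    have "norm (fourier H (- snd w)) \<le> (\<integral>y. norm (H y) \<partial>lborel)" by (rule norm_fourier_le)
    also have "\<dots> \<le> B0 * (J * ?s)"
      unfolding H_def using le[OF \<psi> G B0] mult_left_mono[OF iG B(1)] by (rule order.trans)
    finally have 1: "norm (fourier H (- snd w)) \<le> B0 * (J * ?s)" .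
    have dH: "(H has_derivative (\<lambda>h. \<psi> (y - fst w) * frechet_derivative G (at y) h + frechet_derivative \<psi> (at (y - fst w)) h * G y)) (at y)" for y
    proof -
      have "(\<psi> has_derivative frechet_derivative \<psi> (at (y - fst w))) (at (y - fst w))"
        by (intro has_derivative_frechet schwartz_differentiable \<psi>)
      then have "((\<lambda>y. \<psi> (y - fst w)) has_derivative frechet_derivative \<psi> (at (y - fst w))) (at y)"
        by (intro has_derivative_compose[of "\<lambda>y. y - fst w" "\<lambda>h. h" y UNIV \<psi>, simplified]) (auto intro!: derivative_eq_intros)
      then show ?thesis unfolding H_def
        by (intro has_derivative_mult has_derivative_frechet schwartz_differentiable G)
    qed
    have "2 * pi * \<bar>snd w \<bullet> b\<bar> * norm (fourier H (- snd w)) = norm (fourier (dir_deriv b H) (- snd w))"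
      unfolding fourier_dir_deriv[OF H b] by (simp add: norm_mult)
    also have "\<dots> \<le> (\<integral>y. norm (dir_deriv b H y) \<partial>lborel)" by (rule norm_fourier_le)
    also have "\<dots> \<le> (\<integral>y. norm (\<psi> (y - fst w) * dir_deriv b G y) + norm (dir_deriv b \<psi> (y - fst w) * G y) \<partial>lborel)"
      unfolding frechet_derivative_at[OF dH, symmetric]
      by (rule integral_mono)
        (auto intro!: norm_triangle_ineq Bochner_Integration.integrable_add integrable_norm schwartz_integrable schwartz_add schwartz_mult schwartz_translation \<psi> G dG d\<psi>
          schwartz_translation[OF d\<psi>] simp del: integrable_norm_iff)
    also have "\<dots> = (\<integral>y. norm (\<psi> (y - fst w) * dir_deriv b G y) \<partial>lborel) + (\<integral>y. norm (dir_deriv b \<psi> (y - fst w) * G y) \<partial>lborel)"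
      by (intro Bochner_Integration.integral_add integrable_norm schwartz_integrable schwartz_mult schwartz_translation schwartz_translation[OF d\<psi>] \<psi> G dG)
    also have "\<dots> \<le> B0 * (J * ?s) + B1 * (J * ?s)"
      using le[OF \<psi> dG B0, of "fst w"] mult_left_mono[OF idG B(1)] le[OF d\<psi> G B1, of "fst w"] mult_left_mono[OF iG B(2)]
      by linarith
    finally have "2 * pi * \<bar>snd w \<bullet> b\<bar> * norm (fourier H (- snd w)) \<le> B0 * (J * ?s) + B1 * (J * ?s)" .
    moreover have "1 * (\<bar>snd w \<bullet> b\<bar> * norm (fourier H (- snd w))) \<le> (2 * pi) * (\<bar>snd w \<bullet> b\<bar> * norm (fourier H (- snd w)))"
      using pi_gt3 by (intro mult_right_mono) auto
    ultimately have "\<bar>snd w \<bullet> b\<bar> * norm (fourier H (- snd w)) \<le> B0 * (J * ?s) + B1 * (J * ?s)"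
      by (simp add: mult.assoc)
    with 1 show ?thesis unfolding eq by (simp add: algebra_simps)
  qed
  then show ?thesis using B J by (intro that[of "(2 * B0 + B1) * J"]) auto
qed

text \<open>The coefficients may fail to be summable; convergence then rests on the growth of the
  frequencies and holds after pairing with each Schwartz function.\<close>

definition tf_series :: "('a::euclidean_space \<Rightarrow> complex) \<Rightarrow> (nat \<Rightarrow> real) \<Rightarrow> (nat \<Rightarrow> 'a \<times> 'a) \<Rightarrow> ('a \<Rightarrow> complex) \<Rightarrow> complex" where
  "tf_series \<psi> c w G = (\<Sum>k. of_real (c k) * distribution_of (tf_shift \<psi> (w k)) G)"

lemma
  fixes \<psi> :: "'a::euclidean_space \<Rightarrow> complex"
  assumes \<psi>: "\<psi> \<in> schwartz_space" and b: "b \<in> Basis" and c: "\<And>k. 0 \<le> c k"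
    and summable: "summable (\<lambda>k. c k / (1 + \<bar>snd (w k) \<bullet> b\<bar>))"
  shows tf_series_summable: "G \<in> schwartz_space \<Longrightarrow>
      summable (\<lambda>k. norm (complex_of_real (c k) * distribution_of (tf_shift \<psi> (w k)) G))"
    and tf_series_tempered: "tf_series \<psi> c w \<in> tempered_distributions"
proof -
  let ?N = "2 * DIM('a)"
  obtain C where C: "0 \<le> C" "\<And>w G. G \<in> schwartz_space \<Longrightarrow>
    (1 + \<bar>snd w \<bullet> b\<bar>) * norm (distribution_of (tf_shift \<psi> w) G) \<le> C * schwartz_seminorm ?N G"
    using tf_shift_pairing_bound[OF \<psi> b] by blast
  have le: "norm (complex_of_real (c k) * distribution_of (tf_shift \<psi> (w k)) G)
      \<le> c k / (1 + \<bar>snd (w k) \<bullet> b\<bar>) * (C * schwartz_seminorm ?N G)" if "G \<in> schwartz_space" for G k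
  proof -
    have "norm (distribution_of (tf_shift \<psi> (w k)) G) \<le> C * schwartz_seminorm ?N G / (1 + \<bar>snd (w k) \<bullet> b\<bar>)"
      using C(2)[OF that, of "w k"] by (simp add: pos_le_divide_eq add_pos_nonneg mult.commute)
    from mult_left_mono[OF this c[of k]] show ?thesis using c[of k] by (simp add: norm_mult)
  qed
  have sum': "summable (\<lambda>k. norm (complex_of_real (c k) * distribution_of (tf_shift \<psi> (w k)) G))" if G: "G \<in> schwartz_space" for G
    by (rule summable_comparison_test'[OF summable_mult2[OF summable, of "C * schwartz_seminorm ?N G"]]) (use le[OF G] in auto)
  then show "G \<in> schwartz_space \<Longrightarrow>
      summable (\<lambda>k. norm (complex_of_real (c k) * distribution_of (tf_shift \<psi> (w k)) G))" .
  note sm = summable_norm_cancel[OF sum']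
  have T: "distribution_of (tf_shift \<psi> (w k)) \<in> tempered_distributions" for k
    by (intro distribution_of_schwartz tf_shift_schwartz \<psi>)
  have add: "tf_series \<psi> c w (\<lambda>x. f x + g x) = tf_series \<psi> c w f + tf_series \<psi> c w g"
    if "f \<in> schwartz_space" "g \<in> schwartz_space" for f g
    unfolding tf_series_def using suminf_add[OF sm[OF that(1)] sm[OF that(2)]]
    by (simp add: temperedD_add[OF T that] distrib_left)
  have scale: "tf_series \<psi> c w (\<lambda>x. a * f x) = a * tf_series \<psi> c w f" if "f \<in> schwartz_space" for f a
    unfolding tf_series_def using suminf_mult[OF sm[OF that], of a]
    by (simp add: temperedD_scale[OF T that] mult.left_commute)
  have "norm (tf_series \<psi> c w f) \<le> ((\<Sum>k. c k / (1 + \<bar>snd (w k) \<bullet> b\<bar>)) * C) * schwartz_seminorm ?N f"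
    if f: "f \<in> schwartz_space" for f
  proof -
    have "norm (tf_series \<psi> c w f) \<le> (\<Sum>k. norm (complex_of_real (c k) * distribution_of (tf_shift \<psi> (w k)) f))"
      unfolding tf_series_def by (rule summable_norm[OF sum'[OF f]])
    also have "\<dots> \<le> (\<Sum>k. c k / (1 + \<bar>snd (w k) \<bullet> b\<bar>) * (C * schwartz_seminorm ?N f))"
      by (rule suminf_le[OF le[OF f] sum'[OF f] summable_mult2[OF summable]])
    also have "\<dots> = (\<Sum>k. c k / (1 + \<bar>snd (w k) \<bullet> b\<bar>)) * (C * schwartz_seminorm ?N f)"
      by (rule suminf_mult2[OF summable, symmetric])
    finally show ?thesis by (simp add: mult.assoc)
  qed
  with add scale show "tf_series \<psi> c w \<in> tempered_distributions"
    unfolding tempered_distributions_def by blast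
qed

lemma stft_tf_series_le:
  fixes \<psi> \<Phi> :: "'a::euclidean_space \<Rightarrow> complex"
  assumes \<psi>: "\<psi> \<in> schwartz_space" and \<Phi>: "\<Phi> \<in> schwartz_space" and c: "\<And>k. 0 \<le> c k"
  obtains C where "0 < C" "\<And>\<zeta> z. ennreal (norm (stft \<Phi> (tf_series \<psi> c w) \<zeta> (- z)))
    \<le> (\<Sum>k. ennreal C * (ennreal (c k) * bracket_kernel N (\<zeta> - fst (w k))) * bracket_kernel N (z - (- snd (w k))))"
proof -
  let ?\<eta> = "\<lambda>t. cnj (\<Phi> t)"
  have \<eta>: "?\<eta> \<in> schwartz_space" by (rule schwartz_cnj[OF \<Phi>])
  obtain C where C: "0 < C"
    "\<And>x z. ennreal (norm (gabor \<psi> ?\<eta> (x, z))) \<le> ennreal C * (bracket_kernel N x * bracket_kernel N z)"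
    using gabor_le_bracket_kernel[OF \<psi> \<eta>] by blast
  have "ennreal (norm (stft \<Phi> (tf_series \<psi> c w) \<zeta> (- z)))
    \<le> (\<Sum>k. ennreal C * (ennreal (c k) * bracket_kernel N (\<zeta> - fst (w k))) * bracket_kernel N (z - (- snd (w k))))" for \<zeta> z
  proof -
    have "ennreal (norm (stft \<Phi> (tf_series \<psi> c w) \<zeta> (- z)))
      \<le> (\<Sum>k. ennreal (norm (of_real (c k) * distribution_of (tf_shift \<psi> (w k)) (tf_shift ?\<eta> (\<zeta>, z)))))"
      unfolding stft_eq_tf_shift tf_series_def minus_minus by (rule norm_suminf_le_ennreal)
    also have "\<dots> \<le> (\<Sum>k. ennreal C * (ennreal (c k) * bracket_kernel N (\<zeta> - fst (w k))) * bracket_kernel N (z - (- snd (w k))))"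
    proof (rule suminf_le)
      fix k
      have "norm (distribution_of (tf_shift \<psi> (w k)) (tf_shift ?\<eta> (\<zeta>, z))) = norm (gabor (tf_shift \<psi> (w k)) ?\<eta> (\<zeta>, - z))"
        by (simp add: gabor_eq_distribution_of)
      also have "\<dots> = norm (gabor \<psi> ?\<eta> (\<zeta> - fst (w k), - z - snd (w k)))"
        unfolding norm_gabor_tf_shift[OF \<psi> \<eta>] by (simp add: minus_prod_def)
      finally have "ennreal (norm (of_real (c k) * distribution_of (tf_shift \<psi> (w k)) (tf_shift ?\<eta> (\<zeta>, z))))
        = ennreal (c k) * ennreal (norm (gabor \<psi> ?\<eta> (\<zeta> - fst (w k), - z - snd (w k))))"
        using c[of k] by (simp add: norm_mult ennreal_mult)
      also have "\<dots> \<le> ennreal (c k) * (ennreal C * (bracket_kernel N (\<zeta> - fst (w k)) * bracket_kernel N (- z - snd (w k))))"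
        by (intro mult_left_mono C) auto
      also have "bracket_kernel N (- z - snd (w k)) = bracket_kernel N (z - (- snd (w k)))"
        using bracket_kernel_minus_commute[of N "- snd (w k)" z] by (simp add: minus_diff_commute[of z])
      finally show "ennreal (norm (of_real (c k) * distribution_of (tf_shift \<psi> (w k)) (tf_shift ?\<eta> (\<zeta>, z))))
        \<le> ennreal C * (ennreal (c k) * bracket_kernel N (\<zeta> - fst (w k))) * bracket_kernel N (z - (- snd (w k)))"
        by (simp add: ac_simps)
    qed auto
    finally show ?thesis .
  qed
  with C(1) show ?thesis by (rule that)
qed


text \<open>The short-time Fourier transform of the series is dominated by bumps at the phase space
  positions of the atoms. Summable coefficients allow any positions. Positions on a lattice separate
  the bumps in the outer variable, where only the exponent \<open>q\<close> counts. Pure modulations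
  share one position and separate in the inner variable, where only \<open>p\<close> counts.\<close>

lemma tf_series_wiener_amalgam:
  fixes \<psi> \<Phi> :: "'a::euclidean_space \<Rightarrow> complex"
  assumes \<psi>: "\<psi> \<in> schwartz_space" and \<Phi>: "\<Phi> \<in> schwartz_space" and c: "\<And>k. 0 \<le> c k"
    and tempered: "tf_series \<psi> c w \<in> tempered_distributions" and p: "1 \<le> p" and q: "1 \<le> q" and b: "b \<in> Basis"
    and cases: "summable c \<or>
      (\<forall>k. c k \<le> 1) \<and> (\<forall>k. fst (w k) = real k *\<^sub>R b) \<and> (q \<noteq> \<infinity> \<longrightarrow> summable (\<lambda>k. c k powr enn2real q)) \<or>
      (\<forall>k. c k \<le> 1) \<and> (\<forall>k. w k = (0, - (real k *\<^sub>R b))) \<and> (p \<noteq> \<infinity> \<longrightarrow> summable (\<lambda>k. c k powr enn2real p))"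
  shows "tf_series \<psi> c w \<in> wiener_amalgam \<Phi> p q"
proof -
  define N where "N = 2 * DIM('a)"
  have N: "2 * DIM('a) \<le> N" by (simp add: N_def)
  obtain C where C': "0 < C" "\<And>\<zeta> z. ennreal (norm (stft \<Phi> (tf_series \<psi> c w) \<zeta> (- z)))
    \<le> (\<Sum>k. ennreal C * (ennreal (c k) * bracket_kernel N (\<zeta> - fst (w k))) * bracket_kernel N (z - (- snd (w k))))"
    by (rule stft_tf_series_le[where c = c and w = w and N = N, OF \<psi> \<Phi> c]) (rule that)
  define \<sigma> where "\<sigma> = tf_series \<psi> c w"
  note C = C'[folded \<sigma>_def]
  have kernel_measurable: "(\<lambda>x::'a. \<Sum>k. ennreal (d k) * bracket_kernel N (x - Z k)) \<in> borel_measurable borel" for d Z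
  proof -
    have "(\<lambda>x. bracket_kernel N (x - Z k)) \<in> borel_measurable borel" for k by measurable
    then show ?thesis by measurable
  qed
  define h where "h \<zeta> z = ennreal (norm (stft \<Phi> \<sigma> \<zeta> (- z)))" for \<zeta> z
  have h: "(\<lambda>w. h (fst w) (snd w)) \<in> borel_measurable borel"
    unfolding h_def using stft_measurable(2)[OF tempered[folded \<sigma>_def] \<Phi>] by measurable
  then have h2: "(\<lambda>(\<zeta>, z). h \<zeta> z) \<in> borel_measurable (borel \<Otimes>\<^sub>M borel)"
    by (simp add: borel_prod split_beta')
  then have h1: "h \<zeta> \<in> borel_measurable borel" for \<zeta>
    using measurable_compose[OF _ h, of "\<lambda>z. (\<zeta>, z)" borel]
    by (simp add: borel_measurable_continuous_onI continuous_intros)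
  have hp: "(\<lambda>\<zeta>. Lp_enorm p (h \<zeta>)) \<in> borel_measurable borel" by (rule Lp_enorm_measurable[OF h2])
  note inner = Lp_enorm_mono[OF p h1 C(2)[folded h_def], THEN order.trans]
  have "Lp_enorm q (\<lambda>\<zeta>. Lp_enorm p (h \<zeta>)) < \<infinity>"
    using cases
  proof (elim disjE)
    assume s: "summable c"
    obtain D where D: "1 \<le> D" "\<And>(w :: nat \<Rightarrow> ennreal) Z. Lp_enorm p (\<lambda>z::'a. \<Sum>k. w k * bracket_kernel N (z - Z k)) \<le> ennreal D * (\<Sum>k. w k)"
      using Lp_enorm_kernel_sum[OF N p] by blast
    obtain D' where D': "1 \<le> D'" "\<And>(w :: nat \<Rightarrow> ennreal) Z. Lp_enorm q (\<lambda>z::'a. \<Sum>k. w k * bracket_kernel N (z - Z k)) \<le> ennreal D' * (\<Sum>k. w k)"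
      using Lp_enorm_kernel_sum[OF N q] by blast
    have "Lp_enorm p (h \<zeta>) \<le> ennreal D * (\<Sum>k. ennreal C * (ennreal (c k) * bracket_kernel N (\<zeta> - fst (w k))))" for \<zeta>
      by (rule inner, rule D(2))
    also have "ennreal D * (\<Sum>k. ennreal C * (ennreal (c k) * bracket_kernel N (\<zeta> - fst (w k))))
      = (\<Sum>k. (ennreal (D * C) * ennreal (c k)) * bracket_kernel N (\<zeta> - fst (w k)))" for \<zeta>
      using D(1) C(1) by (simp add: ennreal_mult mult.assoc)
    finally have "Lp_enorm q (\<lambda>\<zeta>. Lp_enorm p (h \<zeta>)) \<le> ennreal D' * (\<Sum>k. ennreal (D * C) * ennreal (c k))"
      by (rule order.trans[OF Lp_enorm_mono[OF q hp] D'(2)])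
    also have "(\<Sum>k. ennreal (D * C) * ennreal (c k)) = ennreal (D * C) * ennreal (suminf c)"
      using suminf_ennreal2[OF c s] by simp
    also have "ennreal D' * (ennreal (D * C) * ennreal (suminf c)) < \<infinity>" by (simp add: ennreal_mult_less_top)
    finally show ?thesis .
  next
    assume lattice: "(\<forall>k. c k \<le> 1) \<and> (\<forall>k. fst (w k) = real k *\<^sub>R b) \<and> (q \<noteq> \<infinity> \<longrightarrow> summable (\<lambda>k. c k powr enn2real q))"
    obtain D where D: "1 \<le> D" "\<And>(w :: nat \<Rightarrow> ennreal) Z. Lp_enorm p (\<lambda>z::'a. \<Sum>k. w k * bracket_kernel N (z - Z k)) \<le> ennreal D * (\<Sum>k. w k)"
      using Lp_enorm_kernel_sum[OF N p] by blast
    let ?K = "\<lambda>\<zeta>. \<Sum>k. ennreal (c k) * bracket_kernel N (\<zeta> - real k *\<^sub>R b)"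
    have "Lp_enorm p (h \<zeta>) \<le> ennreal D * (\<Sum>k. ennreal C * (ennreal (c k) * bracket_kernel N (\<zeta> - fst (w k))))" for \<zeta>
      by (rule inner, rule D(2))
    also have "ennreal D * (\<Sum>k. ennreal C * (ennreal (c k) * bracket_kernel N (\<zeta> - fst (w k)))) = ennreal (D * C) * ?K \<zeta>" for \<zeta>
      using D(1) C(1) lattice by (simp add: ennreal_mult mult.assoc)
    finally have "Lp_enorm q (\<lambda>\<zeta>. Lp_enorm p (h \<zeta>)) \<le> Lp_enorm q (\<lambda>\<zeta>. ennreal (D * C) * ?K \<zeta>)"
      by (intro Lp_enorm_mono q hp)
    also have "\<dots> \<le> ennreal (D * C) * Lp_enorm q ?K"
      using D C by (intro Lp_enorm_cmult_le q kernel_measurable) auto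
    also have "\<dots> < \<infinity>"
      using Lp_enorm_lattice_kernel_sum[where c = c, OF N q b c] lattice by (simp add: ennreal_mult_less_top)
    finally show ?thesis .
  next
    assume lattice: "(\<forall>k. c k \<le> 1) \<and> (\<forall>k. w k = (0, - (real k *\<^sub>R b))) \<and> (p \<noteq> \<infinity> \<longrightarrow> summable (\<lambda>k. c k powr enn2real p))"
    let ?K = "\<lambda>z. \<Sum>k. ennreal (c k) * bracket_kernel N (z - real k *\<^sub>R b)"
    obtain M where M: "Lp_enorm p ?K = ennreal M" "0 \<le> M"
      using Lp_enorm_lattice_kernel_sum[where c = c, OF N p b c] lattice by (auto simp: less_top_ennreal)
    have le: "Lp_enorm p (h \<zeta>) \<le> ennreal (C * M) * bracket_kernel N \<zeta>" for \<zeta>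
    proof -
      let ?t = "C * inverse (\<langle>\<zeta>\<rangle> ^ N)"
      have "(\<Sum>k. ennreal C * (ennreal (c k) * bracket_kernel N (\<zeta> - fst (w k))) * bracket_kernel N (z - (- snd (w k)))) = ennreal ?t * ?K z" for z
        using lattice C(1) by (simp add: bracket_kernel_def[of N \<zeta>] ennreal_mult ac_simps flip: ennreal_suminf_cmult)
      then have "Lp_enorm p (h \<zeta>) \<le> Lp_enorm p (\<lambda>z. ennreal ?t * ?K z)"
        using Lp_enorm_mono[OF p h1 C(2)[folded h_def, of \<zeta>]] by presburger
      also have "\<dots> \<le> ennreal ?t * Lp_enorm p ?K"
        using C by (intro Lp_enorm_cmult_le p kernel_measurable) auto
      also have "\<dots> = ennreal (C * M) * bracket_kernel N \<zeta>"
        using C(1) M by (simp add: bracket_kernel_def ac_simps flip: ennreal_mult)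
      finally show ?thesis .
    qed
    obtain D where D: "1 \<le> D" "\<And>(w :: nat \<Rightarrow> ennreal) Z. Lp_enorm q (\<lambda>z::'a. \<Sum>k. w k * bracket_kernel N (z - Z k)) \<le> ennreal D * (\<Sum>k. w k)"
      using Lp_enorm_kernel_sum[OF N q] by blast
    \<comment> \<open>A single bump is written as a kernel sum with one nonzero coefficient to reuse
      the estimate for sums.\<close>
    have "Lp_enorm q (\<lambda>\<zeta>. Lp_enorm p (h \<zeta>)) \<le> Lp_enorm q (\<lambda>\<zeta>::'a. \<Sum>k. (if k = (0::nat) then ennreal (C * M) else 0) * bracket_kernel N (\<zeta> - 0))"
    proof (rule Lp_enorm_mono[OF q hp])
      fix \<zeta> :: 'a
      have "ennreal (C * M) * bracket_kernel N \<zeta> \<le> (\<Sum>k. (if k = 0 then ennreal (C * M) else 0) * bracket_kernel N (\<zeta> - 0))"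
        using sum_le_suminf[of "\<lambda>k. (if k = 0 then ennreal (C * M) else 0) * bracket_kernel N (\<zeta> - 0)" "{0}"] by simp
      then show "Lp_enorm p (h \<zeta>) \<le> (\<Sum>k. (if k = 0 then ennreal (C * M) else 0) * bracket_kernel N (\<zeta> - 0))"
        by (rule order.trans[OF le])
    qed
    also have "\<dots> \<le> ennreal D * (\<Sum>k. if k = 0 then ennreal (C * M) else 0)" by (rule D(2))
    also have "(\<Sum>k::nat. if k = 0 then ennreal (C * M) else 0) = ennreal (C * M)"
      using suminf_finite[of "{0::nat}" "\<lambda>k. if k = 0 then ennreal (C * M) else 0"] by simp
    also have "ennreal D * ennreal (C * M) < \<infinity>" by (simp add: ennreal_mult_less_top)
    finally show ?thesis .
  qed
  then show ?thesis
    using tempered unfolding wiener_amalgam_def wiener_norm_def h_def \<sigma>_def by simp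
qed

section \<open>Weighted energies of Gabor atoms\<close>

text \<open>The Peetre inequality for real exponents; for negative ones \<open>x\<close> and
  \<open>y\<close> change roles.\<close>

lemma bracket_powr_shift_le: "\<langle>x\<rangle> powr r \<le> (2 * \<langle>x - y\<rangle>) powr \<bar>r\<bar> * \<langle>y\<rangle> powr r"
proof (cases "0 \<le> r")
  case True
  have "\<langle>x\<rangle> \<le> 2 * \<langle>x - y\<rangle> * \<langle>y\<rangle>" using bracket_add_le[of "x - y" y] by simp
  then have "\<langle>x\<rangle> powr r \<le> (2 * \<langle>x - y\<rangle> * \<langle>y\<rangle>) powr r" using True by (intro powr_mono2) auto
  then show ?thesis using True by (simp add: powr_mult)
next
  case False
  have "\<langle>y\<rangle> \<le> 2 * \<langle>x - y\<rangle> * \<langle>x\<rangle>" using bracket_add_le[of "y - x" x] by (simp add: bracket_minus_commute)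
  then have "\<langle>y\<rangle> powr (- r) \<le> (2 * \<langle>x - y\<rangle> * \<langle>x\<rangle>) powr (- r)" using False by (intro powr_mono2) auto
  then have "\<langle>y\<rangle> powr (- r) \<le> (2 * \<langle>x - y\<rangle>) powr \<bar>r\<bar> * \<langle>x\<rangle> powr (- r)" using False by (simp add: powr_mult)
  then show ?thesis by (simp add: powr_minus field_simps)
qed

text \<open>By covariance the energy is an integral over translates, and the weight at
  \<open>v\<close> is compared with the weight at \<open>w\<close> at the cost of a power of the
  bracket of the difference. That power is integrated against the decaying transform, with a result
  independent of \<open>w\<close>.\<close>

lemma gabor_energy_tf_shift_le:
  fixes f \<psi> :: "'a::euclidean_space \<Rightarrow> complex"
  assumes f: "f \<in> schwartz_space" and \<psi>: "\<psi> \<in> schwartz_space"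
  obtains C where "0 \<le> C" "\<And>w. gabor_energy \<psi> r (tf_shift f w) \<le> ennreal (C * \<langle>snd w\<rangle> powr (2 * r))"
proof -
  define k where "k = nat \<lceil>\<bar>r\<bar>\<rceil>"
  have k: "\<bar>r\<bar> \<le> real k" unfolding k_def by linarith
  obtain B where B: "0 < B" "\<And>x z. \<langle>x\<rangle> ^ k * \<langle>z\<rangle> ^ k * norm (gabor f \<psi> (x, z)) \<le> B"
    using gabor_decay[OF f \<psi>] by blast
  have pk: "\<langle>x\<rangle> powr \<bar>r\<bar> \<le> \<langle>x\<rangle> ^ k" for x :: 'a
    using powr_mono[OF k bracket_ge_1, of x] by (simp add: powr_realpow)
  define F where "F w = (ennreal (norm (gabor f \<psi> w) * \<langle>snd w\<rangle> powr \<bar>r\<bar>))\<^sup>2" for w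
  have [measurable]: "gabor f \<psi> \<in> borel_measurable borel" by (rule gabor_measurable[OF f \<psi>])
  have [measurable]: "F \<in> borel_measurable borel" unfolding F_def by measurable
  have "(\<integral>\<^sup>+w. F w \<partial>lborel) \<le> (\<integral>\<^sup>+w. ennreal (B * (norm (gabor f \<psi> w) * \<langle>w\<rangle> ^ k)) \<partial>lborel)"
  proof (rule nn_integral_mono)
    fix w :: "'a \<times> 'a"
    let ?g = "norm (gabor f \<psi> w)"
    have "?g * \<langle>snd w\<rangle> powr \<bar>r\<bar> \<le> ?g * \<langle>snd w\<rangle> ^ k" by (intro mult_left_mono pk) auto
    also have "1 * (?g * \<langle>snd w\<rangle> ^ k) \<le> \<langle>fst w\<rangle> ^ k * (?g * \<langle>snd w\<rangle> ^ k)"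
      by (intro mult_right_mono bracket_power_ge_1) auto
    also have "\<dots> \<le> B" using B(2)[of "fst w" "snd w"] by (simp add: ac_simps)
    finally have 1: "?g * \<langle>snd w\<rangle> powr \<bar>r\<bar> \<le> B" by simp
    have "?g * \<langle>snd w\<rangle> powr \<bar>r\<bar> \<le> ?g * \<langle>w\<rangle> ^ k"
      using pk[of "snd w"] power_mono[OF bracket_snd_le[of w], of k] by (intro mult_left_mono) auto
    then have "(?g * \<langle>snd w\<rangle> powr \<bar>r\<bar>)\<^sup>2 \<le> B * (?g * \<langle>w\<rangle> ^ k)"
      unfolding power2_eq_square by (rule mult_mono[OF 1]) (use B(1) in auto)
    then show "F w \<le> ennreal (B * (?g * \<langle>w\<rangle> ^ k))"
      unfolding F_def by (simp add: ennreal_power ennreal_leI)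
  qed
  also have "\<dots> < \<infinity>"
    using integrable_mult_right[OF gabor_weighted_integrable[OF f \<psi>, of k], of B] B(1)
    unfolding integrable_iff_bounded by simp
  finally obtain I where I: "(\<integral>\<^sup>+w. F w \<partial>lborel) = ennreal I" "0 \<le> I" by (auto simp: less_top_ennreal)
  let ?D = "(2 powr \<bar>r\<bar>)\<^sup>2"
  show ?thesis
  proof (rule that[of "?D * I"])
    fix w :: "'a \<times> 'a"
    have "gabor_energy \<psi> r (tf_shift f w) \<le> (\<integral>\<^sup>+v. ennreal (?D * \<langle>snd w\<rangle> powr (2 * r)) * F (v - w) \<partial>lborel)"
      unfolding gabor_energy_def
    proof (rule nn_integral_mono)
      fix v :: "'a \<times> 'a"
      let ?g = "norm (gabor f \<psi> (v - w))"
      have "norm (gabor (tf_shift f w) \<psi> v) * \<langle>snd v\<rangle> powr r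
        \<le> ?g * ((2 * \<langle>snd v - snd w\<rangle>) powr \<bar>r\<bar> * \<langle>snd w\<rangle> powr r)"
        unfolding norm_gabor_tf_shift[OF f \<psi>] by (intro mult_left_mono bracket_powr_shift_le) auto
      also have "\<dots> = (2 powr \<bar>r\<bar> * \<langle>snd w\<rangle> powr r) * (?g * \<langle>snd (v - w)\<rangle> powr \<bar>r\<bar>)"
        by (simp add: powr_mult ac_simps)
      finally have "(ennreal (norm (gabor (tf_shift f w) \<psi> v) * \<langle>snd v\<rangle> powr r))\<^sup>2
        \<le> (ennreal ((2 powr \<bar>r\<bar> * \<langle>snd w\<rangle> powr r) * (?g * \<langle>snd (v - w)\<rangle> powr \<bar>r\<bar>)))\<^sup>2"
        by (intro power_mono ennreal_leI) auto
      also have "\<dots> = ennreal ((2 powr \<bar>r\<bar> * \<langle>snd w\<rangle> powr r)\<^sup>2) * F (v - w)"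
        unfolding F_def by (simp add: ennreal_mult power_mult_distrib ennreal_power)
      also have "(2 powr \<bar>r\<bar> * \<langle>snd w\<rangle> powr r)\<^sup>2 = ?D * \<langle>snd w\<rangle> powr (2 * r)"
        by (simp add: power_mult_distrib) (simp add: power2_eq_square flip: powr_add)
      finally show "(ennreal (norm (gabor (tf_shift f w) \<psi> v) * \<langle>snd v\<rangle> powr r))\<^sup>2
        \<le> ennreal (?D * \<langle>snd w\<rangle> powr (2 * r)) * F (v - w)" .
    qed
    also have "\<dots> = ennreal (?D * \<langle>snd w\<rangle> powr (2 * r)) * (\<integral>\<^sup>+v. F (v - w) \<partial>lborel)"
      by (rule nn_integral_cmult) measurable
    also have "(\<integral>\<^sup>+v. F (v - w) \<partial>lborel) = ennreal I"
      unfolding I(1)[symmetric] by (rule nn_integral_translate) measurable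
    also have "ennreal (?D * \<langle>snd w\<rangle> powr (2 * r)) * ennreal I = ennreal (?D * I * \<langle>snd w\<rangle> powr (2 * r))"
      using I(2) by (simp add: ac_simps flip: ennreal_mult)
    finally show "gabor_energy \<psi> r (tf_shift f w) \<le> ennreal (?D * I * \<langle>snd w\<rangle> powr (2 * r))" .
  qed (use I in auto)
qed

lemma gabor_sum:
  assumes J: "finite J" and F: "\<And>j. j \<in> J \<Longrightarrow> F j \<in> schwartz_space" and \<psi>: "\<psi> \<in> schwartz_space"
  shows "gabor (\<lambda>x. \<Sum>j\<in>J. of_real (d j) * F j x) \<psi> w = (\<Sum>j\<in>J. of_real (d j) * gabor (F j) \<psi> w)"
proof -
  have T: "distribution_of (tf_shift \<psi> (fst w, - snd w)) \<in> tempered_distributions"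
    by (intro distribution_of_schwartz tf_shift_schwartz \<psi>)
  have g: "gabor f \<psi> w = distribution_of (tf_shift \<psi> (fst w, - snd w)) f" for f
    unfolding gabor_eq_distribution_of by (simp add: distribution_of_def mult.commute)
  show ?thesis
    unfolding g using J F
  proof (induction J rule: finite_induct)
    case empty
    then show ?case by (simp add: distribution_of_def)
  next
    case (insert j J)
    have "(\<lambda>x. of_real (d j) * F j x) \<in> schwartz_space" "(\<lambda>x. \<Sum>j\<in>J. of_real (d j) * F j x) \<in> schwartz_space"
      using insert by (auto intro!: schwartz_scale schwartz_sum)
    then show ?case
      using insert temperedD_add[OF T] temperedD_scale[OF T] by simp
  qed
qed

text \<open>Translates of a decaying atom along a lattice are almost orthogonal. Bounded overlap of
  the kernels, used through the weighted inequality with exponent 2, replaces orthogonality and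
  leaves the sum of the squared coefficients.\<close>

lemma gabor_energy_lattice_sum_le:
  fixes f \<psi> :: "'a::euclidean_space \<Rightarrow> complex" and b :: 'a
  assumes f: "f \<in> schwartz_space" and \<psi>: "\<psi> \<in> schwartz_space" and b: "b \<in> Basis" and \<epsilon>: "\<epsilon> \<in> {1, - 1 :: real}"
  shows "\<exists>C\<ge>0. \<forall>n d. (\<forall>j. 0 \<le> d j) \<longrightarrow>
    gabor_energy \<psi> r (\<lambda>x. \<Sum>j<n. of_real (d j) * tf_shift f ((\<epsilon> * real j) *\<^sub>R b, 0) x)
      \<le> ennreal (C * (\<Sum>j<n. (d j)\<^sup>2))"
proof -
  define M where "M = 2 * DIM('a)"
  define k where "k = nat \<lceil>\<bar>r\<bar>\<rceil>"
  \<comment> \<open>Of these powers \<open>k\<close> pays for the weight of exponent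
    \<open>r\<close>, and \<open>M\<close> remain as an integrable kernel.\<close>
  define N where "N = M + k"
  let ?K = "bracket_kernel M :: 'a \<Rightarrow> ennreal"
  have M: "2 * DIM('a) \<le> M" "2 \<le> M" using DIM_positive[where 'a = 'a] by (auto simp: M_def)
  have k: "r \<le> real k" unfolding k_def by linarith
  obtain C where C: "0 < C" "\<And>x z. ennreal (norm (gabor f \<psi> (x, z))) \<le> ennreal C * (bracket_kernel N x * bracket_kernel N z)"
    using gabor_le_bracket_kernel[OF f \<psi>] by blast
  obtain S :: real where S: "0 \<le> S" "\<And>b x. b \<in> Basis \<Longrightarrow> (\<Sum>k. bracket_kernel M (real k *\<^sub>R b - (x :: 'a))) \<le> ennreal S"
    using bracket_kernel_lattice_sum[OF M(2)] by blast
  obtain I where I: "(\<integral>\<^sup>+x. bracket_kernel M (x::'a) \<partial>lborel) = ennreal I" "0 \<le> I"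
    using nn_integral_bracket_kernel[OF M(1)] by (auto simp: less_top_ennreal)
  define a where "a j = (\<epsilon> * real j) *\<^sub>R b" for j
  have S': "(\<Sum>j. ?K (x - a j)) \<le> ennreal S" for x
  proof -
    have "?K (x - a j) = ?K (real j *\<^sub>R b - \<epsilon> *\<^sub>R x)" for j
      using \<epsilon> bracket_kernel_minus_commute[of M x "a j"]
      by (auto simp: a_def bracket_kernel_def add.commute)
    then show ?thesis using S(2)[OF b, of "\<epsilon> *\<^sub>R x"] by simp
  qed
  have tr: "(\<integral>\<^sup>+x. ?K (x - y) \<partial>lborel) = ennreal I" for y
    unfolding I(1)[symmetric] by (rule nn_integral_translate) measurable
  have NM: "bracket_kernel N x \<le> ?K x" for x :: 'a
    unfolding bracket_kernel_def N_def
    by (intro ennreal_leI le_imp_inverse_le power_increasing bracket_ge_1) auto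
  have Nr: "bracket_kernel N z * ennreal (\<langle>z\<rangle> powr r) \<le> ?K z" for z :: 'a
  proof -
    have "\<langle>z\<rangle> powr r \<le> \<langle>z\<rangle> ^ k" using powr_mono[OF k bracket_ge_1, of z] by (simp add: powr_realpow)
    then have "inverse (\<langle>z\<rangle> ^ N) * \<langle>z\<rangle> powr r \<le> inverse (\<langle>z\<rangle> ^ N) * \<langle>z\<rangle> ^ k" by (intro mult_left_mono) auto
    also have "\<dots> = inverse (\<langle>z\<rangle> ^ M)" by (simp add: N_def power_add)
    finally show ?thesis by (simp add: bracket_kernel_def ennreal_leI flip: ennreal_mult)
  qed
  have "gabor_energy \<psi> r (\<lambda>x. \<Sum>j<n. of_real (d j) * tf_shift f (a j, 0) x)
      \<le> ennreal ((C\<^sup>2 * (S + 1) powr 2 * I\<^sup>2) * (\<Sum>j<n. (d j)\<^sup>2))" if d: "\<And>j. 0 \<le> d j" for n d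
  proof -
    \<comment> \<open>Padding with zeros turns the finite sum into a series to which the weighted
      inequality applies.\<close>
    define e where "e j = (if j < n then d j else 0)" for j
    have e: "0 \<le> e j" for j using d by (simp add: e_def)
    have [measurable]: "(\<lambda>x. ?K (x - a j)) \<in> borel_measurable borel" for j by measurable
    define P where "P x = ennreal (C\<^sup>2 * (S + 1) powr 2) * (\<Sum>j<n. ennreal ((d j)\<^sup>2) * ?K (x - a j))" for x
    have [measurable]: "P \<in> borel_measurable borel" unfolding P_def by measurable
    have "gabor_energy \<psi> r (\<lambda>x. \<Sum>j<n. of_real (d j) * tf_shift f (a j, 0) x)
      \<le> (\<integral>\<^sup>+w. P (fst w) * ?K (snd w) \<partial>lborel)"
      unfolding gabor_energy_def
    proof (rule nn_integral_mono)
      fix w :: "'a \<times> 'a"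
      let ?m = "gabor (\<lambda>x. \<Sum>j<n. of_real (d j) * tf_shift f (a j, 0) x) \<psi> w"
      have "norm ?m \<le> (\<Sum>j<n. norm (of_real (d j) * gabor (tf_shift f (a j, 0)) \<psi> w))"
        by (subst gabor_sum) (auto intro!: tf_shift_schwartz f \<psi> norm_sum)
      then have "ennreal (norm ?m) \<le> ennreal (\<Sum>j<n. norm (of_real (d j) * gabor (tf_shift f (a j, 0)) \<psi> w))"
        by (rule ennreal_leI)
      also have "\<dots> = (\<Sum>j<n. ennreal (norm (of_real (d j) * gabor (tf_shift f (a j, 0)) \<psi> w)))"
        by (rule sum_ennreal[symmetric]) simp
      also have "\<dots> \<le> (\<Sum>j<n. (ennreal C * bracket_kernel N (snd w)) * (ennreal (d j) * ?K (fst w - a j)))"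
      proof (rule sum_mono)
        fix j
        have "ennreal (norm (of_real (d j) * gabor (tf_shift f (a j, 0)) \<psi> w)) = ennreal (d j) * ennreal (norm (gabor f \<psi> (fst w - a j, snd w)))"
          using d[of j] by (simp add: norm_mult norm_gabor_tf_shift[OF f \<psi>] ennreal_mult minus_prod_def)
        also have "\<dots> \<le> ennreal (d j) * (ennreal C * (?K (fst w - a j) * bracket_kernel N (snd w)))"
          by (intro mult_left_mono order.trans[OF C(2)] mult_right_mono NM) auto
        finally show "ennreal (norm (of_real (d j) * gabor (tf_shift f (a j, 0)) \<psi> w))
          \<le> (ennreal C * bracket_kernel N (snd w)) * (ennreal (d j) * ?K (fst w - a j))"
          by (simp add: ac_simps)
      qed
      also have "\<dots> = ennreal C * bracket_kernel N (snd w) * (\<Sum>j<n. ennreal (d j) * ?K (fst w - a j))"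
        by (rule sum_distrib_left[symmetric])
      finally have "ennreal (norm ?m) * ennreal (\<langle>snd w\<rangle> powr r)
        \<le> ennreal C * bracket_kernel N (snd w) * (\<Sum>j<n. ennreal (d j) * ?K (fst w - a j)) * ennreal (\<langle>snd w\<rangle> powr r)"
        by (rule mult_right_mono) simp
      also have "\<dots> = ennreal C * (\<Sum>j<n. ennreal (d j) * ?K (fst w - a j)) * (bracket_kernel N (snd w) * ennreal (\<langle>snd w\<rangle> powr r))"
        by (simp only: ac_simps)
      also have "\<dots> \<le> ennreal C * (\<Sum>j<n. ennreal (d j) * ?K (fst w - a j)) * ?K (snd w)"
        by (intro mult_left_mono Nr) auto
      finally have "(ennreal (norm ?m * \<langle>snd w\<rangle> powr r))\<^sup>2 \<le> (ennreal C * (\<Sum>j<n. ennreal (d j) * ?K (fst w - a j)) * ?K (snd w))\<^sup>2"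
        by (intro power_mono) (auto simp: ennreal_mult)
      also have "\<dots> = (ennreal (C\<^sup>2) * (\<Sum>j<n. ennreal (d j) * ?K (fst w - a j))\<^sup>2) * (?K (snd w) * ?K (snd w))"
        using C(1) by (simp add: power_mult_distrib power2_eq_square[of "?K (snd w)"] ennreal_power)
      also have "\<dots> \<le> (ennreal (C\<^sup>2) * (ennreal ((S + 1) powr 2) * (\<Sum>j<n. ennreal ((d j)\<^sup>2) * ?K (fst w - a j)))) * (?K (snd w) * 1)"
      proof (intro mult_mono mult_left_mono bracket_kernel_le_1)
        have "(\<Sum>j<n. ennreal (d j) * ?K (fst w - a j)) = (\<Sum>j. ennreal (e j) * ?K (fst w - a j))"
          by (subst suminf_finite[of "{..<n}"]) (auto simp: e_def)
        moreover have "(\<Sum>j<n. ennreal ((d j)\<^sup>2) * ?K (fst w - a j)) = (\<Sum>j. ennreal (e j powr 2) * ?K (fst w - a j))"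
          using d by (subst suminf_finite[of "{..<n}"]) (auto simp: e_def)
        ultimately show "(\<Sum>j<n. ennreal (d j) * ?K (fst w - a j))\<^sup>2
          \<le> ennreal ((S + 1) powr 2) * (\<Sum>j<n. ennreal ((d j)\<^sup>2) * ?K (fst w - a j))"
          using weighted_suminf_powr_le[of e 2 "\<lambda>j. ?K (fst w - a j)" S, OF e _ S' S(1)] by (simp add: ennreal_powr_two)
      qed auto
      finally show "(ennreal (norm ?m * \<langle>snd w\<rangle> powr r))\<^sup>2
        \<le> P (fst w) * ?K (snd w)"
        by (simp add: P_def ennreal_mult mult.assoc)
    qed
    also have "\<dots> = (\<integral>\<^sup>+x. (\<integral>\<^sup>+z. P x * ?K z \<partial>lborel) \<partial>lborel)"
    proof (subst nn_integral_lborel_Pair)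
      have "fst \<in> borel_measurable (borel :: ('a \<times> 'a) measure)" "snd \<in> borel_measurable (borel :: ('a \<times> 'a) measure)"
        by (intro borel_measurable_continuous_onI continuous_intros)+
      then show "(\<lambda>w. P (fst w) * ?K (snd w)) \<in> borel_measurable borel"
        using measurable_compose[of fst borel borel P borel] measurable_compose[of snd borel borel ?K borel] by measurable
    qed simp
    also have "\<dots> = (\<integral>\<^sup>+x. P x * ennreal I \<partial>lborel)"
      by (intro nn_integral_cong, subst nn_integral_cmult) (measurable, simp only: I(1))
    also have "\<dots> = (\<integral>\<^sup>+x. P x \<partial>lborel) * ennreal I"
      by (rule nn_integral_multc) measurable
    also have "(\<integral>\<^sup>+x. P x \<partial>lborel) = ennreal (C\<^sup>2 * (S + 1) powr 2) * (\<integral>\<^sup>+x. (\<Sum>j<n. ennreal ((d j)\<^sup>2) * ?K (x - a j)) \<partial>lborel)"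
      unfolding P_def by (rule nn_integral_cmult) measurable
    also have "(\<integral>\<^sup>+x. (\<Sum>j<n. ennreal ((d j)\<^sup>2) * ?K (x - a j)) \<partial>lborel) = (\<Sum>j<n. \<integral>\<^sup>+x. ennreal ((d j)\<^sup>2) * ?K (x - a j) \<partial>lborel)"
      by (rule nn_integral_sum) measurable
    also have "\<dots> = (\<Sum>j<n. ennreal ((d j)\<^sup>2) * ennreal I)"
      by (intro sum.cong refl, subst nn_integral_cmult) (auto simp: tr)
    also have "\<dots> = (\<Sum>j<n. ennreal ((d j)\<^sup>2)) * ennreal I" by (rule sum_distrib_right[symmetric])
    also have "(\<Sum>j<n. ennreal ((d j)\<^sup>2)) = ennreal (\<Sum>j<n. (d j)\<^sup>2)" by (rule sum_ennreal) simp
    also have "ennreal (C\<^sup>2 * (S + 1) powr 2) * (ennreal (\<Sum>j<n. (d j)\<^sup>2) * ennreal I) * ennreal I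
      = ennreal ((C\<^sup>2 * (S + 1) powr 2 * I\<^sup>2) * (\<Sum>j<n. (d j)\<^sup>2))"
      using I(2) S(1) by (simp add: sum_nonneg power2_eq_square[of I] ac_simps flip: ennreal_mult)
    finally show ?thesis .
  qed
  then show ?thesis
    unfolding a_def using S(1) I(2) by (intro exI[of _ "C\<^sup>2 * (S + 1) powr 2 * I\<^sup>2"]) auto
qed

section \<open>Chirped tensor products as symbols\<close>

text \<open>For \<open>s = 1 - 2 * \<tau>\<close> the chirp is the conjugate of the one in
  \<open>wigner_test \<tau>\<close>, so it disappears when the two are multiplied.\<close>

definition chirp_tensor :: "real \<Rightarrow> ('a::euclidean_space \<Rightarrow> complex) \<Rightarrow> ('a \<Rightarrow> complex) \<Rightarrow> 'a \<times> 'a \<Rightarrow> complex" where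
  "chirp_tensor s a b = (\<lambda>(x, \<xi>). cis (- 2 * pi * s * (x \<bullet> \<xi>)) * (a x * b \<xi>))"

lemma chirp_tensor_schwartz:
  assumes "a \<in> schwartz_space" "b \<in> schwartz_space"
  shows "chirp_tensor s a b \<in> schwartz_space"
  using schwartz_chirp[OF schwartz_tensor[OF assms], of "- 2 * pi * s"] by (simp add: chirp_tensor_def)

definition symbol_shift :: "real \<Rightarrow> 'a::euclidean_space \<times> 'a \<Rightarrow> 'a \<times> 'a \<Rightarrow> ('a \<times> 'a) \<times> ('a \<times> 'a)" where
  "symbol_shift s \<alpha> \<beta> = ((fst \<alpha>, fst \<beta>), (snd \<alpha> - s *\<^sub>R fst \<beta>, snd \<beta> - s *\<^sub>R fst \<alpha>))"

text \<open>Expanding the bilinear phase around the shifted point, the mixed terms are modulations: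
  a position shift in one factor becomes a frequency shift in the other variable. The constant term
  is a phase, which the orthogonality hypothesis makes trivial.\<close>

lemma chirp_tensor_tf_shift:
  assumes "fst \<alpha> \<bullet> fst \<beta> = 0"
  shows "chirp_tensor s (tf_shift f \<alpha>) (tf_shift g \<beta>) = tf_shift (chirp_tensor s f g) (symbol_shift s \<alpha> \<beta>)"
proof
  fix y :: "'a \<times> 'a"
  obtain x \<xi> where y: "y = (x, \<xi>)" by (cases y)
  have "cis (- 2 * pi * s * (x \<bullet> \<xi>)) * (cis (2 * pi * (x \<bullet> snd \<alpha>)) * cis (2 * pi * (\<xi> \<bullet> snd \<beta>)))
    = cis (2 * pi * (x \<bullet> (snd \<alpha> - s *\<^sub>R fst \<beta>) + \<xi> \<bullet> (snd \<beta> - s *\<^sub>R fst \<alpha>)))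
      * cis (- 2 * pi * s * ((x - fst \<alpha>) \<bullet> (\<xi> - fst \<beta>)))"
    using assms by (simp add: cis_mult inner_diff_left inner_diff_right inner_commute algebra_simps)
  then have "cis (- 2 * pi * s * (x \<bullet> \<xi>)) * (cis (2 * pi * (x \<bullet> snd \<alpha>)) * cis (2 * pi * (\<xi> \<bullet> snd \<beta>))) * (f (x - fst \<alpha>) * g (\<xi> - fst \<beta>))
    = cis (2 * pi * (x \<bullet> (snd \<alpha> - s *\<^sub>R fst \<beta>) + \<xi> \<bullet> (snd \<beta> - s *\<^sub>R fst \<alpha>)))
      * cis (- 2 * pi * s * ((x - fst \<alpha>) \<bullet> (\<xi> - fst \<beta>))) * (f (x - fst \<alpha>) * g (\<xi> - fst \<beta>))"
    by (rule arg_cong)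
  then show "chirp_tensor s (tf_shift f \<alpha>) (tf_shift g \<beta>) y = tf_shift (chirp_tensor s f g) (symbol_shift s \<alpha> \<beta>) y"
    unfolding y by (simp add: chirp_tensor_def tf_shift_apply symbol_shift_def inner_Pair ac_simps)
qed

lemma integral_tensor:
  fixes f :: "'a::euclidean_space \<Rightarrow> complex" and g :: "'b::euclidean_space \<Rightarrow> complex"
  assumes "f \<in> schwartz_space" "g \<in> schwartz_space"
  shows "(\<integral>w. f (fst w) * g (snd w) \<partial>lborel) = (\<integral>x. f x \<partial>lborel) * (\<integral>y. g y \<partial>lborel)"
proof -
  have "(\<lambda>(x, y). f x * g y) = (\<lambda>w. f (fst w) * g (snd w))" by auto
  then have "integrable lborel (\<lambda>w. f (fst w) * g (snd w))"
    using schwartz_integrable[OF schwartz_tensor[OF assms]] by simp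
  then have "integrable (lborel \<Otimes>\<^sub>M lborel) (\<lambda>w. f (fst w) * g (snd w))" by (simp add: lborel_prod)
  from lborel_pair.integral_fst'[OF this]
  have "(\<integral>w. f (fst w) * g (snd w) \<partial>lborel) = (\<integral>x. (\<integral>y. f x * g y \<partial>lborel) \<partial>lborel)"
    by (simp add: lborel_prod)
  then show ?thesis by simp
qed

text \<open>
  Up to the chirp, the Wigner distribution for \<open>\<tau> \<in> {0, 1}\<close> is the tensor product of one of the two
  functions with the Fourier transform of the other, and \<open>\<tau>\<close> decides which is which. For \<open>\<tau> = 1\<close> the
  Fourier transform appears reflected.
\<close>

definition output_slot :: "real \<Rightarrow> ('a \<Rightarrow> complex) \<Rightarrow> ('a \<Rightarrow> complex) \<Rightarrow> 'a \<Rightarrow> complex" where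
  "output_slot \<tau> h f = (if \<tau> = 0 then h else f)"

definition fourier_slot :: "real \<Rightarrow> ('a::euclidean_space \<Rightarrow> complex) \<Rightarrow> 'a \<Rightarrow> complex" where
  "fourier_slot \<tau> f = (\<lambda>\<xi>. fourier f ((1 - 2 * \<tau>) *\<^sub>R \<xi>))"

lemma fourier_slot_schwartz:
  assumes "\<tau> \<in> {0, 1}" "f \<in> schwartz_space"
  shows "fourier_slot \<tau> f \<in> schwartz_space"
  using assms(1) schwartz_fourier[OF assms(2)] schwartz_reflect[OF schwartz_fourier[OF assms(2)]]
  by (auto simp: fourier_slot_def)

text \<open>The chirps cancel and the variables separate, so the bilinear form of the operator is a
  product of one functional of \<open>f\<close> and one of \<open>h\<close>.\<close>

lemma distribution_of_chirp_tensor_wigner_test: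
  fixes f h :: "'a::euclidean_space \<Rightarrow> complex"
  assumes \<tau>: "\<tau> \<in> {0, 1}" and S: "f \<in> schwartz_space" "h \<in> schwartz_space" "a \<in> schwartz_space" "b \<in> schwartz_space"
  shows "distribution_of (chirp_tensor (1 - 2 * \<tau>) a b) (wigner_test \<tau> h f)
    = distribution_of a (output_slot \<tau> h f) * distribution_of b (fourier_slot \<tau> (output_slot \<tau> f h))"
proof -
  let ?u = "output_slot \<tau> h f" and ?V = "fourier_slot \<tau> (output_slot \<tau> f h)"
  have u: "?u \<in> schwartz_space" and V: "?V \<in> schwartz_space"
    using \<tau> S by (auto intro!: fourier_slot_schwartz simp: output_slot_def)
  have W: "wigner_test \<tau> h f w = cis (2 * pi * (1 - 2 * \<tau>) * (fst w \<bullet> snd w)) * (?u (fst w) * ?V (snd w))" for w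
    using \<tau> S by (cases w) (auto simp: wigner_test_0 wigner_test_1 output_slot_def fourier_slot_def)
  have "chirp_tensor (1 - 2 * \<tau>) a b w * wigner_test \<tau> h f w = (a (fst w) * ?u (fst w)) * (b (snd w) * ?V (snd w))" for w
  proof -
    have "cis (- 2 * pi * (1 - 2 * \<tau>) * (fst w \<bullet> snd w)) * cis (2 * pi * (1 - 2 * \<tau>) * (fst w \<bullet> snd w)) = 1"
      by (simp add: cis_mult)
    then have "cis (- 2 * pi * (1 - 2 * \<tau>) * (fst w \<bullet> snd w)) * cis (2 * pi * (1 - 2 * \<tau>) * (fst w \<bullet> snd w))
        * ((a (fst w) * ?u (fst w)) * (b (snd w) * ?V (snd w))) = (a (fst w) * ?u (fst w)) * (b (snd w) * ?V (snd w))"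
      by (metis mult_1)
    then show ?thesis unfolding W chirp_tensor_def split_beta' by (simp only: ac_simps)
  qed
  then show ?thesis
    unfolding distribution_of_def using integral_tensor[OF schwartz_mult[OF S(3) u] schwartz_mult[OF S(4) V]] by simp
qed

lemma fourier_sum:
  assumes J: "finite J" and F: "\<And>j. j \<in> J \<Longrightarrow> F j \<in> schwartz_space"
  shows "fourier (\<lambda>x. \<Sum>j\<in>J. of_real (d j) * F j x) \<xi> = (\<Sum>j\<in>J. of_real (d j) * fourier (F j) \<xi>)"
  using J F
proof (induction J rule: finite_induct)
  case empty
  then show ?case by (simp add: fourier_def)
next
  case (insert j J)
  have S: "(\<lambda>x. of_real (d j) * F j x) \<in> schwartz_space" "(\<lambda>x. \<Sum>j\<in>J. of_real (d j) * F j x) \<in> schwartz_space"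
    using insert by (auto intro!: schwartz_scale schwartz_sum)
  then show ?case
    using insert fourier_add[OF schwartz_integrable[OF S(1)] schwartz_integrable[OF S(2)], of \<xi>] by (simp add: fourier_scale)
qed

lemma distribution_of_sum:
  assumes J: "finite J" and F: "\<And>j. j \<in> J \<Longrightarrow> F j \<in> schwartz_space" and a: "a \<in> schwartz_space"
  shows "distribution_of a (\<lambda>x. \<Sum>j\<in>J. of_real (d j) * F j x) = (\<Sum>j\<in>J. of_real (d j) * distribution_of a (F j))"
  using J F
proof (induction J rule: finite_induct)
  case empty
  then show ?case by (simp add: distribution_of_def)
next
  case (insert j J)
  have "(\<lambda>x. of_real (d j) * F j x) \<in> schwartz_space" "(\<lambda>x. \<Sum>j\<in>J. of_real (d j) * F j x) \<in> schwartz_space"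
    using insert by (auto intro!: schwartz_scale schwartz_sum)
  then show ?case
    using insert temperedD_add[OF distribution_of_schwartz[OF a]] temperedD_scale[OF distribution_of_schwartz[OF a]] by simp
qed

section \<open>Overlaps of Gaussian atoms\<close>

abbreviation gauss :: "'a::euclidean_space \<Rightarrow> complex" where
  "gauss \<equiv> gaussian 1"

lemma gauss_schwartz: "gauss \<in> schwartz_space"
  by (rule schwartz_gaussian') simp

lemma fourier_gauss: "fourier gauss = gauss"
  by (rule ext) (simp add: fourier_gaussian)

lemma gauss_minus: "gauss (- x) = gauss x"
  by (simp add: gaussian_def)

lemma gauss_square: "gauss x * gauss x = gaussian (sqrt 2) x"
  by (simp add: gaussian_def flip: of_real_mult exp_add)

text \<open>Solves for the atom whose transformed slot is a prescribed one. The Fourier transform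
  exchanges position and frequency, the sign \<open>1 - 2 * \<tau>\<close> compensates the
  reflection for \<tau> = 1, and orthogonality of the components removes a phase.\<close>

lemma fourier_slot_tf_shift:
  assumes \<tau>: "\<tau> \<in> {0, 1}" and \<beta>: "fst \<beta> \<bullet> snd \<beta> = 0"
  shows "fourier_slot \<tau> (tf_shift gauss ((1 - 2 * \<tau>) *\<^sub>R (snd \<beta>, fst \<beta>))) = tf_shift gauss (fst \<beta>, - snd \<beta>)"
proof
  fix \<xi> :: 'a
  show "fourier_slot \<tau> (tf_shift gauss ((1 - 2 * \<tau>) *\<^sub>R (snd \<beta>, fst \<beta>))) \<xi> = tf_shift gauss (fst \<beta>, - snd \<beta>) \<xi>"
    using \<tau> \<beta> gauss_minus[of "\<xi> - fst \<beta>"]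
    by (auto simp: fourier_slot_def fourier_tf_shift[OF gauss_schwartz] fourier_gauss tf_shift_apply inner_diff_right inner_commute scaleR_Pair
        inner_add_right)
qed

lemma fourier_slot_gauss: "\<tau> \<in> {0, 1} \<Longrightarrow> fourier_slot \<tau> gauss = gauss"
  by (auto simp: fourier_slot_def fourier_gauss gauss_minus)

lemma tf_shift_0: "tf_shift \<psi> 0 = \<psi>"
  by (auto simp: tf_shift_apply)

text \<open>The pairing is bilinear, so an atom is matched by the one with opposite frequency: the
  modulations cancel and the squared Gaussian remains.\<close>

lemma gauss_overlap_self:
  fixes \<beta> :: "'a::euclidean_space \<times> 'a"
  shows "distribution_of (tf_shift gauss \<beta>) (tf_shift gauss (fst \<beta>, - snd \<beta>)) = of_real (l2sq (gauss :: 'a \<Rightarrow> complex))"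
proof -
  have "tf_shift gauss \<beta> x * tf_shift gauss (fst \<beta>, - snd \<beta>) x = of_real ((norm (gauss (x - fst \<beta>)))\<^sup>2)" for x
  proof -
    let ?g = "gauss (x - fst \<beta>)"
    have "tf_shift gauss \<beta> x * tf_shift gauss (fst \<beta>, - snd \<beta>) x
      = (cis (2 * pi * (x \<bullet> snd \<beta>)) * cis (2 * pi * (x \<bullet> - snd \<beta>))) * (?g * ?g)"
      unfolding tf_shift_apply fst_conv snd_conv by (simp only: ac_simps)
    also have "cis (2 * pi * (x \<bullet> snd \<beta>)) * cis (2 * pi * (x \<bullet> - snd \<beta>)) = 1" by (simp add: cis_mult)
    also have "1 * (?g * ?g) = of_real ((norm ?g)\<^sup>2)" by (simp add: gaussian_def power2_eq_square)
    finally show ?thesis .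
  qed
  then have "distribution_of (tf_shift gauss \<beta>) (tf_shift gauss (fst \<beta>, - snd \<beta>)) = (\<integral>x. of_real ((norm (gauss (x - fst \<beta>)))\<^sup>2) \<partial>lborel)"
    by (simp add: distribution_of_def)
  also have "\<dots> = of_real (\<integral>x. (norm (gauss (x - fst \<beta>)))\<^sup>2 \<partial>lborel)" by (rule integral_complex_of_real)
  also have "(\<integral>x. (norm (gauss (x - fst \<beta>)))\<^sup>2 \<partial>lborel) = l2sq (gauss :: 'a \<Rightarrow> complex)"
    unfolding l2sq_def
    by (rule integral_translate[of "\<lambda>x. (norm (gauss x))\<^sup>2"]) (use schwartz_borel[OF gauss_schwartz] in measurable)
  finally show ?thesis .
qed

text \<open>For pure translates the integrand is positive; for pure modulations the overlap is the
  Fourier transform of a Gaussian and thus positive. Shifts mixing the two would bring in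
  oscillating phases.\<close>

lemma gauss_overlap_nonneg:
  fixes \<alpha> \<beta> :: "'a::euclidean_space \<times> 'a"
  assumes "(snd \<alpha> = 0 \<and> snd \<beta> = 0) \<or> (fst \<alpha> = 0 \<and> fst \<beta> = 0)"
  shows "distribution_of (tf_shift gauss \<alpha>) (tf_shift gauss (fst \<beta>, - snd \<beta>)) \<in> \<real>\<^sub>\<ge>\<^sub>0"
  using assms
proof (elim disjE conjE)
  assume "snd \<alpha> = 0" "snd \<beta> = 0"
  then have "distribution_of (tf_shift gauss \<alpha>) (tf_shift gauss (fst \<beta>, - snd \<beta>))
    = (\<integral>x. of_real (exp (- (pi * (norm (x - fst \<alpha>))\<^sup>2)) * exp (- (pi * (norm (x - fst \<beta>))\<^sup>2))) \<partial>lborel)"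
    by (simp add: distribution_of_def tf_shift_apply gaussian_def)
  also have "\<dots> = of_real (\<integral>x. exp (- (pi * (norm (x - fst \<alpha>))\<^sup>2)) * exp (- (pi * (norm (x - fst \<beta>))\<^sup>2)) \<partial>lborel)"
    by (rule integral_complex_of_real)
  also have "\<dots> \<in> \<real>\<^sub>\<ge>\<^sub>0" by simp
  finally show ?thesis .
next
  assume 0: "fst \<alpha> = 0" "fst \<beta> = 0"
  have "tf_shift gauss \<alpha> x * tf_shift gauss (fst \<beta>, - snd \<beta>) x = cis (- 2 * pi * (x \<bullet> (snd \<beta> - snd \<alpha>))) * gaussian (sqrt 2) x" for x
  proof -
    have "cis (2 * pi * (x \<bullet> snd \<alpha>)) * cis (2 * pi * (x \<bullet> - snd \<beta>)) = cis (- 2 * pi * (x \<bullet> (snd \<beta> - snd \<alpha>)))"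
      by (simp add: cis_mult inner_diff_right algebra_simps)
    then show ?thesis using 0 by (simp add: tf_shift_apply ac_simps flip: gauss_square)
  qed
  then have "distribution_of (tf_shift gauss \<alpha>) (tf_shift gauss (fst \<beta>, - snd \<beta>)) = fourier (gaussian (sqrt 2)) (snd \<beta> - snd \<alpha>)"
    by (simp add: distribution_of_def fourier_def)
  also have "\<dots> \<in> \<real>\<^sub>\<ge>\<^sub>0"
    unfolding fourier_gaussian[of "sqrt 2", simplified] by (simp add: gaussian_def flip: of_real_mult of_real_power of_real_divide)
  finally show ?thesis .
qed

section \<open>Necessity\<close>

text \<open>With nonnegative overlaps the modulus of the series is the series itself, and dropping
  the terms off the diagonal and outside \<open>J\<close> only decreases it. One factor
  \<open>G\<close> is the diagonal overlap, the other belongs to the fixed Gaussian in the second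
  slot.\<close>

lemma norm_suminf_ge_diagonal:
  fixes X :: "nat \<Rightarrow> nat \<Rightarrow> complex"
  assumes X: "\<And>k j. X k j \<in> \<real>\<^sub>\<ge>\<^sub>0" "\<And>k. X k k = of_real G" and G: "0 \<le> G"
    and c: "\<And>k. 0 \<le> c k" and d: "\<And>j. 0 \<le> d j" and J: "finite J"
    and summable: "summable (\<lambda>k. norm (of_real (c k) * ((\<Sum>j\<in>J. of_real (d j) * X k j) * of_real G)))"
  shows "G\<^sup>2 * (\<Sum>k\<in>J. c k * d k) \<le> norm (\<Sum>k. of_real (c k) * ((\<Sum>j\<in>J. of_real (d j) * X k j) * of_real G))"
proof -
  define t where "t k = c k * ((\<Sum>j\<in>J. d j * Re (X k j)) * G)" for k
  have re: "0 \<le> Re (X k j)" "X k j = of_real (Re (X k j))" for k j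
    using X(1)[of k j] by (auto simp: complex_nonneg_Reals_iff complex_eq_iff)
  have eq: "of_real (c k) * ((\<Sum>j\<in>J. of_real (d j) * X k j) * of_real G) = complex_of_real (t k)" for k
    unfolding t_def by (subst re(2)) simp
  have t: "0 \<le> t k" for k
    unfolding t_def by (intro mult_nonneg_nonneg sum_nonneg c d re G)
  have s: "summable t" using summable t unfolding eq by simp
  have "G\<^sup>2 * (\<Sum>k\<in>J. c k * d k) = (\<Sum>k\<in>J. c k * ((d k * Re (X k k)) * G))"
    by (simp add: X(2) sum_distrib_left power2_eq_square ac_simps)
  also have "\<dots> \<le> (\<Sum>k\<in>J. t k)"
    unfolding t_def
    by (intro sum_mono mult_left_mono mult_right_mono c G member_le_sum[OF _ _ J, of _ "\<lambda>j. d j * Re (X _ j)"] mult_nonneg_nonneg d re) auto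
  also have "\<dots> \<le> suminf t" by (rule sum_le_suminf[OF s J]) (use t in auto)
  also have "\<dots> = norm (\<Sum>k. complex_of_real (t k))"
    unfolding suminf_of_real[OF s, symmetric] using suminf_nonneg[OF s t] by simp
  finally show ?thesis unfolding eq .
qed

text \<open>
  The atoms \<open>\<gamma> k\<close> sit in the first or in the second tensor factor of the symbol, according to \<open>side\<close>;
  together with \<open>\<tau>\<close> this determines whether the input or the output of the operator gets tested
  against the matching superposition of atoms, the other one being a fixed Gaussian.
\<close>

lemma bounded_symbol_series_test:
  fixes \<phi> :: "'a::euclidean_space \<Rightarrow> complex" and \<gamma> :: "nat \<Rightarrow> 'a \<times> 'a" and side :: bool and \<tau> :: real
  defines "\<alpha> \<equiv> \<lambda>k. if side then \<gamma> k else 0" and "\<beta> \<equiv> \<lambda>k. if side then 0 else \<gamma> k"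
  defines "test \<equiv> \<lambda>k. if side then (fst (\<gamma> k), - snd (\<gamma> k)) else (1 - 2 * \<tau>) *\<^sub>R (snd (\<gamma> k), fst (\<gamma> k))"
  assumes \<tau>: "\<tau> \<in> {0, 1}" and \<phi>: "\<phi> \<in> schwartz_space" "\<phi> \<noteq> (\<lambda>_. 0)"
    and \<gamma>: "(\<forall>k. snd (\<gamma> k) = 0) \<or> (\<forall>k. fst (\<gamma> k) = 0)"
    and c: "\<And>k. 0 \<le> c k" and b: "b \<in> Basis"
    and summable: "summable (\<lambda>k. c k / (1 + \<bar>snd (symbol_shift (1 - 2 * \<tau>) (\<alpha> k) (\<beta> k)) \<bullet> b\<bar>))"
    and bounded: "modulation_bounded \<phi>
      (op_tau \<tau> (tf_series (chirp_tensor (1 - 2 * \<tau>) gauss gauss) c (\<lambda>k. symbol_shift (1 - 2 * \<tau>) (\<alpha> k) (\<beta> k))))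
      2 2 (weight_v 0 t1) 2 2 (weight_v 0 t2)"
  shows "\<exists>C\<ge>0. \<forall>J d. finite J \<longrightarrow> (\<forall>j. 0 \<le> d j) \<longrightarrow>
    ennreal ((\<Sum>k\<in>J. c k * d k)\<^sup>2) \<le> ennreal C *
      gabor_energy (if (\<tau> = 0) = side then \<phi> else (\<lambda>t. cnj (\<phi> t))) (if (\<tau> = 0) = side then - t2 else t1)
        (\<lambda>x. \<Sum>j\<in>J. of_real (d j) * tf_shift gauss (test j) x)"
proof -
  define s where "s = 1 - 2 * \<tau>"
  define \<psi>0 where "\<psi>0 = chirp_tensor s gauss (gauss :: 'a \<Rightarrow> complex)"
  define w where "w k = symbol_shift s (\<alpha> k) (\<beta> k)" for k
  define \<sigma> where "\<sigma> = tf_series \<psi>0 c w"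
  have \<psi>0: "\<psi>0 \<in> schwartz_space" unfolding \<psi>0_def by (intro chirp_tensor_schwartz gauss_schwartz)
  note sm = summable[folded s_def, folded w_def]
  note bd = bounded[folded s_def, folded w_def \<psi>0_def, folded \<sigma>_def]
  have \<sigma>: "\<sigma> \<in> tempered_distributions" unfolding \<sigma>_def by (rule tf_series_tempered[OF \<psi>0 b c sm])
  \<comment> \<open>True when the atoms are tested by the output function \<open>h\<close>, whose
    dual weight has exponent \<open>- t2\<close>; otherwise they are tested by the input
    \<open>f\<close> with exponent \<open>t1\<close>. The primed variants belong to the function
    that stays a fixed Gaussian.\<close>
  let ?h = "(\<tau> = 0) = side"
  let ?\<psi> = "if ?h then \<phi> else (\<lambda>t. cnj (\<phi> t))" and ?r = "if ?h then - t2 else t1"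
  let ?\<psi>' = "if ?h then (\<lambda>t. cnj (\<phi> t)) else \<phi>" and ?r' = "if ?h then t1 else - t2"
  have \<psi>': "?\<psi>' \<in> schwartz_space" using \<phi> by (auto intro: schwartz_cnj)
  obtain C0 where C0: "0 \<le> C0"
    "\<And>f h. f \<in> schwartz_space \<Longrightarrow> h \<in> schwartz_space \<Longrightarrow>
      (ennreal (l2sq \<phi> * norm (op_tau \<tau> \<sigma> f h)))\<^sup>2
        \<le> ennreal C0 * (gabor_energy (\<lambda>t. cnj (\<phi> t)) t1 f * gabor_energy \<phi> (- t2) h)"
    using op_tau_weak_bound[OF \<tau> \<sigma> \<phi>(1) bd] by blast
  obtain C1 where C1: "0 \<le> C1" "\<And>w. gabor_energy ?\<psi>' ?r' (tf_shift gauss w) \<le> ennreal (C1 * \<langle>snd w\<rangle> powr (2 * ?r'))"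
    using gabor_energy_tf_shift_le[OF gauss_schwartz \<psi>'] by blast
  have static: "gabor_energy ?\<psi>' ?r' gauss \<le> ennreal C1" using C1(2)[of 0] by (simp add: tf_shift_0)
  define G where "G = l2sq (gauss :: 'a \<Rightarrow> complex)"
  have "gauss (0 :: 'a) \<noteq> 0" by (simp add: gaussian_def)
  then have G: "0 < G" unfolding G_def by (intro l2sq_pos gauss_schwartz) force
  have L: "0 < l2sq \<phi>" by (rule l2sq_pos[OF \<phi>])
  have gg: "distribution_of gauss (gauss :: 'a \<Rightarrow> complex) = of_real G"
    using gauss_overlap_self[of "0 :: 'a \<times> 'a"] by (simp add: G_def tf_shift_0 flip: zero_prod_def)
  define X where "X k j = distribution_of (tf_shift gauss (\<gamma> k)) (tf_shift gauss (fst (\<gamma> j), - snd (\<gamma> j)))" for k j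
  have X: "X k j \<in> \<real>\<^sub>\<ge>\<^sub>0" "X k k = of_real G" for k j
    unfolding X_def G_def using \<gamma> by (auto intro!: gauss_overlap_nonneg gauss_overlap_self)
  have "ennreal ((\<Sum>k\<in>J. c k * d k)\<^sup>2) \<le> ennreal (C0 * C1 / (l2sq \<phi> * G\<^sup>2)\<^sup>2) *
      gabor_energy ?\<psi> ?r (\<lambda>x. \<Sum>j\<in>J. of_real (d j) * tf_shift gauss (test j) x)"
    if J: "finite J" and d: "\<And>j. 0 \<le> d j" for J d
  proof -
    define m where "m = (\<lambda>x. \<Sum>j\<in>J. of_real (d j) * tf_shift gauss (test j) x)"
    have m: "m \<in> schwartz_space"
      unfolding m_def using J by (auto intro!: schwartz_sum schwartz_scale tf_shift_schwartz gauss_schwartz)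
    define f where "f = (if ?h then gauss else m)"
    define h where "h = (if ?h then m else gauss)"
    have fh: "f \<in> schwartz_space" "h \<in> schwartz_space" by (auto simp: f_def h_def m gauss_schwartz)
    \<comment> \<open>Since all atoms are pure translates or all are pure modulations, the phases in
      the Fourier slot vanish.\<close>
    have ortho: "fst (\<gamma> j) \<bullet> snd (\<gamma> j) = 0" for j using \<gamma> by auto
    have atom: "distribution_of (tf_shift \<psi>0 (w k)) (wigner_test \<tau> h f) = (\<Sum>j\<in>J. of_real (d j) * X k j) * of_real G" for k
    proof -
      have "tf_shift \<psi>0 (w k) = chirp_tensor s (tf_shift gauss (\<alpha> k)) (tf_shift gauss (\<beta> k))"
        unfolding \<psi>0_def w_def by (rule chirp_tensor_tf_shift[symmetric]) (simp add: \<alpha>_def \<beta>_def)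
      then have "distribution_of (tf_shift \<psi>0 (w k)) (wigner_test \<tau> h f)
        = distribution_of (tf_shift gauss (\<alpha> k)) (output_slot \<tau> h f)
          * distribution_of (tf_shift gauss (\<beta> k)) (fourier_slot \<tau> (output_slot \<tau> f h))"
        unfolding s_def
        by (simp only:) (intro distribution_of_chirp_tensor_wigner_test \<tau> fh tf_shift_schwartz gauss_schwartz)
      also have "\<dots> = (\<Sum>j\<in>J. of_real (d j) * X k j) * of_real G"
      proof (cases side)
        case True
        then have "output_slot \<tau> h f = m" "output_slot \<tau> f h = gauss"
          using \<tau> by (auto simp: output_slot_def f_def h_def)
        moreover have "distribution_of (tf_shift gauss (\<gamma> k)) m = (\<Sum>j\<in>J. of_real (d j) * X k j)"
          unfolding m_def X_def using True
          by (subst distribution_of_sum[OF J]) (auto intro!: tf_shift_schwartz gauss_schwartz simp: test_def)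
        ultimately show ?thesis
          using True \<tau> by (simp add: \<alpha>_def \<beta>_def tf_shift_0 fourier_slot_gauss gg)
      next
        case False
        then have slots: "output_slot \<tau> h f = gauss" "output_slot \<tau> f h = m"
          using \<tau> by (auto simp: output_slot_def f_def h_def)
        have atoms: "fourier_slot \<tau> (tf_shift gauss (test j)) = tf_shift gauss (fst (\<gamma> j), - snd (\<gamma> j))" for j
          unfolding test_def using False fourier_slot_tf_shift[OF \<tau> ortho[of j]] by (simp only: if_False)
        have "fourier_slot \<tau> m = (\<lambda>\<xi>. \<Sum>j\<in>J. of_real (d j) * fourier_slot \<tau> (tf_shift gauss (test j)) \<xi>)"
          unfolding fourier_slot_def m_def
          by (subst fourier_sum[OF J]) (auto intro!: tf_shift_schwartz gauss_schwartz)
        also have "\<dots> = (\<lambda>\<xi>. \<Sum>j\<in>J. of_real (d j) * tf_shift gauss (fst (\<gamma> j), - snd (\<gamma> j)) \<xi>)"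
          using atoms by simp
        finally have "fourier_slot \<tau> m = (\<lambda>\<xi>. \<Sum>j\<in>J. of_real (d j) * tf_shift gauss (fst (\<gamma> j), - snd (\<gamma> j)) \<xi>)" .
        then have "distribution_of (tf_shift gauss (\<gamma> k)) (fourier_slot \<tau> m) = (\<Sum>j\<in>J. of_real (d j) * X k j)"
          unfolding X_def
          by (simp only:) (rule distribution_of_sum[OF J], auto intro!: tf_shift_schwartz gauss_schwartz)
        then show ?thesis
          using False slots by (simp add: \<alpha>_def \<beta>_def tf_shift_0 gg)
      qed
      finally show ?thesis .
    qed
    have op: "op_tau \<tau> \<sigma> f h = (\<Sum>k. of_real (c k) * ((\<Sum>j\<in>J. of_real (d j) * X k j) * of_real G))"
      unfolding op_tau_eq \<sigma>_def tf_series_def atom ..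
    have "G\<^sup>2 * (\<Sum>k\<in>J. c k * d k) \<le> norm (op_tau \<tau> \<sigma> f h)"
      unfolding op
      using tf_series_summable[OF \<psi>0 b c sm wigner_test_schwartz[OF \<tau> fh]] G
      by (intro norm_suminf_ge_diagonal X c d J) (auto simp only: atom)
    then have "(l2sq \<phi> * G\<^sup>2) * (\<Sum>k\<in>J. c k * d k) \<le> l2sq \<phi> * norm (op_tau \<tau> \<sigma> f h)"
      using L by (simp add: mult.assoc)
    then have "(ennreal ((l2sq \<phi> * G\<^sup>2) * (\<Sum>k\<in>J. c k * d k)))\<^sup>2 \<le> (ennreal (l2sq \<phi> * norm (op_tau \<tau> \<sigma> f h)))\<^sup>2"
      by (intro power_mono ennreal_leI) auto
    also have "\<dots> \<le> ennreal C0 * (gabor_energy (\<lambda>t. cnj (\<phi> t)) t1 f * gabor_energy \<phi> (- t2) h)"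
      by (rule C0(2)[OF fh])
    also have "\<dots> = ennreal C0 * (gabor_energy ?\<psi>' ?r' gauss * gabor_energy ?\<psi> ?r m)"
      by (simp add: f_def h_def mult.commute)
    also have "\<dots> \<le> ennreal C0 * (ennreal C1 * gabor_energy ?\<psi> ?r m)"
      by (intro mult_left_mono mult_right_mono static) auto
    finally have main: "(ennreal ((l2sq \<phi> * G\<^sup>2) * (\<Sum>k\<in>J. c k * d k)))\<^sup>2 \<le> ennreal C0 * (ennreal C1 * gabor_energy ?\<psi> ?r m)" .
    let ?q = "(l2sq \<phi> * G\<^sup>2)\<^sup>2"
    have q: "0 < ?q" using L G by simp
    have S0: "0 \<le> (\<Sum>k\<in>J. c k * d k)" by (intro sum_nonneg mult_nonneg_nonneg c d)
    have "ennreal ((\<Sum>k\<in>J. c k * d k)\<^sup>2) = ennreal (1 / ?q) * (ennreal ((l2sq \<phi> * G\<^sup>2) * (\<Sum>k\<in>J. c k * d k)))\<^sup>2"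
      using L G S0 q by (simp add: ennreal_power power_mult_distrib flip: ennreal_mult)
    also have "\<dots> \<le> ennreal (1 / ?q) * (ennreal C0 * (ennreal C1 * gabor_energy ?\<psi> ?r m))"
      by (intro mult_left_mono main) auto
    also have "\<dots> = ennreal (C0 * C1 / ?q) * gabor_energy ?\<psi> ?r m"
    proof -
      have "ennreal (1 / ?q) * (ennreal C0 * ennreal C1) = ennreal (C0 * C1 / ?q)"
        using C0(1) C1(1) q by (simp flip: ennreal_mult)
      then show ?thesis by (simp only: mult.assoc[symmetric])
    qed
    finally show ?thesis unfolding m_def .
  qed
  then show ?thesis using C0(1) C1(1) L G by (intro exI[of _ "C0 * C1 / (l2sq \<phi> * G\<^sup>2)\<^sup>2"]) auto
qed


section \<open>Necessity of the conditions on the weights and on the exponents\<close>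

lemma summable_Suc_powr: "summable (\<lambda>k. (real k + 1) powr s) \<longleftrightarrow> s < - 1"
  using summable_Suc_iff[of "\<lambda>k. real k powr s"] by (simp add: summable_real_powr_iff add.commute)

text \<open>Summable coefficients place the series in every amalgam space under consideration, so
  only the weights can be violated. Testing with one atom at a time compares its squared coefficient
  with its energy.\<close>

lemma weights_if_modulation_bounded:
  fixes \<phi> :: "'a::euclidean_space \<Rightarrow> complex" and \<Phi> :: "'a \<times> 'a \<Rightarrow> complex"
  assumes p: "1 \<le> p" and q: "1 \<le> q" and \<tau>: "\<tau> \<in> {0, 1}"
    and \<phi>: "\<phi> \<in> schwartz_space" "\<phi> \<noteq> (\<lambda>_. 0)" and \<Phi>: "\<Phi> \<in> schwartz_space"
    and bounded: "\<And>\<sigma>. \<sigma> \<in> wiener_amalgam \<Phi> p q \<Longrightarrow>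
      modulation_bounded \<phi> (op_tau \<tau> \<sigma>) 2 2 (weight_v 0 t1) 2 2 (weight_v 0 t2)"
  shows "t2 \<le> 0 \<and> 0 \<le> t1"
proof (rule ccontr)
  assume neg: "\<not> (t2 \<le> 0 \<and> 0 \<le> t1)"
  \<comment> \<open>Chosen so that the tested function is the output exactly when \<open>t2\<close>
    is positive; in either case the exponent \<open>r\<close> of the tested energy is
    negative.\<close>
  define side where "side \<longleftrightarrow> (\<tau> = 0) = (0 < t2)"
  define r where "r = (if (\<tau> = 0) = side then - t2 else t1)"
  have r: "r < 0" using neg by (auto simp: r_def side_def)
  define \<psi> where "\<psi> = (if (\<tau> = 0) = side then \<phi> else (\<lambda>t. cnj (\<phi> t)))"
  have \<psi>: "\<psi> \<in> schwartz_space" using \<phi> by (auto simp: \<psi>_def intro: schwartz_cnj)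
  obtain b0 :: 'a where b0: "b0 \<in> Basis" using nonempty_Basis by blast
  have b: "(b0, 0 :: 'a) \<in> Basis" using b0 by (simp add: Basis_prod_def)
  \<comment> \<open>Raised to the power \<open>2 * r\<close>, frequencies of size
    \<open>(k + 1) powr (3 / - r)\<close> give energies of order -6, against squared coefficients of
    order -4.\<close>
  define \<xi> where "\<xi> k = ((real k + 1) powr (3 / - r)) *\<^sub>R b0" for k
  \<comment> \<open>In the second tensor factor the tested function enters through its Fourier
    transform, so there its frequency appears as a position.\<close>
  define \<gamma> where "\<gamma> k = (if side then (0, \<xi> k) else (\<xi> k, 0))" for k
  have \<gamma>: "(\<forall>k. snd (\<gamma> k) = 0) \<or> (\<forall>k. fst (\<gamma> k) = 0)" by (simp add: \<gamma>_def)
  define c where "c k = (real k + 1) powr (- 2)" for k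
  have c: "0 \<le> c k" for k by (simp add: c_def)
  have sc: "summable c" unfolding c_def summable_Suc_powr by simp
  define w where "w k = symbol_shift (1 - 2 * \<tau>) (if side then \<gamma> k else 0) (if side then 0 else \<gamma> k)" for k
  have sm: "summable (\<lambda>k. c k / (1 + \<bar>snd (w k) \<bullet> (b0, 0)\<bar>))"
  proof (rule summable_comparison_test'[OF sc])
    show "norm (c k / (1 + \<bar>snd (w k) \<bullet> (b0, 0)\<bar>)) \<le> c k" for k
      using c[of k] by (simp add: divide_le_eq mult_le_cancel_left1 add_pos_nonneg)
  qed
  let ?\<psi>0 = "chirp_tensor (1 - 2 * \<tau>) gauss (gauss :: 'a \<Rightarrow> complex)"
  have \<psi>0: "?\<psi>0 \<in> schwartz_space" by (intro chirp_tensor_schwartz gauss_schwartz)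
  have "tf_series ?\<psi>0 c w \<in> wiener_amalgam \<Phi> p q"
    by (rule tf_series_wiener_amalgam[OF \<psi>0 \<Phi> c tf_series_tempered[OF \<psi>0 b c sm] p q b]) (simp add: sc)
  from bounded_symbol_series_test[OF \<tau> \<phi> \<gamma> c b sm[unfolded w_def] bounded[OF this, unfolded w_def]]
  obtain C where C: "0 \<le> C" "\<And>J d. finite J \<Longrightarrow> (\<forall>j. 0 \<le> d j) \<Longrightarrow>
    ennreal ((\<Sum>k\<in>J. c k * d k)\<^sup>2) \<le> ennreal C * gabor_energy \<psi> r (\<lambda>x. \<Sum>j\<in>J. of_real (d j) *
      tf_shift gauss (if side then (fst (\<gamma> j), - snd (\<gamma> j)) else (1 - 2 * \<tau>) *\<^sub>R (snd (\<gamma> j), fst (\<gamma> j))) x)"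
    unfolding \<psi>_def r_def by blast
  obtain C1 where C1: "0 \<le> C1" "\<And>w. gabor_energy \<psi> r (tf_shift gauss w) \<le> ennreal (C1 * \<langle>snd w\<rangle> powr (2 * r))"
    using gabor_energy_tf_shift_le[OF gauss_schwartz \<psi>] by blast
  have growth: "(real n + 1) powr (- 4) \<le> C * C1 * (real n + 1) powr (- 6)" for n
  proof -
    define v where "v = (if side then (fst (\<gamma> n), - snd (\<gamma> n)) else (1 - 2 * \<tau>) *\<^sub>R (snd (\<gamma> n), fst (\<gamma> n)))"
    have "norm (snd v) = (real n + 1) powr (3 / - r)"
      using \<tau> b0 by (auto simp: v_def \<gamma>_def \<xi>_def)
    then have "(real n + 1) powr (3 / - r) \<le> \<langle>snd v\<rangle>" using norm_le_bracket[of "snd v"] by simp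
    then have "\<langle>snd v\<rangle> powr (2 * r) \<le> ((real n + 1) powr (3 / - r)) powr (2 * r)"
      using r by (intro powr_mono2') auto
    also have "\<dots> = (real n + 1) powr (- 6)" using r by (simp add: powr_powr)
    finally have le: "\<langle>snd v\<rangle> powr (2 * r) \<le> (real n + 1) powr (- 6)" .
    \<comment> \<open>The test function is the single atom with index \<open>n\<close>, with
      coefficient 1.\<close>
    have "ennreal ((c n)\<^sup>2) \<le> ennreal C * gabor_energy \<psi> r (tf_shift gauss v)"
      using C(2)[of "{n}" "\<lambda>_. 1"] by (simp add: v_def)
    also have "\<dots> \<le> ennreal C * ennreal (C1 * (real n + 1) powr (- 6))"
      by (intro mult_left_mono order.trans[OF C1(2)] ennreal_leI C1 le) auto
    also have "\<dots> = ennreal (C * C1 * (real n + 1) powr (- 6))"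
      using C(1) C1(1) by (simp add: mult.assoc flip: ennreal_mult)
    finally have "(c n)\<^sup>2 \<le> C * C1 * (real n + 1) powr (- 6)"
      using C(1) C1(1) by (subst (asm) ennreal_le_iff) auto
    moreover have "(c n)\<^sup>2 = (real n + 1) powr (- 4)" by (simp add: c_def power2_eq_square flip: powr_add)
    ultimately show ?thesis by simp
  qed
  obtain n :: nat where n: "C * C1 < real n" using reals_Archimedean2 by blast
  have "(real n + 1) powr 6 * (real n + 1) powr (- 4) \<le> (real n + 1) powr 6 * (C * C1 * (real n + 1) powr (- 6))"
    by (intro mult_left_mono growth) auto
  moreover have "(real n + 1) powr 6 * (real n + 1) powr (- 4) = (real n + 1) powr 2" by (subst powr_add[symmetric]) simp
  moreover have "(real n + 1) powr 6 * (real n + 1) powr (- 6) = 1" by (subst powr_add[symmetric]) simp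
  ultimately have "(real n + 1) powr 2 \<le> C * C1" by (metis mult.left_commute mult.right_neutral)
  moreover have "real n + 1 \<le> (real n + 1) powr 2" using powr_mono[of 1 2 "real n + 1"] by simp
  ultimately show False using n by linarith
qed

lemma exponents_if_modulation_bounded:
  fixes \<phi> :: "'a::euclidean_space \<Rightarrow> complex" and \<Phi> :: "'a \<times> 'a \<Rightarrow> complex"
  assumes p: "1 \<le> p" and q: "1 \<le> q" and \<tau>: "\<tau> \<in> {0, 1}"
    and \<phi>: "\<phi> \<in> schwartz_space" "\<phi> \<noteq> (\<lambda>_. 0)" and \<Phi>: "\<Phi> \<in> schwartz_space"
    and bounded: "\<And>\<sigma>. \<sigma> \<in> wiener_amalgam \<Phi> p q \<Longrightarrow>
      modulation_bounded \<phi> (op_tau \<tau> \<sigma>) 2 2 (weight_v 0 t1) 2 2 (weight_v 0 t2)"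
  shows "p \<le> 2 \<and> q \<le> 2"
proof (rule ccontr)
  assume neg: "\<not> (p \<le> 2 \<and> q \<le> 2)"
  \<comment> \<open>If \<open>q\<close> is not the offending exponent, then \<open>p\<close> is, and
    modulations in the second factor are used instead of translates in the first.\<close>
  define side where "side \<longleftrightarrow> 2 < q"
  define r where "r = (if (\<tau> = 0) = side then - t2 else t1)"
  define \<psi> where "\<psi> = (if (\<tau> = 0) = side then \<phi> else (\<lambda>t. cnj (\<phi> t)))"
  have \<psi>: "\<psi> \<in> schwartz_space" using \<phi> by (auto simp: \<psi>_def intro: schwartz_cnj)
  obtain b0 :: 'a where b0: "b0 \<in> Basis" using nonempty_Basis by blast
  then have b: "(b0, 0 :: 'a) \<in> Basis" "(0 :: 'a, b0) \<in> Basis" by (auto simp: Basis_prod_def)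
  define \<gamma> where "\<gamma> k = (if side then (real k *\<^sub>R b0, 0) else (0, - (real k *\<^sub>R b0)))" for k
  have \<gamma>: "(\<forall>k. snd (\<gamma> k) = 0) \<or> (\<forall>k. fst (\<gamma> k) = 0)" by (simp add: \<gamma>_def)
  \<comment> \<open>The borderline power: its u-th powers are summable for every u > 2, but its
    squares form the harmonic series.\<close>
  define c where "c k = (real k + 1) powr (- 1 / 2)" for k
  have c: "0 \<le> c k" for k by (simp add: c_def)
  have c1: "c k \<le> 1" for k unfolding c_def using powr_mono[of "- 1 / 2" 0 "real k + 1"] by simp
  have sc: "summable (\<lambda>k. c k powr enn2real u)" if "2 < u" "u \<noteq> \<infinity>" for u
  proof -
    have "2 < enn2real u" using that by (cases u) (auto simp: ennreal_less_iff simp flip: ennreal_numeral)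
    then show ?thesis unfolding c_def by (simp add: powr_powr summable_Suc_powr)
  qed
  define w where "w k = symbol_shift (1 - 2 * \<tau>) (if side then \<gamma> k else 0) (if side then 0 else \<gamma> k)" for k
  \<comment> \<open>Both placements give the second variable a frequency of size \<open>k\<close>:
    for modulations directly, for translates through the chirp. This growth makes the series a
    tempered distribution.\<close>
  have "\<bar>snd (w k) \<bullet> (0, b0)\<bar> = real k" for k
    using \<tau> b0 by (auto simp: w_def \<gamma>_def symbol_shift_def inner_Pair)
  then have "c k / (1 + \<bar>snd (w k) \<bullet> (0, b0)\<bar>) = (real k + 1) powr (- 3 / 2)" for k
    using powr_diff[of "real k + 1" "- 1 / 2" 1] by (simp add: c_def add.commute)
  then have sm: "summable (\<lambda>k. c k / (1 + \<bar>snd (w k) \<bullet> (0, b0)\<bar>))"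
    by (simp add: summable_Suc_powr)
  let ?\<psi>0 = "chirp_tensor (1 - 2 * \<tau>) gauss (gauss :: 'a \<Rightarrow> complex)"
  have \<psi>0: "?\<psi>0 \<in> schwartz_space" by (intro chirp_tensor_schwartz gauss_schwartz)
  note tempered = tf_series_tempered[OF \<psi>0 b(2) c sm]
  have "tf_series ?\<psi>0 c w \<in> wiener_amalgam \<Phi> p q"
  proof (cases side)
    case True
    then have "fst (w k) = real k *\<^sub>R (b0, 0)" for k by (simp add: w_def \<gamma>_def symbol_shift_def)
    then show ?thesis
      using True sc[of q] c1 by (intro tf_series_wiener_amalgam[OF \<psi>0 \<Phi> c tempered p q b(1)]) (auto simp: side_def)
  next
    case False
    then have "w k = (0, - (real k *\<^sub>R (0, b0)))" for k
      by (simp add: w_def \<gamma>_def symbol_shift_def zero_prod_def)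
    moreover have "2 < p" using False neg by (simp add: side_def not_less)
    ultimately show ?thesis
      using sc[of p] c1 by (intro tf_series_wiener_amalgam[OF \<psi>0 \<Phi> c tempered p q b(2)]) auto
  qed
  from bounded_symbol_series_test[OF \<tau> \<phi> \<gamma> c b(2) sm[unfolded w_def] bounded[OF this, unfolded w_def]]
  obtain C where C: "0 \<le> C" "\<And>J d. finite J \<Longrightarrow> (\<forall>j. 0 \<le> d j) \<Longrightarrow>
    ennreal ((\<Sum>k\<in>J. c k * d k)\<^sup>2) \<le> ennreal C * gabor_energy \<psi> r (\<lambda>x. \<Sum>j\<in>J. of_real (d j) *
      tf_shift gauss (if side then (fst (\<gamma> j), - snd (\<gamma> j)) else (1 - 2 * \<tau>) *\<^sub>R (snd (\<gamma> j), fst (\<gamma> j))) x)"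
    unfolding \<psi>_def r_def by blast
  \<comment> \<open>In either placement the test atoms are pure translates along \<open>b0\<close>,
    with \<epsilon> recording the direction. Their frequencies stay at 0, so the weights have no
    influence whatever the sign of \<open>r\<close>.\<close>
  define \<epsilon> where "\<epsilon> = (if side then 1 else - (1 - 2 * \<tau>))"
  have \<epsilon>: "\<epsilon> \<in> {1, - 1}" using \<tau> by (auto simp: \<epsilon>_def)
  have test: "(if side then (fst (\<gamma> j), - snd (\<gamma> j)) else (1 - 2 * \<tau>) *\<^sub>R (snd (\<gamma> j), fst (\<gamma> j))) = ((\<epsilon> * real j) *\<^sub>R b0, 0)" for j
    by (simp add: \<gamma>_def \<epsilon>_def left_diff_distrib flip: scaleR_minus_left)
  obtain C1 where C1: "0 \<le> C1" "\<And>n d. (\<forall>j. 0 \<le> d j) \<Longrightarrow>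
    gabor_energy \<psi> r (\<lambda>x. \<Sum>j<n. of_real (d j) * tf_shift gauss ((\<epsilon> * real j) *\<^sub>R b0, 0) x)
      \<le> ennreal (C1 * (\<Sum>j<n. (d j)\<^sup>2))"
    using gabor_energy_lattice_sum_le[where r = r, OF gauss_schwartz \<psi> b0 \<epsilon>] by blast
  \<comment> \<open>Testing with the coefficients themselves puts the square of the partial sum on
    the left and the partial sum once on the right; cancelling bounds the harmonic sums.\<close>
  have "(\<Sum>k<n. (c k)\<^sup>2) \<le> C * C1" for n
  proof -
    let ?A = "\<Sum>k<n. (c k)\<^sup>2"
    have A: "0 \<le> ?A" by (simp add: sum_nonneg)
    have "ennreal (?A\<^sup>2) \<le> ennreal C * gabor_energy \<psi> r (\<lambda>x. \<Sum>j<n. of_real (c j) * tf_shift gauss ((\<epsilon> * real j) *\<^sub>R b0, 0) x)"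
      using C(2)[of "{..<n}" c, unfolded test] c by (simp add: power2_eq_square)
    also have "\<dots> \<le> ennreal C * ennreal (C1 * ?A)" by (intro mult_left_mono C1 allI c) auto
    also have "\<dots> = ennreal (C * C1 * ?A)" using C(1) C1(1) A by (simp add: mult.assoc flip: ennreal_mult)
    finally have "?A\<^sup>2 \<le> C * C1 * ?A" using C(1) C1(1) A by (subst (asm) ennreal_le_iff) auto
    then show ?thesis
      using A C(1) C1(1) by (cases "?A = 0") (auto simp: power2_eq_square)
  qed
  then have "summable (\<lambda>k. (c k)\<^sup>2)" by (intro summableI_nonneg_bounded) auto
  moreover have "(c k)\<^sup>2 = (real k + 1) powr (- 1)" for k
    by (simp add: c_def power2_eq_square flip: powr_add)
  ultimately show False using summable_Suc_powr[of "- 1"] by simp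
qed

theorem theorem6p13:
  fixes p q :: ennreal and t1 t2 \<tau> :: real
    and \<phi> :: "real ^ 'd \<Rightarrow> complex"
    and \<Phi> :: "(real ^ 'd) \<times> (real ^ 'd) \<Rightarrow> complex"
  assumes "1 \<le> p" and "1 \<le> q" and "\<tau> \<in> {0, 1}"
    and "\<phi> \<in> schwartz_space" and "\<phi> \<noteq> (\<lambda>_. 0)"
    and "\<Phi> \<in> schwartz_space" and "\<Phi> \<noteq> (\<lambda>_. 0)"
  shows "(\<forall>\<sigma>\<in>wiener_amalgam \<Phi> p q.
            modulation_bounded \<phi> (op_tau \<tau> \<sigma>) 2 2 (weight_v 0 t1) 2 2 (weight_v 0 t2))
         \<longleftrightarrow> t2 \<le> 0 \<and> 0 \<le> t1 \<and> p \<le> 2 \<and> q \<le> 2"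
proof
  assume bounded: "\<forall>\<sigma>\<in>wiener_amalgam \<Phi> p q.
    modulation_bounded \<phi> (op_tau \<tau> \<sigma>) 2 2 (weight_v 0 t1) 2 2 (weight_v 0 t2)"
  show "t2 \<le> 0 \<and> 0 \<le> t1 \<and> p \<le> 2 \<and> q \<le> 2"
    using weights_if_modulation_bounded[OF assms(1-6), of t1 t2] exponents_if_modulation_bounded[OF assms(1-6), of t1 t2] bounded
    by blast
next
  assume "t2 \<le> 0 \<and> 0 \<le> t1 \<and> p \<le> 2 \<and> q \<le> 2"
  then show "\<forall>\<sigma>\<in>wiener_amalgam \<Phi> p q.
    modulation_bounded \<phi> (op_tau \<tau> \<sigma>) 2 2 (weight_v 0 t1) 2 2 (weight_v 0 t2)"
    using modulation_bounded_if_exponents_le_2[OF assms(3) _ assms(4-7)] assms(1,2) by blast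
qed

end
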